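(* Suppose that $\mathbb{P}$ is admissible, that there is a non-random constant $c_0>0$ with $\mathbb{P}[\omega_t(x,y)\ge c_0]=1$ for every $(x,y)\in E_d$ and $t\in\mathbb{R}$, and that there is a non-random constant $c_1\in[1,\infty)$ with $\mathbb{P}[c_1^{-1}\le\omega_t(e)/\omega_0(e)\le c_1]=1$ for all $e\in E_d$ and $t\in\mathbb{R}$. Then there exists $C<\infty$ such that for any $y,y'\in\mathbb{Z}^d$ and $t\ge1$, $$\Big|\frac{\partial}{\partial t}\,\bar p_{0,t}(y,y')\Big|\le C\,t^{-d/2-1}.$$
   Context: Setting. Let $d\ge 1$, let $|\cdot|$ be the graph distance on $\mathbb{Z}^d$ (the $\ell^1$-distance), $E_d=\{(x,y):x,y\in\mathbb{Z}^d,\ |x-y|=1\}$ (oriented nearest-neighbour bonds), and write $x\sim y$ if $(x,y)\in E_d$. Let $\Omega=(0,\infty)^{\mathbb{R}\times E_d}$ with Borel $\sigma$-algebra $\mathcal{F}$; its elements are families $\omega=\{\omega_t(e): e\in E_d, t\in\mathbb{R}\}$ of time-dependent conductances, and $\omega_t(x,y)=0$ if $(x,y)\notin E_d$. Time-space shifts: $(\tau_{s,z}\omega)_t(x,y)=\omega_{t+s}(x+z,y+z)$ for $(s,z)\in\mathbb{R}\times\mathbb{Z}^d$. A probability measure $\mathbb{P}$ on $(\Omega,\mathcal{F})$ (expectation $\mathbb{E}$) is called admissible if: (i) $\mathbb{P}$ is stationary and ergodic with respect to the time-space shifts $\{\tau_{s,z}\}$; (ii) $\mathbb{P}[\omega_t(x,y)=\omega_t(y,x)\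 \forall t\in\mathbb{R}]=1$ for all $(x,y)\in E_d$; (iii) $\mathbb{E}[\omega_t(e)]<\infty$ for all $e\in E_d$, $t\in\mathbb{R}$; (iv) for every $A\in\mathcal{F}$ the map $(\omega,t,x)\mapsto \mathbf 1_A(\tau_{t,x}\omega)$ is jointly measurable with respect to $\mathcal{F}\otimes\mathcal{B}(\mathbb{R})\otimes\mathcal{P}(\mathbb{Z}^d)$. Process. For fixed $\omega$, $X=(X_t)_{t\ge s}$ under $\mathrm{P}^\omega_{s,x}$ (expectation $\mathrm{E}^\omega_{s,x}$) is the time-inhomogeneous continuous-time Markov chain (variable speed random walk) started at time $s$ in $x\in\mathbb{Z}^d$ with time-dependent generator $(\mathcal{L}^\omega_t f)(x)=\sum_{y\sim x}\omega_t(x,y)(f(y)-f(x))$: if it arrives in $z$ at time $r$, its next jump time $J$ satisfies $\mathrm{P}(J>t)=\exp(-\int_r^t\mu^\omega_u(z)\,du)$, where $\mu^\omega_u(z)=\sum_{y\sim z}\omega_u(z,y)$, and given $J$ it jumps to $y$ with probability $\omega_J(z,y)/\mu^\omega_J(z)$. For admissible $\mathbb{P}$, for $\mathbb{P}$-a.e. $\omega$ the rates are locally integrable in time and the process does not explode. Heat kernels: $p^\omega_{s,t}(x,y)=\mathrm{P}^\omega_{s,x}[X_t=y]$ and $\bar p_{s,t}(x,y)=\mathbb{E}[p^\omega_{s,t}(x,y)]$ for $s\le t$. *)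

theory Defs
  imports "HOL-Probability.Probability"
begin

section \<open>Time-dependent conductances\<close>

text \<open>
  The dimension is \<open>d = CARD('n)\<close>.  An environment is a total function on time and pairs of
  sites; membership in \<open>environments\<close> makes it positive on bonds and zero off bonds, so that
  this set, with the topology of pointwise convergence, is a copy of
  \<open>(0,\<infinity>)\<close> to the power \<open>\<real> \<times> E\<^sub>d\<close>.
\<close>

type_synonym 'n site = "(int, 'n) vec"
type_synonym 'n environment = "real \<Rightarrow> 'n site \<times> 'n site \<Rightarrow> real"

definition graph_dist :: "'n::finite site \<Rightarrow> 'n site \<Rightarrow> int" where
  "graph_dist x y = (\<Sum>i\<in>UNIV. \<bar>x $ i - y $ i\<bar>)"

definition bonds :: "('n::finite site \<times> 'n site) set" where
  "bonds = {(x, y). graph_dist x y = 1}"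

definition environments :: "'n::finite environment set" where
  "environments = {\<omega>. \<forall>t e. (e \<in> bonds \<longrightarrow> 0 < \<omega> t e) \<and> (e \<notin> bonds \<longrightarrow> \<omega> t e = 0)}"

definition shift :: "real \<Rightarrow> 'n::finite site \<Rightarrow> 'n environment \<Rightarrow> 'n environment" where
  "shift s z \<omega> = (\<lambda>t (x, y). \<omega> (t + s) (x + z, y + z))"

text \<open>
  Joint measurability of \<open>(\<omega>, t, x) \<mapsto> 1\<^sub>A (\<tau>\<^sub>t\<^sub>,\<^sub>x \<omega>)\<close>
  forces every path of the underlying space to be Borel measurable in time (fix \<open>\<omega>\<close> and take
  for \<open>A\<close> the event that the conductance of a given bond at time 0 exceeds a level).  Hence it
  can never hold on the set of all functions from \<open>\<real>\<close> to the positive reals.  We therefore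
  let the environment measure live on an arbitrary shift-invariant set of environments (for example the
  continuous ones), equipped with the trace of the Borel \<open>\<sigma>\<close>-algebra.  The choice
  \<open>space P = environments\<close> is allowed, and is the formulation with the full product space.
\<close>

definition environment_law :: "'n::finite environment measure \<Rightarrow> bool" where
  "environment_law P \<longleftrightarrow>
     prob_space P \<and>
     space P \<subseteq> environments \<and>
     sets P = sets (restrict_space borel (space P)) \<and>
     (\<forall>s z. \<forall>\<omega>\<in>space P. shift s z \<omega> \<in> space P)"

definition stationary_law :: "'n::finite environment measure \<Rightarrow> bool" where
  "stationary_law P \<longleftrightarrow> (\<forall>s z. distr P P (shift s z) = P)"

definition ergodic_law :: "'n::finite environment measure \<Rightarrow> bool" where
  "ergodic_law P \<longleftrightarrow>
     (\<forall>A\<in>sets P. (\<forall>s z. shift s z -` A \<inter> space P = A) \<longrightarrow> measure P A = 0 \<or> measure P A = 1)"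

definition admissible :: "'n::finite environment measure \<Rightarrow> bool" where
  "admissible P \<longleftrightarrow>
     environment_law P \<and>
     stationary_law P \<and> ergodic_law P \<and>
     (\<forall>(x, y)\<in>bonds. AE \<omega> in P. \<forall>t. \<omega> t (x, y) = \<omega> t (y, x)) \<and>
     (\<forall>e\<in>bonds. \<forall>t. integrable P (\<lambda>\<omega>. \<omega> t e)) \<and>
     (\<forall>A\<in>sets P. (\<lambda>(\<omega>, t, x). indicator A (shift t x \<omega>) :: real)
        \<in> borel_measurable (P \<Otimes>\<^sub>M (borel \<Otimes>\<^sub>M count_space UNIV)))"


section \<open>The variable speed random walk\<close>

definition exit_rate :: "'n::finite environment \<Rightarrow> real \<Rightarrow> 'n site \<Rightarrow> real" where
  "exit_rate \<omega> u z = (\<Sum>y | (z, y) \<in> bonds. \<omega> u (z, y))"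

definition locally_integrable_rates :: "'n::finite environment \<Rightarrow> bool" where
  "locally_integrable_rates \<omega> \<longleftrightarrow>
     (\<forall>e\<in>bonds. \<forall>a b. set_integrable lborel {a..b} (\<lambda>t. \<omega> t e))"

text \<open>
  The law of the next jump time after arrival in \<open>z\<close> at time \<open>r\<close>.  It lives on the extended
  reals, \<open>\<infinity>\<close> meaning that the walk stays in \<open>z\<close> forever.
\<close>

definition jump_time_law :: "'n::finite environment \<Rightarrow> real \<Rightarrow> 'n site \<Rightarrow> ereal measure" where
  "jump_time_law \<omega> r z =
     (THE N. prob_space N \<and> sets N = sets borel \<and>
        (\<forall>t\<ge>r. measure N {ereal t<..} = exp (- (LBINT u:{r..t}. exit_rate \<omega> u z))))"

definition jump_target_law :: "'n::finite environment \<Rightarrow> real \<Rightarrow> 'n site \<Rightarrow> 'n site measure" where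
  "jump_target_law \<omega> t z = point_measure UNIV (\<lambda>y. ennreal (\<omega> t (z, y) / exit_rate \<omega> t z))"

text \<open>
  The walk is built from its sequence of (arrival time, arrival site) pairs.  After a jump time
  \<open>\<infinity>\<close> the sequence stays constant; an arrival time \<open>-\<infinity>\<close> never occurs.
\<close>

abbreviation jump_space :: "(ereal \<times> 'n::finite site) measure" where
  "jump_space \<equiv> borel \<Otimes>\<^sub>M count_space UNIV"

definition jump_kernel ::
    "'n::finite environment \<Rightarrow> ereal \<times> 'n site \<Rightarrow> (ereal \<times> 'n site) measure" where
  "jump_kernel \<omega> = (\<lambda>(r, z).
     if r = \<infinity> then return jump_space (\<infinity>, z)
     else jump_time_law \<omega> (real_of_ereal r) z \<bind>
       (\<lambda>J. if J = \<infinity> then return jump_space (\<infinity>, z)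
             else distr (jump_target_law \<omega> (real_of_ereal J) z) jump_space (\<lambda>y. (J, y))))"

primrec jump_step ::
    "'n::finite environment \<Rightarrow> real \<Rightarrow> 'n site \<Rightarrow> nat \<Rightarrow> (nat \<Rightarrow> ereal \<times> 'n site)
      \<Rightarrow> (ereal \<times> 'n site) measure" where
  "jump_step \<omega> s x 0 h = return jump_space (ereal s, x)"
| "jump_step \<omega> s x (Suc k) h = jump_kernel \<omega> (h k)"

text \<open>
  \<open>Ionescu_Tulcea.CI\<close> is the projective family of finite-dimensional laws generated by the
  transition kernels, and \<open>projective_family.lim\<close> is its projective limit.
\<close>

definition walk_law ::
    "'n::finite environment \<Rightarrow> real \<Rightarrow> 'n site \<Rightarrow> (nat \<Rightarrow> ereal \<times> 'n site) measure" where
  "walk_law \<omega> s x =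
     projective_family.lim UNIV (Ionescu_Tulcea.CI (jump_step \<omega> s x) (\<lambda>_. jump_space)) (\<lambda>_. jump_space)"

text \<open>
  The position at time \<open>t\<close>, for \<open>t\<close> not before the starting time; \<open>None\<close> means that the walk
  has exploded by time \<open>t\<close>.
\<close>

definition walk_at :: "real \<Rightarrow> (nat \<Rightarrow> ereal \<times> 'n::finite site) \<Rightarrow> 'n site option" where
  "walk_at t h =
     (if \<exists>n. ereal t < fst (h (Suc n))
      then Some (snd (h (LEAST n. ereal t < fst (h (Suc n))))) else None)"

text \<open>
  The walk is defined only in environments with locally integrable rates, which for an admissible
  law is almost every environment; the value 0 elsewhere is a convention on a null set.
\<close>

definition heat_kernel ::
    "'n::finite environment \<Rightarrow> real \<Rightarrow> real \<Rightarrow> 'n site \<Rightarrow> 'n site \<Rightarrow> real" where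
  "heat_kernel \<omega> s t x y =
     (if locally_integrable_rates \<omega>
      then measure (walk_law \<omega> s x) {h \<in> space (walk_law \<omega> s x). walk_at t h = Some y}
      else 0)"

definition mean_heat_kernel ::
    "'n::finite environment measure \<Rightarrow> real \<Rightarrow> real \<Rightarrow> 'n site \<Rightarrow> 'n site \<Rightarrow> real" where
  "mean_heat_kernel P s t x y = (\<integral>\<omega>. heat_kernel \<omega> s t x y \<partial>P)"


section \<open>The walk is well defined in environments with locally integrable rates\<close>

text \<open>
  The law in \<open>jump_time_law\<close> exists and is unique, and the transition kernels satisfy the
  hypotheses of the Ionescu-Tulcea theorem.
\<close>

lemma ereal_measure_eqI:
  fixes M N :: "ereal measure"
  assumes "prob_space M" "prob_space N" and s: "sets M = sets borel" "sets N = sets borel"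
    and eq: "\<And>t. r \<le> t \<Longrightarrow> measure M {ereal t<..} = measure N {ereal t<..}"
    and one: "measure M {ereal r<..} = 1"
  shows "M = N"
proof -
  interpret M: prob_space M by fact
  interpret N: prob_space N by fact
  let ?E = "insert UNIV (range (greaterThan :: ereal \<Rightarrow> _))"
  have sp: "space M = UNIV" "space N = UNIV"
    using s[THEN sets_eq_imp_space_eq] by auto
  have gen: "sets borel = sigma_sets UNIV ?E"
  proof -
    have "sets (borel :: ereal measure) = sigma_sets UNIV (range greaterThan)"
      by (subst borel_Ioi) auto
    also have "\<dots> = sigma_sets UNIV ?E"
      by (intro antisym sigma_sets_mono' sigma_sets_mono)
        (auto intro: sigma_sets_top sigma_sets.Basic)
    finally show ?thesis .
  qed
  have eq': "measure M {a<..} = measure N {a<..}" for a :: ereal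
  proof (cases "a \<ge> ereal r")
    case True
    moreover have "{\<infinity>::ereal<..} = {}" by auto
    ultimately show ?thesis using eq by (cases a) auto
  next
    case False
    then have *: "{ereal r<..} \<subseteq> {a<..}" by auto
    have "measure M {a<..} \<ge> measure M {ereal r<..}"
      by (rule M.finite_measure_mono[OF *]) (simp add: s)
    moreover have "measure N {a<..} \<ge> measure N {ereal r<..}"
      by (rule N.finite_measure_mono[OF *]) (simp add: s)
    ultimately show ?thesis
      using one eq[of r] M.prob_le_1[of "{a<..}"] N.prob_le_1[of "{a<..}"] by linarith
  qed
  show ?thesis
  proof (rule measure_eqI_generator_eq[where E = ?E and \<Omega> = UNIV and A = "\<lambda>_. UNIV"])
    show "Int_stable ?E"
      proof -
      have *: "{a<..} \<inter> {b<..} = {max a b<..}" for a b :: ereal by auto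
      show ?thesis unfolding Int_stable_def by (auto simp: *)
    qed
    show "emeasure M X = emeasure N X" if "X \<in> ?E" for X
      using that eq' M.emeasure_space_1 N.emeasure_space_1 sp
      by (auto simp: M.emeasure_eq_measure N.emeasure_eq_measure)
    show "emeasure M UNIV \<noteq> \<infinity>" by simp
  qed (use s gen in auto)
qed

context
  fixes \<omega> :: "'n::finite environment"
  assumes env: "\<omega> \<in> environments" and loc: "locally_integrable_rates \<omega>"
begin

definition total_rate :: "'n site \<Rightarrow> real \<Rightarrow> real \<Rightarrow> real" where "total_rate z r t = (LBINT u:{r..t}. exit_rate \<omega> u z)"

lemma exit_nonneg: "0 \<le> exit_rate \<omega> u z"
  unfolding exit_rate_def using env by (intro sum_nonneg) (auto simp: environments_def less_imp_le)

lemma exit_integrable: "set_integrable lborel {a..b} (\<lambda>u. exit_rate \<omega> u z)"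
proof -
  have "integrable lborel (\<lambda>u. \<Sum>y | (z, y) \<in> bonds. indicator {a..b} u *\<^sub>R \<omega> u (z, y))"
    using loc unfolding locally_integrable_rates_def set_integrable_def
    by (intro Bochner_Integration.integrable_sum) auto
  then show ?thesis
    unfolding set_integrable_def exit_rate_def by (simp add: sum_distrib_left)
qed

lemma meas_bond: assumes "e \<in> bonds" shows "(\<lambda>t. \<omega> t e) \<in> borel_measurable borel"
proof -
  have m: "(\<lambda>t. indicator {-real n..real n} t *\<^sub>R \<omega> t e) \<in> borel_measurable borel" for n :: nat
  proof -
    have "integrable lborel (\<lambda>t. indicator {-real n..real n} t *\<^sub>R \<omega> t e)"
      using loc assms unfolding locally_integrable_rates_def set_integrable_def by blast
    from borel_measurable_integrable[OF this] show ?thesis by simp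
  qed
  show ?thesis
  proof (rule borel_measurable_LIMSEQ_real[OF _ m])
    fix t :: real
    obtain N :: nat where N: "real N \<ge> \<bar>t\<bar>" using real_arch_simple by blast
    show "(\<lambda>n. indicator {-real n..real n} t *\<^sub>R \<omega> t e) \<longlonglongrightarrow> \<omega> t e"
      by (rule tendsto_eventually) (use N in \<open>auto intro!: eventually_sequentiallyI[of N] simp: indicator_def\<close>)
  qed
qed

lemma meas_env[measurable]: "(\<lambda>t. \<omega> t e) \<in> borel_measurable borel"
proof (cases "e \<in> bonds")
  case False
  then have "\<omega> t e = 0" for t using env unfolding environments_def by blast
  then show ?thesis by simp
qed (rule meas_bond)

lemma meas_exit[measurable]: "(\<lambda>t. exit_rate \<omega> t z) \<in> borel_measurable borel"
  unfolding exit_rate_def by measurable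

lemma total_rate_refl: "total_rate z r r = 0"
  unfolding total_rate_def set_lebesgue_integral_def
  by (rule integral_eq_zero_AE) (use AE_lborel_singleton[of r] in eventually_elim, auto)

lemma total_rate_mono: "t \<le> t' \<Longrightarrow> total_rate z r t \<le> total_rate z r t'"
  unfolding total_rate_def set_lebesgue_integral_def
  using exit_integrable exit_nonneg
  by (intro integral_mono) (auto simp: set_integrable_def indicator_def)

lemma total_rate_nonneg: "0 \<le> total_rate z r t"
  unfolding total_rate_def set_lebesgue_integral_def
  using exit_nonneg by (intro integral_nonneg_AE) auto

lemma total_rate_cont: "continuous_on {r..b} (total_rate z r)"
proof -
  have "(\<lambda>u. exit_rate \<omega> u z) integrable_on {r..b}"
    using exit_integrable by (rule set_borel_integral_eq_integral)
  then have "continuous_on {r..b} (\<lambda>t. integral {r..t} (\<lambda>u. exit_rate \<omega> u z))"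
    by (rule indefinite_integral_continuous_1)
  then show ?thesis
    unfolding total_rate_def using set_borel_integral_eq_integral(2)[OF exit_integrable] by simp
qed

definition first_passage :: "'n site \<Rightarrow> real \<Rightarrow> real \<Rightarrow> ereal" where "first_passage z r \<xi> = Inf {ereal t | t. r \<le> t \<and> \<xi> \<le> total_rate z r t}"

lemma first_passage_gt: assumes "r \<le> t" shows "ereal t < first_passage z r \<xi> \<longleftrightarrow> total_rate z r t < \<xi>"
proof
  assume "ereal t < first_passage z r \<xi>"
  then show "total_rate z r t < \<xi>"
    using assms unfolding first_passage_def
    by (metis (mono_tags, lifting) Inf_lower leD leI mem_Collect_eq)
next
  assume lt: "total_rate z r t < \<xi>"
  have "continuous_on {r..t+1} (total_rate z r)" by (rule total_rate_cont)
  then have "((total_rate z r) \<longlongrightarrow> total_rate z r t) (at t within {r..t+1})"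
    using assms by (auto simp: continuous_on_def)
  then have "\<forall>\<^sub>F s in at t within {r..t+1}. total_rate z r s < \<xi>"
    using lt by (rule order_tendstoD)
  then obtain d where d: "d > 0" "\<And>s. s \<in> {r..t+1} \<Longrightarrow> s \<noteq> t \<Longrightarrow> dist s t < d \<Longrightarrow> total_rate z r s < \<xi>"
    unfolding eventually_at by auto
  define s where "s = t + min (d/2) 1"
  have s: "total_rate z r s < \<xi>" "t < s"
    using d assms by (auto simp: s_def dist_real_def)
  have "ereal s \<le> first_passage z r \<xi>"
    unfolding first_passage_def
  proof (rule Inf_greatest, clarsimp)
    fix u assume "r \<le> u" "\<xi> \<le> total_rate z r u"
    then show "s \<le> u" using s total_rate_mono[of u s z r] by (meson leD le_less_trans linorder_linear not_le)
  qed
  with s show "ereal t < first_passage z r \<xi>" by (meson less_ereal.simps(1) less_le_trans)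
qed

lemma first_passage_ge: "ereal r \<le> first_passage z r \<xi>"
  unfolding first_passage_def by (rule Inf_greatest) auto

lemma total_rate_meas[measurable]: "(\<lambda>r. total_rate z r t) \<in> borel_measurable borel"
proof -
  have [measurable]: "Measurable.pred (borel \<Otimes>\<^sub>M borel) (\<lambda>p. snd p \<in> {fst p..t} :: bool)" for t :: real
    by (simp add: atLeastAtMost_iff)
  have "(\<lambda>r. \<integral>u. indicator {r..t} u *\<^sub>R exit_rate \<omega> u z \<partial>lborel) \<in> borel_measurable borel"
    by measurable
  then show ?thesis unfolding total_rate_def set_lebesgue_integral_def .
qed

lemma first_passage_meas[measurable]: "(\<lambda>(r, \<xi>). first_passage z r \<xi>) \<in> borel_measurable (borel \<Otimes>\<^sub>M borel)"
proof (rule borel_measurableI_greater)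
  fix y :: ereal
  show "{p \<in> space (borel \<Otimes>\<^sub>M borel). y < (case p of (r, \<xi>) \<Rightarrow> first_passage z r \<xi>)} \<in> sets (borel \<Otimes>\<^sub>M borel)"
  proof (cases y)
    case (real t)
    have eq: "y < first_passage z r \<xi> \<longleftrightarrow> t < r \<or> (r \<le> t \<and> total_rate z r t < \<xi>)" for r \<xi>
      using first_passage_gt[of r t z \<xi>] first_passage_ge[of r z \<xi>] real
      by (metis less_ereal.simps(1) less_le_trans not_less)
    show ?thesis unfolding case_prod_beta eq by measurable
  next
    case PInf
    then show ?thesis by simp
  next
    case MInf
    have "y < first_passage z r \<xi>" for r \<xi>
      using first_passage_ge[of r z \<xi>] MInf by (cases "first_passage z r \<xi>") auto
    then show ?thesis by (simp add: case_prod_beta)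
  qed
qed

abbreviation (input) "Exp1 \<equiv> density lborel (\<lambda>x. ennreal (exponential_density 1 x))"

lemma law_first_passage: 
  shows "prob_space (distr Exp1 borel (first_passage z r))" (is ?A)
   and "r \<le> t \<Longrightarrow> measure (distr Exp1 borel (first_passage z r)) {ereal t<..} = exp (- total_rate z r t)"
proof -
  interpret E: prob_space Exp1 by (rule prob_space_exponential_density) simp
  have [measurable]: "first_passage z r \<in> borel_measurable borel" for r
    using measurable_compose[OF measurable_Pair1' first_passage_meas, of r z] by simp
  show ?A by (rule E.prob_space_distr) simp
  assume t: "r \<le> t"
  have "distributed Exp1 lborel (\<lambda>x. x) (exponential_density 1)"
    by (auto simp: distributed_def distr_id2)
  from E.exponential_distributedD_gt[OF this total_rate_nonneg[of z r t]]
  have "E.prob {\<xi>. total_rate z r t < \<xi>} = exp (- total_rate z r t)" by simp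
  moreover have "first_passage z r -` {ereal t<..} = {\<xi>. total_rate z r t < \<xi>}"
    using first_passage_gt[OF t] by auto
  ultimately show "measure (distr Exp1 borel (first_passage z r)) {ereal t<..} = exp (- total_rate z r t)"
    by (subst measure_distr) auto
qed

lemma jump_time_law_eq: "jump_time_law \<omega> r z = distr Exp1 borel (first_passage z r)"
  unfolding jump_time_law_def total_rate_def[symmetric]
proof (rule the_equality)
  show "prob_space (distr Exp1 borel (first_passage z r)) \<and>
    sets (distr Exp1 borel (first_passage z r)) = sets borel \<and>
    (\<forall>t\<ge>r. measure (distr Exp1 borel (first_passage z r)) {ereal t<..} = exp (- total_rate z r t))"
    using law_first_passage by auto
  fix N :: "ereal measure"
  assume N: "prob_space N \<and> sets N = sets borel \<and> (\<forall>t\<ge>r. measure N {ereal t<..} = exp (- total_rate z r t))"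
  then show "N = distr Exp1 borel (first_passage z r)"
    using law_first_passage by (intro ereal_measure_eqI[of _ _ r]) (auto simp: total_rate_refl)
qed

lemma
  prob_space_jump_time_law: "prob_space (jump_time_law \<omega> r z)" and
  jump_time_law_survival:
    "r \<le> t \<Longrightarrow> measure (jump_time_law \<omega> r z) {ereal t<..}
       = exp (- (LBINT u:{r..t}. exit_rate \<omega> u z))"
  using law_first_passage by (simp_all add: jump_time_law_eq total_rate_def[symmetric])

lemma nbr_ex: "\<exists>y. (z, y) \<in> (bonds :: ('n site \<times> 'n site) set)"
proof -
  obtain k :: 'n where True by simp
  have "graph_dist z (z + axis k 1) = 1"
    unfolding graph_dist_def by (simp add: axis_def if_distrib[of abs] cong: if_cong)
  then show ?thesis by (auto simp: bonds_def)
qed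

lemma nbr_fin: "finite {y. (z, y) \<in> (bonds :: ('n site \<times> 'n site) set)}"
proof -
  have "y \<in> vec_lambda ` (UNIV \<rightarrow>\<^sub>E {Min (range (\<lambda>i. z $ i)) - 1..Max (range (\<lambda>i. z $ i)) + 1})"
    if "(z, y) \<in> bonds" for y
  proof -
    have *: "\<bar>z $ i - y $ i\<bar> \<le> 1" for i
      using that member_le_sum[of i UNIV "\<lambda>i. \<bar>z $ i - y $ i\<bar>"] unfolding bonds_def graph_dist_def by auto
    have "Min (range (\<lambda>i. z $ i)) - 1 \<le> y $ i \<and> y $ i \<le> Max (range (\<lambda>i. z $ i)) + 1" for i
    proof -
      have "Min (range (\<lambda>i. z $ i)) \<le> z $ i" "z $ i \<le> Max (range (\<lambda>i. z $ i))" by auto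
      with *[of i] show ?thesis by linarith
    qed
    then show ?thesis by (intro image_eqI[of _ _ "vec_nth y"]) auto
  qed
  then have "{y. (z, y) \<in> bonds} \<subseteq> vec_lambda ` (UNIV \<rightarrow>\<^sub>E {Min (range (\<lambda>i. z $ i)) - 1..Max (range (\<lambda>i. z $ i)) + 1})"
    by blast
  then show ?thesis
    by (rule finite_subset) (intro finite_imageI finite_PiE finite_atLeastAtMost_int finite_class.finite_UNIV)
qed

lemma target_prob: "prob_space (jump_target_law \<omega> t z)"
proof
  let ?B = "{y. (z, y) \<in> bonds}"
  have pos: "exit_rate \<omega> t z > 0"
    unfolding exit_rate_def using env nbr_ex nbr_fin
    by (intro sum_pos) (auto simp: environments_def)
  have "emeasure (jump_target_law \<omega> t z) UNIV = (\<integral>\<^sup>+y. ennreal (\<omega> t (z, y) / exit_rate \<omega> t z) \<partial>count_space UNIV)"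
    unfolding jump_target_law_def point_measure_def by (subst emeasure_density) auto
  also have "\<dots> = (\<Sum>y\<in>?B. ennreal (\<omega> t (z, y) / exit_rate \<omega> t z))"
    using env nbr_fin by (intro nn_integral_count_space') (auto simp: environments_def)
  also have "\<dots> = ennreal (\<Sum>y\<in>?B. \<omega> t (z, y) / exit_rate \<omega> t z)"
    using env exit_nonneg by (intro sum_ennreal) (auto simp: environments_def less_imp_le)
  also have "\<dots> = 1"
    using pos by (simp add: sum_divide_distrib[symmetric] exit_rate_def)
  finally show "emeasure (jump_target_law \<omega> t z) (space (jump_target_law \<omega> t z)) = 1"
    by (simp add: jump_target_law_def space_point_measure)
qed

lemma prob_spaceI_alg: "prob_space M \<Longrightarrow> sets M = sets N \<Longrightarrow> M \<in> space (subprob_algebra N)"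
  by (auto simp: space_subprob_algebra intro: prob_space_imp_subprob_space)

lemma target_meas: 
  "(\<lambda>J. distr (jump_target_law \<omega> (real_of_ereal J) z) jump_space (\<lambda>y. (J, y)))
    \<in> measurable borel (subprob_algebra jump_space)"
proof (rule measurable_distr2[where M="count_space UNIV"])
  show "(\<lambda>J. jump_target_law \<omega> (real_of_ereal J) z) \<in> measurable borel (subprob_algebra (count_space UNIV))"
  proof (rule measurable_subprob_algebra)
    fix J :: ereal
    show "subprob_space (jump_target_law \<omega> (real_of_ereal J) z)"
      using target_prob prob_space_imp_subprob_space by blast
    show "sets (jump_target_law \<omega> (real_of_ereal J) z) = sets (count_space UNIV)"
      by (simp add: jump_target_law_def sets_point_measure)
  next
    fix A :: "'n site set"
    have "emeasure (jump_target_law \<omega> (real_of_ereal J) z) A =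
       (\<Sum>y | (z,y) \<in> bonds. ennreal (\<omega> (real_of_ereal J) (z, y) / exit_rate \<omega> (real_of_ereal J) z) * indicator A y)" for J
    unfolding jump_target_law_def point_measure_def using nbr_fin[of z] env
      by (subst emeasure_density, simp, simp, intro nn_integral_count_space')
        (simp_all add: environments_def)
    then show "(\<lambda>J. emeasure (jump_target_law \<omega> (real_of_ereal J) z) A) \<in> borel_measurable borel"
      by simp
  qed
qed simp

lemma kernel_meas: "jump_kernel \<omega> \<in> measurable jump_space (subprob_algebra jump_space)"
proof -
  have *: "(\<lambda>r. jump_kernel \<omega> (r, z)) \<in> measurable borel (subprob_algebra jump_space)" for z
  proof -
    note target_meas[measurable]
    have jtl: "(\<lambda>r. jump_time_law \<omega> (real_of_ereal r) z) \<in> measurable borel (subprob_algebra borel)"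
      unfolding jump_time_law_eq
    proof (rule measurable_distr2[where M=lborel])
      show "(\<lambda>(x, y). first_passage z (real_of_ereal x) y) \<in> borel_measurable (borel \<Otimes>\<^sub>M lborel)" 
        using measurable_compose[OF _ first_passage_meas, of "\<lambda>p. (real_of_ereal (fst p), snd p)" "borel \<Otimes>\<^sub>M lborel" z]
        by (simp add: case_prod_beta)
      show "(\<lambda>r::ereal. Exp1) \<in> borel \<rightarrow>\<^sub>M subprob_algebra lborel"
        using prob_space_exponential_density[of 1] by (intro measurable_const prob_spaceI_alg) auto
    qed
    have ret: "(\<lambda>r::ereal. return jump_space (\<infinity>, z)) \<in> borel \<rightarrow>\<^sub>M subprob_algebra (jump_space :: (ereal \<times> 'n site) measure)"
      by (intro measurable_const prob_spaceI_alg prob_space_return) (auto simp: space_pair_measure)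
    have m: "(\<lambda>J. if J = \<infinity> then return jump_space (\<infinity>, z)
             else distr (jump_target_law \<omega> (real_of_ereal J) z) jump_space (\<lambda>y. (J, y)))
       \<in> borel \<rightarrow>\<^sub>M subprob_algebra jump_space"
      by (rule measurable_If[OF ret target_meas]) simp
    show ?thesis
      unfolding jump_kernel_def prod.case
      by (rule measurable_If[OF ret measurable_bind2[OF jtl m]]) simp
  qed
  have "(\<lambda>p. jump_kernel \<omega> (fst p, z)) \<in> measurable jump_space (subprob_algebra jump_space)" for z
    by (rule measurable_compose[OF measurable_fst *])
  then have "(\<lambda>p. (\<lambda>z. jump_kernel \<omega> (fst p, z)) (snd p)) \<in> measurable jump_space (subprob_algebra jump_space)"
    by (rule measurable_compose_countable) auto
  then show ?thesis by simp
qed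

lemma kernel_prob: "prob_space (jump_kernel \<omega> p)"
proof (cases p)
  case (Pair r z)
  note target_meas[measurable]
  have ret: "(\<lambda>r::ereal. return jump_space (\<infinity>, z)) \<in> borel \<rightarrow>\<^sub>M subprob_algebra (jump_space :: (ereal \<times> 'n site) measure)"
      by (intro measurable_const prob_spaceI_alg prob_space_return) (auto simp: space_pair_measure)
  have m: "(\<lambda>J. if J = \<infinity> then return jump_space (\<infinity>, z)
             else distr (jump_target_law \<omega> (real_of_ereal J) z) jump_space (\<lambda>y. (J, y)))
       \<in> borel \<rightarrow>\<^sub>M subprob_algebra jump_space"
      by (rule measurable_If[OF ret target_meas]) simp
  have 1: "prob_space (jump_time_law \<omega> (real_of_ereal r) z)"
    unfolding jump_time_law_eq by (rule law_first_passage)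
  have r: "prob_space (return (jump_space :: (ereal \<times> 'n site) measure) (\<infinity>, z))"
    by (intro prob_space_return) (simp add: space_pair_measure)
  have 2: "prob_space (if J = \<infinity> then return jump_space (\<infinity>, z)
             else distr (jump_target_law \<omega> (real_of_ereal J) z) jump_space (\<lambda>y. (J, y)))" for J
    proof -
    have "(\<lambda>y. (J, y)) \<in> measurable (jump_target_law \<omega> (real_of_ereal J) z) jump_space"
      unfolding jump_target_law_def measurable_point_measure_eq1 by (simp add: space_pair_measure)
    with r show ?thesis by (auto intro: prob_space.prob_space_distr target_prob)
  qed
  have "prob_space (jump_time_law \<omega> (real_of_ereal r) z \<bind>
       (\<lambda>J. if J = \<infinity> then return jump_space (\<infinity>, z)
             else distr (jump_target_law \<omega> (real_of_ereal J) z) jump_space (\<lambda>y. (J, y))))"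
    by (rule prob_space.prob_space_bind[OF 1, where S=jump_space])
       (use 2 m in \<open>auto simp: jump_time_law_eq\<close>)
  with r show ?thesis unfolding Pair jump_kernel_def by auto
qed

lemma Ionescu_Tulcea_jump_step: "Ionescu_Tulcea (jump_step \<omega> s x) (\<lambda>_. jump_space)"
proof (rule Ionescu_Tulcea.intro)
  fix i
  show "jump_step \<omega> s x i \<in> measurable (PiM {0..<i} (\<lambda>_. jump_space)) (subprob_algebra jump_space)"
  proof (cases i)
    case 0
    have "jump_step \<omega> s x 0 = (\<lambda>h. return jump_space (ereal s, x))" by auto
    with 0 show ?thesis by (auto intro!: measurable_const prob_spaceI_alg prob_space_return simp: space_pair_measure)
  next
    case (Suc k)
    then show ?thesis
      using measurable_compose[OF measurable_component_singleton[of k "{0..<i}" "\<lambda>_. jump_space"] kernel_meas]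
      by (simp add: jump_step.simps(2)[abs_def])
  qed
next
  fix i and h :: "nat \<Rightarrow> ereal \<times> 'n site"
  assume "h \<in> space (Pi\<^sub>M {0..<i} (\<lambda>_. jump_space))"
  show "prob_space (jump_step \<omega> s x i h)"
    by (cases i) (auto intro!: prob_space_return kernel_prob simp: space_pair_measure)
qed

end

end

theory Submission
  imports Defs
begin

text \<open>
Let \<open>f t\<close> be the averaged kernel between two sites. Splitting the walk at time zero, by the Chapman-Kolmogorov
identity and stationarity in time, gives for all \<open>\<sigma>, \<tau> \<ge> 0\<close>
the representation of \<open>f (\<sigma> + \<tau>)\<close> as the expectation of the sum over \<open>z\<close> of
\<open>p (- \<sigma>) 0 y z * p 0 \<tau> z y'\<close> (\<open>mean_kernel_pairing\<close>). The two factors are functions of \<open>\<sigma>\<close> and of \<open>\<tau>\<close> separately,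
so a time derivative can be shared between them as half a derivative of each. Half a derivative in time costs only one
spatial gradient, and gradients are controlled by the energy identity. For the kernel of one environment there is no such
freedom in the choice of representation, and no pointwise bound on its time derivative.

In detail, \<open>N\<close> such representations with times in steps of \<open>\<delta> = t / (3 * N)\<close> are superposed with a
tent-shaped weight. The difference between \<open>f t\<close> and \<open>f (t - \<delta>)\<close>, multiplied by a weight of order \<open>N\<close>, is then a pairing of one sampled
kernel with the increments of the other. By Fourier analysis on the cyclic group of order \<open>N\<close> it is bounded by the sum of the
time energies of the two samples (\<open>abs_sum_mult_increment_le_half_energy\<close>). The time energy is the pairing of the increments of the samples
with their discrete Hilbert transform in time. The increments are integrals of the generator, and the generator paired
with the transform is a Dirichlet form. Since the conductances are comparable up to \<open>c1\<close> with those at time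
zero, the Dirichlet form may be taken with weights that do not depend on time, and with respect to such weights the transform, which acts only in time,
contracts (\<open>sampled_time_energy_bound\<close>). Averaged over one sampling step, the time energy is therefore bounded by the squared norm of
the kernel at a time of order \<open>t\<close> (\<open>averaged_time_energy_bound\<close>), and this norm is of order \<open>t powr (- d / 2)\<close> by the Nash inequality and
ellipticity (\<open>killed_flow_decay\<close>). Both bounds are proved for walks killed outside large boxes and carried over to the
lattice by Fatou's lemma. Stationarity in space and time reversal provide the sum over the splitting site \<open>z\<close>, for
both factors (\<open>mean_sample_energy\<close>). Division by the weight yields the increment bound
\<open>C * \<delta> * t powr (- d / 2 - 1)\<close> (\<open>mean_kernel_increment\<close>).

It remains to know that \<open>f\<close> is differentiable. The forward equation holds in integrated form, with a drift that involves the
conductances at the running time. In expectation the environment can be shifted so that these become the conductances at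
time zero, and the drift is then continuous in time by dominated convergence (\<open>mean_kernel_has_derivative\<close>). The bound on the derivative follows as
\<open>N\<close> grows.

The random walk is connected to analysis by an explicit series for its kernel over the number of jumps
(\<open>heat_kernel_eq_transition\<close>), whose terms are iterated integrals over the jump times. Chapman-Kolmogorov, reversal, covariance
under shifts, monotone approximation by boxes and joint measurability are all read off from the series.
\<close>

section \<open>Calculus of indefinite Lebesgue integrals\<close>

text \<open>
This replaces almost-everywhere differentiation of absolutely continuous functions: an error that is
quadratic in the increments of a continuous monotone function vanishes when the interval is subdivided.
\<close>
lemma quadratic_increments_imp_const:
  fixes H M :: "real \<Rightarrow> real"
  assumes ab: "a \<le> b" and M: "continuous_on {a..b} M" "\<And>u v. a \<le> u \<Longrightarrow> u \<le> v \<Longrightarrow> v \<le> b \<Longrightarrow> M u \<le> M v"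
    and H: "\<And>u v. a \<le> u \<Longrightarrow> u \<le> v \<Longrightarrow> v \<le> b \<Longrightarrow> \<bar>H v - H u\<bar> \<le> K * (M v - M u)\<^sup>2"
  shows "H b = H a"
proof -
  define D where "D = M b - M a"
  have D0: "D \<ge> 0" using M(2)[of a b] ab by (simp add: D_def)
  \<comment> \<open>Cut the interval where \<open>M\<close> takes \<open>n\<close> equally spaced values.\<close>
  have bound: "\<bar>H b - H a\<bar> \<le> K * D\<^sup>2 / real n" if n: "n > 0" for n :: nat
  proof (cases "D = 0")
    case True
    then show ?thesis using H[of a b] ab by (simp add: D_def)
  next
    case False
    with D0 have Dpos: "D > 0" by simp
    have "\<exists>x. a \<le> x \<and> x \<le> b \<and> M x = M a + real i / real n * D" if "i \<le> n" for i
    proof (rule IVT'[OF _ _ ab M(1)])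
      show "M a \<le> M a + real i / real n * D" using D0 by simp
      have "real i / real n * D \<le> 1 * D"
        using that n D0 by (intro mult_right_mono) (auto simp: field_simps)
      then show "M a + real i / real n * D \<le> M b" by (simp add: D_def)
    qed
    then obtain x where x: "\<And>i. i \<le> n \<Longrightarrow> a \<le> x i \<and> x i \<le> b \<and> M (x i) = M a + real i / real n * D"
      by metis
    have inc: "\<bar>H (x (Suc i)) - H (x i)\<bar> \<le> K * (D / real n)\<^sup>2" if i: "i < n" for i
    proof -
      have eq: "M (x (Suc i)) - M (x i) = D / real n"
        using x[of i] x[of "Suc i"] i n by (simp add: field_simps)
      have "x i \<le> x (Suc i)"
      proof (rule ccontr)
        assume "\<not> ?thesis"
        then have "M (x (Suc i)) \<le> M (x i)" using x[of i] x[of "Suc i"] i by (intro M(2)) auto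
        moreover have "D / real n > 0" using Dpos n by simp
        ultimately show False using eq by linarith
      qed
      then show ?thesis using H[of "x i" "x (Suc i)"] x[of i] x[of "Suc i"] i eq by simp
    qed
    have "\<bar>H (x m) - H (x 0)\<bar> \<le> real m * (K * (D / real n)\<^sup>2)" if "m \<le> n" for m
      using that
    proof (induction m)
      case (Suc m)
      then show ?case using inc[of m] by (simp add: algebra_simps)
    qed simp
    from this[of n] have 1: "\<bar>H (x n) - H (x 0)\<bar> \<le> K * D\<^sup>2 / real n"
      using n by (simp add: field_simps power2_eq_square)
    have 2: "H (x 0) = H a" using H[of a "x 0"] x[of 0] by simp
    have 3: "H b = H (x n)" using H[of "x n" b] x[of n] n by (simp add: D_def)
    show ?thesis using 1 2 3 by simp
  qed
  have "(\<lambda>n. K * D\<^sup>2 / real n) \<longlonglongrightarrow> 0" by (rule lim_const_over_n)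
  then have "\<bar>H b - H a\<bar> \<le> 0"
    by (rule tendsto_lowerbound) (auto intro!: eventually_sequentiallyI[of 1] bound)
  then show ?thesis by simp
qed

lemma set_lebesgue_integral_combine:
  fixes f :: "real \<Rightarrow> real"
  assumes "a \<le> b" "b \<le> c" and f: "set_integrable lborel {a..c} f"
  shows "(LBINT r:{a..b}. f r) + (LBINT r:{b..c}. f r) = (LBINT r:{a..c}. f r)"
proof -
  have 1: "set_integrable lborel {a..b} f" "set_integrable lborel {b..c} f"
    using assms by (auto intro: set_integrable_subset)
  show ?thesis
    using assms 1 f by (simp add: set_borel_integral_eq_integral Henstock_Kurzweil_Integration.integral_combine)
qed

lemma continuous_on_set_lebesgue_integral:
  fixes f :: "real \<Rightarrow> real"
  assumes f: "set_integrable lborel {a..b} f"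
  shows "continuous_on {a..b} (\<lambda>t. LBINT r:{a..t}. f r)"
proof -
  have "continuous_on {a..b} (\<lambda>t. integral {a..t} f)"
    using f by (intro indefinite_integral_continuous_1 set_borel_integral_eq_integral)
  moreover have "(LBINT r:{a..t}. f r) = integral {a..t} f" if "t \<in> {a..b}" for t
    using that f by (intro set_borel_integral_eq_integral) (auto intro: set_integrable_subset)
  ultimately show ?thesis by (metis (no_types, lifting) continuous_on_eq)
qed

lemma set_integrable_continuous_mult:
  fixes f g :: "real \<Rightarrow> real"
  assumes g: "continuous_on {a..b} g" and f: "set_integrable lborel {a..b} f"
  shows "set_integrable lborel {a..b} (\<lambda>r. g r * f r)"
proof -
  have "bounded (g ` {a..b})" using compact_continuous_image[OF g] compact_imp_bounded by blast
  then obtain B where "\<forall>x\<in>g ` {a..b}. norm x \<le> B" unfolding bounded_iff by blast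
  then have B: "\<bar>g r\<bar> \<le> B" if "r \<in> {a..b}" for r using that by auto
  have m: "(\<lambda>r. indicator {a..b} r *\<^sub>R f r) \<in> borel_measurable lborel"
    using f unfolding set_integrable_def by simp
  have g': "(\<lambda>r. indicator {a..b} r *\<^sub>R g r) \<in> borel_measurable lborel"
    using borel_measurable_continuous_on_indicator[OF _ g] by simp
  have eq: "(\<lambda>r. indicator {a..b} r *\<^sub>R (g r * f r)) = (\<lambda>r. (indicator {a..b} r *\<^sub>R g r) * (indicator {a..b} r *\<^sub>R f r))"
    by (auto simp: indicator_def)
  show ?thesis unfolding set_integrable_def
  proof (rule Bochner_Integration.integrable_bound)
    show "integrable lborel (\<lambda>r. B * (indicator {a..b} r *\<^sub>R f r))"
      using f unfolding set_integrable_def by (rule integrable_mult_right)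
    show "(\<lambda>r. indicator {a..b} r *\<^sub>R (g r * f r)) \<in> borel_measurable lborel"
      unfolding eq using g' m by (rule borel_measurable_times)
    show "AE r in lborel. norm (indicator {a..b} r *\<^sub>R (g r * f r)) \<le> norm (B * (indicator {a..b} r *\<^sub>R f r))"
    proof (intro AE_I2)
      fix r
      have "\<bar>g r\<bar> * \<bar>f r\<bar> \<le> \<bar>B\<bar> * \<bar>f r\<bar>" if "r \<in> {a..b}"
        using B[OF that] by (intro mult_right_mono) auto
      then show "norm (indicator {a..b} r *\<^sub>R (g r * f r)) \<le> norm (B * (indicator {a..b} r *\<^sub>R f r))"
        by (auto simp: indicator_def abs_mult)
    qed
  qed
qed

lemma set_lebesgue_integral_nonneg':
  fixes f :: "real \<Rightarrow> real"
  assumes "\<And>r. r \<in> A \<Longrightarrow> 0 \<le> f r"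
  shows "0 \<le> (LBINT r:A. f r)"
  unfolding set_lebesgue_integral_def
  by (intro integral_nonneg_AE AE_I2) (use assms in \<open>auto simp: indicator_def\<close>)

lemma set_lebesgue_integral_mono':
  fixes f g :: "real \<Rightarrow> real"
  assumes "set_integrable lborel A f" "set_integrable lborel A g" "\<And>r. r \<in> A \<Longrightarrow> f r \<le> g r"
  shows "(LBINT r:A. f r) \<le> (LBINT r:A. g r)"
  by (rule set_integral_mono[OF assms])

text \<open>
The difference between both sides has increments that are quadratic in those of
\<open>t \<mapsto> LBINT r:{a..t}. \<bar>f r\<bar>\<close>: the Taylor remainder of \<open>G\<close> and the variation of \<open>G'\<close> each
contribute two factors. It is therefore constant. The rule serves integrands such as the conductances, which
are merely measurable in time.
\<close>
lemma indefinite_integral_chain_rule: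
  fixes f F G G' :: "real \<Rightarrow> real"
  assumes ab: "a \<le> b" and f: "set_integrable lborel {a..b} f"
    and F: "\<And>t. t \<in> {a..b} \<Longrightarrow> F t = F a + (LBINT r:{a..t}. f r)"
    and S: "\<And>t. t \<in> {a..b} \<Longrightarrow> F t \<in> S"
    and G: "\<And>x y. x \<in> S \<Longrightarrow> y \<in> S \<Longrightarrow> \<bar>G y - G x - G' x * (y - x)\<bar> \<le> K * (y - x)\<^sup>2"
    and G': "\<And>x y. x \<in> S \<Longrightarrow> y \<in> S \<Longrightarrow> \<bar>G' y - G' x\<bar> \<le> K * \<bar>y - x\<bar>"
    and K: "0 \<le> K"
  shows "set_integrable lborel {a..b} (\<lambda>r. G' (F r) * f r)"
    and "G (F b) - G (F a) = (LBINT r:{a..b}. G' (F r) * f r)"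
proof -
  have contF: "continuous_on {a..b} F"
    using continuous_on_set_lebesgue_integral[OF f] F
    by (subst continuous_on_cong[OF refl F]) (auto intro!: continuous_intros)
  have contG': "continuous_on S G'"
  proof (rule continuous_onI)
    fix x e :: real assume x: "x \<in> S" and e: "0 < e"
    show "\<exists>d>0. \<forall>x'\<in>S. dist x' x < d \<longrightarrow> dist (G' x') (G' x) \<le> e"
    proof (intro exI conjI ballI impI)
      show "0 < e / (K + 1)" using K e by simp
      fix y assume y: "y \<in> S" "dist y x < e / (K + 1)"
      have "K * \<bar>y - x\<bar> \<le> (K + 1) * \<bar>y - x\<bar>" by (intro mult_right_mono) auto
      also have "\<dots> \<le> e" using y K by (simp add: dist_real_def field_simps)
      finally show "dist (G' y) (G' x) \<le> e" using G'[OF x y(1)] by (simp add: dist_real_def)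
    qed
  qed
  have cont: "continuous_on {a..b} (\<lambda>r. G' (F r))"
    by (rule continuous_on_compose2[OF contG' contF]) (use S in auto)
  show int: "set_integrable lborel {a..b} (\<lambda>r. G' (F r) * f r)"
    by (rule set_integrable_continuous_mult[OF cont f])
  have fabs: "set_integrable lborel {a..b} (\<lambda>r. \<bar>f r\<bar>)"
    using set_integrable_abs[OF f] by simp
  define M where "M t = (LBINT r:{a..t}. \<bar>f r\<bar>)" for t
  define H where "H t = G (F t) - (LBINT r:{a..t}. G' (F r) * f r)" for t
  have sub: "set_integrable lborel {u..v} g" if "set_integrable lborel {a..b} g" "a \<le> u" "v \<le> b" for u v and g :: "real \<Rightarrow> real"
    using that by (auto intro: set_integrable_subset)
  have Mdiff: "M v - M u = (LBINT r:{u..v}. \<bar>f r\<bar>)" if "a \<le> u" "u \<le> v" "v \<le> b" for u v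
    using set_lebesgue_integral_combine[of a u v "\<lambda>r. \<bar>f r\<bar>"] that sub[OF fabs, of a v] by (simp add: M_def)
  have Fdiff: "F v - F u = (LBINT r:{u..v}. f r)" if "a \<le> u" "u \<le> v" "v \<le> b" for u v
    using set_lebesgue_integral_combine[of a u v f] that sub[OF f, of a v] F[of u] F[of v] by simp
  have Fle: "\<bar>F v - F u\<bar> \<le> M v - M u" if "a \<le> u" "u \<le> v" "v \<le> b" for u v
  proof -
    have "norm (LBINT r:{u..v}. f r) \<le> (LBINT r:{u..v}. norm (f r))"
      by (rule set_integral_norm_bound) (use that sub[OF f] in auto)
    then show ?thesis using Mdiff[OF that] Fdiff[OF that] by simp
  qed
  have "H b = H a"
  proof (rule quadratic_increments_imp_const[OF ab, of M H "2 * K"])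
    show "continuous_on {a..b} M" unfolding M_def by (rule continuous_on_set_lebesgue_integral[OF fabs])
    show mono: "M u \<le> M v" if "a \<le> u" "u \<le> v" "v \<le> b" for u v
      using Fle[OF that] by linarith
    fix u v assume uv: "a \<le> u" "u \<le> v" "v \<le> b"
    let ?d = "M v - M u"
    have d0: "?d \<ge> 0" using mono[OF uv] by simp
    have i1: "set_integrable lborel {u..v} (\<lambda>r. G' (F r) * f r)" using sub[OF int] uv by simp
    have i2: "set_integrable lborel {u..v} f" using sub[OF f] uv by simp
    have i3: "set_integrable lborel {u..v} (\<lambda>r. \<bar>f r\<bar>)" using sub[OF fabs] uv by simp
    have "H v - H u = G (F v) - G (F u) - (LBINT r:{u..v}. G' (F r) * f r)"
      using set_lebesgue_integral_combine[of a u v "\<lambda>r. G' (F r) * f r"] uv sub[OF int, of a v]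
      by (simp add: H_def)
    also have "\<dots> = (G (F v) - G (F u) - G' (F u) * (F v - F u))
        - ((LBINT r:{u..v}. G' (F r) * f r) - (LBINT r:{u..v}. G' (F u) * f r))"
      using Fdiff[OF uv] by simp
    also have "(LBINT r:{u..v}. G' (F r) * f r) - (LBINT r:{u..v}. G' (F u) * f r)
       = (LBINT r:{u..v}. G' (F r) * f r - G' (F u) * f r)"
      using i1 i2 by (intro set_integral_diff(2)[symmetric]) auto
    finally have e: "H v - H u = (G (F v) - G (F u) - G' (F u) * (F v - F u))
        - (LBINT r:{u..v}. G' (F r) * f r - G' (F u) * f r)" .
    have "\<bar>LBINT r:{u..v}. G' (F r) * f r - G' (F u) * f r\<bar> \<le> (LBINT r:{u..v}. \<bar>G' (F r) * f r - G' (F u) * f r\<bar>)"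
      using set_integral_norm_bound[OF set_integral_diff(1)[OF i1 set_integrable_mult_right[OF i2]]] by auto
    also have "\<dots> \<le> (LBINT r:{u..v}. K * ?d * \<bar>f r\<bar>)"
    proof (rule set_lebesgue_integral_mono')
      show "set_integrable lborel {u..v} (\<lambda>r. \<bar>G' (F r) * f r - G' (F u) * f r\<bar>)"
        using set_integrable_abs[OF set_integral_diff(1)[OF i1 set_integrable_mult_right[OF i2]]] by auto
      show "set_integrable lborel {u..v} (\<lambda>r. K * ?d * \<bar>f r\<bar>)" using i3 by simp
      fix r assume r: "r \<in> {u..v}"
      have "\<bar>G' (F r) - G' (F u)\<bar> \<le> K * \<bar>F r - F u\<bar>" using r uv by (intro G' S) auto
      also have "\<dots> \<le> K * ?d"
        using Fle[of u r] mono[of r v] r uv K by (intro mult_left_mono) auto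
      finally have "\<bar>G' (F r) - G' (F u)\<bar> * \<bar>f r\<bar> \<le> K * ?d * \<bar>f r\<bar>" by (intro mult_right_mono) auto
      then show "\<bar>G' (F r) * f r - G' (F u) * f r\<bar> \<le> K * ?d * \<bar>f r\<bar>"
        by (simp add: left_diff_distrib[symmetric] abs_mult)
    qed
    also have "\<dots> = K * ?d\<^sup>2" using Mdiff[OF uv] by (simp add: power2_eq_square)
    finally have 1: "\<bar>LBINT r:{u..v}. G' (F r) * f r - G' (F u) * f r\<bar> \<le> K * ?d\<^sup>2" .
    have "\<bar>G (F v) - G (F u) - G' (F u) * (F v - F u)\<bar> \<le> K * (F v - F u)\<^sup>2"
      using uv by (intro G S) auto
    also have "\<dots> \<le> K * ?d\<^sup>2"
      using Fle[OF uv] d0 K by (intro mult_left_mono abs_le_square_iff[THEN iffD1]) auto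
    finally show "\<bar>H v - H u\<bar> \<le> 2 * K * ?d\<^sup>2" using e 1 by linarith
  qed
  moreover have "(LBINT r:{a..a}. G' (F r) * f r) = 0"
    unfolding set_lebesgue_integral_def
    by (rule integral_eq_zero_AE) (use AE_lborel_singleton[of a] in eventually_elim, auto)
  ultimately show "G (F b) - G (F a) = (LBINT r:{a..b}. G' (F r) * f r)" by (simp add: H_def)
qed

lemma indefinite_integral_square:
  fixes f F :: "real \<Rightarrow> real"
  assumes "a \<le> b" "set_integrable lborel {a..b} f"
    and "\<And>t. t \<in> {a..b} \<Longrightarrow> F t = F a + (LBINT r:{a..t}. f r)"
  shows "set_integrable lborel {a..b} (\<lambda>r. F r * f r)"
    and "(F b)\<^sup>2 - (F a)\<^sup>2 = 2 * (LBINT r:{a..b}. F r * f r)"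
proof -
  have 1: "\<bar>y\<^sup>2 - x\<^sup>2 - 2 * x * (y - x)\<bar> \<le> 2 * (y - x)\<^sup>2" for x y :: real
  proof -
    have "y\<^sup>2 - x\<^sup>2 - 2 * x * (y - x) = (y - x)\<^sup>2" by (simp add: power2_eq_square algebra_simps)
    then show ?thesis by simp
  qed
  have 2: "\<bar>2 * y - 2 * x\<bar> \<le> 2 * \<bar>y - x\<bar>" for x y :: real by (auto simp: abs_if)
  note * = indefinite_integral_chain_rule[OF assms, of UNIV "\<lambda>x. x\<^sup>2" "\<lambda>x. 2 * x" 2, OF _ UNIV_I 1 2]
  have "set_integrable lborel {a..b} (\<lambda>r. (1/2) * (2 * F r * f r))"
    by (rule set_integrable_mult_right) (use *(1) in simp)
  then show "set_integrable lborel {a..b} (\<lambda>r. F r * f r)" by simp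
  show "(F b)\<^sup>2 - (F a)\<^sup>2 = 2 * (LBINT r:{a..b}. F r * f r)"
    using *(2) by (simp add: mult.assoc)
qed

text \<open>
The probability that a clock with rate \<open>m\<close> rings before \<open>b\<close>, written as the integral of its
density.
\<close>
lemma indefinite_integral_exp_neg:
  fixes m :: "real \<Rightarrow> real"
  assumes ab: "a \<le> b" and m: "set_integrable lborel {a..b} m" "\<And>r. 0 \<le> m r"
  shows "set_integrable lborel {a..b} (\<lambda>r. m r * exp (- (LBINT v:{a..r}. m v)))"
    and "1 - exp (- (LBINT v:{a..b}. m v)) = (LBINT r:{a..b}. m r * exp (- (LBINT v:{a..r}. m v)))"
proof -
  let ?F = "\<lambda>t. LBINT v:{a..t}. m v"
  have F0: "?F a = 0"
    unfolding set_lebesgue_integral_def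
    by (rule integral_eq_zero_AE) (use AE_lborel_singleton[of a] in eventually_elim, auto)
  have F: "?F t = ?F a + ?F t" for t using F0 by simp
  have S: "?F t \<in> {0..}" for t using set_lebesgue_integral_nonneg'[of _ m] m by simp
  have G': "\<bar>- exp (- y) - - exp (- x)\<bar> \<le> 1 * \<bar>y - x\<bar>" if "x \<in> {0..}" "y \<in> {0..}" for x y :: real
  proof -
    have *: "\<bar>exp (-v) - exp (-u)\<bar> \<le> \<bar>v - u\<bar>" if "0 \<le> u" "u \<le> v" for u v :: real
    proof -
      have "exp (-u) * (1 - exp (-(v-u))) \<le> 1 * (1 - exp (-(v-u)))"
        using that by (intro mult_right_mono) auto
      also have "\<dots> \<le> v - u" unfolding mult_1 using exp_ge_add_one_self[of "-(v-u)"] by linarith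
      finally have "exp (-u) - exp (-v) \<le> v - u" by (simp add: algebra_simps exp_add[symmetric] mult_exp_exp)
      moreover have "exp (-v) \<le> exp (-u)" using that by simp
      ultimately show ?thesis by linarith
    qed
    show ?thesis using *[of x y] *[of y x] that by (cases "x \<le> y") (auto simp: abs_minus_commute)
  qed
  have G: "\<bar>exp (- y) - exp (- x) - - exp (- x) * (y - x)\<bar> \<le> 1 * (y - x)\<^sup>2" if "x \<in> {0..}" "y \<in> {0..}" for x y :: real
  proof -
    have eq: "exp (- y) - exp (- x) - - exp (- x) * (y - x) = exp (-x) * (exp (x - y) - 1 + (y - x))"
      by (simp add: algebra_simps mult_exp_exp)
    have lo: "exp (-x) * (exp (x - y) - 1 + (y - x)) \<ge> 0"
    proof (intro mult_nonneg_nonneg)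
      show "0 \<le> exp (x - y) - 1 + (y - x)" using exp_ge_add_one_self[of "x - y"] by linarith
    qed simp
    have "exp (-y) \<ge> exp (-x) * (1 + (x - y))" 
      using mult_left_mono[OF exp_ge_add_one_self[of "x-y"], of "exp (-x)"] by (simp add: mult_exp_exp)
    have up: "exp (-x) * (exp (x - y) - 1 + (y - x)) \<le> (y - x)\<^sup>2"
    proof -
      have "exp (-x) \<ge> exp (-y) * (1 + (y - x))"
        using mult_left_mono[OF exp_ge_add_one_self[of "y-x"], of "exp (-y)"] by (simp add: mult_exp_exp)
      then have "exp (- y) - exp (- x) + exp (- x) * (y - x) \<le> (exp (-x) - exp (-y)) * (y - x)"
        by (simp add: algebra_simps)
      also have "\<dots> \<le> \<bar>exp (-x) - exp (-y)\<bar> * \<bar>y - x\<bar>"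
        by (metis abs_ge_self abs_mult)
      also have "\<dots> \<le> \<bar>y - x\<bar> * \<bar>y - x\<bar>"
        using G'[OF that] by (intro mult_right_mono) auto
      also have "\<dots> = (y - x)\<^sup>2" by (simp add: power2_eq_square)
      finally show ?thesis using eq by simp
    qed
    show ?thesis unfolding eq using lo up by simp
  qed
  note * = indefinite_integral_chain_rule[OF ab m(1) F S G G']
  have "set_integrable lborel {a..b} (\<lambda>r. (-1) * (- exp (- ?F r) * m r))"
    by (rule set_integrable_mult_right) (use *(1) in simp)
  then show "set_integrable lborel {a..b} (\<lambda>r. m r * exp (- ?F r))" by (simp add: mult.commute)
  have "exp (- ?F b) - exp (- ?F a) = (LBINT r:{a..b}. - exp (- ?F r) * m r)" using *(2) by simp
  also have "\<dots> = - (LBINT r:{a..b}. m r * exp (- ?F r))"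
  proof -
    have "(\<lambda>r. - exp (- ?F r) * m r) = (\<lambda>r. (-1) * (m r * exp (- ?F r)))" by (auto simp: mult.commute)
    then show ?thesis by (simp only: set_integral_mult_right)
  qed
  finally show "1 - exp (- ?F b) = (LBINT r:{a..b}. m r * exp (- ?F r))" using F0 by simp
qed

section \<open>Half a derivative on a cyclic group\<close>

definition dft :: "nat \<Rightarrow> (nat \<Rightarrow> complex) \<Rightarrow> nat \<Rightarrow> complex" where
  "dft N b k = (\<Sum>j<N. b j * cis (- (2 * pi * real j * real k / real N)))"

text \<open>
The forward difference on the cyclic group of order \<open>N\<close> has Fourier symbol
\<open>cis (2 * pi * k / N) - 1\<close>; weighting by the modulus of the symbol gives the squared norm of half
a derivative.
\<close>
definition half_energy :: "nat \<Rightarrow> (nat \<Rightarrow> complex) \<Rightarrow> real" where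
  "half_energy N b = (\<Sum>k<N. cmod (cis (2 * pi * real k / real N) - 1) * (cmod (dft N b k))\<^sup>2) / real N"

lemma root_of_unity_sum:
  assumes kl: "k < N" "l < N"
  shows "(\<Sum>j<N. cis (2 * pi * real j * (real k - real l) / real N)) = (if k = l then of_nat N else 0)"
proof (cases "k = l")
  case False
  define z where "z = cis (2 * pi * (real k - real l) / real N)"
  have pw: "cis (2 * pi * real j * (real k - real l) / real N) = z ^ j" for j
    unfolding z_def Complex.DeMoivre by (rule arg_cong[where f=cis]) simp
  have zN: "z ^ N = 1"
  proof -
    have "z ^ N = cis (2 * pi * (real k - real l))" using kl by (simp add: z_def Complex.DeMoivre)
    also have "\<dots> = cis (2 * pi * of_int (int k - int l))" by simp
    also have "\<dots> = 1" by (rule cis_multiple_2pi) simp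
    finally show ?thesis .
  qed
  have "z \<noteq> 1"
  proof
    assume "z = 1"
    then have "cos (2 * pi * (real k - real l) / real N) = 1" by (simp add: z_def complex_eq_iff)
    then obtain n :: int where "2 * pi * (real k - real l) / real N = of_int n * 2 * pi"
      unfolding cos_one_2pi_int by auto
    then have "2 * pi * ((real k - real l) / real N) = 2 * pi * of_int n" by simp
    then have "(real k - real l) / real N = of_int n" by (subst (asm) mult_cancel_left) simp
    then have "real k - real l = of_int n * real N" using kl by (simp add: field_simps)
    then have eq: "int k - int l = n * int N" by (metis of_int_diff of_int_eq_iff of_int_mult of_int_of_nat_eq)
    have "\<bar>int k - int l\<bar> < int N" using kl by linarith
    then have "\<bar>n\<bar> * int N < 1 * int N" unfolding eq by (simp add: abs_mult)
    then have "\<bar>n\<bar> < 1" using kl by (simp only: mult_less_cancel_right)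
    then show False using eq False by simp
  qed
  then show ?thesis using False zN by (simp add: pw geometric_sum)
qed simp

lemma dft_parseval:
  "(\<Sum>k<N. cnj (dft N a k) * dft N b k) = of_nat N * (\<Sum>j<N. cnj (a j) * b j)"
proof -
  have "(\<Sum>k<N. cnj (dft N a k) * dft N b k)
     = (\<Sum>k<N. \<Sum>i<N. \<Sum>j<N. cnj (a i) * b j * cis (2 * pi * real k * (real i - real j) / real N))"
  proof (intro sum.cong refl)
    fix k
    let ?c = "\<lambda>j. cis (- (2 * pi * real j * real k / real N))"
    have c: "cnj (?c i) * ?c j = cis (2 * pi * real k * (real i - real j) / real N)" for i j
      by (simp add: cis_cnj cis_mult algebra_simps diff_divide_distrib)
    have "cnj (dft N a k) * dft N b k = (\<Sum>i<N. \<Sum>j<N. cnj (a i) * cnj (?c i) * (b j * ?c j))"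
      unfolding dft_def cnj_sum complex_cnj_mult by (rule sum_product)
    also have "\<dots> = (\<Sum>i<N. \<Sum>j<N. cnj (a i) * b j * (cnj (?c i) * ?c j))"
      by (simp only: mult_ac)
    finally show "cnj (dft N a k) * dft N b k
        = (\<Sum>i<N. \<Sum>j<N. cnj (a i) * b j * cis (2 * pi * real k * (real i - real j) / real N))"
      unfolding c .
  qed
  also have "\<dots> = (\<Sum>i<N. \<Sum>j<N. cnj (a i) * b j * (\<Sum>k<N. cis (2 * pi * real k * (real i - real j) / real N)))"
    unfolding sum_distrib_left by (subst sum.swap) (intro sum.cong refl sum.swap)
  also have "\<dots> = (\<Sum>i<N. \<Sum>j<N. if i = j then of_nat N * (cnj (a i) * b j) else 0)"
    by (intro sum.cong refl) (simp add: root_of_unity_sum)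
  also have "\<dots> = of_nat N * (\<Sum>j<N. cnj (a j) * b j)"
    by (simp add: sum_distrib_left)
  finally show ?thesis .
qed

lemma dft_parseval_norm: "(\<Sum>k<N. (cmod (dft N b k))\<^sup>2) = real N * (\<Sum>j<N. (cmod (b j))\<^sup>2)"
proof -
  have *: "cnj z * z = of_real ((cmod z)\<^sup>2)" for z :: complex
    by (metis complex_norm_square mult.commute)
  show ?thesis using dft_parseval[of N b b] unfolding * of_real_sum[symmetric]
    by (metis of_real_eq_iff of_real_mult of_real_of_nat_eq)
qed

lemma dft_diff: "dft N (\<lambda>j. a j - b j) k = dft N a k - dft N b k"
  by (simp add: dft_def left_diff_distrib sum_subtractf)

lemma dft_cyclic_shift:
  assumes k: "k < N"
  shows "dft N (\<lambda>j. b (Suc j mod N)) k = cis (2 * pi * real k / real N) * dft N b k"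
proof -
  obtain n where N: "N = Suc n" using k by (cases N) auto
  let ?c = "\<lambda>j. cis (- (2 * pi * real j * real k / real N))"
  have per: "?c N = 1"
  proof -
    have "?c N = cis (2 * pi * of_int (- int k))" using k by (simp add: mult.assoc)
    also have "\<dots> = 1" by (rule cis_multiple_2pi) simp
    finally show ?thesis .
  qed
  have sh: "?c j = cis (2 * pi * real k / real N) * ?c (Suc j)" for j
    using k by (simp add: cis_mult add_divide_distrib[symmetric] field_simps)
  have "dft N (\<lambda>j. b (Suc j mod N)) k = (\<Sum>j<n. b (Suc j) * ?c j) + b 0 * ?c n"
    unfolding dft_def by (simp add: N)
  also have "\<dots> = cis (2 * pi * real k / real N) * ((\<Sum>j<n. b (Suc j) * ?c (Suc j)) + b 0 * ?c 0)"
  proof -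
    have "?c n = cis (2 * pi * real k / real N) * ?c 0" using sh[of n] per N by simp
    moreover have "b (Suc j) * ?c j = cis (2 * pi * real k / real N) * (b (Suc j) * ?c (Suc j))" for j
      by (subst sh) (simp only: mult_ac)
    ultimately show ?thesis by (simp only: sum_distrib_left distrib_left mult_ac)
  qed
  also have "(\<Sum>j<n. b (Suc j) * ?c (Suc j)) + b 0 * ?c 0 = dft N b k"
    unfolding dft_def N by (subst sum.lessThan_Suc_shift) simp
  finally show ?thesis .
qed

lemma half_energy_nonneg: "0 \<le> half_energy N b"
  unfolding half_energy_def by (intro divide_nonneg_nonneg sum_nonneg) auto

text \<open>
A full difference falls on \<open>b\<close> in the pairing, but after Parseval its symbol can be shared
equally between the two factors. This symmetric splitting is the reason why only half a time
derivative of each kernel has to be controlled.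
\<close>
lemma abs_sum_mult_increment_le_half_energy:
  assumes N: "N > 0"
  shows "cmod (\<Sum>j<N. cnj (a j) * (b (Suc j mod N) - b j)) \<le> (half_energy N a + half_energy N b) / 2"
proof -
  let ?e = "\<lambda>k. cis (2 * pi * real k / real N) - 1"
  have "of_nat N * (\<Sum>j<N. cnj (a j) * (b (Suc j mod N) - b j))
      = (\<Sum>k<N. cnj (dft N a k) * dft N (\<lambda>j. b (Suc j mod N) - b j) k)"
    by (rule dft_parseval[symmetric])
  also have "\<dots> = (\<Sum>k<N. cnj (dft N a k) * (?e k * dft N b k))"
    by (intro sum.cong refl) (simp add: dft_diff dft_cyclic_shift[of _ _ b] algebra_simps)
  finally have eq: "of_nat N * (\<Sum>j<N. cnj (a j) * (b (Suc j mod N) - b j)) = \<dots>" .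
  have "real N * cmod (\<Sum>j<N. cnj (a j) * (b (Suc j mod N) - b j))
      = cmod (\<Sum>k<N. cnj (dft N a k) * (?e k * dft N b k))"
    unfolding eq[symmetric] by (simp add: norm_mult)
  also have "\<dots> \<le> (\<Sum>k<N. cmod (?e k) * (cmod (dft N a k) * cmod (dft N b k)))"
    by (rule sum_norm_le) (simp add: norm_mult mult_ac)
  also have "\<dots> \<le> (\<Sum>k<N. cmod (?e k) * (((cmod (dft N a k))\<^sup>2 + (cmod (dft N b k))\<^sup>2) / 2))"
  proof (intro sum_mono mult_left_mono)
    fix k show "cmod (dft N a k) * cmod (dft N b k) \<le> ((cmod (dft N a k))\<^sup>2 + (cmod (dft N b k))\<^sup>2) / 2"
      using sum_squares_bound[of "cmod (dft N a k)" "cmod (dft N b k)"] by simp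
  qed simp
  also have "\<dots> = real N * ((half_energy N a + half_energy N b) / 2)"
    unfolding half_energy_def using N
    by (simp add: sum.distrib[symmetric] sum_divide_distrib sum_distrib_left distrib_left add_divide_distrib)
  finally show ?thesis using N by simp
qed

text \<open>
The Fourier multiplier by the phase of the symbol of the forward difference. Constants are
annihilated, since \<open>sgn 0 = 0\<close>.
\<close>
definition discrete_hilbert :: "nat \<Rightarrow> (nat \<Rightarrow> complex) \<Rightarrow> nat \<Rightarrow> complex" where
  "discrete_hilbert N b j = (\<Sum>k<N. sgn (cis (2 * pi * real k / real N) - 1) * dft N b k
      * cis (2 * pi * real j * real k / real N)) / of_nat N"

lemma discrete_hilbert_diff:
  "discrete_hilbert N (\<lambda>j. a j - b j) j = discrete_hilbert N a j - discrete_hilbert N b j"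
  by (simp add: discrete_hilbert_def dft_diff algebra_simps sum_subtractf diff_divide_distrib)

lemma discrete_hilbert_zero: "(\<And>j. j < N \<Longrightarrow> b j = 0) \<Longrightarrow> discrete_hilbert N b j = 0"
  by (simp add: discrete_hilbert_def dft_def)

lemma dft_discrete_hilbert:
  assumes l: "l < N"
  shows "dft N (discrete_hilbert N b) l = sgn (cis (2 * pi * real l / real N) - 1) * dft N b l"
proof -
  let ?s = "\<lambda>k. sgn (cis (2 * pi * real k / real N) - 1) * dft N b k"
  have "dft N (discrete_hilbert N b) l
      = (\<Sum>j<N. \<Sum>k<N. ?s k * cis (2 * pi * real j * (real k - real l) / real N)) / of_nat N"
  proof -
    have c: "cis (2 * pi * real j * real k / real N) * cis (- (2 * pi * real j * real l / real N))
        = cis (2 * pi * real j * (real k - real l) / real N)" for j k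
      by (simp add: cis_mult right_diff_distrib diff_divide_distrib)
    show ?thesis
      unfolding dft_def[of N "discrete_hilbert N b"] discrete_hilbert_def c[symmetric]
      by (simp only: sum_divide_distrib sum_distrib_right mult.assoc times_divide_eq_left)
  qed
  also have "\<dots> = (\<Sum>k<N. ?s k * (\<Sum>j<N. cis (2 * pi * real j * (real k - real l) / real N))) / of_nat N"
    by (subst sum.swap) (simp add: sum_distrib_left)
  also have "\<dots> = (\<Sum>k<N. if k = l then of_nat N * ?s k else 0) / of_nat N"
    using l by (intro arg_cong2[where f="(/)"] refl sum.cong) (auto simp: root_of_unity_sum)
  also have "\<dots> = ?s l" using l by simp
  finally show ?thesis .
qed

text \<open>
All symbols have modulus at most one.
\<close>
lemma discrete_hilbert_contraction:
  assumes N: "N > 0"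
  shows "(\<Sum>j<N. (cmod (discrete_hilbert N b j))\<^sup>2) \<le> (\<Sum>j<N. (cmod (b j))\<^sup>2)"
proof -
  have "real N * (\<Sum>j<N. (cmod (discrete_hilbert N b j))\<^sup>2) = (\<Sum>k<N. (cmod (dft N (discrete_hilbert N b) k))\<^sup>2)"
    by (rule dft_parseval_norm[symmetric])
  also have "\<dots> \<le> (\<Sum>k<N. (cmod (dft N b k))\<^sup>2)"
    by (intro sum_mono power_mono) (auto simp: dft_discrete_hilbert norm_mult norm_sgn)
  also have "\<dots> = real N * (\<Sum>j<N. (cmod (b j))\<^sup>2)" by (rule dft_parseval_norm)
  finally show ?thesis using N by simp
qed

text \<open>
Multiplying the symbol of the difference by the conjugate of its phase leaves its modulus. This
turns the half energy, which is defined spectrally, into a pairing to which a differential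
equation for \<open>b\<close> can be applied.
\<close>
lemma half_energy_eq_hilbert_increment:
  assumes N: "N > 0"
  shows "complex_of_real (half_energy N b)
    = (\<Sum>j<N. cnj (discrete_hilbert N b j) * (b (Suc j mod N) - b j))"
proof -
  let ?e = "\<lambda>k. cis (2 * pi * real k / real N) - 1"
  have sg: "cnj (sgn z) * z = of_real (cmod z)" for z :: complex
  proof (cases "z = 0")
    case False
    have "cnj (sgn z) * z = (cnj z * z) / of_real (cmod z)"
      by (simp add: sgn_div_norm scaleR_conv_of_real field_simps)
    also have "cnj z * z = of_real (cmod z * cmod z)"
      by (metis complex_norm_square mult.commute power2_eq_square)
    finally show ?thesis using False by simp
  qed simp
  have sq: "cnj z * z = of_real ((cmod z)\<^sup>2)" for z :: complex
    by (metis complex_norm_square mult.commute)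
  have "of_nat N * (\<Sum>j<N. cnj (discrete_hilbert N b j) * (b (Suc j mod N) - b j))
      = (\<Sum>k<N. cnj (dft N (discrete_hilbert N b) k) * dft N (\<lambda>j. b (Suc j mod N) - b j) k)"
    by (rule dft_parseval[symmetric])
  also have "\<dots> = (\<Sum>k<N. (cnj (sgn (?e k)) * ?e k) * (cnj (dft N b k) * dft N b k))"
    by (intro sum.cong refl) (simp add: dft_discrete_hilbert dft_diff dft_cyclic_shift[of _ _ b] algebra_simps)
  also have "\<dots> = (\<Sum>k<N. of_real (cmod (?e k) * (cmod (dft N b k))\<^sup>2))"
    unfolding sg sq by simp
  also have "\<dots> = of_nat N * complex_of_real (half_energy N b)"
    using N by (simp add: half_energy_def)
  finally show ?thesis using N by simp
qed

text \<open>
For real data, reflection in time conjugates the Fourier transform.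
\<close>
lemma half_energy_reflect:
  assumes N: "N > 0" and real: "\<And>j. b j \<in> \<real>"
  shows "half_energy N (\<lambda>j. b ((N - j) mod N)) = half_energy N b"
proof -
  have "dft N (\<lambda>j. b ((N - j) mod N)) k = cnj (dft N b k)" for k
  proof -
    let ?c = "\<lambda>j. cis (- (2 * pi * real j * real k / real N))"
    have per: "?c (N - j) = cnj (?c j)" if "j \<le> N" for j
    proof -
      have "?c (N - j) = cis (2 * pi * of_int (- int k)) * cis (2 * pi * real j * real k / real N)"
      proof -
        have "- (2 * pi * real (N - j) * real k / real N)
           = 2 * pi * of_int (- int k) + 2 * pi * real j * real k / real N"
          using that N by (simp add: of_nat_diff field_simps)
        then show ?thesis by (simp only: cis_mult)
      qed
      also have "cis (2 * pi * of_int (- int k)) = 1" by (rule cis_multiple_2pi) simp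
      finally show ?thesis by (simp add: cis_cnj)
    qed
    have rr: "(N - (N - j) mod N) mod N = j" if "j < N" for j
      using that by (cases "j = 0") auto
    have "dft N (\<lambda>j. b ((N - j) mod N)) k = (\<Sum>j<N. b j * ?c ((N - j) mod N))"
      unfolding dft_def
      by (rule sum.reindex_bij_witness[where i="\<lambda>j. (N - j) mod N" and j="\<lambda>j. (N - j) mod N"])
        (use N in \<open>simp_all add: rr\<close>)
    also have "\<dots> = (\<Sum>j<N. b j * cnj (?c j))"
    proof (intro sum.cong refl)
      fix j assume "j \<in> {..<N}"
      then show "b j * ?c ((N - j) mod N) = b j * cnj (?c j)"
        using per[of j] by (cases "j = 0") (auto simp: mod_if)
    qed
    also have "\<dots> = cnj (dft N b k)"
      unfolding dft_def cnj_sum complex_cnj_mult using real by (simp add: Reals_cnj_iff)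
    finally show ?thesis .
  qed
  then show ?thesis by (simp add: half_energy_def)
qed

section \<open>Transition kernels as series over the number of jumps\<close>

(* These rules conclude measurability of functions of the form t \<mapsto> \<omega> t e, a pattern that unifies with
   every real function. *)
declare meas_env[measurable del] meas_exit[measurable del]
  total_rate_meas[measurable del] first_passage_meas[measurable del]

definition survival :: "(real \<Rightarrow> 'a \<Rightarrow> real) \<Rightarrow> real \<Rightarrow> real \<Rightarrow> 'a \<Rightarrow> real" where
  "survival m s t x = exp (- (LBINT u:{s..t}. m u x))"

text \<open>
The weight of all trajectories from \<open>x\<close> at time \<open>s\<close> to \<open>y\<close> at time \<open>t\<close> with exactly \<open>n\<close> jumps,
by recursion on the last jump, which happens at time \<open>u\<close> out of the site \<open>z\<close>. The values are extended
nonnegative reals, so that sums and integrals may be exchanged freely.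
\<close>
primrec path_kernel :: "(real \<Rightarrow> 'a \<Rightarrow> 'a \<Rightarrow> real) \<Rightarrow> (real \<Rightarrow> 'a \<Rightarrow> real) \<Rightarrow> nat
    \<Rightarrow> real \<Rightarrow> real \<Rightarrow> 'a \<Rightarrow> 'a \<Rightarrow> ennreal" where
  "path_kernel c m 0 s t x y = (if x = y then ennreal (survival m s t x) else 0)"
| "path_kernel c m (Suc n) s t x y = (\<integral>\<^sup>+u. indicator {s..t} u *
     ((\<integral>\<^sup>+z. path_kernel c m n s u x z * ennreal (c u z y) \<partial>count_space UNIV) * ennreal (survival m u t y)) \<partial>lborel)"

definition transition :: "(real \<Rightarrow> 'a \<Rightarrow> 'a \<Rightarrow> real) \<Rightarrow> (real \<Rightarrow> 'a \<Rightarrow> real)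
    \<Rightarrow> real \<Rightarrow> real \<Rightarrow> 'a \<Rightarrow> 'a \<Rightarrow> ennreal" where
  "transition c m s t x y = (\<Sum>n. path_kernel c m n s t x y)"

lemma borel_measurable_indicator_Icc:
  fixes f g h :: "'w \<Rightarrow> real"
  assumes [measurable]: "f \<in> borel_measurable M" "g \<in> borel_measurable M" "h \<in> borel_measurable M"
  shows "(\<lambda>w. indicator {f w..h w} (g w) :: real) \<in> borel_measurable M"
    and "(\<lambda>w. indicator {f w..h w} (g w) :: ennreal) \<in> borel_measurable M"
proof -
  have [measurable]: "{w \<in> space M. f w \<le> g w \<and> g w \<le> h w} \<in> sets M" by measurable
  have "(\<lambda>w. indicator {w \<in> space M. f w \<le> g w \<and> g w \<le> h w} w :: real) \<in> borel_measurable M"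
    "(\<lambda>w. indicator {w \<in> space M. f w \<le> g w \<and> g w \<le> h w} w :: ennreal) \<in> borel_measurable M"
    by measurable
  then show "(\<lambda>w. indicator {f w..h w} (g w) :: real) \<in> borel_measurable M"
    "(\<lambda>w. indicator {f w..h w} (g w) :: ennreal) \<in> borel_measurable M"
    by (auto simp: indicator_def cong: measurable_cong)
qed

lemma borel_measurable_nn_integral_count_space:
  fixes f :: "'a::countable \<Rightarrow> 'b \<Rightarrow> ennreal"
  assumes "\<And>z. f z \<in> borel_measurable M"
  shows "(\<lambda>w. \<integral>\<^sup>+z. f z w \<partial>count_space UNIV) \<in> borel_measurable M"
proof -
  interpret sigma_finite_measure "count_space (UNIV :: 'a set)"
    by (rule sigma_finite_measure_count_space_countable) simp
  have "(\<lambda>p. f (fst p) (snd p)) \<in> borel_measurable (count_space UNIV \<Otimes>\<^sub>M M)"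
    by (rule measurable_pair_measure_countable1) (use assms in auto)
  from measurable_compose[OF measurable_pair_swap' this]
  have "(\<lambda>(w, z). f z w) \<in> borel_measurable (M \<Otimes>\<^sub>M count_space UNIV)"
    by (simp add: case_prod_beta)
  then show ?thesis by (rule borel_measurable_nn_integral)
qed

lemma survival_measurable:
  assumes m: "(\<lambda>(w, u). mm w u x) \<in> borel_measurable (W \<Otimes>\<^sub>M borel)"
  shows "(\<lambda>(w, s, t). survival (mm w) s t x) \<in> borel_measurable (W \<Otimes>\<^sub>M (borel \<Otimes>\<^sub>M borel))"
proof -
  have 1: "(\<lambda>(p, u). mm (fst p) u x) \<in> borel_measurable ((W \<Otimes>\<^sub>M (borel \<Otimes>\<^sub>M borel)) \<Otimes>\<^sub>M lborel)"
    using measurable_compose[OF _ m, of "\<lambda>(p, u). (fst p, u)" "(W \<Otimes>\<^sub>M (borel \<Otimes>\<^sub>M borel)) \<Otimes>\<^sub>M lborel"]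
    by (simp add: case_prod_beta')
  have 2: "(\<lambda>(p, u::real). indicator {fst (snd p)..snd (snd p)} u :: real)
      \<in> borel_measurable ((W \<Otimes>\<^sub>M (borel \<Otimes>\<^sub>M borel)) \<Otimes>\<^sub>M lborel)"
    unfolding case_prod_beta' by (rule borel_measurable_indicator_Icc(1)) measurable
  have "(\<lambda>p. LBINT u. indicator {fst (snd p)..snd (snd p)} u *\<^sub>R mm (fst p) u x)
      \<in> borel_measurable (W \<Otimes>\<^sub>M (borel \<Otimes>\<^sub>M borel))"
    using borel_measurable_times[OF 2[unfolded case_prod_beta'] 1[unfolded case_prod_beta']]
    by (intro lborel.borel_measurable_lebesgue_integral) (simp add: case_prod_beta')
  then show ?thesis
    unfolding survival_def set_lebesgue_integral_def case_prod_beta' by measurable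
qed

text \<open>
The parameter \<open>w\<close> is the environment in the applications; joint measurability in the environment and
both times is what Fubini requires later.
\<close>
lemma path_kernel_measurable:
  fixes cc :: "'w \<Rightarrow> real \<Rightarrow> 'a::countable \<Rightarrow> 'a \<Rightarrow> real"
  assumes c: "\<And>x y. (\<lambda>(w, u). cc w u x y) \<in> borel_measurable (W \<Otimes>\<^sub>M borel)"
    and m: "\<And>x. (\<lambda>(w, u). mm w u x) \<in> borel_measurable (W \<Otimes>\<^sub>M borel)"
  shows "(\<lambda>(w, s, t). path_kernel (cc w) (mm w) n s t x y) \<in> borel_measurable (W \<Otimes>\<^sub>M (borel \<Otimes>\<^sub>M borel))"
proof (induction n arbitrary: x y)
  case 0
  have "(\<lambda>(w, s, t). ennreal (survival (mm w) s t x)) \<in> borel_measurable (W \<Otimes>\<^sub>M (borel \<Otimes>\<^sub>M borel))"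
    using measurable_compose[OF survival_measurable[of "\<lambda>w. mm w", OF m] measurable_ennreal] by (simp add: case_prod_beta')
  then show ?case by (cases "x = y") (simp_all add: case_prod_beta')
next
  case (Suc n)
  let ?B = "(W \<Otimes>\<^sub>M (borel \<Otimes>\<^sub>M borel)) \<Otimes>\<^sub>M lborel :: (('w \<times> real \<times> real) \<times> real) measure"
  have P: "(\<lambda>q. path_kernel (cc (fst (fst q))) (mm (fst (fst q))) n (fst (snd (fst q))) (snd q) x z) \<in> borel_measurable ?B" for z
    using measurable_compose[OF _ Suc[of x z], of "\<lambda>q. (fst (fst q), fst (snd (fst q)), snd q)" ?B]
    by (simp add: case_prod_beta')
  have C: "(\<lambda>q. ennreal (cc (fst (fst q)) (snd q) z y)) \<in> borel_measurable ?B" for z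
    using measurable_compose[OF _ c[of z y], of "\<lambda>q. (fst (fst q), snd q)" ?B]
    by (simp add: case_prod_beta')
  have S: "(\<lambda>q. ennreal (survival (mm (fst (fst q))) (snd q) (snd (snd (fst q))) y)) \<in> borel_measurable ?B"
    using measurable_compose[OF _ survival_measurable[of "\<lambda>w. mm w", OF m[of y]], of "\<lambda>q. (fst (fst q), snd q, snd (snd (fst q)))" ?B]
    by (simp add: case_prod_beta')
  have I: "(\<lambda>q. indicator {fst (snd (fst q))..snd (snd (fst q))} (snd q) :: ennreal) \<in> borel_measurable ?B"
    by (intro borel_measurable_indicator_Icc) measurable
  have "(\<lambda>(q, u). indicator {fst (snd q)..snd (snd q)} u *
      ((\<integral>\<^sup>+z. path_kernel (cc (fst q)) (mm (fst q)) n (fst (snd q)) u x z * ennreal (cc (fst q) u z y) \<partial>count_space UNIV)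
       * ennreal (survival (mm (fst q)) u (snd (snd q)) y))) \<in> borel_measurable ?B"
    unfolding case_prod_beta'
    by (intro borel_measurable_times_ennreal I S borel_measurable_nn_integral_count_space P C)
  from lborel.borel_measurable_nn_integral[OF this]
  show ?case by (simp add: case_prod_beta')
qed

lemma transition_measurable:
  fixes cc :: "'w \<Rightarrow> real \<Rightarrow> 'a::countable \<Rightarrow> 'a \<Rightarrow> real"
  assumes c: "\<And>x y. (\<lambda>(w, u). cc w u x y) \<in> borel_measurable (W \<Otimes>\<^sub>M borel)"
    and m: "\<And>x. (\<lambda>(w, u). mm w u x) \<in> borel_measurable (W \<Otimes>\<^sub>M borel)"
  shows "(\<lambda>(w, s, t). transition (cc w) (mm w) s t x y) \<in> borel_measurable (W \<Otimes>\<^sub>M (borel \<Otimes>\<^sub>M borel))"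
proof -
  have [measurable]: "(\<lambda>q. path_kernel (cc (fst q)) (mm (fst q)) n (fst (snd q)) (snd (snd q)) x y)
      \<in> borel_measurable (W \<Otimes>\<^sub>M (borel \<Otimes>\<^sub>M borel))" for n
    using path_kernel_measurable[where cc=cc and mm=mm, OF c m, of n x y] by (simp add: case_prod_beta')
  show ?thesis unfolding transition_def case_prod_beta' by measurable
qed

text \<open>
The exit rate \<open>m\<close> is independent of the jump rates \<open>c\<close>. If it exceeds their sum, the excess is a killing
rate; keeping \<open>m\<close> and truncating \<open>c\<close> to a box describes the walk killed on leaving the box.
\<close>
locale jump_rates =
  fixes c :: "real \<Rightarrow> 'a::countable \<Rightarrow> 'a \<Rightarrow> real" and m :: "real \<Rightarrow> 'a \<Rightarrow> real"
  assumes c_measurable[measurable]: "\<And>x y. (\<lambda>u. c u x y) \<in> borel_measurable borel"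
    and m_measurable[measurable]: "\<And>x. (\<lambda>u. m u x) \<in> borel_measurable borel"
    and c_nonneg: "\<And>u x y. 0 \<le> c u x y"
    and m_nonneg: "\<And>u x. 0 \<le> m u x"
    and m_integrable: "\<And>a b x. set_integrable lborel {a..b} (\<lambda>u. m u x)"
begin

abbreviation "S \<equiv> survival m"
abbreviation "P \<equiv> path_kernel c m"
abbreviation "p \<equiv> transition c m"

text \<open>
Measurability for one fixed choice of rates is the case of a one-point parameter space.
\<close>
lemma measurable_prod_trivial:
  assumes "(\<lambda>(w, s, t). f s t) \<in> borel_measurable (count_space {()} \<Otimes>\<^sub>M (borel \<Otimes>\<^sub>M borel))"
    and "g \<in> measurable M borel" "h \<in> measurable M borel"
  shows "(\<lambda>v. f (g v) (h v)) \<in> borel_measurable M"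
proof -
  have "(\<lambda>v. ((), g v, h v)) \<in> measurable M (count_space {()} \<Otimes>\<^sub>M (borel \<Otimes>\<^sub>M borel))"
    using assms by (intro measurable_Pair measurable_count_space_const) auto
  from measurable_compose[OF this assms(1)] show ?thesis by simp
qed

lemma c_measurable': "(\<lambda>(w, u). c u x y) \<in> borel_measurable (count_space {()} \<Otimes>\<^sub>M borel)"
  using measurable_compose[OF measurable_snd c_measurable] by (simp add: case_prod_beta')

lemma m_measurable': "(\<lambda>(w, u). m u x) \<in> borel_measurable (count_space {()} \<Otimes>\<^sub>M borel)"
  using measurable_compose[OF measurable_snd m_measurable] by (simp add: case_prod_beta')

lemma S_measurable[measurable (raw)]:
  "g \<in> measurable M borel \<Longrightarrow> h \<in> measurable M borel \<Longrightarrow> (\<lambda>v. S (g v) (h v) x) \<in> borel_measurable M"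
  using survival_measurable[where mm="\<lambda>_. m", OF m_measurable', of x]
  by (rule measurable_prod_trivial) 

lemma P_measurable[measurable (raw)]:
  "g \<in> measurable M borel \<Longrightarrow> h \<in> measurable M borel \<Longrightarrow> (\<lambda>v. P n (g v) (h v) x y) \<in> borel_measurable M"
  using path_kernel_measurable[where cc="\<lambda>_. c" and mm="\<lambda>_. m", OF c_measurable' m_measurable', of n x y] by (rule measurable_prod_trivial)

lemma p_measurable[measurable (raw)]:
  "g \<in> measurable M borel \<Longrightarrow> h \<in> measurable M borel \<Longrightarrow> (\<lambda>v. p (g v) (h v) x y) \<in> borel_measurable M"
  using transition_measurable[where cc="\<lambda>_. c" and mm="\<lambda>_. m", OF c_measurable' m_measurable', of x y] by (rule measurable_prod_trivial)

lemma S_mult: "s \<le> r \<Longrightarrow> r \<le> t \<Longrightarrow> ennreal (S s t x) = ennreal (S s r x) * ennreal (S r t x)"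
  unfolding survival_def using set_lebesgue_integral_combine[OF _ _ m_integrable, of s r t x]
  by (simp add: ennreal_mult[symmetric] mult_exp_exp)

lemma nn_integral_count_space_eq_single:
  fixes f :: "'a \<Rightarrow> ennreal"
  assumes "\<And>z. z \<noteq> x \<Longrightarrow> f z = 0"
  shows "(\<integral>\<^sup>+z. f z \<partial>count_space UNIV) = f x"
  using assms by (subst nn_integral_count_space'[of "{x}"]) auto

lemma nn_integral_count_space_commute:
  fixes f :: "'a \<Rightarrow> 'b \<Rightarrow> ennreal"
  assumes "\<And>z. f z \<in> borel_measurable M"
  shows "(\<integral>\<^sup>+u. \<integral>\<^sup>+z. f z u \<partial>count_space UNIV \<partial>M) = (\<integral>\<^sup>+z. \<integral>\<^sup>+u. f z u \<partial>M \<partial>count_space UNIV)"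
  using assms by (intro nn_integral_count_space_nn_integral) auto

text \<open>
The recursion on the last jump also yields the one on the first jump: by induction, both sides
describe the same iterated integral over all jump times, and Tonelli exchanges the two extreme ones.
\<close>
lemma path_kernel_first_jump:
  "P (Suc n) s t x y = (\<integral>\<^sup>+v. indicator {s..t} v *
     (ennreal (S s v x) * (\<integral>\<^sup>+w. ennreal (c v x w) * P n v t w y \<partial>count_space UNIV)) \<partial>lborel)"
proof (induction n arbitrary: s t x y)
  case 0
  have 1: "(\<integral>\<^sup>+z. P 0 s u x z * ennreal (c u z y) \<partial>count_space UNIV) = ennreal (S s u x) * ennreal (c u x y)" for u
    by (subst nn_integral_count_space_eq_single[of x]) auto
  have 2: "(\<integral>\<^sup>+w. ennreal (c v x w) * P 0 v t w y \<partial>count_space UNIV) = ennreal (c v x y) * ennreal (S v t y)" for v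
    by (subst nn_integral_count_space_eq_single[of y]) auto
  show ?case unfolding path_kernel.simps(2)[of c m 0] 1 2 by (simp only: mult.assoc)
next
  case (Suc n)
  define T where "T u z v w = indicator {s..t} u * indicator {s..u} v * ennreal (S s v x) * ennreal (c v x w)
     * P n v u w z * ennreal (c u z y) * ennreal (S u t y)" for u z v w
  note [measurable] = borel_measurable_indicator_Icc
  have Tm1[measurable]: "(\<lambda>v. T u z v w) \<in> borel_measurable borel" for u z w
    unfolding T_def by measurable
  have Tm2[measurable]: "(\<lambda>u. T u z v w) \<in> borel_measurable borel" for v z w
    unfolding T_def by measurable
  have Tm3[measurable]: "(\<lambda>(u, v). T u z v w) \<in> borel_measurable (borel \<Otimes>\<^sub>M borel)" for z w
    unfolding T_def case_prod_beta' by measurable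
  have Tw: "(\<lambda>v. \<integral>\<^sup>+w. T u z v w \<partial>count_space UNIV) \<in> borel_measurable borel" for u z
    by (rule borel_measurable_nn_integral_count_space) measurable
  have Tw2: "(\<lambda>u. \<integral>\<^sup>+w. T u z v w \<partial>count_space UNIV) \<in> borel_measurable borel" for v z
    by (rule borel_measurable_nn_integral_count_space) measurable
  have Tz2: "(\<lambda>u. \<integral>\<^sup>+z. T u z v w \<partial>count_space UNIV) \<in> borel_measurable borel" for v w
    by (rule borel_measurable_nn_integral_count_space) measurable
  have Tzw: "(\<lambda>(u, v). \<integral>\<^sup>+z. \<integral>\<^sup>+w. T u z v w \<partial>count_space UNIV \<partial>count_space UNIV) \<in> borel_measurable (borel \<Otimes>\<^sub>M borel)"
    unfolding case_prod_beta'
    by (intro borel_measurable_nn_integral_count_space) (use Tm3 in \<open>simp add: case_prod_beta'\<close>)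
  have lhs: "P (Suc (Suc n)) s t x y = (\<integral>\<^sup>+u. \<integral>\<^sup>+z. \<integral>\<^sup>+v. \<integral>\<^sup>+w. T u z v w \<partial>count_space UNIV \<partial>lborel \<partial>count_space UNIV \<partial>lborel)"
    unfolding path_kernel.simps(2)[of c m "Suc n"] Suc
  proof (intro nn_integral_cong)
    fix u :: real
    have m1: "(\<lambda>v. \<integral>\<^sup>+w. ennreal (c v x w) * P n v u w z \<partial>count_space UNIV) \<in> borel_measurable borel" for z
      by (rule borel_measurable_nn_integral_count_space) measurable
    note [measurable] = m1
    have "indicator {s..t} u * ((\<integral>\<^sup>+z. (\<integral>\<^sup>+v. indicator {s..u} v * (ennreal (S s v x) *
        (\<integral>\<^sup>+w. ennreal (c v x w) * P n v u w z \<partial>count_space UNIV)) \<partial>lborel) * ennreal (c u z y) \<partial>count_space UNIV) * ennreal (S u t y))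
      = (\<integral>\<^sup>+z. indicator {s..t} u * ((\<integral>\<^sup>+v. indicator {s..u} v * (ennreal (S s v x) *
        (\<integral>\<^sup>+w. ennreal (c v x w) * P n v u w z \<partial>count_space UNIV)) \<partial>lborel) * ennreal (c u z y) * ennreal (S u t y)) \<partial>count_space UNIV)"
      by (subst nn_integral_cmult[symmetric], simp, subst nn_integral_multc[symmetric], simp, simp only: nn_integral_cmult mult.assoc) (simp add: mult.assoc nn_integral_cmult nn_integral_multc)
    also have "\<dots> = (\<integral>\<^sup>+z. \<integral>\<^sup>+v. \<integral>\<^sup>+w. T u z v w \<partial>count_space UNIV \<partial>lborel \<partial>count_space UNIV)"
    proof (intro nn_integral_cong)
      fix z
      have Teq: "T u z v w = indicator {s..t} u * ((indicator {s..u} v * (ennreal (S s v x)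
          * (ennreal (c v x w) * P n v u w z))) * (ennreal (c u z y) * ennreal (S u t y)))" for v w
        unfolding T_def by (simp only: mult.assoc)
      show "indicator {s..t} u * ((\<integral>\<^sup>+v. indicator {s..u} v * (ennreal (S s v x) *
        (\<integral>\<^sup>+w. ennreal (c v x w) * P n v u w z \<partial>count_space UNIV)) \<partial>lborel) * ennreal (c u z y) * ennreal (S u t y))
        = (\<integral>\<^sup>+v. \<integral>\<^sup>+w. T u z v w \<partial>count_space UNIV \<partial>lborel)"
        unfolding Teq by (subst mult.assoc) (simp add: nn_integral_cmult nn_integral_multc)
    qed
    finally show "indicator {s..t} u * ((\<integral>\<^sup>+z. (\<integral>\<^sup>+v. indicator {s..u} v * (ennreal (S s v x) *
        (\<integral>\<^sup>+w. ennreal (c v x w) * P n v u w z \<partial>count_space UNIV)) \<partial>lborel) * ennreal (c u z y) \<partial>count_space UNIV) * ennreal (S u t y))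
      = (\<integral>\<^sup>+z. \<integral>\<^sup>+v. \<integral>\<^sup>+w. T u z v w \<partial>count_space UNIV \<partial>lborel \<partial>count_space UNIV)" .
  qed
  also have "\<dots> = (\<integral>\<^sup>+u. \<integral>\<^sup>+v. \<integral>\<^sup>+z. \<integral>\<^sup>+w. T u z v w \<partial>count_space UNIV \<partial>count_space UNIV \<partial>lborel \<partial>lborel)"
    by (intro nn_integral_cong nn_integral_count_space_commute[symmetric]) (use Tw in simp)
  also have "\<dots> = (\<integral>\<^sup>+v. \<integral>\<^sup>+u. \<integral>\<^sup>+z. \<integral>\<^sup>+w. T u z v w \<partial>count_space UNIV \<partial>count_space UNIV \<partial>lborel \<partial>lborel)"
    by (rule lborel_pair.Fubini'[symmetric]) (use Tzw in \<open>simp add: case_prod_beta'\<close>)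
  also have "\<dots> = (\<integral>\<^sup>+v. \<integral>\<^sup>+u. \<integral>\<^sup>+w. \<integral>\<^sup>+z. T u z v w \<partial>count_space UNIV \<partial>count_space UNIV \<partial>lborel \<partial>lborel)"
    by (intro nn_integral_cong nn_integral_count_space_commute) simp
  also have "\<dots> = (\<integral>\<^sup>+v. \<integral>\<^sup>+w. \<integral>\<^sup>+u. \<integral>\<^sup>+z. T u z v w \<partial>count_space UNIV \<partial>lborel \<partial>count_space UNIV \<partial>lborel)"
    by (intro nn_integral_cong nn_integral_count_space_commute) (use Tz2 in simp)
  also have "\<dots> = (\<integral>\<^sup>+v. indicator {s..t} v *
     (ennreal (S s v x) * (\<integral>\<^sup>+w. ennreal (c v x w) * P (Suc n) v t w y \<partial>count_space UNIV)) \<partial>lborel)"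
  proof (intro nn_integral_cong)
    fix v :: real
    have ind: "indicator {s..t} u * indicator {s..u} v = (indicator {s..t} v * indicator {v..t} u :: ennreal)" for u
      by (auto simp: indicator_def)
    have Teq: "T u z v w = indicator {s..t} v * (ennreal (S s v x) * (ennreal (c v x w)
        * (indicator {v..t} u * ((P n v u w z * ennreal (c u z y)) * ennreal (S u t y)))))" for u z w
      unfolding T_def ind by (simp only: mult_ac)
    have m1: "(\<lambda>u. \<integral>\<^sup>+z. P n v u w z * ennreal (c u z y) \<partial>count_space UNIV) \<in> borel_measurable borel" for w
      by (rule borel_measurable_nn_integral_count_space) measurable
    note [measurable] = m1
    show "(\<integral>\<^sup>+w. \<integral>\<^sup>+u. \<integral>\<^sup>+z. T u z v w \<partial>count_space UNIV \<partial>lborel \<partial>count_space UNIV)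
      = indicator {s..t} v * (ennreal (S s v x) * (\<integral>\<^sup>+w. ennreal (c v x w) * P (Suc n) v t w y \<partial>count_space UNIV))"
      unfolding Teq path_kernel.simps(2)[of c m n] by (simp add: nn_integral_cmult nn_integral_multc)
  qed
  finally show ?case .
qed

end

section \<open>Chapman-Kolmogorov identity, time reversal and monotone limits\<close>

context jump_rates begin

text \<open>
The \<open>n\<close> jumps are distributed over \<open>[s, r]\<close> and \<open>[r, t]\<close>. In the induction the last jump lies either
before \<open>r\<close>, and then the survival probability factorises at \<open>r\<close>, or after \<open>r\<close>, and then the
induction hypothesis applies up to that jump.
\<close>
lemma path_kernel_split:
  assumes "s \<le> r" "r \<le> t"
  shows "P n s t x y = (\<Sum>k\<le>n. \<integral>\<^sup>+w. P k s r x w * P (n - k) r t w y \<partial>count_space UNIV)"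
  using assms(2)
proof (induction n arbitrary: t y)
  case 0
  have "(\<integral>\<^sup>+w. P 0 s r x w * P 0 r t w y \<partial>count_space UNIV) = P 0 s r x x * P 0 r t x y"
    by (rule nn_integral_count_space_eq_single) simp
  moreover have "P 0 s t x y = P 0 s r x x * P 0 r t x y"
    using S_mult[OF assms(1) 0, of x] by auto
  ultimately show ?case by (simp del: path_kernel.simps)
next
  case (Suc n)
  note [measurable] = borel_measurable_indicator_Icc
  define h where "h u = (\<integral>\<^sup>+z. P n s u x z * ennreal (c u z y) \<partial>count_space UNIV)" for u
  have [measurable]: "h \<in> borel_measurable borel"
    unfolding h_def by (rule borel_measurable_nn_integral_count_space) measurable
  have "P (Suc n) s t x y = (\<integral>\<^sup>+u. indicator {s..r} u * (h u * ennreal (S u t y)) + indicator {r..t} u * (h u * ennreal (S u t y)) \<partial>lborel)"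
    unfolding path_kernel.simps(2) h_def[symmetric]
    by (rule nn_integral_cong_AE, use AE_lborel_singleton[of r] in eventually_elim)
      (use assms(1) Suc.prems in \<open>auto simp: indicator_def\<close>)
  also have "\<dots> = (\<integral>\<^sup>+u. indicator {s..r} u * (h u * ennreal (S u t y)) \<partial>lborel)
      + (\<integral>\<^sup>+u. indicator {r..t} u * (h u * ennreal (S u t y)) \<partial>lborel)"
    by (rule nn_integral_add) measurable
  also have "(\<integral>\<^sup>+u. indicator {s..r} u * (h u * ennreal (S u t y)) \<partial>lborel)
      = (\<integral>\<^sup>+u. (indicator {s..r} u * (h u * ennreal (S u r y))) * ennreal (S r t y) \<partial>lborel)"
  proof (rule nn_integral_cong)
    fix u
    show "indicator {s..r} u * (h u * ennreal (S u t y)) = indicator {s..r} u * (h u * ennreal (S u r y)) * ennreal (S r t y)"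
    proof (cases "u \<in> {s..r}")
      case True
      then have e: "ennreal (S u t y) = ennreal (S u r y) * ennreal (S r t y)"
        by (intro S_mult Suc.prems) simp
      show ?thesis unfolding e by (simp only: mult.assoc)
    qed simp
  qed
  also have "\<dots> = P (Suc n) s r x y * ennreal (S r t y)"
    unfolding path_kernel.simps(2) h_def[symmetric] by (rule nn_integral_multc) measurable
  also have "\<dots> = (\<integral>\<^sup>+w. P (Suc n) s r x w * P 0 r t w y \<partial>count_space UNIV)"
    by (subst nn_integral_count_space_eq_single[of y]) auto
  also have "(\<integral>\<^sup>+u. indicator {r..t} u * (h u * ennreal (S u t y)) \<partial>lborel)
      = (\<integral>\<^sup>+u. (\<Sum>k\<le>n. \<integral>\<^sup>+w. P k s r x w * (indicator {r..t} u *
           ((\<integral>\<^sup>+z. P (n - k) r u w z * ennreal (c u z y) \<partial>count_space UNIV) * ennreal (S u t y))) \<partial>count_space UNIV) \<partial>lborel)"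
  proof (intro nn_integral_cong)
    fix u :: real
    show "indicator {r..t} u * (h u * ennreal (S u t y)) = (\<Sum>k\<le>n. \<integral>\<^sup>+w. P k s r x w * (indicator {r..t} u *
           ((\<integral>\<^sup>+z. P (n - k) r u w z * ennreal (c u z y) \<partial>count_space UNIV) * ennreal (S u t y))) \<partial>count_space UNIV)"
    proof (cases "u \<in> {r..t}")
      case True
      then have "r \<le> u" by simp
      have "h u = (\<integral>\<^sup>+z. (\<Sum>k\<le>n. \<integral>\<^sup>+w. P k s r x w * P (n - k) r u w z * ennreal (c u z y) \<partial>count_space UNIV) \<partial>count_space UNIV)"
        unfolding h_def Suc.IH[OF \<open>r \<le> u\<close>] sum_distrib_right by (simp add: nn_integral_multc)
      also have "\<dots> = (\<Sum>k\<le>n. \<integral>\<^sup>+z. \<integral>\<^sup>+w. P k s r x w * P (n - k) r u w z * ennreal (c u z y) \<partial>count_space UNIV \<partial>count_space UNIV)"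
        by (rule nn_integral_sum) simp
      also have "\<dots> = (\<Sum>k\<le>n. \<integral>\<^sup>+w. P k s r x w * (\<integral>\<^sup>+z. P (n - k) r u w z * ennreal (c u z y) \<partial>count_space UNIV) \<partial>count_space UNIV)"
        by (intro sum.cong refl, subst nn_integral_count_space_commute) (simp_all add: nn_integral_cmult mult.assoc)
      finally have hu: "h u = \<dots>" .
      have "h u * ennreal (S u t y) = (\<Sum>k\<le>n. \<integral>\<^sup>+w. P k s r x w *
          (\<integral>\<^sup>+z. P (n - k) r u w z * ennreal (c u z y) \<partial>count_space UNIV) * ennreal (S u t y) \<partial>count_space UNIV)"
        unfolding hu sum_distrib_right by (intro sum.cong refl nn_integral_multc[symmetric]) simp
      with True show ?thesis by (simp add: mult.assoc)
    qed simp
  qed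
  also have "\<dots> = (\<Sum>k\<le>n. \<integral>\<^sup>+w. P k s r x w * P (Suc (n - k)) r t w y \<partial>count_space UNIV)"
  proof -
    have m1: "(\<lambda>u. \<integral>\<^sup>+z. P j r u w z * ennreal (c u z y) \<partial>count_space UNIV) \<in> borel_measurable borel" for j w
      by (rule borel_measurable_nn_integral_count_space) measurable
    note [measurable] = m1
    have m2: "(\<lambda>u. \<integral>\<^sup>+w. P k s r x w * (indicator {r..t} u *
           ((\<integral>\<^sup>+z. P (n - k) r u w z * ennreal (c u z y) \<partial>count_space UNIV) * ennreal (S u t y))) \<partial>count_space UNIV) \<in> borel_measurable borel" for k
      by (rule borel_measurable_nn_integral_count_space) measurable
    show ?thesis
    proof (subst nn_integral_sum, use m2 in simp, intro sum.cong refl)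
      fix k
      have "(\<integral>\<^sup>+u. \<integral>\<^sup>+w. P k s r x w * (indicator {r..t} u *
           ((\<integral>\<^sup>+z. P (n - k) r u w z * ennreal (c u z y) \<partial>count_space UNIV) * ennreal (S u t y))) \<partial>count_space UNIV \<partial>lborel)
        = (\<integral>\<^sup>+w. \<integral>\<^sup>+u. P k s r x w * (indicator {r..t} u *
           ((\<integral>\<^sup>+z. P (n - k) r u w z * ennreal (c u z y) \<partial>count_space UNIV) * ennreal (S u t y))) \<partial>lborel \<partial>count_space UNIV)"
        by (rule nn_integral_count_space_commute) measurable
      also have "\<dots> = (\<integral>\<^sup>+w. P k s r x w * P (Suc (n - k)) r t w y \<partial>count_space UNIV)"
        unfolding path_kernel.simps(2)
        by (intro nn_integral_cong nn_integral_cmult) measurable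
      finally show "(\<integral>\<^sup>+u. \<integral>\<^sup>+w. P k s r x w * (indicator {r..t} u *
           ((\<integral>\<^sup>+z. P (n - k) r u w z * ennreal (c u z y) \<partial>count_space UNIV) * ennreal (S u t y))) \<partial>count_space UNIV \<partial>lborel)
        = (\<integral>\<^sup>+w. P k s r x w * P (Suc (n - k)) r t w y \<partial>count_space UNIV)" .
    qed
  qed
  finally show ?case
    by (simp add: Suc_diff_le add.commute)
qed

lemma chapman_kolmogorov:
  assumes "s \<le> r" "r \<le> t"
  shows "p s t x y = (\<integral>\<^sup>+w. p s r x w * p r t w y \<partial>count_space UNIV)"
proof -
  have cauchy: "(\<Sum>n. \<Sum>k\<le>n. a k * b (n - k)) = (\<Sum>k. a k) * (\<Sum>k. b k)" for a b :: "nat \<Rightarrow> ennreal"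
  proof -
    have "(\<Sum>n. \<Sum>k\<le>n. a k * b (n - k)) = (\<Sum>n. \<Sum>k. if k \<le> n then a k * b (n - k) else 0)"
    proof (rule suminf_cong)
      fix n
      show "(\<Sum>k\<le>n. a k * b (n - k)) = (\<Sum>k. if k \<le> n then a k * b (n - k) else 0)"
        by (subst suminf_finite[of "{..n}"]) auto
    qed
    also have "\<dots> = (\<Sum>k. \<Sum>n. if k \<le> n then a k * b (n - k) else 0)"
      using nn_integral_count_space_nn_integral[of "UNIV :: nat set" "\<lambda>k n. if k \<le> n then a k * b (n - k) else 0" "count_space UNIV"]
      by (simp add: nn_integral_count_space_nat)
    also have "\<dots> = (\<Sum>k. \<Sum>n. a k * b n)"
    proof (rule suminf_cong)
      fix k
      show "(\<Sum>n. if k \<le> n then a k * b (n - k) else 0) = (\<Sum>n. a k * b n)"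
        using suminf_offset[of "\<lambda>n. if k \<le> n then a k * b (n - k) else 0" k, OF summableI] by simp
    qed
    also have "\<dots> = (\<Sum>k. a k) * (\<Sum>k. b k)" by simp
    finally show ?thesis .
  qed
  have "p s t x y = (\<Sum>n. \<integral>\<^sup>+w. (\<Sum>k\<le>n. P k s r x w * P (n - k) r t w y) \<partial>count_space UNIV)"
    unfolding transition_def path_kernel_split[OF assms] by (intro suminf_cong nn_integral_sum[symmetric]) simp
  also have "\<dots> = (\<integral>\<^sup>+w. (\<Sum>n. \<Sum>k\<le>n. P k s r x w * P (n - k) r t w y) \<partial>count_space UNIV)"
    by (rule nn_integral_suminf[symmetric]) simp
  also have "\<dots> = (\<integral>\<^sup>+w. p s r x w * p r t w y \<partial>count_space UNIV)"
    unfolding transition_def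
    by (intro nn_integral_cong cauchy[of "\<lambda>k. P k s r x _" "\<lambda>k. P k r t _ y"])
  finally show ?thesis .
qed

text \<open>
Summation over the number of jumps turns the recursion into the Duhamel formula.
\<close>
lemma transition_last_jump:
  "p s t x y = (if x = y then ennreal (S s t x) else 0)
    + (\<integral>\<^sup>+u. indicator {s..t} u * ((\<integral>\<^sup>+z. p s u x z * ennreal (c u z y) \<partial>count_space UNIV) * ennreal (S u t y)) \<partial>lborel)"
proof -
  note [measurable] = borel_measurable_indicator_Icc
  have [measurable]: "(\<lambda>u. \<integral>\<^sup>+z. P n s u x z * ennreal (c u z y) \<partial>count_space UNIV) \<in> borel_measurable borel" for n
    by (rule borel_measurable_nn_integral_count_space) measurable
  have "p s t x y = (\<Sum>n. P (Suc n) s t x y) + P 0 s t x y"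
    unfolding transition_def by (subst suminf_offset[of _ 1]) (auto intro!: summableI)
  also have "(\<Sum>n. P (Suc n) s t x y) = (\<integral>\<^sup>+u. (\<Sum>n. indicator {s..t} u *
     ((\<integral>\<^sup>+z. P n s u x z * ennreal (c u z y) \<partial>count_space UNIV) * ennreal (S u t y))) \<partial>lborel)"
    unfolding path_kernel.simps(2) by (rule nn_integral_suminf[symmetric]) measurable
  also have "\<dots> = (\<integral>\<^sup>+u. indicator {s..t} u * ((\<integral>\<^sup>+z. p s u x z * ennreal (c u z y) \<partial>count_space UNIV) * ennreal (S u t y)) \<partial>lborel)"
  proof (rule nn_integral_cong)
    fix u
    have "(\<integral>\<^sup>+z. p s u x z * ennreal (c u z y) \<partial>count_space UNIV)
        = (\<Sum>n. \<integral>\<^sup>+z. P n s u x z * ennreal (c u z y) \<partial>count_space UNIV)"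
      unfolding transition_def by (subst nn_integral_suminf[symmetric]) simp_all
    then show "(\<Sum>n. indicator {s..t} u * ((\<integral>\<^sup>+z. P n s u x z * ennreal (c u z y) \<partial>count_space UNIV) * ennreal (S u t y)))
      = indicator {s..t} u * ((\<integral>\<^sup>+z. p s u x z * ennreal (c u z y) \<partial>count_space UNIV) * ennreal (S u t y))"
      by simp
  qed
  finally show ?thesis by (simp add: add.commute)
qed

end

text \<open>
Reading a trajectory backwards exchanges first and last jumps, so the recursion on the last jump for one
family of rates is the recursion on the first jump for the other.
\<close>
lemma path_kernel_reversal:
  assumes "jump_rates c m" "jump_rates c' m'"
    and c': "\<And>u x y. c' u x y = c (- u) y x" and m': "\<And>u x. m' u x = m (- u) x"
  shows "path_kernel c m n s t x y = path_kernel c' m' n (- t) (- s) y x"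
proof -
  interpret A: jump_rates c m by fact
  interpret B: jump_rates c' m' by fact
  have S: "survival m' (-t) (-s) x = survival m s t x" for s t x
  proof -
    have "(LBINT u:{-t..-s}. m (-u) x) = (LBINT u:{s..t}. m u x)"
    proof -
      have "{u. - u \<in> {s..t}} = {-t..-s}" by auto
      then show ?thesis using set_integral_reflect[of "{s..t}" "\<lambda>u. m u x"] by simp
    qed
    then show ?thesis unfolding survival_def m' by simp
  qed
  show ?thesis
  proof (induction n arbitrary: s t x y)
    case 0
    then show ?case using S[of t s x] by auto
  next
    case (Suc n)
    note [measurable] = borel_measurable_indicator_Icc
    have m1: "(\<lambda>u. \<integral>\<^sup>+w. ennreal (c' u y w) * path_kernel c' m' n u (-s) w x \<partial>count_space UNIV) \<in> borel_measurable borel"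
      by (rule borel_measurable_nn_integral_count_space) measurable
    note [measurable] = m1
    have "path_kernel c' m' (Suc n) (- t) (- s) y x = (\<integral>\<^sup>+v. indicator {-t..-s} v *
     (ennreal (survival m' (-t) v y) * (\<integral>\<^sup>+w. ennreal (c' v y w) * path_kernel c' m' n v (-s) w x \<partial>count_space UNIV)) \<partial>lborel)"
      by (rule B.path_kernel_first_jump)
    also have "\<dots> = (\<integral>\<^sup>+v. indicator {-t..-s} (-v) *
     (ennreal (survival m' (-t) (-v) y) * (\<integral>\<^sup>+w. ennreal (c' (-v) y w) * path_kernel c' m' n (-v) (-s) w x \<partial>count_space UNIV)) \<partial>lborel)"
      by (subst nn_integral_real_affine[where c="-1" and t=0]) auto
    also have "\<dots> = path_kernel c m (Suc n) s t x y"
      unfolding path_kernel.simps(2)[of c m] S c' Suc[symmetric]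
      by (intro nn_integral_cong) (auto simp: indicator_def mult_ac)
    finally show ?case by simp
  qed
qed

lemma transition_reversal:
  assumes "jump_rates c m" "jump_rates c' m'"
    and "\<And>u x y. c' u x y = c (- u) y x" "\<And>u x. m' u x = m (- u) x"
  shows "transition c m s t x y = transition c' m' (- t) (- s) y x"
  unfolding transition_def path_kernel_reversal[OF assms] ..

text \<open>
Monotone convergence in every iterated integral. The exit rate must not change with \<open>k\<close>, which is why boxes
are imposed by killing and not by reflection.
\<close>
lemma path_kernel_mono_tendsto:
  fixes ck :: "nat \<Rightarrow> real \<Rightarrow> 'a::countable \<Rightarrow> 'a \<Rightarrow> real"
  assumes J: "\<And>k. jump_rates (ck k) m"
    and inc: "\<And>u x y. incseq (\<lambda>k. ck k u x y)"
    and ev: "\<And>u x y. eventually (\<lambda>k. ck k u x y = c u x y) sequentially"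
  shows "incseq (\<lambda>k. path_kernel (ck k) m n s t x y)"
    and "(\<lambda>k. path_kernel (ck k) m n s t x y) \<longlonglongrightarrow> path_kernel c m n s t x y"
proof -
  note [measurable] = borel_measurable_indicator_Icc
  interpret J: jump_rates "ck k" m for k by (rule J)
  have "incseq (\<lambda>k. path_kernel (ck k) m n s t x y) \<and>
    (\<lambda>k. path_kernel (ck k) m n s t x y) \<longlonglongrightarrow> path_kernel c m n s t x y"
  proof (induction n arbitrary: s t x y)
    case 0
    then show ?case by auto
  next
    case (Suc n)
    let ?f = "\<lambda>k u z. path_kernel (ck k) m n s u x z * ennreal (ck k u z y)"
    let ?g = "\<lambda>u z. path_kernel c m n s u x z * ennreal (c u z y)"
    have f_inc: "incseq (\<lambda>k. ?f k u z)" for u z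
      using Suc inc by (auto simp: incseq_def intro!: mult_mono ennreal_leI)
    have f_lim: "(\<lambda>k. ?f k u z) \<longlonglongrightarrow> ?g u z" for u z
    proof (rule Lim_transform_eventually)
      show "(\<lambda>k. path_kernel (ck k) m n s u x z * ennreal (c u z y)) \<longlonglongrightarrow> ?g u z"
        using Suc by (cases "ennreal (c u z y) = 0") (auto intro!: tendsto_mult_ennreal)
      show "\<forall>\<^sub>F k in sequentially. path_kernel (ck k) m n s u x z * ennreal (c u z y) = ?f k u z"
        using ev[of u z y] by eventually_elim simp
    qed
    let ?F = "\<lambda>k u. \<integral>\<^sup>+z. ?f k u z \<partial>count_space UNIV"
    have F_inc: "incseq (\<lambda>k. ?F k u)" for u
      using f_inc by (auto simp: incseq_def intro!: nn_integral_mono)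
    have F_lim: "(\<lambda>k. ?F k u) \<longlonglongrightarrow> (\<integral>\<^sup>+z. ?g u z \<partial>count_space UNIV)" for u
      by (rule nn_integral_LIMSEQ) (use f_inc f_lim in \<open>auto simp: incseq_def le_fun_def\<close>)
    have F_meas[measurable]: "?F k \<in> borel_measurable borel" for k
      by (rule borel_measurable_nn_integral_count_space) measurable
    let ?H = "\<lambda>k u. indicator {s..t} u * (?F k u * ennreal (survival m u t y))"
    have H_inc: "incseq (\<lambda>k. ?H k u)" for u
      using F_inc by (auto simp: incseq_def intro!: mult_left_mono mult_right_mono)
    have "(\<lambda>k. \<integral>\<^sup>+u. ?H k u \<partial>lborel) \<longlonglongrightarrow> (\<integral>\<^sup>+u. indicator {s..t} u * ((\<integral>\<^sup>+z. ?g u z \<partial>count_space UNIV) * ennreal (survival m u t y)) \<partial>lborel)"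
    proof (rule nn_integral_LIMSEQ)
      show "incseq ?H" using H_inc by (auto simp: incseq_def le_fun_def)
      show "(\<lambda>k. ?H k u) \<longlonglongrightarrow> indicator {s..t} u * ((\<integral>\<^sup>+z. ?g u z \<partial>count_space UNIV) * ennreal (survival m u t y))" for u
        by (cases "u \<in> {s..t}") (auto intro!: tendsto_mult_ennreal F_lim simp: survival_def)
    qed measurable
    moreover have "incseq (\<lambda>k. \<integral>\<^sup>+u. ?H k u \<partial>lborel)"
      using H_inc by (auto simp: incseq_def intro!: nn_integral_mono)
    ultimately show ?case by simp
  qed
  then show "incseq (\<lambda>k. path_kernel (ck k) m n s t x y)"
    "(\<lambda>k. path_kernel (ck k) m n s t x y) \<longlonglongrightarrow> path_kernel c m n s t x y" by auto
qed

lemma transition_mono_tendsto: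
  fixes ck :: "nat \<Rightarrow> real \<Rightarrow> 'a::countable \<Rightarrow> 'a \<Rightarrow> real"
  assumes "\<And>k. jump_rates (ck k) m" "\<And>u x y. incseq (\<lambda>k. ck k u x y)"
    and "\<And>u x y. eventually (\<lambda>k. ck k u x y = c u x y) sequentially"
  shows "incseq (\<lambda>k. transition (ck k) m s t x y)"
    and "(\<lambda>k. transition (ck k) m s t x y) \<longlonglongrightarrow> transition c m s t x y"
proof -
  note * = path_kernel_mono_tendsto[OF assms]
  show "incseq (\<lambda>k. transition (ck k) m s t x y)"
    unfolding transition_def using *(1) by (auto simp: incseq_def intro!: suminf_le)
  have "(\<lambda>k. \<integral>\<^sup>+n. path_kernel (ck k) m n s t x y \<partial>count_space UNIV)
      \<longlonglongrightarrow> (\<integral>\<^sup>+n. path_kernel c m n s t x y \<partial>count_space UNIV)"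
    by (rule nn_integral_LIMSEQ) (use * in \<open>auto simp: incseq_def le_fun_def\<close>)
  then show "(\<lambda>k. transition (ck k) m s t x y) \<longlonglongrightarrow> transition c m s t x y"
    by (simp add: transition_def nn_integral_count_space_nat)
qed

section \<open>The law of a single jump\<close>

context
  fixes \<omega> :: "'n::finite environment"
  assumes env: "\<omega> \<in> environments" and loc: "locally_integrable_rates \<omega>"
begin

lemma jump_rates_environment: "jump_rates (\<lambda>u x y. \<omega> u (x, y)) (exit_rate \<omega>)"
proof
  show "0 \<le> \<omega> u (x, y)" for u x y
    using env unfolding environments_def by (cases "(x, y) \<in> bonds") (auto simp: less_imp_le)
qed (use env loc in \<open>auto intro: meas_env meas_exit exit_nonneg exit_integrable\<close>)

interpretation jump_rates "\<lambda>u x y. \<omega> u (x, y)" "exit_rate \<omega>"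
  by (rule jump_rates_environment)

text \<open>
The exponential clock of the walk has the density \<open>exit_rate \<omega> u z * S r u z\<close>.
\<close>
lemma survival_diff:
  assumes "r \<le> a" "a \<le> b"
  shows "(\<integral>\<^sup>+u. indicator {a<..b} u * ennreal (exit_rate \<omega> u z * S r u z) \<partial>lborel) = ennreal (S r a z - S r b z)"
proof -
  have i: "set_integrable lborel {a..b} (\<lambda>u. exit_rate \<omega> u z * S a u z)"
    and e: "1 - S a b z = (LBINT u:{a..b}. exit_rate \<omega> u z * S a u z)"
    unfolding survival_def
    using indefinite_integral_exp_neg[OF assms(2) m_integrable m_nonneg, of z] by auto
  have "(\<integral>\<^sup>+u. indicator {a<..b} u * ennreal (exit_rate \<omega> u z * S r u z) \<partial>lborel)
      = (\<integral>\<^sup>+u. ennreal (S r a z) * ennreal (indicator {a..b} u *\<^sub>R (exit_rate \<omega> u z * S a u z)) \<partial>lborel)"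
  proof (rule nn_integral_cong_AE, use AE_lborel_singleton[of a] in eventually_elim)
    fix u assume "u \<noteq> a"
    show "indicator {a<..b} u * ennreal (exit_rate \<omega> u z * S r u z)
      = ennreal (S r a z) * ennreal (indicator {a..b} u *\<^sub>R (exit_rate \<omega> u z * S a u z))"
    proof (cases "u \<in> {a..b}")
      case True
      then have "ennreal (S r u z) = ennreal (S r a z) * ennreal (S a u z)"
        using assms by (intro S_mult) auto
      then show ?thesis using True \<open>u \<noteq> a\<close> m_nonneg[of u z]
        by (simp add: ennreal_mult' mult_ac)
    next
      case False then show ?thesis by (auto simp: indicator_def)
    qed
  qed
  also have "\<dots> = ennreal (S r a z) * (\<integral>\<^sup>+u. ennreal (indicator {a..b} u *\<^sub>R (exit_rate \<omega> u z * S a u z)) \<partial>lborel)"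
    by (rule nn_integral_cmult) measurable
  also have "(\<integral>\<^sup>+u. ennreal (indicator {a..b} u *\<^sub>R (exit_rate \<omega> u z * S a u z)) \<partial>lborel) = ennreal (1 - S a b z)"
    unfolding e set_lebesgue_integral_def
    by (rule nn_integral_eq_integral) (use i m_nonneg in \<open>auto simp: set_integrable_def survival_def\<close>)
  also have "ennreal (S r a z) * ennreal (1 - S a b z) = ennreal (S r a z - S r b z)"
  proof -
    have "S r b z = S r a z * S a b z"
      using S_mult[OF assms, of z] by (simp add: survival_def ennreal_mult[symmetric])
    moreover have "0 \<le> S r a z" by (simp add: survival_def)
    ultimately show ?thesis by (simp add: ennreal_mult'[symmetric] algebra_simps)
  qed
  finally show ?thesis .
qed

text \<open>
The restriction of the jump time law to finite times and the measure with this density agree on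
half-open intervals, by the survival function, and hence everywhere.
\<close>
lemma nn_integral_jump_time_law:
  fixes G :: "ereal \<Rightarrow> ennreal"
  assumes G[measurable]: "G \<in> borel_measurable borel" and "G \<infinity> = 0"
  shows "(\<integral>\<^sup>+J. G J \<partial>jump_time_law \<omega> r z)
    = (\<integral>\<^sup>+u. indicator {r<..} u * (ennreal (exit_rate \<omega> u z * S r u z) * G (ereal u)) \<partial>lborel)"
proof -
  let ?N = "jump_time_law \<omega> r z"
  interpret N: prob_space ?N by (rule prob_space_jump_time_law[OF env loc])
  have sN[measurable_cong]: "sets ?N = sets borel" using jump_time_law_eq[OF env loc] by simp
  have tail: "measure ?N {ereal t<..} = S r t z" if "r \<le> t" for t
    using jump_time_law_survival[OF env loc that] by (simp add: survival_def)
  have tail1: "measure ?N {ereal r<..} = 1" using tail[of r] total_rate_refl[OF env loc, of z r]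
    unfolding survival_def total_rate_def[OF env loc] by simp
  have Sr: "S r r z = 1" using tail[of r] tail1 by simp
  have ae: "AE J in ?N. ereal r < J"
    using N.prob_eq_1[of "{ereal r<..}"] tail1 by auto
  define M1 where "M1 = distr (density ?N (indicator {J. J \<noteq> \<infinity>})) borel real_of_ereal"
  define M2 where "M2 = density lborel (\<lambda>u. indicator {r<..} u * ennreal (exit_rate \<omega> u z * S r u z))"
  have fin[measurable]: "{J :: ereal. J \<noteq> \<infinity>} \<in> sets borel" by measurable
  have vm[measurable]: "real_of_ereal -` {a<..b} \<in> sets borel" for a b
  proof -
    have "(\<lambda>J::ereal. real_of_ereal J) \<in> borel_measurable borel" by measurable
    from measurable_sets[OF this, of "{a<..b}"] show ?thesis by simp
  qed
  have Ioc: "emeasure M1 {a<..b} = emeasure M2 {a<..b}" for a b :: real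
  proof (cases "max a r \<le> b")
    case False
    have "emeasure M1 {a<..b} = emeasure (density ?N (indicator {J. J \<noteq> \<infinity>})) (real_of_ereal -` {a<..b})"
      unfolding M1_def by (subst emeasure_distr) (auto simp: sets_eq_imp_space_eq[OF sN])
    also have "\<dots> = (\<integral>\<^sup>+J. indicator {J. J \<noteq> \<infinity>} J * indicator (real_of_ereal -` {a<..b}) J \<partial>?N)"
      by (rule emeasure_density) (auto simp: sN measurable_cong_sets[OF sN refl])
    also have "\<dots> = (\<integral>\<^sup>+J. 0 \<partial>?N)"
    proof (rule nn_integral_cong_AE, use ae in eventually_elim)
      fix J assume "ereal r < J"
      then show "indicator {J. J \<noteq> \<infinity>} J * indicator (real_of_ereal -` {a<..b}) J = (0::ennreal)"
        using False by (cases J) (auto simp: indicator_def)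
    qed
    finally have 1: "emeasure M1 {a<..b} = 0" by simp
    have "emeasure M2 {a<..b} = (\<integral>\<^sup>+u. indicator {r<..} u * ennreal (exit_rate \<omega> u z * S r u z) * indicator {a<..b} u \<partial>lborel)"
      unfolding M2_def by (rule emeasure_density) measurable
    also have "\<dots> = (\<integral>\<^sup>+u. 0 \<partial>(lborel :: real measure))"
      by (rule nn_integral_cong) (use False in \<open>auto simp: indicator_def max_def split: if_splits\<close>)
    finally show ?thesis using 1 by simp
  next
    case True
    define a' where "a' = max a r"
    have a': "r \<le> a'" "a' \<le> b" using True by (auto simp: a'_def)
    have "emeasure M1 {a<..b} = emeasure (density ?N (indicator {J. J \<noteq> \<infinity>})) (real_of_ereal -` {a<..b})"
      unfolding M1_def by (subst emeasure_distr) (auto simp: sets_eq_imp_space_eq[OF sN])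
    also have "\<dots> = (\<integral>\<^sup>+J. indicator {J. J \<noteq> \<infinity>} J * indicator (real_of_ereal -` {a<..b}) J \<partial>?N)"
      by (rule emeasure_density) (auto simp: sN measurable_cong_sets[OF sN refl])
    also have "\<dots> = (\<integral>\<^sup>+J. indicator {ereal a'<..ereal b} J \<partial>?N)"
    proof (rule nn_integral_cong_AE, use ae in eventually_elim)
      fix J assume "ereal r < J"
      then show "indicator {J. J \<noteq> \<infinity>} J * indicator (real_of_ereal -` {a<..b}) J
          = (indicator {ereal a'<..ereal b} J :: ennreal)"
        by (cases J) (auto simp: indicator_def a'_def)
    qed
    also have "\<dots> = emeasure ?N {ereal a'<..ereal b}" by (rule nn_integral_indicator) simp
    also have "\<dots> = ennreal (measure ?N ({ereal a'<..} - {ereal b<..}))"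
      unfolding N.emeasure_eq_measure by (intro arg_cong[where f=ennreal] arg_cong[where f="measure ?N"]) auto
    also have "measure ?N ({ereal a'<..} - {ereal b<..}) = S r a' z - S r b z"
      using a' by (subst N.finite_measure_Diff) (auto simp: tail)
    finally have 1: "emeasure M1 {a<..b} = ennreal (S r a' z - S r b z)" .
    have "emeasure M2 {a<..b} = (\<integral>\<^sup>+u. indicator {r<..} u * ennreal (exit_rate \<omega> u z * S r u z) * indicator {a<..b} u \<partial>lborel)"
      unfolding M2_def by (rule emeasure_density) measurable
    also have "\<dots> = (\<integral>\<^sup>+u. indicator {a'<..b} u * ennreal (exit_rate \<omega> u z * S r u z) \<partial>lborel)"
      by (rule nn_integral_cong) (auto simp: indicator_def a'_def)
    also have "\<dots> = ennreal (S r a' z - S r b z)" by (rule survival_diff[OF a'])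
    finally show ?thesis using 1 by simp
  qed
  have "M1 = M2"
  proof (rule measure_eqI_generator_eq[where E="range (\<lambda>(a, b). {a<..b::real})" and \<Omega>=UNIV and A="\<lambda>i. {- real i<..real i}"])
    show "Int_stable (range (\<lambda>(a, b). {a<..b::real}))"
    proof (rule Int_stableI_image)
      fix p q :: "real \<times> real"
      show "\<exists>k\<in>UNIV. (case p of (a, b) \<Rightarrow> {a<..b}) \<inter> (case q of (a, b) \<Rightarrow> {a<..b}) = (case k of (a, b) \<Rightarrow> {a<..b})"
        by (rule bexI[of _ "(max (fst p) (fst q), min (snd p) (snd q))"]) (auto split: prod.splits)
    qed
    show "sets M1 = sigma_sets UNIV (range (\<lambda>(a, b). {a<..b::real}))"
      "sets M2 = sigma_sets UNIV (range (\<lambda>(a, b). {a<..b::real}))"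
      unfolding M1_def M2_def by (simp_all add: borel_sigma_sets_Ioc)
    show "(\<Union>i. {- real i<..real i}) = UNIV"
    proof safe
      fix x :: real
      obtain n :: nat where "real n > \<bar>x\<bar>" using reals_Archimedean2 by blast
      then show "x \<in> (\<Union>i. {- real i<..real i})" by (auto intro!: exI[of _ n])
    qed simp_all
    show "emeasure M1 {- real i<..real i} \<noteq> \<infinity>" for i
    proof (cases "r \<le> real i \<and> - real i \<le> real i")
      case True
      have "emeasure M1 {- real i<..real i} \<le> emeasure M1 UNIV" by (rule emeasure_mono) (auto simp: M1_def)
      also have "\<dots> = emeasure (density ?N (indicator {J. J \<noteq> \<infinity>})) UNIV"
        unfolding M1_def by (subst emeasure_distr) (auto simp: sets_eq_imp_space_eq[OF sN])
      also have "\<dots> = (\<integral>\<^sup>+J. indicator {J. J \<noteq> \<infinity>} J * indicator UNIV J \<partial>?N)"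
        by (rule emeasure_density) measurable
      also have "\<dots> \<le> (\<integral>\<^sup>+J. 1 \<partial>?N)" by (rule nn_integral_mono) (auto simp: indicator_def)
      also have "\<dots> = 1" using N.emeasure_space_1 by simp
      finally show ?thesis by (auto simp: top_unique)
    next
      case False
      have "emeasure M1 {- real i<..real i} \<le> emeasure M1 UNIV" by (rule emeasure_mono) (auto simp: M1_def)
      also have "\<dots> = emeasure (density ?N (indicator {J. J \<noteq> \<infinity>})) UNIV"
        unfolding M1_def by (subst emeasure_distr) (auto simp: sets_eq_imp_space_eq[OF sN])
      also have "\<dots> = (\<integral>\<^sup>+J. indicator {J. J \<noteq> \<infinity>} J * indicator UNIV J \<partial>?N)"
        by (rule emeasure_density) measurable
      also have "\<dots> \<le> (\<integral>\<^sup>+J. 1 \<partial>?N)" by (rule nn_integral_mono) (auto simp: indicator_def)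
      also have "\<dots> = 1" using N.emeasure_space_1 by simp
      finally show ?thesis by (auto simp: top_unique)
    qed
  qed (use Ioc in auto)
  have "(\<integral>\<^sup>+J. G J \<partial>?N) = (\<integral>\<^sup>+J. indicator {J. J \<noteq> \<infinity>} J * G (ereal (real_of_ereal J)) \<partial>?N)"
    by (rule nn_integral_cong_AE, use ae in eventually_elim)
      (auto simp: indicator_def assms(2) ereal_real)
  also have "\<dots> = (\<integral>\<^sup>+J. G (ereal (real_of_ereal J)) \<partial>density ?N (indicator {J. J \<noteq> \<infinity>}))"
    by (rule nn_integral_density[symmetric]) measurable
  also have "\<dots> = (\<integral>\<^sup>+u. G (ereal u) \<partial>M1)"
    unfolding M1_def by (rule nn_integral_distr[symmetric]) measurable
  also have "\<dots> = (\<integral>\<^sup>+u. indicator {r<..} u * ennreal (exit_rate \<omega> u z * S r u z) * G (ereal u) \<partial>lborel)"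
    unfolding \<open>M1 = M2\<close> M2_def by (rule nn_integral_density) measurable
  finally show ?thesis by (simp only: mult.assoc)
qed

lemma exit_rate_pos: "exit_rate \<omega> t z > 0"
  unfolding exit_rate_def using env nbr_ex[OF env loc] nbr_fin[OF env loc]
  by (intro sum_pos) (auto simp: environments_def)

lemma nn_integral_jump_target_law:
  "(\<integral>\<^sup>+y. g y \<partial>jump_target_law \<omega> t z)
    = (\<integral>\<^sup>+y. ennreal (\<omega> t (z, y) / exit_rate \<omega> t z) * g y \<partial>count_space UNIV)"
  unfolding jump_target_law_def point_measure_def
  by (subst nn_integral_density) auto

lemma nn_integral_jump_kernel_bind:
  fixes f :: "ereal \<times> 'n site \<Rightarrow> ennreal"
  assumes f[measurable]: "f \<in> borel_measurable jump_space"
  shows "(\<integral>\<^sup>+q. f q \<partial>jump_kernel \<omega> (ereal r, z)) = (\<integral>\<^sup>+J. (if J = \<infinity> then f (\<infinity>, z)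
     else (\<integral>\<^sup>+y. f (J, y) \<partial>jump_target_law \<omega> (real_of_ereal J) z)) \<partial>jump_time_law \<omega> r z)"
proof -
  note tm = target_meas[OF env loc, of z]
  have sN: "sets (jump_time_law \<omega> r z) = sets borel" using jump_time_law_eq[OF env loc] by simp
  have ret: "(\<lambda>r::ereal. return jump_space (\<infinity>, z)) \<in> borel \<rightarrow>\<^sub>M subprob_algebra (jump_space :: (ereal \<times> 'n site) measure)"
    by (intro measurable_const prob_spaceI_alg[OF env loc] prob_space_return) (auto simp: space_pair_measure)
  have m: "(\<lambda>J. if J = \<infinity> then return jump_space (\<infinity>, z)
             else distr (jump_target_law \<omega> (real_of_ereal J) z) jump_space (\<lambda>y. (J, y)))
       \<in> borel \<rightarrow>\<^sub>M subprob_algebra jump_space"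
    by (rule measurable_If[OF ret tm]) simp
  have m': "(\<lambda>J. if J = \<infinity> then return jump_space (\<infinity>, z)
             else distr (jump_target_law \<omega> (real_of_ereal J) z) jump_space (\<lambda>y. (J, y)))
       \<in> jump_time_law \<omega> r z \<rightarrow>\<^sub>M subprob_algebra jump_space"
    using m by (subst measurable_cong_sets[OF sN refl])
  have "(\<integral>\<^sup>+q. f q \<partial>jump_kernel \<omega> (ereal r, z)) = (\<integral>\<^sup>+J. \<integral>\<^sup>+q. f q \<partial>(if J = \<infinity> then return jump_space (\<infinity>, z)
             else distr (jump_target_law \<omega> (real_of_ereal J) z) jump_space (\<lambda>y. (J, y))) \<partial>jump_time_law \<omega> r z)"
    unfolding jump_kernel_def by (simp, rule nn_integral_bind[OF f m'])
  also have "\<dots> = (\<integral>\<^sup>+J. (if J = \<infinity> then f (\<infinity>, z)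
     else (\<integral>\<^sup>+y. f (J, y) \<partial>jump_target_law \<omega> (real_of_ereal J) z)) \<partial>jump_time_law \<omega> r z)"
  proof (rule nn_integral_cong)
    fix J
    have "(\<lambda>y. (J, y)) \<in> measurable (jump_target_law \<omega> (real_of_ereal J) z) jump_space"
      unfolding jump_target_law_def measurable_point_measure_eq1 by (simp add: space_pair_measure)
    then show "(\<integral>\<^sup>+q. f q \<partial>(if J = \<infinity> then return jump_space (\<infinity>, z)
             else distr (jump_target_law \<omega> (real_of_ereal J) z) jump_space (\<lambda>y. (J, y))))
      = (if J = \<infinity> then f (\<infinity>, z) else (\<integral>\<^sup>+y. f (J, y) \<partial>jump_target_law \<omega> (real_of_ereal J) z))"
      by (auto simp: nn_integral_return nn_integral_distr space_pair_measure)
  qed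
  finally show ?thesis .
qed

text \<open>
The exit rate in the density of the jump time cancels the normalisation of the target law, which leaves
the conductance of the bond that is crossed.
\<close>
lemma nn_integral_jump_kernel:
  fixes f :: "ereal \<times> 'n site \<Rightarrow> ennreal"
  assumes f[measurable]: "f \<in> borel_measurable jump_space" and "\<And>y. f (\<infinity>, y) = 0"
  shows "(\<integral>\<^sup>+q. f q \<partial>jump_kernel \<omega> (ereal r, z)) = (\<integral>\<^sup>+u. indicator {r<..} u *
    (ennreal (S r u z) * (\<integral>\<^sup>+y. ennreal (\<omega> u (z, y)) * f (ereal u, y) \<partial>count_space UNIV)) \<partial>lborel)"
proof -
  let ?G = "\<lambda>J. (if J = \<infinity> then f (\<infinity>, z) else (\<integral>\<^sup>+y. f (J, y) \<partial>jump_target_law \<omega> (real_of_ereal J) z))"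
  have [measurable]: "(\<lambda>J. f (J, y)) \<in> borel_measurable borel" for y
    by (rule measurable_compose[OF _ f]) simp
  have [measurable]: "(\<lambda>J. \<integral>\<^sup>+y. ennreal (\<omega> (real_of_ereal J) (z, y) / exit_rate \<omega> (real_of_ereal J) z) * f (J, y) \<partial>count_space UNIV)
    \<in> borel_measurable borel"
  proof (rule borel_measurable_nn_integral_count_space)
    fix y
    have [measurable]: "(\<lambda>J. \<omega> (real_of_ereal J) (z, y)) \<in> borel_measurable borel"
      "(\<lambda>J. exit_rate \<omega> (real_of_ereal J) z) \<in> borel_measurable borel"
      by (rule measurable_compose[OF _ c_measurable] measurable_compose[OF _ m_measurable], measurable)+
    show "(\<lambda>J. ennreal (\<omega> (real_of_ereal J) (z, y) / exit_rate \<omega> (real_of_ereal J) z) * f (J, y)) \<in> borel_measurable borel"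
      by measurable
  qed
  have "?G \<in> borel_measurable borel"
    unfolding nn_integral_jump_target_law by measurable
  then have "(\<integral>\<^sup>+q. f q \<partial>jump_kernel \<omega> (ereal r, z)) = (\<integral>\<^sup>+u. indicator {r<..} u *
    (ennreal (exit_rate \<omega> u z * S r u z) * ?G (ereal u)) \<partial>lborel)"
    unfolding nn_integral_jump_kernel_bind[OF f] using assms(2)
    by (intro nn_integral_jump_time_law) auto
  also have "\<dots> = (\<integral>\<^sup>+u. indicator {r<..} u *
    (ennreal (S r u z) * (\<integral>\<^sup>+y. ennreal (\<omega> u (z, y)) * f (ereal u, y) \<partial>count_space UNIV)) \<partial>lborel)"
  proof (rule nn_integral_cong)
    fix u
    have "ennreal (exit_rate \<omega> u z * S r u z) * ?G (ereal u)
      = ennreal (S r u z) * (ennreal (exit_rate \<omega> u z) * (\<integral>\<^sup>+y. ennreal (\<omega> u (z, y) / exit_rate \<omega> u z) * f (ereal u, y) \<partial>count_space UNIV))"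
      using exit_rate_pos[of u z] by (simp add: nn_integral_jump_target_law ennreal_mult' survival_def mult_ac)
    also have "ennreal (exit_rate \<omega> u z) * (\<integral>\<^sup>+y. ennreal (\<omega> u (z, y) / exit_rate \<omega> u z) * f (ereal u, y) \<partial>count_space UNIV)
      = (\<integral>\<^sup>+y. ennreal (exit_rate \<omega> u z) * (ennreal (\<omega> u (z, y) / exit_rate \<omega> u z) * f (ereal u, y)) \<partial>count_space UNIV)"
      by (rule nn_integral_cmult[symmetric]) simp
    also have "\<dots> = (\<integral>\<^sup>+y. ennreal (\<omega> u (z, y)) * f (ereal u, y) \<partial>count_space UNIV)"
    proof (rule nn_integral_cong)
      fix y
      have "ennreal (exit_rate \<omega> u z) * ennreal (\<omega> u (z, y) / exit_rate \<omega> u z) = ennreal (\<omega> u (z, y))"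
        using exit_rate_pos[of u z] c_nonneg[of u z y] by (simp add: ennreal_mult[symmetric])
      then show "ennreal (exit_rate \<omega> u z) * (ennreal (\<omega> u (z, y) / exit_rate \<omega> u z) * f (ereal u, y))
        = ennreal (\<omega> u (z, y)) * f (ereal u, y)" by (simp add: mult.assoc[symmetric])
    qed
    finally show "indicator {r<..} u * (ennreal (exit_rate \<omega> u z * S r u z) * ?G (ereal u)) = indicator {r<..} u *
    (ennreal (S r u z) * (\<integral>\<^sup>+y. ennreal (\<omega> u (z, y)) * f (ereal u, y) \<partial>count_space UNIV))" by simp
  qed
  finally show ?thesis .
qed

lemma jump_kernel_survival:
  assumes "r \<le> t"
  shows "(\<integral>\<^sup>+q. indicator {q. ereal t < fst q} q \<partial>jump_kernel \<omega> (ereal r, z)) = ennreal (S r t z)"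
proof -
  interpret N: prob_space "jump_time_law \<omega> r z" by (rule prob_space_jump_time_law[OF env loc])
  have sN: "sets (jump_time_law \<omega> r z) = sets borel" using jump_time_law_eq[OF env loc] by simp
  have "(\<integral>\<^sup>+q. indicator {q. ereal t < fst q} q \<partial>jump_kernel \<omega> (ereal r, z))
     = (\<integral>\<^sup>+J. (if J = \<infinity> then indicator {q. ereal t < fst q} (\<infinity>, z)
     else (\<integral>\<^sup>+y. indicator {q. ereal t < fst q} (J, y) \<partial>jump_target_law \<omega> (real_of_ereal J) z)) \<partial>jump_time_law \<omega> r z)"
    by (rule nn_integral_jump_kernel_bind) measurable
  also have "\<dots> = (\<integral>\<^sup>+J. indicator {ereal t<..} J \<partial>jump_time_law \<omega> r z)"
  proof (rule nn_integral_cong)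
    fix J
    interpret T: prob_space "jump_target_law \<omega> (real_of_ereal J) z" by (rule target_prob[OF env loc])
    have "(\<integral>\<^sup>+y. indicator {q. ereal t < fst q} (J, y) \<partial>jump_target_law \<omega> (real_of_ereal J) z)
       = (\<integral>\<^sup>+y. indicator {ereal t<..} J \<partial>jump_target_law \<omega> (real_of_ereal J) z)"
      by (rule nn_integral_cong) (auto simp: indicator_def)
    also have "\<dots> = indicator {ereal t<..} J" using T.emeasure_space_1 by simp
    finally show "(if J = \<infinity> then indicator {q. ereal t < fst q} (\<infinity>, z)
     else (\<integral>\<^sup>+y. indicator {q. ereal t < fst q} (J, y) \<partial>jump_target_law \<omega> (real_of_ereal J) z)) = indicator {ereal t<..} J"
      by (auto simp: indicator_def)
  qed
  also have "\<dots> = ennreal (S r t z)"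
    using jump_time_law_survival[OF env loc assms, of z] sN
    by (simp add: N.emeasure_eq_measure survival_def)
  finally show ?thesis .
qed

end

section \<open>The heat kernel of the walk as a jump series\<close>

text \<open>
The position at time \<open>t\<close> is the one recorded at the last jump before the first jump time beyond \<open>t\<close>.
\<close>
lemma walk_at_eq_Some_iff:
  "walk_at t h = Some y \<longleftrightarrow>
    (\<exists>n. snd (h n) = y \<and> ereal t < fst (h (Suc n)) \<and> (\<forall>k<n. \<not> ereal t < fst (h (Suc k))))"
proof
  let ?n = "LEAST n. ereal t < fst (h (Suc n))"
  assume L: "walk_at t h = Some y"
  have ex: "\<exists>n. ereal t < fst (h (Suc n))"
  proof (rule ccontr)
    assume "\<not> ?thesis"
    then have "walk_at t h = None" unfolding walk_at_def by (rule if_not_P)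
    with L show False by simp
  qed
  have "walk_at t h = Some (snd (h ?n))" unfolding walk_at_def using ex by (rule if_P)
  then have "snd (h ?n) = y" using L by simp
  moreover have "ereal t < fst (h (Suc ?n))" by (rule LeastI_ex[OF ex])
  moreover have "\<forall>k<?n. \<not> ereal t < fst (h (Suc k))" using not_less_Least by blast
  ultimately show "\<exists>n. snd (h n) = y \<and> ereal t < fst (h (Suc n)) \<and> (\<forall>k<n. \<not> ereal t < fst (h (Suc k)))"
    by blast
next
  assume "\<exists>n. snd (h n) = y \<and> ereal t < fst (h (Suc n)) \<and> (\<forall>k<n. \<not> ereal t < fst (h (Suc k)))"
  then obtain n where n: "snd (h n) = y" "ereal t < fst (h (Suc n))" "\<forall>k<n. \<not> ereal t < fst (h (Suc k))"
    by blast
  have least: "(LEAST n. ereal t < fst (h (Suc n))) = n"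
    using n(2,3) by (intro Least_equality) (auto simp: not_less[symmetric])
  show "walk_at t h = Some y"
    unfolding walk_at_def least using n(1,2) by auto
qed

context
  fixes \<omega> :: "'n::finite environment" and s :: real and x :: "'n site"
  assumes env: "\<omega> \<in> environments" and loc: "locally_integrable_rates \<omega>"
begin

interpretation jump_rates "\<lambda>u x y. \<omega> u (x, y)" "exit_rate \<omega>"
  by (rule jump_rates_environment[OF env loc])

interpretation IT: Ionescu_Tulcea "jump_step \<omega> s x" "\<lambda>_. jump_space"
  by (rule Ionescu_Tulcea_jump_step[OF env loc])

abbreviation "walk \<equiv> walk_law \<omega> s x"

lemma sets_walk: "sets walk = sets (Pi\<^sub>M UNIV (\<lambda>_. jump_space))"
  unfolding walk_law_def by simp

lemma prob_space_walk: "prob_space walk"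
proof -
  have "prob_space (distr IT.PF.lim (Pi\<^sub>M {} (\<lambda>_. jump_space)) (\<lambda>x. restrict x {}))"
    unfolding IT.distr_lim[OF finite.emptyI] by (rule IT.PF.prob_space_P) auto
  then show ?thesis unfolding walk_law_def
    by (rule prob_space_distrD[rotated]) (auto intro!: measurable_restrict)
qed

lemma walk_component_measurable: "(\<lambda>h. h n) \<in> measurable walk jump_space"
  unfolding measurable_cong_sets[OF sets_walk refl] by (rule measurable_component_singleton) simp

text \<open>
The projective limit is consistent with the finite-step laws of the Ionescu-Tulcea construction.
\<close>
lemma nn_integral_walk_restrict:
  assumes [measurable]: "f \<in> borel_measurable (Pi\<^sub>M {0..<n} (\<lambda>_. jump_space))"
  shows "(\<integral>\<^sup>+h. f (restrict h {0..<n}) \<partial>walk) = (\<integral>\<^sup>+h. f h \<partial>IT.C 0 n (\<lambda>_. undefined))"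
proof -
  have r: "(\<lambda>h. restrict h {0..<n}) \<in> measurable IT.PF.lim (Pi\<^sub>M {0..<n} (\<lambda>_. jump_space))"
    unfolding measurable_cong_sets[OF IT.PF.sets_lim refl]
    by (rule measurable_restrict) (rule measurable_component_singleton, simp)
  have up: "IT.up_to {0..<n} \<le> n" by (subst IT.up_to_iff) auto
  have sp: "(\<lambda>_. undefined) \<in> space (Pi\<^sub>M {0..<0::nat} (\<lambda>_. jump_space))" by (auto simp: space_PiM PiE_def extensional_def)
  have CI: "IT.CI {0..<n} = IT.C 0 n (\<lambda>_. undefined)"
  proof (rule measure_eqI)
    show "sets (IT.CI {0..<n}) = sets (IT.C 0 n (\<lambda>_. undefined))"
      using IT.sets_C[OF sp, of n] by (simp add: IT.PF.sets_P)
    fix A assume "A \<in> sets (IT.CI {0..<n})"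
    then have A: "A \<in> sets (Pi\<^sub>M {0..<n} (\<lambda>_. jump_space))" by (simp add: IT.PF.sets_P)
    have "prod_emb {0..<n} (\<lambda>_. jump_space) {0..<n} A = A"
    proof -
      have "restrict h {0..<n} = h" if "h \<in> A" for h
        using sets.sets_into_space[OF A] that by (intro extensional_restrict) (auto simp: space_PiM PiE_def)
      moreover have "restrict h {0..<n} = h" if "h \<in> {0..<n} \<rightarrow>\<^sub>E space (jump_space :: (ereal \<times> 'n site) measure)" for h
        using that by (intro extensional_restrict) (auto simp: PiE_def)
      ultimately show ?thesis
        using sets.sets_into_space[OF A] by (auto simp: prod_emb_def space_PiM)
    qed
    then show "emeasure (IT.CI {0..<n}) A = emeasure (IT.C 0 n (\<lambda>_. undefined)) A"
      using IT.emeasure_CI[OF _ A, of n] by simp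
  qed
  have "(\<integral>\<^sup>+h. f (restrict h {0..<n}) \<partial>walk) = (\<integral>\<^sup>+h. f h \<partial>distr IT.PF.lim (Pi\<^sub>M {0..<n} (\<lambda>_. jump_space)) (\<lambda>h. restrict h {0..<n}))"
    unfolding walk_law_def by (rule nn_integral_distr[symmetric, OF r]) measurable
  also have "\<dots> = (\<integral>\<^sup>+h. f h \<partial>IT.C 0 n (\<lambda>_. undefined))"
    by (subst IT.distr_lim) (simp_all add: CI)
  finally show ?thesis .
qed

lemma nn_integral_C_Suc:
  assumes [measurable]: "f \<in> borel_measurable (Pi\<^sub>M {0..<Suc n} (\<lambda>_. jump_space))"
  shows "(\<integral>\<^sup>+h. f h \<partial>IT.C 0 (Suc n) (\<lambda>_. undefined))
    = (\<integral>\<^sup>+h. \<integral>\<^sup>+q. f (h(n := q)) \<partial>jump_step \<omega> s x n h \<partial>IT.C 0 n (\<lambda>_. undefined))"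
proof -
  have sp: "(\<lambda>_. undefined) \<in> space (Pi\<^sub>M {0..<0::nat} (\<lambda>_. jump_space))" by (auto simp: space_PiM PiE_def extensional_def)
  have eP: "IT.eP n \<in> measurable (IT.C 0 n (\<lambda>_. undefined)) (subprob_algebra (Pi\<^sub>M {0..<Suc n} (\<lambda>_. jump_space)))"
    using IT.measurable_eP[of n] IT.sets_C[OF sp, of n] by (simp cong: measurable_cong_sets)
  have "(\<integral>\<^sup>+h. f h \<partial>IT.C 0 (Suc n) (\<lambda>_. undefined)) = (\<integral>\<^sup>+h. \<integral>\<^sup>+g. f g \<partial>IT.eP n h \<partial>IT.C 0 n (\<lambda>_. undefined))"
    unfolding IT.C.simps(2) add_0 by (rule nn_integral_bind[OF _ eP]) measurable
  also have "\<dots> = (\<integral>\<^sup>+h. \<integral>\<^sup>+q. f (h(n := q)) \<partial>jump_step \<omega> s x n h \<partial>IT.C 0 n (\<lambda>_. undefined))"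
    using IT.space_C[OF sp, of n] by (intro nn_integral_cong IT.nn_integral_eP) auto
  finally show ?thesis .
qed

lemma nn_integral_walk_0:
  assumes f[measurable]: "f \<in> borel_measurable jump_space"
  shows "(\<integral>\<^sup>+h. f (h 0) \<partial>walk) = f (ereal s, x)"
proof -
  have [measurable]: "(\<lambda>h. h 0) \<in> measurable (Pi\<^sub>M {0..<Suc 0} (\<lambda>_. jump_space)) jump_space"
    by (rule measurable_component_singleton) simp
  have "(\<integral>\<^sup>+h. f (h 0) \<partial>walk) = (\<integral>\<^sup>+h. f (restrict h {0..<Suc 0} 0) \<partial>walk)" by simp
  also have "\<dots> = (\<integral>\<^sup>+h. f (h 0) \<partial>IT.C 0 (Suc 0) (\<lambda>_. undefined))"
    by (rule nn_integral_walk_restrict) measurable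
  also have "\<dots> = (\<integral>\<^sup>+h. \<integral>\<^sup>+q. f ((h(0 := q)) 0) \<partial>jump_step \<omega> s x 0 h \<partial>IT.C 0 0 (\<lambda>_. undefined))"
    by (rule nn_integral_C_Suc) measurable
  also have "\<dots> = (\<integral>\<^sup>+h. f (ereal s, x) \<partial>(return (Pi\<^sub>M {0..<0::nat} (\<lambda>_. jump_space :: (ereal \<times> 'n site) measure)) (\<lambda>_. undefined)))"
    by (simp add: nn_integral_return space_pair_measure)
  also have "\<dots> = f (ereal s, x)"
    by (rule nn_integral_return) (auto simp: space_PiM PiE_def extensional_def)
  finally show ?thesis .
qed

text \<open>
The Markov property of the jump chain, reduced to a single step.
\<close>
lemma nn_integral_walk_Suc:
  assumes f[measurable]: "(\<lambda>(p, q). f p q) \<in> borel_measurable (jump_space \<Otimes>\<^sub>M jump_space)"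
  shows "(\<integral>\<^sup>+h. f (h n) (h (Suc n)) \<partial>walk) = (\<integral>\<^sup>+h. \<integral>\<^sup>+q. f (h n) q \<partial>jump_kernel \<omega> (h n) \<partial>walk)"
proof -
  have [measurable]: "(\<lambda>h. h n) \<in> measurable (Pi\<^sub>M {0..<Suc n} (\<lambda>_. jump_space)) jump_space"
    by (rule measurable_component_singleton) simp
  have [measurable]: "(\<lambda>h. h n) \<in> measurable (Pi\<^sub>M {0..<Suc (Suc n)} (\<lambda>_. jump_space)) jump_space"
    "(\<lambda>h. h (Suc n)) \<in> measurable (Pi\<^sub>M {0..<Suc (Suc n)} (\<lambda>_. jump_space)) jump_space"
    by (rule measurable_component_singleton, simp)+
  have m2: "(\<lambda>h. f (h n) (h (Suc n))) \<in> borel_measurable (Pi\<^sub>M {0..<Suc (Suc n)} (\<lambda>_. jump_space))"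
    using measurable_compose[OF measurable_Pair f, of "\<lambda>h. h n" "Pi\<^sub>M {0..<Suc (Suc n)} (\<lambda>_. jump_space)" "\<lambda>h. h (Suc n)"]
    by simp
  have k: "jump_kernel \<omega> \<in> measurable jump_space (subprob_algebra jump_space)" by (rule kernel_meas[OF env loc])
  have m3: "(\<lambda>p. \<integral>\<^sup>+q. f p q \<partial>jump_kernel \<omega> p) \<in> borel_measurable jump_space"
    by (rule nn_integral_measurable_subprob_algebra2[OF f k])
  have "(\<integral>\<^sup>+h. f (h n) (h (Suc n)) \<partial>walk) = (\<integral>\<^sup>+h. f (restrict h {0..<Suc (Suc n)} n) (restrict h {0..<Suc (Suc n)} (Suc n)) \<partial>walk)"
    by simp
  also have "\<dots> = (\<integral>\<^sup>+h. f (h n) (h (Suc n)) \<partial>IT.C 0 (Suc (Suc n)) (\<lambda>_. undefined))"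
    by (rule nn_integral_walk_restrict[OF m2])
  also have "\<dots> = (\<integral>\<^sup>+h. \<integral>\<^sup>+q. f ((h(Suc n := q)) n) ((h(Suc n := q)) (Suc n)) \<partial>jump_step \<omega> s x (Suc n) h \<partial>IT.C 0 (Suc n) (\<lambda>_. undefined))"
    by (rule nn_integral_C_Suc[OF m2])
  also have "\<dots> = (\<integral>\<^sup>+h. \<integral>\<^sup>+q. f (h n) q \<partial>jump_kernel \<omega> (h n) \<partial>IT.C 0 (Suc n) (\<lambda>_. undefined))" by simp
  also have "\<dots> = (\<integral>\<^sup>+h. (\<lambda>g. \<integral>\<^sup>+q. f (g n) q \<partial>jump_kernel \<omega> (g n)) (restrict h {0..<Suc n}) \<partial>walk)"
    by (rule nn_integral_walk_restrict[symmetric]) (rule measurable_compose[OF _ m3], measurable)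
  finally show ?thesis by simp
qed

text \<open>
Jump times do not decrease along the chain almost surely, so a jump time beyond \<open>t\<close> stays beyond \<open>t\<close>.
\<close>
lemma AE_walk_mono_aux:
  assumes "AE h in walk. ereal s \<le> fst (h n)"
  shows "AE h in walk. fst (h n) \<le> fst (h (Suc n))"
proof -
  note walk_component_measurable[measurable]
  have z: "(\<integral>\<^sup>+q. indicator {q. fst q < fst p} q \<partial>jump_kernel \<omega> p) = 0" if "ereal s \<le> fst p" for p :: "ereal \<times> 'n site"
  proof (cases p)
    case (Pair r z)
    show ?thesis
    proof (cases r)
      case (real r')
      have "(\<integral>\<^sup>+q. indicator {q. fst q < ereal r'} q \<partial>jump_kernel \<omega> (ereal r', z))
        = (\<integral>\<^sup>+u. indicator {r'<..} u * (ennreal (S r' u z) * (\<integral>\<^sup>+y. ennreal (\<omega> u (z, y)) *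
            indicator {q. fst q < ereal r'} (ereal u, y) \<partial>count_space UNIV)) \<partial>lborel)"
      proof (rule nn_integral_jump_kernel[OF env loc])
        have "{q \<in> space jump_space. fst q < ereal r'} \<in> sets (jump_space :: (ereal \<times> 'n site) measure)" by measurable
        then show "(\<lambda>q. indicator {q. fst q < ereal r'} q :: ennreal) \<in> borel_measurable (jump_space :: (ereal \<times> 'n site) measure)"
          by (intro borel_measurable_indicator) (simp add: space_pair_measure)
      qed simp
      also have "\<dots> = (\<integral>\<^sup>+u. 0 \<partial>(lborel :: real measure))"
        by (rule nn_integral_cong) (auto simp: indicator_def)
      finally show ?thesis unfolding Pair real by simp
    next
      case PInf
      then show ?thesis unfolding Pair
        by (simp add: jump_kernel_def nn_integral_return space_pair_measure)
    qed (use that Pair in auto)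
  qed
  have "(\<integral>\<^sup>+h. indicator {pq. ereal s \<le> fst (fst pq) \<and> fst (snd pq) < fst (fst pq)} (h n, h (Suc n)) \<partial>walk)
    = (\<integral>\<^sup>+h. \<integral>\<^sup>+q. indicator {pq. ereal s \<le> fst (fst pq) \<and> fst (snd pq) < fst (fst pq)} (h n, q) \<partial>jump_kernel \<omega> (h n) \<partial>walk)"
    by (rule nn_integral_walk_Suc) measurable
  also have "\<dots> = (\<integral>\<^sup>+h. 0 \<partial>walk)"
  proof (rule nn_integral_cong)
    fix h
    have "(\<integral>\<^sup>+q. indicator {pq. ereal s \<le> fst (fst pq) \<and> fst (snd pq) < fst (fst pq)} (h n, q) \<partial>jump_kernel \<omega> (h n))
        = (\<integral>\<^sup>+q. (if ereal s \<le> fst (h n) then indicator {q. fst q < fst (h n)} q else 0) \<partial>jump_kernel \<omega> (h n))"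
      by (rule nn_integral_cong) (auto simp: indicator_def)
    also have "\<dots> = 0" using z[of "h n"] by (cases "ereal s \<le> fst (h n)") auto
    finally show "(\<integral>\<^sup>+q. indicator {pq. ereal s \<le> fst (fst pq) \<and> fst (snd pq) < fst (fst pq)} (h n, q) \<partial>jump_kernel \<omega> (h n)) = 0" .
  qed
  finally have "(\<integral>\<^sup>+h. indicator {pq. ereal s \<le> fst (fst pq) \<and> fst (snd pq) < fst (fst pq)} (h n, h (Suc n)) \<partial>walk) = 0" by simp
  then have "AE h in walk. indicator {pq. ereal s \<le> fst (fst pq) \<and> fst (snd pq) < fst (fst pq)} (h n, h (Suc n)) = (0::ennreal)"
    by (subst (asm) nn_integral_0_iff_AE) measurable
  then show ?thesis using assms
    by eventually_elim (auto simp: indicator_def not_less split: if_splits)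
qed

lemma AE_walk_start: "AE h in walk. ereal s \<le> fst (h n)"
proof (induction n)
  case 0
  note walk_component_measurable[measurable]
  have "(\<integral>\<^sup>+h. indicator {q. \<not> ereal s \<le> fst q} (h 0) \<partial>walk) = (indicator {q. \<not> ereal s \<le> fst q} (ereal s, x) :: ennreal)"
    by (rule nn_integral_walk_0) measurable
  then have "(\<integral>\<^sup>+h. indicator {q. \<not> ereal s \<le> fst q} (h 0) \<partial>walk) = 0" by simp
  then have "AE h in walk. indicator {q. \<not> ereal s \<le> fst q} (h 0) = (0::ennreal)"
    by (subst (asm) nn_integral_0_iff_AE) measurable
  then show ?case by eventually_elim (auto simp: indicator_def split: if_splits)
next
  case (Suc n)
  from Suc AE_walk_mono_aux[OF Suc] show ?case by eventually_elim auto
qed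

lemmas AE_walk_mono = AE_walk_mono_aux[OF AE_walk_start]

text \<open>
The conditional probability, given the \<open>n\<close>-th entry \<open>q\<close> of the jump chain, that the walk rests in \<open>y\<close> at
time \<open>t\<close> without a further jump.
\<close>
definition occupied :: "real \<Rightarrow> 'n site \<Rightarrow> ereal \<times> 'n site \<Rightarrow> ennreal" where
  "occupied t y q = indicator {q. ereal s \<le> fst q \<and> fst q \<le> ereal t \<and> snd q = y} q * ennreal (S (real_of_ereal (fst q)) t y)"

lemma occupied_measurable[measurable]: "occupied t y \<in> borel_measurable jump_space"
  unfolding occupied_def[abs_def] by measurable

lemma occupied_measurable2:
  "(\<lambda>(h, u). occupied u y (h n)) \<in> borel_measurable (walk \<Otimes>\<^sub>M borel)"
proof -
  note walk_component_measurable[measurable]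
  have [measurable]: "(\<lambda>p. indicator {q. ereal s \<le> fst q \<and> fst q \<le> ereal (snd p) \<and> snd q = y} (fst p n) :: ennreal) \<in> borel_measurable (walk \<Otimes>\<^sub>M borel)"
  proof -
    have "{p \<in> space (walk \<Otimes>\<^sub>M borel). ereal s \<le> fst (fst p n) \<and> fst (fst p n) \<le> ereal (snd p) \<and> snd (fst p n) = y} \<in> sets (walk \<Otimes>\<^sub>M borel)"
      by measurable
    from borel_measurable_indicator[OF this] show ?thesis
      by (auto simp: indicator_def cong: measurable_cong)
  qed
  show ?thesis unfolding occupied_def case_prod_beta' by measurable
qed

text \<open>
Integrating out one step of the jump chain reproduces the recursion that defines the path kernel.
\<close>
lemma expectation_occupied:
  assumes "s \<le> t"
  shows "(\<integral>\<^sup>+h. occupied t y (h n) \<partial>walk) = P n s t x y"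
  using assms
proof (induction n arbitrary: t y)
  case 0
  have "(\<integral>\<^sup>+h. occupied t y (h 0) \<partial>walk) = occupied t y (ereal s, x)"
    by (rule nn_integral_walk_0) measurable
  then show ?case using 0 by (auto simp: occupied_def indicator_def)
next
  case (Suc n)
  note walk_component_measurable[measurable]
  note [measurable] = borel_measurable_indicator_Icc
  interpret W: prob_space walk by (rule prob_space_walk)
  interpret WL: pair_sigma_finite walk lborel ..
  let ?J = "\<lambda>h u. \<integral>\<^sup>+z. occupied u z (h n) * ennreal (\<omega> u (z, y)) \<partial>count_space UNIV"
  have inner: "(\<integral>\<^sup>+q. occupied t y q \<partial>jump_kernel \<omega> (h n)) = (\<integral>\<^sup>+u. indicator {s..t} u * (?J h u * ennreal (S u t y)) \<partial>lborel)"
    if h: "ereal s \<le> fst (h n)" for h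
  proof (cases "h n")
    case (Pair r z)
    show ?thesis
    proof (cases r)
      case (real r')
      then have sr: "s \<le> r'" using h Pair by simp
      have "(\<integral>\<^sup>+q. occupied t y q \<partial>jump_kernel \<omega> (h n)) = (\<integral>\<^sup>+u. indicator {r'<..} u *
        (ennreal (S r' u z) * (\<integral>\<^sup>+y'. ennreal (\<omega> u (z, y')) * occupied t y (ereal u, y') \<partial>count_space UNIV)) \<partial>lborel)"
        unfolding Pair real by (rule nn_integral_jump_kernel[OF env loc]) (measurable, simp add: occupied_def)
      also have "\<dots> = (\<integral>\<^sup>+u. indicator {s..t} u * (?J h u * ennreal (S u t y)) \<partial>lborel)"
      proof (rule nn_integral_cong_AE, use AE_lborel_singleton[of r'] in eventually_elim)
        fix u assume "u \<noteq> r'"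
        have 1: "(\<integral>\<^sup>+y'. ennreal (\<omega> u (z, y')) * occupied t y (ereal u, y') \<partial>count_space UNIV)
           = ennreal (\<omega> u (z, y)) * occupied t y (ereal u, y)"
          by (rule nn_integral_count_space_eq_single) (auto simp: occupied_def)
        have 2: "?J h u = occupied u z (h n) * ennreal (\<omega> u (z, y))"
          by (rule nn_integral_count_space_eq_single) (auto simp: occupied_def Pair)
        show "indicator {r'<..} u * (ennreal (S r' u z) * (\<integral>\<^sup>+y'. ennreal (\<omega> u (z, y')) * occupied t y (ereal u, y') \<partial>count_space UNIV))
           = indicator {s..t} u * (?J h u * ennreal (S u t y))"
          unfolding 1 2 using \<open>u \<noteq> r'\<close> sr
          by (auto simp: occupied_def Pair real indicator_def mult_ac)
      qed
      finally show ?thesis .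
    next
      case PInf
      have "?J h u = 0" for u
        by (simp add: occupied_def Pair PInf)
      then show ?thesis unfolding Pair PInf
        by (simp add: jump_kernel_def nn_integral_return space_pair_measure occupied_def)
    qed (use h Pair in auto)
  qed
  have Jm: "(\<lambda>(h, u). ?J h u) \<in> borel_measurable (walk \<Otimes>\<^sub>M lborel)"
  proof -
    have c': "(\<lambda>p. ennreal (\<omega> (snd p) (z, y))) \<in> borel_measurable (walk \<Otimes>\<^sub>M borel)" for z
      using measurable_compose[OF measurable_snd c_measurable] by simp
    have "(\<lambda>p. ?J (fst p) (snd p)) \<in> borel_measurable (walk \<Otimes>\<^sub>M borel)"
      using occupied_measurable2[of _ n]
      by (intro borel_measurable_nn_integral_count_space borel_measurable_times_ennreal c') (simp add: case_prod_beta')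
    then show ?thesis by (simp add: case_prod_beta')
  qed
  have om: "(\<lambda>h. occupied u z (h n)) \<in> borel_measurable walk" for u z by measurable
  have "(\<integral>\<^sup>+h. occupied t y (h (Suc n)) \<partial>walk) = (\<integral>\<^sup>+h. \<integral>\<^sup>+q. occupied t y q \<partial>jump_kernel \<omega> (h n) \<partial>walk)"
    by (rule nn_integral_walk_Suc) measurable
  also have "\<dots> = (\<integral>\<^sup>+h. \<integral>\<^sup>+u. indicator {s..t} u * (?J h u * ennreal (S u t y)) \<partial>lborel \<partial>walk)"
    by (rule nn_integral_cong_AE, use AE_walk_start[of n] in eventually_elim) (rule inner)
  also have "\<dots> = (\<integral>\<^sup>+u. \<integral>\<^sup>+h. indicator {s..t} u * (?J h u * ennreal (S u t y)) \<partial>walk \<partial>lborel)"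
  proof (rule WL.Fubini'[symmetric])
    have "(\<lambda>p. indicator {s..t} (snd p) * (?J (fst p) (snd p) * ennreal (S (snd p) t y))) \<in> borel_measurable (walk \<Otimes>\<^sub>M lborel)"
      using Jm by (intro borel_measurable_times_ennreal) (simp_all add: case_prod_beta')
    then show "(\<lambda>(h, u). indicator {s..t} u * (?J h u * ennreal (S u t y))) \<in> borel_measurable (walk \<Otimes>\<^sub>M lborel)"
      by (simp add: case_prod_beta')
  qed
  also have "\<dots> = (\<integral>\<^sup>+u. indicator {s..t} u * ((\<integral>\<^sup>+z. P n s u x z * ennreal (\<omega> u (z, y)) \<partial>count_space UNIV) * ennreal (S u t y)) \<partial>lborel)"
  proof (rule nn_integral_cong)
    fix u
    show "(\<integral>\<^sup>+h. indicator {s..t} u * (?J h u * ennreal (S u t y)) \<partial>walk)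
      = indicator {s..t} u * ((\<integral>\<^sup>+z. P n s u x z * ennreal (\<omega> u (z, y)) \<partial>count_space UNIV) * ennreal (S u t y))"
    proof (cases "u \<in> {s..t}")
      case True
      have Jh: "(\<lambda>h. ?J h u) \<in> borel_measurable walk"
        by (rule borel_measurable_nn_integral_count_space) measurable
      have "(\<integral>\<^sup>+h. ?J h u * ennreal (S u t y) \<partial>walk) = (\<integral>\<^sup>+h. ?J h u \<partial>walk) * ennreal (S u t y)"
        by (rule nn_integral_multc[OF Jh])
      also have "(\<integral>\<^sup>+h. ?J h u \<partial>walk) = (\<integral>\<^sup>+z. \<integral>\<^sup>+h. occupied u z (h n) * ennreal (\<omega> u (z, y)) \<partial>walk \<partial>count_space UNIV)"
        by (rule nn_integral_count_space_commute) measurable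
      also have "\<dots> = (\<integral>\<^sup>+z. P n s u x z * ennreal (\<omega> u (z, y)) \<partial>count_space UNIV)"
        using True Suc.IH[of u] by (intro nn_integral_cong) (simp add: nn_integral_multc[OF om])
      finally show ?thesis using True by simp
    qed simp
  qed
  finally show ?case by simp
qed

text \<open>
The event that the walk is in \<open>y\<close> at time \<open>t\<close> splits according to the number of jumps before \<open>t\<close>, and
each part has the weight of the corresponding path kernel.
\<close>
lemma heat_kernel_eq_transition:
  assumes "s \<le> t"
  shows "ennreal (heat_kernel \<omega> s t x y) = p s t x y"
proof -
  note walk_component_measurable[measurable]
  interpret W: prob_space walk by (rule prob_space_walk)
  let ?A = "\<lambda>n. {h \<in> space walk. ereal s \<le> fst (h n) \<and> fst (h n) \<le> ereal t \<and> snd (h n) = y \<and> ereal t < fst (h (Suc n))}"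
  let ?B = "\<lambda>n. {h \<in> space walk. snd (h n) = y \<and> ereal t < fst (h (Suc n)) \<and> (\<forall>k<n. \<not> ereal t < fst (h (Suc k)))}"
  have A: "emeasure walk (?A n) = P n s t x y" for n
  proof -
    have "emeasure walk (?A n) = (\<integral>\<^sup>+h. indicator {p. ereal s \<le> fst p \<and> fst p \<le> ereal t \<and> snd p = y} (h n) * indicator {q. ereal t < fst q} (h (Suc n)) \<partial>walk)"
    proof -
      have "?A n \<in> sets walk" by measurable
      then have "emeasure walk (?A n) = (\<integral>\<^sup>+h. indicator (?A n) h \<partial>walk)" by simp
      also have "\<dots> = (\<integral>\<^sup>+h. indicator {p. ereal s \<le> fst p \<and> fst p \<le> ereal t \<and> snd p = y} (h n) * indicator {q. ereal t < fst q} (h (Suc n)) \<partial>walk)"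
        by (rule nn_integral_cong) (simp add: indicator_def)
      finally show ?thesis .
    qed
    also have "\<dots> = (\<integral>\<^sup>+h. \<integral>\<^sup>+q. indicator {p. ereal s \<le> fst p \<and> fst p \<le> ereal t \<and> snd p = y} (h n) * indicator {q. ereal t < fst q} q \<partial>jump_kernel \<omega> (h n) \<partial>walk)"
      by (rule nn_integral_walk_Suc) measurable
    also have "\<dots> = (\<integral>\<^sup>+h. occupied t y (h n) \<partial>walk)"
    proof (rule nn_integral_cong)
      fix h
      show "(\<integral>\<^sup>+q. indicator {p. ereal s \<le> fst p \<and> fst p \<le> ereal t \<and> snd p = y} (h n) * indicator {q. ereal t < fst q} q \<partial>jump_kernel \<omega> (h n)) = occupied t y (h n)"
      proof (cases "ereal s \<le> fst (h n) \<and> fst (h n) \<le> ereal t \<and> snd (h n) = y")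
        case True
        then obtain r where r: "h n = (ereal r, y)" "r \<le> t"
          by (cases "h n"; cases "fst (h n)") auto
        then show ?thesis using True jump_kernel_survival[OF env loc r(2), of y] by (simp add: occupied_def)
      qed (auto simp: occupied_def)
    qed
    also have "\<dots> = P n s t x y" by (rule expectation_occupied[OF assms])
    finally show ?thesis .
  qed
  have AB: "emeasure walk (?B n) = emeasure walk (?A n)" for n
  proof (rule emeasure_eq_AE)
    have start: "AE h in walk. h 0 = (ereal s, x)"
    proof -
      have "(\<integral>\<^sup>+h. indicator {q. fst q \<noteq> ereal s \<or> snd q \<noteq> x} (h 0) \<partial>walk) = (indicator {q. fst q \<noteq> ereal s \<or> snd q \<noteq> x} (ereal s, x) :: ennreal)"
        by (rule nn_integral_walk_0) measurable
      then have "(\<integral>\<^sup>+h. indicator {q. fst q \<noteq> ereal s \<or> snd q \<noteq> x} (h 0) \<partial>walk) = 0" by simp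
      then have "AE h in walk. indicator {q. fst q \<noteq> ereal s \<or> snd q \<noteq> x} (h 0) = (0::ennreal)"
        by (subst (asm) nn_integral_0_iff_AE) measurable
      then show ?thesis by eventually_elim (auto simp: indicator_def prod_eq_iff split: if_splits)
    qed
    have mono: "AE h in walk. \<forall>k. fst (h k) \<le> fst (h (Suc k))"
      unfolding AE_all_countable using AE_walk_mono by blast
    show "AE h in walk. h \<in> ?B n \<longleftrightarrow> h \<in> ?A n"
      using start mono AE_walk_start[of n]
    proof eventually_elim
      case (elim h)
      have inc: "fst (h i) \<le> fst (h j)" if "i \<le> j" for i j
        using that elim(2) by (induction rule: dec_induct) (auto intro: order_trans)
      have "(\<forall>k<n. \<not> ereal t < fst (h (Suc k))) \<longleftrightarrow> fst (h n) \<le> ereal t"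
      proof
        assume l: "\<forall>k<n. \<not> ereal t < fst (h (Suc k))"
        show "fst (h n) \<le> ereal t"
        proof (cases n)
          case 0 then show ?thesis using elim(1) assms by simp
        next
          case (Suc m) then show ?thesis using l by (auto simp: not_less)
        qed
      next
        assume le: "fst (h n) \<le> ereal t"
        show "\<forall>k<n. \<not> ereal t < fst (h (Suc k))"
        proof (intro allI impI)
          fix k assume "k < n"
          then have "fst (h (Suc k)) \<le> fst (h n)" by (intro inc) simp
          with le show "\<not> ereal t < fst (h (Suc k))" by (auto simp: not_less)
        qed
      qed
      then show ?case using elim(3) by auto
    qed
  qed measurable
  have walk_at: "{h \<in> space walk. walk_at t h = Some y} = (\<Union>n. ?B n)"
    unfolding walk_at_eq_Some_iff by blast
  have "ennreal (heat_kernel \<omega> s t x y) = emeasure walk (\<Union>n. ?B n)"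
    unfolding heat_kernel_def walk_at using loc by (simp add: W.emeasure_eq_measure)
  also have "\<dots> = (\<Sum>n. emeasure walk (?B n))"
  proof (rule suminf_emeasure[symmetric])
    have "?B n \<in> sets walk" for n by measurable
    then show "range ?B \<subseteq> sets walk" by blast
    show "disjoint_family ?B"
      unfolding disjoint_family_on_def
    proof (intro ballI impI)
      fix m n :: nat assume "m \<noteq> n"
      then show "?B m \<inter> ?B n = {}" by (cases rule: linorder_cases[of m n]) blast+
    qed
  qed
  also have "\<dots> = p s t x y" unfolding AB A transition_def ..
  finally show ?thesis .
qed

text \<open>
The events of resting in different sites are disjoint.
\<close>
lemma transition_sum_le_1:
  assumes "s \<le> t"
  shows "(\<integral>\<^sup>+y. p s t x y \<partial>count_space UNIV) \<le> 1"
proof -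
  interpret W: prob_space walk by (rule prob_space_walk)
  note walk_component_measurable[measurable]
  have m: "{h \<in> space walk. walk_at t h = Some y} \<in> sets walk" for y
  proof -
    have "{h \<in> space walk. walk_at t h = Some y} = (\<Union>n. {h \<in> space walk. snd (h n) = y \<and> ereal t < fst (h (Suc n)) \<and> (\<forall>k<n. \<not> ereal t < fst (h (Suc k)))})"
      unfolding walk_at_eq_Some_iff by blast
    also have "\<dots> \<in> sets walk" by measurable
    finally show ?thesis .
  qed
  have "(\<integral>\<^sup>+y. p s t x y \<partial>count_space UNIV) = (\<integral>\<^sup>+y. emeasure walk {h \<in> space walk. walk_at t h = Some y} \<partial>count_space UNIV)"
    unfolding heat_kernel_eq_transition[OF assms, symmetric] heat_kernel_def using loc
    by (simp add: W.emeasure_eq_measure)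
  also have "\<dots> = emeasure walk (\<Union>y. {h \<in> space walk. walk_at t h = Some y})"
    by (rule emeasure_UN_countable[symmetric]) (use m in \<open>auto simp: disjoint_family_on_def\<close>)
  also have "\<dots> \<le> 1" by (rule W.measure_le_1)
  finally show ?thesis .
qed

end

section \<open>Nash inequality on the lattice\<close>

lemma infsum_finite_support:
  fixes f :: "'a \<Rightarrow> real"
  assumes "finite A" "\<And>x. x \<notin> A \<Longrightarrow> f x = 0"
  shows "(\<Sum>\<^sub>\<infinity>x. f x) = sum f A"
proof -
  have "(\<Sum>\<^sub>\<infinity>x. f x) = (\<Sum>\<^sub>\<infinity>x\<in>A. f x)" by (rule infsum_cong_neutral) (use assms in auto)
  then show ?thesis using assms by simp
qed

text \<open>
Used for finitely supported functions only, where it is the Euclidean norm of the restriction to any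
finite set that contains the support.
\<close>
definition l2norm :: "('a \<Rightarrow> real) \<Rightarrow> real" where
  "l2norm f = sqrt (\<Sum>\<^sub>\<infinity>x. (f x)\<^sup>2)"

lemma l2norm_eq: "finite A \<Longrightarrow> (\<And>x. x \<notin> A \<Longrightarrow> f x = 0) \<Longrightarrow> l2norm f = L2_set f A"
  unfolding l2norm_def L2_set_def by (subst infsum_finite_support[of A]) auto

lemma l2norm_triangle:
  assumes "finite {x. f x \<noteq> 0}" "finite {x. g x \<noteq> 0}"
  shows "l2norm (\<lambda>x. f x + g x) \<le> l2norm f + l2norm g"
proof -
  let ?A = "{x. f x \<noteq> 0} \<union> {x. g x \<noteq> 0}"
  have "finite ?A" using assms by simp
  then show ?thesis using L2_set_triangle_ineq[of f g ?A]
    by (subst (1 2 3) l2norm_eq[of ?A]) auto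
qed

lemma infsum_translate: "(\<Sum>\<^sub>\<infinity>x. f (x + z)) = (\<Sum>\<^sub>\<infinity>x. f (x :: 'a::ab_group_add) :: real)"
proof -
  have "bij (\<lambda>x :: 'a. x + z)" by (rule bij_plus_right)
  from infsum_reindex_bij_betw[OF this, of f] show ?thesis by simp
qed

lemma l2norm_translate: "l2norm (\<lambda>x. f (x + z)) = l2norm (f :: 'a::ab_group_add \<Rightarrow> real)"
  unfolding l2norm_def using infsum_translate[of "\<lambda>x. (f x)\<^sup>2" z] by simp

lemma finite_support_translate:
  fixes f :: "'a::ab_group_add \<Rightarrow> real"
  assumes "finite {x. f x \<noteq> 0}"
  shows "finite {x. f (x + z) \<noteq> 0}"
proof -
  have "{x. f (x + z) \<noteq> 0} = (\<lambda>x. x - z) ` {x. f x \<noteq> 0}"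
    by (auto simp: image_iff) (metis add_diff_cancel_right')
  then show ?thesis using assms by simp
qed

lemma finite_support_diff_translate:
  fixes u :: "'a::ab_group_add \<Rightarrow> real"
  assumes "finite {x. u x \<noteq> 0}"
  shows "finite {x. u (x + z) - u x \<noteq> 0}"
  by (rule finite_subset[of _ "{x. u (x + z) \<noteq> 0} \<union> {x. u x \<noteq> 0}"])
    (use assms finite_support_translate[OF assms] in auto)

definition translation_gap :: "('a::ab_group_add \<Rightarrow> real) \<Rightarrow> 'a \<Rightarrow> real" where
  "translation_gap u z = l2norm (\<lambda>x. u (x + z) - u x)"

lemma translation_gap_nonneg: "0 \<le> translation_gap u z"
  unfolding translation_gap_def l2norm_def by (auto intro!: infsum_nonneg)

lemma translation_gap_0: "translation_gap u 0 = 0"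
  by (simp add: translation_gap_def l2norm_def)

text \<open>
The triangle inequality, combined with the translation invariance of the norm.
\<close>
lemma translation_gap_add:
  assumes u: "finite {x. u x \<noteq> 0}"
  shows "translation_gap u (z + w) \<le> translation_gap u z + translation_gap u w"
proof -
  let ?f = "\<lambda>x. u (x + w) - u x"
  have "translation_gap u (z + w) = l2norm (\<lambda>x. ?f (x + z) + (u (x + z) - u x))"
    unfolding translation_gap_def by (simp add: add.assoc)
  also have "\<dots> \<le> l2norm (\<lambda>x. ?f (x + z)) + l2norm (\<lambda>x. u (x + z) - u x)"
    by (rule l2norm_triangle)
      (intro finite_support_translate[of ?f] finite_support_diff_translate u)+
  also have "l2norm (\<lambda>x. ?f (x + z)) = l2norm ?f" by (rule l2norm_translate)
  finally show ?thesis by (simp add: translation_gap_def)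
qed

lemma translation_gap_axis:
  fixes u :: "'n::finite site \<Rightarrow> real"
  assumes u: "finite {x. u x \<noteq> 0}"
  shows "translation_gap u (axis i (int k)) \<le> real k * translation_gap u (axis i 1)"
proof (induction k)
  case 0
  have a: "axis i 0 = (0 :: 'n site)" by (simp add: axis_def vec_eq_iff)
  show ?case unfolding of_nat_0 a translation_gap_0 by simp
next
  case (Suc k)
  have "axis i (int (Suc k)) = axis i 1 + (axis i (int k) :: 'n site)" by (simp add: axis_def vec_eq_iff)
  then have "translation_gap u (axis i (int (Suc k))) \<le> translation_gap u (axis i 1) + translation_gap u (axis i (int k))"
    using translation_gap_add[OF u] by simp
  with Suc show ?case by (simp add: algebra_simps)
qed

text \<open>
Moving by \<open>z\<close> takes at most \<open>R\<close> unit steps in every coordinate direction.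
\<close>
lemma translation_gap_le_sum:
  fixes u :: "'n::finite site \<Rightarrow> real"
  assumes u: "finite {x. u x \<noteq> 0}" and z: "\<And>i. 0 \<le> z $ i" "\<And>i. z $ i \<le> int R"
  shows "translation_gap u z \<le> real R * (\<Sum>i\<in>UNIV. translation_gap u (axis i 1))"
proof -
  have *: "translation_gap u (\<Sum>i\<in>I. axis i (z $ i)) \<le> real R * (\<Sum>i\<in>I. translation_gap u (axis i 1))"
    if "finite I" for I
    using that
  proof (induction I)
    case empty
    then show ?case by (simp add: translation_gap_0)
  next
    case (insert j I)
    have "translation_gap u (axis j (z $ j)) \<le> real (nat (z $ j)) * translation_gap u (axis j 1)"
      using translation_gap_axis[OF u, of j "nat (z $ j)"] z(1)[of j] by simp
    also have "\<dots> \<le> real R * translation_gap u (axis j 1)"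
      using z[of j] translation_gap_nonneg by (intro mult_right_mono) auto
    finally have "translation_gap u (axis j (z $ j)) \<le> real R * translation_gap u (axis j 1)" .
    moreover have "translation_gap u (\<Sum>i\<in>insert j I. axis i (z $ i)) \<le>
        translation_gap u (axis j (z $ j)) + translation_gap u (\<Sum>i\<in>I. axis i (z $ i))"
      using insert translation_gap_add[OF u] by simp
    ultimately show ?case using insert by (simp add: distrib_left)
  qed
  have "(\<Sum>i\<in>UNIV. axis i (z $ i)) = z"
    by (simp add: vec_eq_iff axis_def if_distrib cong: if_cong)
  with *[of UNIV] show ?thesis by simp
qed

definition gradient_energy :: "('n::finite site \<Rightarrow> real) \<Rightarrow> real" where
  "gradient_energy u = (\<Sum>i\<in>UNIV. (translation_gap u (axis i 1))\<^sup>2)"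

lemma card_box: "finite {z :: 'n::finite site. \<forall>i. 0 \<le> z $ i \<and> z $ i < int R}"
  "card {z :: 'n::finite site. \<forall>i. 0 \<le> z $ i \<and> z $ i < int R} = R ^ CARD('n)"
proof -
  have eq: "{z :: 'n site. \<forall>i. 0 \<le> z $ i \<and> z $ i < int R} = vec_lambda ` (UNIV \<rightarrow>\<^sub>E {0..<int R})"
    (is "?L = ?R")
  proof (intro set_eqI iffI)
    fix z assume "z \<in> ?L"
    then show "z \<in> ?R" by (intro image_eqI[of _ _ "vec_nth z"]) auto
  qed auto
  have inj: "inj_on (vec_lambda :: _ \<Rightarrow> 'n site) A" for A by (auto simp: inj_on_def vec_lambda_inject)
  show "finite ?L" unfolding eq by (intro finite_imageI finite_PiE) auto
  show "card ?L = R ^ CARD('n)" unfolding eq card_image[OF inj] by (subst card_PiE) auto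
qed

text \<open>
Averaging \<open>u\<close> over the translates by a box of side \<open>R\<close> costs a gradient term, and the average is small
because the mass is at most one and the box has \<open>R ^ d\<close> sites.
\<close>
lemma local_average_inequality:
  fixes u :: "'n::finite site \<Rightarrow> real"
  assumes u: "finite {x. u x \<noteq> 0}" and nonneg: "\<And>x. 0 \<le> u x" and mass: "(\<Sum>\<^sub>\<infinity>x. u x) \<le> 1" and R: "R > 0"
  shows "(\<Sum>\<^sub>\<infinity>x. (u x)\<^sup>2) \<le> real CARD('n) * (real R)\<^sup>2 * gradient_energy u / 2 + 1 / real R ^ CARD('n)"
proof -
  let ?A = "{x. u x \<noteq> 0}" and ?d = "real CARD('n)"
  define Bx where "Bx = {z :: 'n site. \<forall>i. 0 \<le> z $ i \<and> z $ i < int R}"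
  have Bx: "finite Bx" "card Bx = R ^ CARD('n)" unfolding Bx_def by (rule card_box)+
  define \<phi> where "\<phi> = (\<Sum>\<^sub>\<infinity>x. (u x)\<^sup>2)"
  have \<phi>A: "\<phi> = (\<Sum>x\<in>?A. (u x)\<^sup>2)" unfolding \<phi>_def by (rule infsum_finite_support) (use u in auto)
  have gap: "(translation_gap u z)\<^sup>2 \<le> ?d * (real R)\<^sup>2 * gradient_energy u" if "z \<in> Bx" for z
  proof -
    have "translation_gap u z \<le> real R * (\<Sum>i\<in>UNIV. translation_gap u (axis i 1))"
      using that by (intro translation_gap_le_sum[OF u]) (auto simp: Bx_def less_imp_le)
    then have "(translation_gap u z)\<^sup>2 \<le> (real R * (\<Sum>i\<in>UNIV. translation_gap u (axis i 1)))\<^sup>2"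
      by (intro power_mono translation_gap_nonneg)
    also have "\<dots> \<le> (real R)\<^sup>2 * (?d * gradient_energy u)"
      unfolding power_mult_distrib gradient_energy_def
      using sum_squared_le_sum_of_squares[of "\<lambda>i. translation_gap u (axis i 1)" UNIV]
      by (intro mult_left_mono) (auto simp: mult.commute)
    finally show ?thesis by (simp add: mult_ac)
  qed
  \<comment> \<open>Polarisation for the translation by \<open>z\<close>; it is summed over the box below.\<close>
  have \<phi>z: "\<phi> = (\<Sum>x\<in>?A. u x * u (x + z)) + (translation_gap u z)\<^sup>2 / 2" for z
  proof -
    let ?C = "?A \<union> {x. u (x + z) \<noteq> 0}"
    have fC: "finite ?C" using u finite_support_translate[OF u] by simp
    have "(translation_gap u z)\<^sup>2 = (\<Sum>\<^sub>\<infinity>x. (u (x + z) - u x)\<^sup>2)"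
      unfolding translation_gap_def l2norm_def by (simp add: infsum_nonneg)
    also have "\<dots> = (\<Sum>x\<in>?C. (u (x + z) - u x)\<^sup>2)" by (rule infsum_finite_support[OF fC]) auto
    also have "\<dots> = (\<Sum>x\<in>?C. (u (x + z))\<^sup>2) + (\<Sum>x\<in>?C. (u x)\<^sup>2) - 2 * (\<Sum>x\<in>?C. u x * u (x + z))"
      by (simp add: power2_diff sum.distrib sum_subtractf sum_distrib_left algebra_simps)
    also have "(\<Sum>x\<in>?C. (u (x + z))\<^sup>2) = (\<Sum>\<^sub>\<infinity>x. (u (x + z))\<^sup>2)"
      by (rule infsum_finite_support[OF fC, symmetric]) auto
    also have "\<dots> = \<phi>" unfolding \<phi>_def by (rule infsum_translate[of "\<lambda>x. (u x)\<^sup>2"])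
    also have "(\<Sum>x\<in>?C. (u x)\<^sup>2) = \<phi>" unfolding \<phi>_def
      by (rule infsum_finite_support[OF fC, symmetric]) auto
    also have "(\<Sum>x\<in>?C. u x * u (x + z)) = (\<Sum>x\<in>?A. u x * u (x + z))"
      by (rule sum.mono_neutral_right[OF fC]) auto
    finally show ?thesis by linarith
  qed
  have "real (card Bx) * \<phi> = (\<Sum>z\<in>Bx. \<phi>)" by simp
  also have "\<dots> = (\<Sum>z\<in>Bx. \<Sum>x\<in>?A. u x * u (x + z)) + (\<Sum>z\<in>Bx. (translation_gap u z)\<^sup>2 / 2)"
    by (subst sum.distrib[symmetric], rule sum.cong[OF refl], rule \<phi>z)
  also have "(\<Sum>z\<in>Bx. (translation_gap u z)\<^sup>2 / 2) \<le> real (card Bx) * (?d * (real R)\<^sup>2 * gradient_energy u / 2)"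
    using gap by (intro sum_bounded_above) auto
  also have "(\<Sum>z\<in>Bx. \<Sum>x\<in>?A. u x * u (x + z)) \<le> 1"
  proof -
    have mA: "(\<Sum>\<^sub>\<infinity>x. u x) = sum u ?A" by (rule infsum_finite_support) (use u in auto)
    have "(\<Sum>z\<in>Bx. \<Sum>x\<in>?A. u x * u (x + z)) = (\<Sum>x\<in>?A. u x * (\<Sum>z\<in>Bx. u (x + z)))"
      by (subst sum.swap) (simp add: sum_distrib_left)
    also have "\<dots> \<le> (\<Sum>x\<in>?A. u x * 1)"
    proof (intro sum_mono mult_left_mono nonneg)
      fix x
      have "(\<Sum>z\<in>Bx. u (x + z)) = sum u ((+) x ` Bx)" by (subst sum.reindex) auto
      also have "\<dots> = sum u ((+) x ` Bx \<inter> ?A)"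
        by (rule sum.mono_neutral_right) (use Bx in auto)
      also have "\<dots> \<le> sum u ?A" by (rule sum_mono2[OF u]) (use nonneg in auto)
      finally show "(\<Sum>z\<in>Bx. u (x + z)) \<le> 1" using mA mass by simp
    qed
    also have "\<dots> \<le> 1" using mA mass by simp
    finally show ?thesis .
  qed
  finally have main: "real (card Bx) * \<phi> \<le> 1 + real (card Bx) * (?d * (real R)\<^sup>2 * gradient_energy u / 2)" by simp
  have c: "real (card Bx) = real R ^ CARD('n)" using Bx by simp
  have c0: "real R ^ CARD('n) > 0" using R by simp
  have "\<phi> = (real R ^ CARD('n) * \<phi>) / real R ^ CARD('n)" using c0 by simp
  also have "\<dots> \<le> (1 + real R ^ CARD('n) * (?d * (real R)\<^sup>2 * gradient_energy u / 2)) / real R ^ CARD('n)"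
    using main c0 unfolding c by (intro divide_right_mono) auto
  also have "\<dots> = ?d * (real R)\<^sup>2 * gradient_energy u / 2 + 1 / real R ^ CARD('n)"
    using c0 by (simp add: add_divide_distrib)
  finally show ?thesis unfolding \<phi>_def .
qed

text \<open>
Optimising the side of the box in the previous inequality.
\<close>
lemma nash_inequality:
  fixes u :: "'n::finite site \<Rightarrow> real"
  assumes u: "finite {x. u x \<noteq> 0}" and nonneg: "\<And>x. 0 \<le> u x" and mass: "(\<Sum>\<^sub>\<infinity>x. u x) \<le> 1"
  shows "(\<Sum>\<^sub>\<infinity>x. (u x)\<^sup>2) powr (1 + 2 / real CARD('n)) / (16 * real CARD('n)) \<le> gradient_energy u"
proof -
  let ?d = "real CARD('n)"
  define \<phi> where "\<phi> = (\<Sum>\<^sub>\<infinity>x. (u x)\<^sup>2)"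
  have d1: "?d \<ge> 1" by (simp add: Suc_leI)
  have g0: "gradient_energy u \<ge> 0" unfolding gradient_energy_def by (intro sum_nonneg) auto
  show ?thesis
  proof (cases "\<phi> = 0")
    case True
    then show ?thesis using g0 unfolding \<phi>_def by simp
  next
    case False
    have "\<phi> \<ge> 0" unfolding \<phi>_def by (intro infsum_nonneg) auto
    with False have pos: "\<phi> > 0" by simp
    have le1: "\<phi> \<le> 1"
    proof -
      let ?A = "{x. u x \<noteq> 0}"
      have mA: "(\<Sum>\<^sub>\<infinity>x. u x) = sum u ?A" by (rule infsum_finite_support) (use u in auto)
      have "\<phi> = (\<Sum>x\<in>?A. (u x)\<^sup>2)" unfolding \<phi>_def by (rule infsum_finite_support) (use u in auto)
      also have "\<dots> \<le> sum u ?A"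
      proof (rule sum_mono)
        fix x assume "x \<in> ?A"
        then have "u x \<le> sum u ?A" using member_le_sum[of x ?A u] nonneg u by auto
        then have "u x \<le> 1" using mA mass by simp
        then show "(u x)\<^sup>2 \<le> u x" using nonneg[of x] by (simp add: power2_eq_square mult_left_le)
      qed
      finally show ?thesis using mA mass by simp
    qed
    \<comment> \<open>This side of the box makes the term \<open>1 / R ^ d\<close> at most half of \<open>\<phi>\<close>, which is then absorbed.\<close>
    define q where "q = (2 / \<phi>) powr (1 / ?d)"
    have q1: "q \<ge> 1" unfolding q_def using pos le1 d1 by (intro ge_one_powr_ge_zero) (auto simp: field_simps)
    define R where "R = nat \<lceil>q\<rceil>"
    have R: "real R \<ge> q" "real R \<le> q + 1" using q1 unfolding R_def by linarith+
    have R2: "real R \<le> 2 * q" using R q1 by linarith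
    have R0: "R > 0" using R(1) q1 by linarith
    have "2 / \<phi> = q ^ CARD('n)"
      unfolding q_def using pos d1 by (simp add: powr_realpow[symmetric] powr_powr)
    also have "\<dots> \<le> real R ^ CARD('n)" using R q1 by (intro power_mono) auto
    finally have "1 / real R ^ CARD('n) \<le> 1 / (2 / \<phi>)"
      using pos R0 by (intro divide_left_mono) auto
    then have half: "1 / real R ^ CARD('n) \<le> \<phi> / 2" by simp
    have "\<phi> \<le> ?d * (real R)\<^sup>2 * gradient_energy u / 2 + 1 / real R ^ CARD('n)"
      unfolding \<phi>_def by (rule local_average_inequality[OF u nonneg mass R0])
    with half have "\<phi> \<le> ?d * (real R)\<^sup>2 * gradient_energy u" by simp
    also have "\<dots> \<le> ?d * (2 * q)\<^sup>2 * gradient_energy u"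
      using R2 g0 by (intro mult_right_mono mult_left_mono power_mono) auto
    finally have 1: "\<phi> \<le> 4 * ?d * q\<^sup>2 * gradient_energy u" by (simp add: power2_eq_square)
    have q2: "q\<^sup>2 = 2 powr (2 / ?d) * \<phi> powr (- 2 / ?d)"
    proof -
      have "q\<^sup>2 = (2 / \<phi>) powr (2 / ?d)"
        unfolding q_def using pos by (simp add: powr_realpow[symmetric] powr_powr)
      then show ?thesis using pos by (simp add: powr_divide powr_minus divide_simps)
    qed
    have "2 powr (2 / ?d) \<le> 2 powr 2" using d1 by (intro powr_mono) (auto simp: field_simps)
    also have "(2::real) powr 2 = 4" by simp
    finally have "q\<^sup>2 \<le> 4 * \<phi> powr (- 2 / ?d)" unfolding q2 by (intro mult_right_mono) auto
    then have "\<phi> \<le> 4 * ?d * (4 * \<phi> powr (- 2 / ?d)) * gradient_energy u"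
      using 1 g0 d1 by (elim order_trans) (intro mult_right_mono mult_left_mono, auto)
    then have "\<phi> * \<phi> powr (2 / ?d) \<le> (16 * ?d * gradient_energy u * \<phi> powr (- 2 / ?d)) * \<phi> powr (2 / ?d)"
      by (intro mult_right_mono) (auto simp: mult_ac)
    also have "\<dots> = 16 * ?d * gradient_energy u"
      using pos by (simp add: mult.assoc powr_add[symmetric])
    also have "\<phi> * \<phi> powr (2 / ?d) = \<phi> powr (1 + 2 / ?d)" using pos by (simp add: powr_add)
    finally show ?thesis using d1 unfolding \<phi>_def[symmetric] by (simp add: field_simps)
  qed
qed

text \<open>
This is the integral form of the differential inequality \<open>\<phi>' \<le> - \<kappa> * \<phi> powr (1 + p)\<close>. Comparing \<open>s\<close> with
\<open>s / 2\<close> bounds the supremum of \<open>s powr (1 / p) * \<phi> s\<close> by a power below one of itself, up to a constant.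
\<close>
lemma superlinear_dissipation_decay:
  fixes \<phi> :: "real \<Rightarrow> real"
  assumes bounds: "\<And>t. 0 \<le> t \<Longrightarrow> 0 \<le> \<phi> t \<and> \<phi> t \<le> 1" and p: "p > 0" and \<kappa>: "\<kappa> > 0"
    and dis: "\<And>s t. 0 \<le> s \<Longrightarrow> s \<le> t \<Longrightarrow> \<kappa> * (t - s) * \<phi> t powr (1 + p) \<le> \<phi> s - \<phi> t"
    and t: "t > 0"
  shows "\<phi> t \<le> (2 powr (1 + 1 / p) / \<kappa>) powr (1 / p) * t powr (- 1 / p)"
proof -
  define A where "A = 2 powr (1 + 1 / p) / \<kappa>"
  have A: "A > 0" using \<kappa> by (simp add: A_def)
  define \<psi> where "\<psi> s = s powr (1 / p) * \<phi> s" for s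
  \<comment> \<open>The supremum is finite by the bound one on \<open>\<phi>\<close>, so it can be divided out at the end.\<close>
  define K where "K = (SUP s\<in>{0<..t}. \<psi> s)"
  have bdd: "bdd_above (\<psi> ` {0<..t})"
  proof (rule bdd_aboveI2)
    fix s assume s: "s \<in> {0<..t}"
    then have "\<psi> s \<le> t powr (1 / p) * 1"
      unfolding \<psi>_def using bounds[of s] p by (intro mult_mono powr_mono2) auto
    then show "\<psi> s \<le> t powr (1 / p)" by simp
  qed
  have le: "\<psi> s \<le> K" if "s \<in> {0<..t}" for s unfolding K_def by (rule cSUP_upper[OF that bdd])
  have \<psi>0: "0 \<le> \<psi> s" if "s > 0" for s unfolding \<psi>_def using bounds[of s] that by auto
  have K0: "0 \<le> K" using le[of t] \<psi>0[of t] t by auto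
  have step: "\<psi> s powr (1 + p) \<le> A * K" if s: "s \<in> {0<..t}" for s
  proof -
    have s0: "s > 0" using s by simp
    have "\<kappa> * (s - s / 2) * \<phi> s powr (1 + p) \<le> \<phi> (s / 2) - \<phi> s" using s by (intro dis) auto
    also have "\<dots> \<le> \<phi> (s / 2)" using bounds[of s] s by auto
    finally have d: "\<phi> s powr (1 + p) \<le> 2 / (\<kappa> * s) * \<phi> (s / 2)" using \<kappa> s0 by (simp add: field_simps)
    have "\<psi> s powr (1 + p) = s powr ((1 + p) / p) * \<phi> s powr (1 + p)"
      unfolding \<psi>_def using bounds[of s] s0 by (simp add: powr_mult powr_powr)
    also have "\<dots> \<le> s powr ((1 + p) / p) * (2 / (\<kappa> * s) * \<phi> (s / 2))"
      using d by (intro mult_left_mono) auto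
    also have "s powr ((1 + p) / p) = s powr (1 / p) * s" using s0 p by (simp add: add_divide_distrib powr_add)
    also have "s powr (1 / p) = 2 powr (1 / p) * (s / 2) powr (1 / p)" using s0 by (simp add: powr_mult[symmetric])
    also have "2 powr (1 / p) * (s / 2) powr (1 / p) * s * (2 / (\<kappa> * s) * \<phi> (s / 2)) = A * \<psi> (s / 2)"
      using s0 \<kappa> by (simp add: A_def \<psi>_def powr_add field_simps)
    also have "\<dots> \<le> A * K" using A s by (intro mult_left_mono le) auto
    finally show ?thesis .
  qed
  have "K \<le> (A * K) powr (1 / (1 + p))"
    unfolding K_def
  proof (rule cSUP_least)
    fix s assume s: "s \<in> {0<..t}"
    have "\<psi> s = (\<psi> s powr (1 + p)) powr (1 / (1 + p))"
      using \<psi>0[of s] s p by (simp add: powr_powr)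
    also have "\<dots> \<le> (A * K) powr (1 / (1 + p))" using step[OF s] p by (intro powr_mono2) auto
    finally show "\<psi> s \<le> (A * (SUP s\<in>{0<..t}. \<psi> s)) powr (1 / (1 + p))" unfolding K_def .
  qed (use t in auto)
  then have "K powr (1 + p) \<le> ((A * K) powr (1 / (1 + p))) powr (1 + p)"
    using K0 p by (intro powr_mono2) auto
  also have "\<dots> = A * K" using A K0 p by (simp add: powr_powr)
  finally have KA: "K powr (1 + p) \<le> A * K" .
  have "K \<le> A powr (1 / p)"
  proof (cases "K = 0")
    case True then show ?thesis by simp
  next
    case False
    with K0 have Kp: "K > 0" by simp
    have "K powr p * K \<le> A * K" using KA Kp by (simp add: powr_add mult.commute)
    then have "K powr p \<le> A" using Kp by simp
    then have "(K powr p) powr (1 / p) \<le> A powr (1 / p)" using p by (intro powr_mono2) auto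
    then show ?thesis using Kp p by (simp add: powr_powr)
  qed
  then have "\<psi> t \<le> A powr (1 / p)" using le[of t] t by simp
  then have "\<psi> t * t powr (- 1 / p) \<le> A powr (1 / p) * t powr (- 1 / p)" by (intro mult_right_mono) auto
  moreover have "\<psi> t * t powr (- 1 / p) = \<phi> t"
    using t by (simp add: \<psi>_def powr_minus field_simps)
  ultimately show ?thesis unfolding A_def by simp
qed

section \<open>The forward equation\<close>

text \<open>
Polarisation of the rule for squares.
\<close>
lemma indefinite_integral_product:
  fixes f g F G :: "real \<Rightarrow> real"
  assumes ab: "a \<le> b" and f: "set_integrable lborel {a..b} f" and g: "set_integrable lborel {a..b} g"
    and F: "\<And>t. t \<in> {a..b} \<Longrightarrow> F t = F a + (LBINT r:{a..t}. f r)"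
    and G: "\<And>t. t \<in> {a..b} \<Longrightarrow> G t = G a + (LBINT r:{a..t}. g r)"
  shows "set_integrable lborel {a..b} (\<lambda>r. F r * g r + G r * f r)"
    and "F b * G b - F a * G a = (LBINT r:{a..b}. F r * g r + G r * f r)"
proof -
  have fg: "set_integrable lborel {a..b} (\<lambda>r. f r + g r)" using f g by (rule set_integral_add)
  have FG: "F t + G t = (F a + G a) + (LBINT r:{a..t}. f r + g r)" if "t \<in> {a..b}" for t
  proof -
    have "set_integrable lborel {a..t} f" "set_integrable lborel {a..t} g"
      using f g that by (auto intro: set_integrable_subset)
    then show ?thesis using F[OF that] G[OF that] by (simp add: set_integral_add(2))
  qed
  note 1 = indefinite_integral_square[OF ab f F]
  note 2 = indefinite_integral_square[OF ab g G]
  note 3 = indefinite_integral_square[OF ab fg FG]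
  have i: "set_integrable lborel {a..b} (\<lambda>r. (F r + G r) * (f r + g r) - F r * f r - G r * g r)"
    by (intro set_integral_diff(1) 1(1) 2(1) 3(1))
  have eq: "(\<lambda>r. (F r + G r) * (f r + g r) - F r * f r - G r * g r) = (\<lambda>r. F r * g r + G r * f r)"
    by (auto simp: algebra_simps)
  show "set_integrable lborel {a..b} (\<lambda>r. F r * g r + G r * f r)" using i unfolding eq .
  have "(LBINT r:{a..b}. F r * g r + G r * f r)
    = (LBINT r:{a..b}. (F r + G r) * (f r + g r)) - (LBINT r:{a..b}. F r * f r) - (LBINT r:{a..b}. G r * g r)"
    unfolding eq[symmetric] using 1(1) 2(1) 3(1) by (simp add: set_integral_diff)
  also have "\<dots> = ((F b + G b)\<^sup>2 - (F a + G a)\<^sup>2) / 2 - ((F b)\<^sup>2 - (F a)\<^sup>2) / 2 - ((G b)\<^sup>2 - (G a)\<^sup>2) / 2"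
    using 1(2) 2(2) 3(2) by simp
  also have "\<dots> = F b * G b - F a * G a" by (simp add: power2_eq_square field_simps)
  finally show "F b * G b - F a * G a = (LBINT r:{a..b}. F r * g r + G r * f r)" by simp
qed

lemma set_lebesgue_integral_singleton: "(LBINT r:{a..a}. f r) = (0::real)" for a :: real
  unfolding set_lebesgue_integral_def
  by (rule integral_eq_zero_AE) (use AE_lborel_singleton[of a] in eventually_elim, auto)

text \<open>
Taking \<open>exp (- (LBINT r:{a..t}. m r))\<close> out of the Duhamel formula exhibits \<open>v\<close> as a product of two indefinite
integrals, to which the product rule applies.
\<close>
lemma duhamel_imp_forward_equation:
  fixes g m v :: "real \<Rightarrow> real"
  assumes ab: "a \<le> b" and g: "set_integrable lborel {a..b} g"
    and m: "set_integrable lborel {a..b} m" "\<And>r. 0 \<le> m r"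
    and v: "\<And>t. t \<in> {a..b} \<Longrightarrow> v t = v0 * exp (- (LBINT r:{a..t}. m r)) + (LBINT u:{a..t}. g u * exp (- (LBINT r:{u..t}. m r)))"
  shows "set_integrable lborel {a..b} (\<lambda>r. g r - m r * v r)"
    and "v b = v0 + (LBINT r:{a..b}. g r - m r * v r)"
proof -
  let ?M = "\<lambda>t. LBINT r:{a..t}. m r"
  let ?E = "\<lambda>t. exp (- ?M t)"
  have Mc: "continuous_on {a..b} ?M" by (rule continuous_on_set_lebesgue_integral[OF m(1)])
  define e where "e r = - (m r * ?E r)" for r
  have sub: "set_integrable lborel {u..w} h" if "set_integrable lborel {a..b} h" "a \<le> u" "w \<le> b" for u w and h :: "real \<Rightarrow> real"
    using that by (auto intro: set_integrable_subset)
  have e_int: "set_integrable lborel {a..b} e"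
    using indefinite_integral_exp_neg(1)[OF ab m] unfolding e_def set_integrable_def by simp
  have Ma: "?M a = 0" by (rule set_lebesgue_integral_singleton)
  have E: "?E t = ?E a + (LBINT r:{a..t}. e r)" if "t \<in> {a..b}" for t
  proof -
    have "1 - ?E t = (LBINT r:{a..t}. m r * ?E r)"
      using that m by (intro indefinite_integral_exp_neg(2)) (auto intro: set_integrable_subset)
    also have "\<dots> = - (LBINT r:{a..t}. e r)" unfolding e_def set_lebesgue_integral_def by simp
    finally show ?thesis using Ma by simp
  qed
  define w where "w t = v0 + (LBINT u:{a..t}. g u * exp (?M u))" for t
  have gE_int: "set_integrable lborel {a..b} (\<lambda>u. g u * exp (?M u))"
    using set_integrable_continuous_mult[OF _ g, of "\<lambda>u. exp (?M u)"] Mc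
    by (simp add: mult.commute continuous_on_exp)
  have wa: "w a = v0" unfolding w_def set_lebesgue_integral_singleton by simp
  have w: "w t = w a + (LBINT u:{a..t}. g u * exp (?M u))" for t unfolding wa by (simp add: w_def)
  have vw: "v t = w t * ?E t" if t: "t \<in> {a..b}" for t
  proof -
    have "(LBINT u:{a..t}. g u * exp (- (LBINT r:{u..t}. m r))) = (LBINT u:{a..t}. (g u * exp (?M u)) * ?E t)"
    proof (rule set_lebesgue_integral_cong)
      show "\<forall>u. u \<in> {a..t} \<longrightarrow> g u * exp (- (LBINT r:{u..t}. m r)) = (g u * exp (?M u)) * ?E t"
      proof safe
        fix u assume u: "u \<in> {a..t}"
        have "?M u + (LBINT r:{u..t}. m r) = ?M t"
          using u t by (intro set_lebesgue_integral_combine sub[OF m(1)]) auto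
        then have "exp (- (LBINT r:{u..t}. m r)) = exp (?M u) * ?E t" by (simp add: mult_exp_exp)
        then show "g u * exp (- (LBINT r:{u..t}. m r)) = (g u * exp (?M u)) * ?E t" by simp
      qed
    qed simp
    also have "\<dots> = (LBINT u:{a..t}. g u * exp (?M u)) * ?E t" by (rule set_integral_mult_left)
    finally show ?thesis using v[OF t] by (simp add: w_def distrib_right)
  qed
  note P = indefinite_integral_product[OF ab gE_int e_int, of w ?E, OF w E]
  have eq: "w r * e r + ?E r * (g r * exp (?M r)) = g r - m r * v r" if "r \<in> {a..b}" for r
    unfolding vw[OF that] e_def by (simp add: algebra_simps mult_exp_exp)
  show "set_integrable lborel {a..b} (\<lambda>r. g r - m r * v r)"
    using P(1) by (subst set_integrable_cong[OF refl refl eq[symmetric]]) auto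
  have "v b = w b * ?E b" using ab by (intro vw) auto
  also have "\<dots> = w a * ?E a + (LBINT r:{a..b}. w r * e r + ?E r * (g r * exp (?M r)))" using P(2) by simp
  also have "(LBINT r:{a..b}. w r * e r + ?E r * (g r * exp (?M r))) = (LBINT r:{a..b}. g r - m r * v r)"
    by (rule set_lebesgue_integral_cong) (use eq in auto)
  finally show "v b = v0 + (LBINT r:{a..b}. g r - m r * v r)" using Ma wa by simp
qed

context jump_rates
begin

text \<open>
The bound by one makes the kernels finite, so that the Duhamel formula may be read in the reals.
\<close>
lemma forward_equation:
  assumes st: "s \<le> t" and le1: "\<And>r z. s \<le> r \<Longrightarrow> p s r x z \<le> 1"
    and N: "finite N" "\<And>u z. z \<notin> N \<Longrightarrow> c u z y = 0"
    and cint: "\<And>a b z. set_integrable lborel {a..b} (\<lambda>u. c u z y)"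
  defines "v \<equiv> \<lambda>r z. enn2real (p s r x z)"
  shows "set_integrable lborel {s..t} (\<lambda>r. (\<Sum>z\<in>N. v r z * c r z y) - m r y * v r y)"
    and "v t y = (if x = y then 1 else 0) + (LBINT r:{s..t}. (\<Sum>z\<in>N. v r z * c r z y) - m r y * v r y)"
proof -
  define g where "g r = (\<Sum>z\<in>N. v r z * c r z y)" for r
  have pv: "p s r x z = ennreal (v r z)" if "s \<le> r" for r z
    unfolding v_def using le1[OF that, of z] by (intro ennreal_enn2real[symmetric]) (auto simp: top_unique less_top[symmetric] intro: le_less_trans)
  have v01: "0 \<le> v r z" "v r z \<le> 1" if "s \<le> r" for r z
  proof -
    show "0 \<le> v r z" by (simp add: v_def)
    show "v r z \<le> 1" using le1[OF that, of z] unfolding v_def by (metis enn2real_leI ennreal_1 zero_le_one)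
  qed
  have vm[measurable]: "(\<lambda>r. v r z) \<in> borel_measurable borel" for z unfolding v_def by measurable
  have gm[measurable]: "g \<in> borel_measurable borel" unfolding g_def by measurable
  have g0: "0 \<le> g r" for r unfolding g_def v_def by (intro sum_nonneg mult_nonneg_nonneg c_nonneg) simp
  have g_int: "set_integrable lborel {s..t'} g" for t'
    unfolding set_integrable_def
  proof (rule Bochner_Integration.integrable_bound)
    show "integrable lborel (\<lambda>r. \<Sum>z\<in>N. indicator {s..t'} r *\<^sub>R c r z y)"
      using cint unfolding set_integrable_def by (intro Bochner_Integration.integrable_sum)
    show "AE r in lborel. norm (indicator {s..t'} r *\<^sub>R g r) \<le> norm (\<Sum>z\<in>N. indicator {s..t'} r *\<^sub>R c r z y)"
    proof (rule AE_I2)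
      fix r
      have "g r \<le> (\<Sum>z\<in>N. c r z y)" if "s \<le> r"
        unfolding g_def using v01[OF that] c_nonneg by (intro sum_mono mult_left_le_one_le) auto
      moreover have "0 \<le> (\<Sum>z\<in>N. c r z y)" using c_nonneg by (intro sum_nonneg)
      ultimately show "norm (indicator {s..t'} r *\<^sub>R g r) \<le> norm (\<Sum>z\<in>N. indicator {s..t'} r *\<^sub>R c r z y)"
        using g0[of r] by (auto simp: indicator_def)
    qed
  qed measurable
  have Sdef: "S u t' y = exp (- (LBINT r:{u..t'}. m r y))" for u t' by (simp add: survival_def)
  have S1: "0 \<le> S u t' z" "S u t' z \<le> 1" for u t' z
    unfolding survival_def using set_lebesgue_integral_nonneg'[of _ "\<lambda>r. m r z"] m_nonneg by auto
  have duh: "v t' y = (if x = y then 1 else 0) * exp (- (LBINT r:{s..t'}. m r y)) + (LBINT u:{s..t'}. g u * exp (- (LBINT r:{u..t'}. m r y)))"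
    if t': "t' \<in> {s..t}" for t'
  proof -
    have gS_int: "set_integrable lborel {s..t'} (\<lambda>u. g u * S u t' y)"
      unfolding set_integrable_def
    proof (rule Bochner_Integration.integrable_bound)
      show "integrable lborel (\<lambda>r. indicator {s..t'} r *\<^sub>R g r)" using g_int unfolding set_integrable_def .
      show "AE r in lborel. norm (indicator {s..t'} r *\<^sub>R (g r * S r t' y)) \<le> norm (indicator {s..t'} r *\<^sub>R g r)"
        using g0 S1 by (intro AE_I2) (auto simp: indicator_def abs_mult mult_left_le)
    qed measurable
    have "(\<integral>\<^sup>+z. p s u x z * ennreal (c u z y) \<partial>count_space UNIV) = ennreal (g u)" if "s \<le> u" for u
    proof -
      have "(\<integral>\<^sup>+z. p s u x z * ennreal (c u z y) \<partial>count_space UNIV) = (\<Sum>z\<in>N. p s u x z * ennreal (c u z y))"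
        using N by (intro nn_integral_count_space') auto
      also have "\<dots> = (\<Sum>z\<in>N. ennreal (v u z * c u z y))"
        unfolding pv[OF that] using v01[OF that] by (simp add: ennreal_mult')
      also have "\<dots> = ennreal (g u)" unfolding g_def using v01[OF that] c_nonneg by (intro sum_ennreal) auto
      finally show ?thesis .
    qed
    then have "(\<integral>\<^sup>+u. indicator {s..t'} u * ((\<integral>\<^sup>+z. p s u x z * ennreal (c u z y) \<partial>count_space UNIV) * ennreal (S u t' y)) \<partial>lborel)
      = (\<integral>\<^sup>+u. ennreal (indicator {s..t'} u *\<^sub>R (g u * S u t' y)) \<partial>lborel)"
      using g0 S1 by (intro nn_integral_cong) (auto simp: indicator_def ennreal_mult')
    also have "\<dots> = ennreal (LBINT u:{s..t'}. g u * S u t' y)"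
      unfolding set_lebesgue_integral_def
      by (rule nn_integral_eq_integral) (use gS_int g0 S1 in \<open>auto simp: set_integrable_def\<close>)
    finally have "ennreal (v t' y) = (if x = y then ennreal (S s t' x) else 0) + ennreal (LBINT u:{s..t'}. g u * S u t' y)"
      using transition_last_jump[of s t' x y] pv[of t' y] t' by simp
    also have "\<dots> = ennreal ((if x = y then 1 else 0) * S s t' y + (LBINT u:{s..t'}. g u * S u t' y))"
    proof -
      have "0 \<le> (LBINT u:{s..t'}. g u * S u t' y)"
        using g0 S1 by (intro set_lebesgue_integral_nonneg') auto
      then show ?thesis using S1(1)[of s t' y]
        by (cases "x = y") (simp_all add: ennreal_plus[symmetric] del: ennreal_plus)
    qed
    finally show ?thesis
      unfolding Sdef using v01(1)[of t' y] t' 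
      by (subst (asm) ennreal_inj) (auto intro!: add_nonneg_nonneg set_lebesgue_integral_nonneg' mult_nonneg_nonneg g0)
  qed
  note D = duhamel_imp_forward_equation[OF st g_int m_integrable m_nonneg duh]
  show "set_integrable lborel {s..t} (\<lambda>r. (\<Sum>z\<in>N. v r z * c r z y) - m r y * v r y)"
    using D(1) by (simp add: g_def)
  show "v t y = (if x = y then 1 else 0) + (LBINT r:{s..t}. (\<Sum>z\<in>N. v r z * c r z y) - m r y * v r y)"
    using D(2) by (simp add: g_def)
qed

end

section \<open>Time energy of sampled heat flows\<close>

definition time_energy :: "nat \<Rightarrow> (nat \<Rightarrow> real) \<Rightarrow> real" where
  "time_energy N b = half_energy N (\<lambda>j. complex_of_real (b j))"

definition real_hilbert :: "nat \<Rightarrow> (nat \<Rightarrow> real) \<Rightarrow> nat \<Rightarrow> real" where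
  "real_hilbert N b j = Re (discrete_hilbert N (\<lambda>j. complex_of_real (b j)) j)"

lemma time_energy_nonneg: "0 \<le> time_energy N b"
  unfolding time_energy_def by (rule half_energy_nonneg)

text \<open>
Only the real part of the pairing survives for real data.
\<close>
lemma time_energy_eq:
  assumes "N > 0"
  shows "time_energy N b = (\<Sum>j<N. real_hilbert N b j * (b (Suc j mod N) - b j))"
proof -
  have "complex_of_real (time_energy N b) = (\<Sum>j<N. cnj (discrete_hilbert N (\<lambda>j. complex_of_real (b j)) j) * complex_of_real (b (Suc j mod N) - b j))"
    unfolding time_energy_def half_energy_eq_hilbert_increment[OF assms] by simp
  then have "Re (complex_of_real (time_energy N b)) = Re (\<Sum>j<N. cnj (discrete_hilbert N (\<lambda>j. complex_of_real (b j)) j) * complex_of_real (b (Suc j mod N) - b j))"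
    by (rule arg_cong)
  then show ?thesis by (simp add: real_hilbert_def)
qed

lemma real_hilbert_contraction:
  assumes "N > 0"
  shows "(\<Sum>j<N. (real_hilbert N b j)\<^sup>2) \<le> (\<Sum>j<N. (b j)\<^sup>2)"
proof -
  have "(\<Sum>j<N. (real_hilbert N b j)\<^sup>2) \<le> (\<Sum>j<N. (cmod (discrete_hilbert N (\<lambda>j. complex_of_real (b j)) j))\<^sup>2)"
    unfolding real_hilbert_def cmod_power2 by (intro sum_mono) simp
  also have "\<dots> \<le> (\<Sum>j<N. (cmod (complex_of_real (b j)))\<^sup>2)" by (rule discrete_hilbert_contraction[OF assms])
  finally show ?thesis by simp
qed

lemma real_hilbert_diff: "real_hilbert N (\<lambda>j. a j - b j) j = real_hilbert N a j - real_hilbert N b j"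
  unfolding real_hilbert_def using discrete_hilbert_diff[of N "\<lambda>j. complex_of_real (a j)" "\<lambda>j. complex_of_real (b j)" j]
  by simp

lemma real_hilbert_zero: "(\<And>j. j < N \<Longrightarrow> b j = 0) \<Longrightarrow> real_hilbert N b j = 0"
  unfolding real_hilbert_def by (subst discrete_hilbert_zero) auto

lemma abs_sum_mult_increment_le:
  assumes "N > 0"
  shows "\<bar>\<Sum>j<N. a j * (b (Suc j mod N) - b j)\<bar> \<le> (time_energy N a + time_energy N b) / 2"
proof -
  have "(\<Sum>j<N. cnj (complex_of_real (a j)) * (complex_of_real (b (Suc j mod N)) - complex_of_real (b j)))
    = complex_of_real (\<Sum>j<N. a j * (b (Suc j mod N) - b j))" by simp
  then show ?thesis
    using abs_sum_mult_increment_le_half_energy[OF assms, of "\<lambda>j. complex_of_real (a j)" "\<lambda>j. complex_of_real (b j)"]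
    unfolding time_energy_def by (metis norm_of_real)
qed

lemma time_energy_reflect: "N > 0 \<Longrightarrow> time_energy N (\<lambda>j. b ((N - j) mod N)) = time_energy N b"
  unfolding time_energy_def by (rule half_energy_reflect) auto

lemma tendsto_time_energy:
  assumes "\<And>j. j < N \<Longrightarrow> ((\<lambda>k. b k j) \<longlongrightarrow> c j) F"
  shows "((\<lambda>k. time_energy N (b k)) \<longlongrightarrow> time_energy N c) F"
proof (cases "N = 0")
  case False
  then show ?thesis
    unfolding time_energy_def half_energy_def dft_def
    using assms by (intro tendsto_intros) auto
qed (simp add: time_energy_def half_energy_def)

lemma borel_measurable_time_energy:
  assumes "\<And>j. j < N \<Longrightarrow> (\<lambda>w. b w j) \<in> borel_measurable M"
  shows "(\<lambda>w. time_energy N (b w)) \<in> borel_measurable M"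
proof -
  have "(\<lambda>w. dft N (\<lambda>j. complex_of_real (b w j)) k) \<in> borel_measurable M" for k
    unfolding dft_def using assms by (intro borel_measurable_sum borel_measurable_times borel_measurable_of_real) auto
  then show ?thesis unfolding time_energy_def half_energy_def by measurable
qed

text \<open>
A cut-off in time that vanishes at both ends, so that the sampled and truncated kernel extends
periodically, and whose slope is \<open>1 / N\<close>.
\<close>
definition tent :: "nat \<Rightarrow> nat \<Rightarrow> real" where
  "tent N j = real (min j (N - j)) / real N"

lemma tent_bounds: "0 \<le> tent N j" "tent N j \<le> 1"
  unfolding tent_def by (auto simp: divide_le_eq_1 min_def)

lemma tent_0: "tent N 0 = 0" and tent_N: "tent N N = 0"
  unfolding tent_def by auto

lemma tent_lipschitz: "\<bar>tent N (Suc j) - tent N j\<bar> \<le> 1 / real N"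
proof -
  have "\<bar>real (min (Suc j) (N - Suc j)) - real (min j (N - j))\<bar> \<le> 1" by (auto simp: min_def)
  then have "\<bar>real (min (Suc j) (N - Suc j)) - real (min j (N - j))\<bar> / real N \<le> 1 / real N"
    by (intro divide_right_mono) auto
  then show ?thesis unfolding tent_def by (simp add: diff_divide_distrib[symmetric])
qed

lemma tent_reflect: "j \<le> N \<Longrightarrow> tent N (N - j) = tent N j"
  unfolding tent_def by (simp add: min.commute)

text \<open>
Every unordered pair is counted twice, hence the factor one half.
\<close>
definition dirichlet_form :: "'a set \<Rightarrow> ('a \<Rightarrow> 'a \<Rightarrow> real) \<Rightarrow> ('a \<Rightarrow> real) \<Rightarrow> ('a \<Rightarrow> real) \<Rightarrow> real" where
  "dirichlet_form B w f g = (\<Sum>y\<in>B. \<Sum>z\<in>B. w y z * ((f y - f z) * (g y - g z))) / 2"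

lemma summation_by_parts:
  assumes "finite B" "L \<subseteq> B" and f: "\<And>y. y \<notin> L \<Longrightarrow> f y = 0" and sym: "\<And>y z. w y z = w z y"
  shows "(\<Sum>y\<in>L. f y * (\<Sum>z\<in>B. w y z * (g z - g y))) = - dirichlet_form B w f g"
proof -
  let ?X = "\<Sum>y\<in>B. \<Sum>z\<in>B. w y z * (f y * (g z - g y))"
  have "(\<Sum>y\<in>L. f y * (\<Sum>z\<in>B. w y z * (g z - g y))) = (\<Sum>y\<in>B. f y * (\<Sum>z\<in>B. w y z * (g z - g y)))"
    using assms(1,2) f by (intro sum.mono_neutral_left) auto
  also have "\<dots> = ?X" by (simp add: sum_distrib_left mult_ac)
  finally have 1: "(\<Sum>y\<in>L. f y * (\<Sum>z\<in>B. w y z * (g z - g y))) = ?X" .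
  have "?X = (\<Sum>y\<in>B. \<Sum>z\<in>B. w z y * (f z * (g y - g z)))" by (rule sum.swap)
  also have "\<dots> = (\<Sum>y\<in>B. \<Sum>z\<in>B. w y z * (f z * (g y - g z)))" by (intro sum.cong refl) (simp add: sym)
  finally have "?X + ?X = ?X + (\<Sum>y\<in>B. \<Sum>z\<in>B. w y z * (f z * (g y - g z)))" by simp
  also have "\<dots> = (\<Sum>y\<in>B. \<Sum>z\<in>B. - (w y z * ((f y - f z) * (g y - g z))))"
    unfolding sum.distrib[symmetric] by (intro sum.cong refl) (simp add: algebra_simps)
  also have "\<dots> = - (2 * dirichlet_form B w f g)" by (simp add: dirichlet_form_def sum_negf)
  finally show ?thesis using 1 by simp
qed

lemma dirichlet_form_nonneg: "(\<And>y z. 0 \<le> w y z) \<Longrightarrow> 0 \<le> dirichlet_form B w f f"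
  unfolding dirichlet_form_def
  by (intro divide_nonneg_nonneg sum_nonneg mult_nonneg_nonneg[OF _ zero_le_square]) auto

lemma dirichlet_form_mono:
  assumes "\<And>y z. y \<in> B \<Longrightarrow> z \<in> B \<Longrightarrow> w y z \<le> c * w' y z"
  shows "dirichlet_form B w f f \<le> c * dirichlet_form B w' f f"
proof -
  have "(\<Sum>y\<in>B. \<Sum>z\<in>B. w y z * ((f y - f z) * (f y - f z))) \<le> (\<Sum>y\<in>B. \<Sum>z\<in>B. c * w' y z * ((f y - f z) * (f y - f z)))"
    using assms by (intro sum_mono mult_right_mono) auto
  then show ?thesis unfolding dirichlet_form_def by (simp add: sum_distrib_left mult.assoc)
qed

text \<open>
Cauchy-Schwarz in the form of the arithmetic-geometric mean inequality, applied bond by bond, so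
that the weights may be replaced by comparable ones.
\<close>
lemma abs_dirichlet_form_le:
  assumes w: "\<And>y z. y \<in> B \<Longrightarrow> z \<in> B \<Longrightarrow> 0 \<le> w y z \<and> w y z \<le> c * w' y z"
  shows "\<bar>dirichlet_form B w f g\<bar> \<le> c / 2 * (dirichlet_form B w' f f + dirichlet_form B w' g g)"
proof -
  have "\<bar>w y z * ((f y - f z) * (g y - g z))\<bar> \<le> c / 2 * (w' y z * ((f y - f z) * (f y - f z)) + w' y z * ((g y - g z) * (g y - g z)))"
    if yz: "y \<in> B" "z \<in> B" for y z
  proof -
    let ?a = "f y - f z" and ?b = "g y - g z"
    have "\<bar>?a * ?b\<bar> \<le> (?a * ?a + ?b * ?b) / 2"
      using sum_squares_bound[of "\<bar>?a\<bar>" "\<bar>?b\<bar>"] by (simp add: abs_mult power2_eq_square)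
    then have "\<bar>w y z * (?a * ?b)\<bar> \<le> w y z * ((?a * ?a + ?b * ?b) / 2)"
      using w[OF yz] by (simp only: abs_mult) (intro mult_mono, auto)
    also have "\<dots> \<le> (c * w' y z) * ((?a * ?a + ?b * ?b) / 2)"
      using w[OF yz] by (intro mult_right_mono) auto
    finally show ?thesis by (simp add: algebra_simps)
  qed
  then have "\<bar>\<Sum>y\<in>B. \<Sum>z\<in>B. w y z * ((f y - f z) * (g y - g z))\<bar>
    \<le> (\<Sum>y\<in>B. \<Sum>z\<in>B. c / 2 * (w' y z * ((f y - f z) * (f y - f z)) + w' y z * ((g y - g z) * (g y - g z))))"
    by (intro order_trans[OF sum_abs] sum_mono) auto
  also have "\<dots> = c / 2 * (2 * dirichlet_form B w' f f + 2 * dirichlet_form B w' g g)"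
    unfolding dirichlet_form_def
    by (simp add: sum_distrib_left sum.distrib distrib_left sum_divide_distrib)
  finally show ?thesis unfolding dirichlet_form_def[of B w] by (simp add: algebra_simps)
qed

lemma
  fixes f :: "'i \<Rightarrow> 'b \<Rightarrow> real"
  assumes "finite I" and f: "\<And>i. i \<in> I \<Longrightarrow> set_integrable M A (f i)"
  shows set_integrable_sum: "set_integrable M A (\<lambda>x. \<Sum>i\<in>I. f i x)"
    and set_integral_sum: "set_lebesgue_integral M A (\<lambda>x. \<Sum>i\<in>I. f i x) = (\<Sum>i\<in>I. set_lebesgue_integral M A (f i))"
proof -
  show "set_integrable M A (\<lambda>x. \<Sum>i\<in>I. f i x)"
    using f unfolding set_integrable_def scaleR_sum_right by (rule Bochner_Integration.integrable_sum)
  show "set_lebesgue_integral M A (\<lambda>x. \<Sum>i\<in>I. f i x) = (\<Sum>i\<in>I. set_lebesgue_integral M A (f i))"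
    using f unfolding set_integrable_def set_lebesgue_integral_def scaleR_sum_right
    by (rule Bochner_Integration.integral_sum)
qed

text \<open>
A solution of the heat equation on \<open>L\<close> with value zero outside; \<open>B\<close> contains \<open>L\<close> together with the
neighbouring sites into which mass is lost. The equation is only assumed in integrated form, because
the weights are only integrable in time.
\<close>
locale finite_heat_flow =
  fixes w :: "real \<Rightarrow> 'a \<Rightarrow> 'a \<Rightarrow> real" and v :: "real \<Rightarrow> 'a \<Rightarrow> real" and L B :: "'a set"
  assumes finB: "finite B" and LB: "L \<subseteq> B"
    and w_nonneg: "\<And>r y z. 0 \<le> w r y z" and w_sym: "\<And>r y z. w r y z = w r z y"
    and w_meas[measurable]: "\<And>y z. (\<lambda>r. w r y z) \<in> borel_measurable borel"
    and w_int: "\<And>a b y z. set_integrable lborel {a..b} (\<lambda>r. w r y z)"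
    and v_out: "\<And>r y. y \<notin> L \<Longrightarrow> v r y = 0"
    and Lv_int: "\<And>s t y. 0 \<le> s \<Longrightarrow> s \<le> t \<Longrightarrow> y \<in> L \<Longrightarrow>
        set_integrable lborel {s..t} (\<lambda>r. \<Sum>z\<in>B. w r y z * (v r z - v r y))"
    and v_eq: "\<And>s t y. 0 \<le> s \<Longrightarrow> s \<le> t \<Longrightarrow> y \<in> L \<Longrightarrow>
        v t y = v s y + (LBINT r:{s..t}. \<Sum>z\<in>B. w r y z * (v r z - v r y))"
begin

abbreviation "E r f g \<equiv> dirichlet_form B (w r) f g"

definition mass2 :: "real \<Rightarrow> real" where "mass2 t = (\<Sum>y\<in>L. (v t y)\<^sup>2)"

lemma finL: "finite L" using finB LB by (rule finite_subset[rotated])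

text \<open>
The chain rule for squares at each site, followed by summation by parts over the sites.
\<close>
lemma energy_identity:
  assumes st: "0 \<le> s" "s \<le> t"
  shows "set_integrable lborel {s..t} (\<lambda>r. E r (v r) (v r))"
    and "mass2 s - mass2 t = 2 * (LBINT r:{s..t}. E r (v r) (v r))"
proof -
  let ?L = "\<lambda>r y. \<Sum>z\<in>B. w r y z * (v r z - v r y)"
  have 1: "set_integrable lborel {s..t} (\<lambda>r. v r y * ?L r y)"
    "(v t y)\<^sup>2 - (v s y)\<^sup>2 = 2 * (LBINT r:{s..t}. v r y * ?L r y)" if y: "y \<in> L" for y
  proof -
    have e: "v r y = v s y + (LBINT r':{s..r}. ?L r' y)" if "r \<in> {s..t}" for r
      by (rule v_eq[OF st(1) _ y]) (use that in simp)
    from indefinite_integral_square[OF st(2) Lv_int[OF st y], of "\<lambda>r. v r y", OF e]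
    show "set_integrable lborel {s..t} (\<lambda>r. v r y * ?L r y)"
      "(v t y)\<^sup>2 - (v s y)\<^sup>2 = 2 * (LBINT r:{s..t}. v r y * ?L r y)" by blast+
  qed
  have eq: "(\<Sum>y\<in>L. v r y * ?L r y) = - E r (v r) (v r)" for r
    by (rule summation_by_parts[OF finB LB v_out w_sym])
  have i: "set_integrable lborel {s..t} (\<lambda>r. \<Sum>y\<in>L. v r y * ?L r y)"
    using 1(1) by (intro set_integrable_sum finL) auto
  show int: "set_integrable lborel {s..t} (\<lambda>r. E r (v r) (v r))"
    using set_integrable_mult_right[OF i, of "-1"] unfolding eq by simp
  have "mass2 t - mass2 s = (\<Sum>y\<in>L. 2 * (LBINT r:{s..t}. v r y * ?L r y))"
    unfolding mass2_def sum_subtractf[symmetric] by (intro sum.cong refl 1(2))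
  also have "\<dots> = 2 * (LBINT r:{s..t}. \<Sum>y\<in>L. v r y * ?L r y)"
  proof -
    have "(LBINT r:{s..t}. \<Sum>y\<in>L. v r y * ?L r y) = (\<Sum>y\<in>L. LBINT r:{s..t}. v r y * ?L r y)"
      by (rule set_integral_sum) (use 1(1) finL in auto)
    then show ?thesis by (simp only: sum_distrib_left)
  qed
  also have "(LBINT r:{s..t}. \<Sum>y\<in>L. v r y * ?L r y) = - (LBINT r:{s..t}. E r (v r) (v r))"
    unfolding eq set_lebesgue_integral_def by simp
  finally show "mass2 s - mass2 t = 2 * (LBINT r:{s..t}. E r (v r) (v r))" by simp
qed

lemma mass2_antimono: "0 \<le> s \<Longrightarrow> s \<le> t \<Longrightarrow> mass2 t \<le> mass2 s"
proof -
  assume st: "0 \<le> s" "s \<le> t"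
  have "0 \<le> (LBINT r:{s..t}. E r (v r) (v r))"
    by (intro set_lebesgue_integral_nonneg' dirichlet_form_nonneg w_nonneg)
  then show ?thesis using energy_identity(2)[OF st] by linarith
qed

lemma mass2_nonneg: "0 \<le> mass2 t" unfolding mass2_def by (intro sum_nonneg) auto

lemma v_cont: assumes "0 \<le> s" shows "continuous_on {s..t} (\<lambda>r. v r y)"
proof (cases "y \<in> L \<and> s \<le> t")
  case True
  have "continuous_on {s..t} (\<lambda>r. v s y + (LBINT r':{s..r}. \<Sum>z\<in>B. w r' y z * (v r' z - v r' y)))"
    using True assms by (intro continuous_intros continuous_on_set_lebesgue_integral Lv_int) auto
  then show ?thesis
  proof (rule continuous_on_eq)
    fix r assume "r \<in> {s..t}"
    then show "v s y + (LBINT r':{s..r}. \<Sum>z\<in>B. w r' y z * (v r' z - v r' y)) = v r y"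
      using True by (intro v_eq[OF assms, symmetric]) auto
  qed
next
  case False
  then show ?thesis using v_out by (cases "y \<in> L") auto
qed

lemma static_energy_cont: assumes "0 \<le> s" shows "continuous_on {s..t} (\<lambda>r. dirichlet_form B a (v r) (v r))"
  unfolding dirichlet_form_def using v_cont[OF assms, of t] by (intro continuous_intros) auto

lemma static_energy_int: assumes "0 \<le> s" shows "set_integrable lborel {s..t} (\<lambda>r. dirichlet_form B a (v r) (v r))"
  by (rule borel_integrable_atLeastAtMost') (rule static_energy_cont[OF assms])

text \<open>
The increment of the flow is the integral of the generator, which the Dirichlet form pairs with \<open>f\<close>.
Comparison with the fixed weights \<open>w0\<close> allows for a test function \<open>f\<close> whose energy is known at other times
only.
\<close>
lemma pairing_bound:
  assumes st: "0 \<le> s" "s \<le> t" and f: "\<And>y. y \<notin> L \<Longrightarrow> f y = 0"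
    and comp: "AE r in lborel. \<forall>y\<in>B. \<forall>z\<in>B. w r y z \<le> c1 * w0 y z"
  shows "\<bar>\<Sum>y\<in>L. f y * (v t y - v s y)\<bar>
    \<le> c1 / 2 * ((t - s) * dirichlet_form B w0 f f + (LBINT r:{s..t}. dirichlet_form B w0 (v r) (v r)))"
proof -
  let ?L = "\<lambda>r y. \<Sum>z\<in>B. w r y z * (v r z - v r y)"
  let ?R = "\<lambda>r. c1 / 2 * (dirichlet_form B w0 f f + dirichlet_form B w0 (v r) (v r))"
  have i1: "set_integrable lborel {s..t} (\<lambda>r. f y * ?L r y)" if "y \<in> L" for y
    using Lv_int[OF st that] by (rule set_integrable_mult_right)
  have eq: "(\<Sum>y\<in>L. f y * ?L r y) = - E r f (v r)" for r
    by (rule summation_by_parts[OF finB LB f w_sym])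
  have i: "set_integrable lborel {s..t} (\<lambda>r. \<Sum>y\<in>L. f y * ?L r y)"
    using i1 by (intro set_integrable_sum finL) auto
  have iE: "set_integrable lborel {s..t} (\<lambda>r. - E r f (v r))" using i unfolding eq .
  have iR0: "set_integrable lborel {s..t} (\<lambda>r. dirichlet_form B w0 f f + dirichlet_form B w0 (v r) (v r))"
    by (intro set_integral_add(1) static_energy_int st borel_integrable_atLeastAtMost' continuous_on_const)
  have iR: "set_integrable lborel {s..t} ?R" using iR0 by (rule set_integrable_mult_right)
  have "(\<Sum>y\<in>L. f y * (v t y - v s y)) = (\<Sum>y\<in>L. LBINT r:{s..t}. f y * ?L r y)"
    by (intro sum.cong refl) (subst v_eq[OF st], auto)
  also have "\<dots> = (LBINT r:{s..t}. \<Sum>y\<in>L. f y * ?L r y)"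
    by (rule set_integral_sum[symmetric]) (use i1 finL in auto)
  also have "\<bar>\<dots>\<bar> \<le> (LBINT r:{s..t}. \<bar>\<Sum>y\<in>L. f y * ?L r y\<bar>)"
    using set_integral_norm_bound[OF i] by simp
  also have "\<dots> \<le> (LBINT r:{s..t}. ?R r)"
    unfolding set_lebesgue_integral_def
  proof (rule integral_mono_AE)
    show "integrable lborel (\<lambda>r. indicator {s..t} r *\<^sub>R \<bar>\<Sum>y\<in>L. f y * ?L r y\<bar>)"
      using set_integrable_abs[OF i] unfolding set_integrable_def .
    show "integrable lborel (\<lambda>r. indicator {s..t} r *\<^sub>R ?R r)" using iR unfolding set_integrable_def .
    show "AE r in lborel. indicator {s..t} r *\<^sub>R \<bar>\<Sum>y\<in>L. f y * ?L r y\<bar> \<le> indicator {s..t} r *\<^sub>R ?R r"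
      using comp
    proof eventually_elim
      case (elim r)
      have "\<bar>E r f (v r)\<bar> \<le> ?R r" using elim w_nonneg by (intro abs_dirichlet_form_le) auto
      then show ?case unfolding eq by (auto simp: indicator_def)
    qed
  qed
  also have "\<dots> = c1 / 2 * (LBINT r:{s..t}. dirichlet_form B w0 f f + dirichlet_form B w0 (v r) (v r))"
    by (rule set_integral_mult_right)
  also have "(LBINT r:{s..t}. dirichlet_form B w0 f f + dirichlet_form B w0 (v r) (v r))
    = (t - s) * dirichlet_form B w0 f f + (LBINT r:{s..t}. dirichlet_form B w0 (v r) (v r))"
    using st by (subst set_integral_add(2)) (auto intro!: static_energy_cont borel_integrable_atLeastAtMost' continuous_on_const simp: set_integral_const)
  finally show ?thesis .
qed

text \<open>
The half energy in time is the pairing of the increments of the flow with the discrete Hilbert transform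
\<open>g\<close> of the samples. The transform acts in time alone and contracts, so the spatial energy of \<open>g\<close>
with respect to weights that do not depend on time, summed over the samples, is at most that of the flow
itself. This is where comparability of the conductances with those at a fixed time is used. The slope of the cut-off
produces the last term.
\<close>
lemma sampled_time_energy_bound:
  assumes \<rho>: "0 \<le> \<rho>" and N: "N > 0" and \<delta>: "\<delta> > 0" and c1: "c1 \<ge> 0" and w0: "\<And>y z. 0 \<le> w0 y z"
    and comp: "AE r in lborel. \<forall>y\<in>B. \<forall>z\<in>B. w r y z \<le> c1 * w0 y z"
  shows "(\<Sum>y\<in>L. time_energy N (\<lambda>j. tent N j * v (\<rho> + real j * \<delta>) y))
    \<le> c1 / 2 * (\<delta> * (\<Sum>j<N. dirichlet_form B w0 (v (\<rho> + real j * \<delta>)) (v (\<rho> + real j * \<delta>)))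
        + (LBINT r:{\<rho>..\<rho> + real N * \<delta>}. dirichlet_form B w0 (v r) (v r))) + mass2 \<rho>"
proof -
  define t where "t j = \<rho> + real j * \<delta>" for j
  have t0: "0 \<le> t j" "\<rho> \<le> t j" "t j \<le> t (Suc j)" "t (Suc j) - t j = \<delta>" for j
    using \<rho> \<delta> by (auto simp: t_def algebra_simps)
  define b where "b y j = tent N j * v (t j) y" for y j
  define g where "g j y = real_hilbert N (b y) j" for j y
  let ?E0 = "\<lambda>f. dirichlet_form B w0 f f"
  let ?I = "\<lambda>j. LBINT r:{t j..t (Suc j)}. ?E0 (v r)"
  have g_out: "g j y = 0" if "y \<notin> L" for j y
    unfolding g_def b_def using v_out[OF that] by (intro real_hilbert_zero) simp
  \<comment> \<open>At the last index both the wrapped sample and the tent at \<open>N\<close> vanish.\<close>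
  have inc: "b y (Suc j mod N) - b y j = tent N (Suc j) * (v (t (Suc j)) y - v (t j) y) + (tent N (Suc j) - tent N j) * v (t j) y"
    if "j < N" for j y
  proof -
    have "b y (Suc j mod N) = tent N (Suc j) * v (t (Suc j)) y"
    proof (cases "Suc j = N")
      case True
      then show ?thesis by (simp add: b_def tent_0 tent_N)
    next
      case False
      then show ?thesis using that by (simp add: b_def)
    qed
    then show ?thesis by (simp add: b_def algebra_simps)
  qed
  have "(\<Sum>y\<in>L. time_energy N (b y)) = (\<Sum>y\<in>L. \<Sum>j<N. g j y * (b y (Suc j mod N) - b y j))"
    unfolding g_def by (intro sum.cong refl time_energy_eq N)
  also have "\<dots> = (\<Sum>j<N. \<Sum>y\<in>L. g j y * (b y (Suc j mod N) - b y j))" by (rule sum.swap)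
  also have "\<dots> = (\<Sum>j<N. tent N (Suc j) * (\<Sum>y\<in>L. g j y * (v (t (Suc j)) y - v (t j) y))
      + (tent N (Suc j) - tent N j) * (\<Sum>y\<in>L. g j y * v (t j) y))"
  proof (intro sum.cong refl)
    fix j assume "j \<in> {..<N}"
    then have j: "j < N" by simp
    show "(\<Sum>y\<in>L. g j y * (b y (Suc j mod N) - b y j)) = tent N (Suc j) * (\<Sum>y\<in>L. g j y * (v (t (Suc j)) y - v (t j) y))
      + (tent N (Suc j) - tent N j) * (\<Sum>y\<in>L. g j y * v (t j) y)"
      unfolding inc[OF j] sum_distrib_left sum.distrib[symmetric]
      by (intro sum.cong refl) (simp add: algebra_simps)
  qed
  also have "\<dots> \<le> (\<Sum>j<N. c1 / 2 * (\<delta> * ?E0 (g j) + ?I j) + (1 / real N) * (\<Sum>y\<in>L. ((g j y)\<^sup>2 + (v (t j) y)\<^sup>2) / 2))"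
  proof (intro sum_mono add_mono)
    fix j
    let ?X = "\<Sum>y\<in>L. g j y * (v (t (Suc j)) y - v (t j) y)"
    have "tent N (Suc j) * ?X \<le> tent N (Suc j) * \<bar>?X\<bar>"
      using tent_bounds[of N "Suc j"] by (intro mult_left_mono) auto
    also have "\<dots> \<le> 1 * \<bar>?X\<bar>"
      using tent_bounds[of N "Suc j"] by (intro mult_right_mono) auto
    also have "\<dots> \<le> c1 / 2 * (\<delta> * ?E0 (g j) + ?I j)"
      using pairing_bound[OF t0(1)[of j] t0(3)[of j] g_out[where j=j] comp] by (simp add: t0(4))
    finally show "tent N (Suc j) * ?X \<le> c1 / 2 * (\<delta> * ?E0 (g j) + ?I j)" .
    have "\<bar>g j y * v (t j) y\<bar> \<le> ((g j y)\<^sup>2 + (v (t j) y)\<^sup>2) / 2" for y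
      using sum_squares_bound[of "\<bar>g j y\<bar>" "\<bar>v (t j) y\<bar>"] by (simp add: abs_mult)
    then have Y: "\<bar>\<Sum>y\<in>L. g j y * v (t j) y\<bar> \<le> (\<Sum>y\<in>L. ((g j y)\<^sup>2 + (v (t j) y)\<^sup>2) / 2)"
      by (intro order_trans[OF sum_abs] sum_mono)
    have "(tent N (Suc j) - tent N j) * (\<Sum>y\<in>L. g j y * v (t j) y) \<le> \<bar>tent N (Suc j) - tent N j\<bar> * \<bar>\<Sum>y\<in>L. g j y * v (t j) y\<bar>"
      by (metis abs_ge_self abs_mult)
    also have "\<dots> \<le> (1 / real N) * (\<Sum>y\<in>L. ((g j y)\<^sup>2 + (v (t j) y)\<^sup>2) / 2)"
      using tent_lipschitz[of N j] Y by (intro mult_mono) auto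
    finally show "(tent N (Suc j) - tent N j) * (\<Sum>y\<in>L. g j y * v (t j) y) \<le> (1 / real N) * (\<Sum>y\<in>L. ((g j y)\<^sup>2 + (v (t j) y)\<^sup>2) / 2)" .
  qed
  also have "\<dots> = c1 / 2 * (\<delta> * (\<Sum>j<N. ?E0 (g j)) + (\<Sum>j<N. ?I j))
      + (1 / real N) * (((\<Sum>y\<in>L. \<Sum>j<N. (g j y)\<^sup>2) + (\<Sum>j<N. mass2 (t j))) / 2)"
    unfolding mass2_def sum.distrib sum_distrib_left[symmetric] sum_divide_distrib[symmetric]
    by (subst sum.swap[of _ L]) (simp add: sum.distrib sum_distrib_left)
  finally have main: "(\<Sum>y\<in>L. time_energy N (b y)) \<le> c1 / 2 * (\<delta> * (\<Sum>j<N. ?E0 (g j)) + (\<Sum>j<N. ?I j))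
      + (1 / real N) * (((\<Sum>y\<in>L. \<Sum>j<N. (g j y)\<^sup>2) + (\<Sum>j<N. mass2 (t j))) / 2)" .
  \<comment> \<open>The contraction is applied to the difference of the samples at two sites, for each pair of sites.\<close>
  have h1: "(\<Sum>j<N. ?E0 (g j)) \<le> (\<Sum>j<N. ?E0 (v (t j)))"
  proof -
    have sq: "(\<Sum>j<N. (g j y - g j z) * (g j y - g j z)) \<le> (\<Sum>j<N. (v (t j) y - v (t j) z) * (v (t j) y - v (t j) z))" for y z
    proof -
      have "(\<Sum>j<N. (g j y - g j z) * (g j y - g j z)) = (\<Sum>j<N. (real_hilbert N (\<lambda>j. b y j - b z j) j)\<^sup>2)"
        unfolding g_def real_hilbert_diff by (simp add: power2_eq_square)
      also have "\<dots> \<le> (\<Sum>j<N. (b y j - b z j)\<^sup>2)" by (rule real_hilbert_contraction[OF N])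
      also have "\<dots> \<le> (\<Sum>j<N. (v (t j) y - v (t j) z)\<^sup>2)"
      proof (rule sum_mono)
        fix j
        have "(b y j - b z j)\<^sup>2 = (tent N j)\<^sup>2 * (v (t j) y - v (t j) z)\<^sup>2"
          by (simp add: b_def right_diff_distrib[symmetric] power_mult_distrib)
        also have "\<dots> \<le> 1 * (v (t j) y - v (t j) z)\<^sup>2"
          using tent_bounds[of N j] by (intro mult_right_mono) (auto simp: power_le_one)
        finally show "(b y j - b z j)\<^sup>2 \<le> (v (t j) y - v (t j) z)\<^sup>2" by simp
      qed
      finally show ?thesis by (simp add: power2_eq_square)
    qed
    have ex: "(\<Sum>j<N. ?E0 (h j)) = (\<Sum>y\<in>B. \<Sum>z\<in>B. w0 y z * (\<Sum>j<N. (h j y - h j z) * (h j y - h j z))) / 2" for h :: "nat \<Rightarrow> 'a \<Rightarrow> real"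
      unfolding dirichlet_form_def sum_divide_distrib[symmetric] sum_distrib_left
      by (subst sum.swap, subst (2) sum.swap) simp
    have "(\<Sum>y\<in>B. \<Sum>z\<in>B. w0 y z * (\<Sum>j<N. (g j y - g j z) * (g j y - g j z)))
      \<le> (\<Sum>y\<in>B. \<Sum>z\<in>B. w0 y z * (\<Sum>j<N. (v (t j) y - v (t j) z) * (v (t j) y - v (t j) z)))"
      by (rule sum_mono, rule sum_mono, rule mult_left_mono[OF sq w0])
    then show ?thesis unfolding ex by (intro divide_right_mono) auto
  qed
  have h2: "(\<Sum>y\<in>L. \<Sum>j<N. (g j y)\<^sup>2) \<le> (\<Sum>j<N. mass2 (t j))"
  proof -
    have "(\<Sum>y\<in>L. \<Sum>j<N. (g j y)\<^sup>2) \<le> (\<Sum>y\<in>L. \<Sum>j<N. (b y j)\<^sup>2)"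
      unfolding g_def by (intro sum_mono real_hilbert_contraction[OF N])
    also have "\<dots> \<le> (\<Sum>y\<in>L. \<Sum>j<N. (v (t j) y)\<^sup>2)"
      unfolding b_def power_mult_distrib using tent_bounds[of N]
      by (intro sum_mono mult_left_le_one_le) (auto simp: power_le_one)
    also have "\<dots> = (\<Sum>j<N. mass2 (t j))" unfolding mass2_def by (rule sum.swap)
    finally show ?thesis .
  qed
  have h3: "(\<Sum>j<N. ?I j) = (LBINT r:{\<rho>..\<rho> + real N * \<delta>}. ?E0 (v r))"
  proof -
    have "(\<Sum>j<n. ?I j) = (LBINT r:{\<rho>..t n}. ?E0 (v r))" for n
    proof (induction n)
      case 0
      then show ?case using set_lebesgue_integral_singleton[of \<rho>] by (simp add: t_def)
    next
      case (Suc n)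
      then show ?case
        using set_lebesgue_integral_combine[OF t0(2)[of n] t0(3)[of n] static_energy_int[OF \<rho>]] by simp
    qed
    then show ?thesis by (simp add: t_def)
  qed
  have h4: "(\<Sum>j<N. mass2 (t j)) \<le> real N * mass2 \<rho>"
    using sum_bounded_above[of "{..<N}" "\<lambda>j. mass2 (t j)" "mass2 \<rho>"] mass2_antimono[OF \<rho> t0(2)] by simp
  have "(1 / real N) * (((\<Sum>y\<in>L. \<Sum>j<N. (g j y)\<^sup>2) + (\<Sum>j<N. mass2 (t j))) / 2) \<le> (1 / real N) * (real N * mass2 \<rho>)"
    using h2 h4 by (intro mult_left_mono) auto
  also have "\<dots> = mass2 \<rho>" using N by simp
  finally have h5: "(1 / real N) * (((\<Sum>y\<in>L. \<Sum>j<N. (g j y)\<^sup>2) + (\<Sum>j<N. mass2 (t j))) / 2) \<le> mass2 \<rho>" .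
  have "c1 / 2 * (\<delta> * (\<Sum>j<N. ?E0 (g j)) + (\<Sum>j<N. ?I j))
    \<le> c1 / 2 * (\<delta> * (\<Sum>j<N. ?E0 (v (t j))) + (LBINT r:{\<rho>..\<rho> + real N * \<delta>}. ?E0 (v r)))"
    unfolding h3 using h1 c1 \<delta> by (intro mult_left_mono add_right_mono) auto
  with main h5 have "(\<Sum>y\<in>L. time_energy N (b y))
    \<le> c1 / 2 * (\<delta> * (\<Sum>j<N. ?E0 (v (t j))) + (LBINT r:{\<rho>..\<rho> + real N * \<delta>}. ?E0 (v r))) + mass2 \<rho>"
    by linarith
  then show ?thesis unfolding b_def t_def .
qed

text \<open>
The sum of static energies at the sampling times is not controlled for one choice of the times, but its mean over an
offset \<open>\<tau>\<close> in one sampling step is the integral of the energy over time, which the energy identity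
bounds by half of \<open>mass2 \<rho>\<close>. Going from \<open>w\<close> to \<open>w0\<close> and back costs the two factors \<open>c1\<close>.
\<close>
lemma averaged_time_energy_bound:
  assumes \<rho>: "0 \<le> \<rho>" and N: "N > 0" and \<delta>: "\<delta> > 0" and c1: "c1 \<ge> 0" and w0: "\<And>y z. 0 \<le> w0 y z"
    and comp: "AE r in lborel. \<forall>y\<in>B. \<forall>z\<in>B. w r y z \<le> c1 * w0 y z"
    and comp': "AE r in lborel. \<forall>y\<in>B. \<forall>z\<in>B. w0 y z \<le> c1 * w r y z"
  shows "(\<integral>\<^sup>+\<tau>. indicator {0..\<delta>} \<tau> * (\<Sum>y\<in>L. ennreal (time_energy N (\<lambda>j. tent N j * v (\<rho> + real j * \<delta> + \<tau>) y))) \<partial>lborel)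
    \<le> ennreal (\<delta> * (c1\<^sup>2 / 2 + 1) * mass2 \<rho>)"
proof -
  define h where "h r = dirichlet_form B w0 (v r) (v r)" for r
  have h0: "0 \<le> h r" for r unfolding h_def by (rule dirichlet_form_nonneg[OF w0])
  have h_int: "set_integrable lborel {a..b} h" if "0 \<le> a" for a b
    unfolding h_def using that by (rule static_energy_int)
  have h_cont: "continuous_on {a..b} h" if "0 \<le> a" for a b
    unfolding h_def using that by (rule static_energy_cont)
  \<comment> \<open>One step longer than the sampled range, so as to contain it for every offset.\<close>
  define H where "H = (LBINT r:{\<rho>..\<rho> + (real N + 1) * \<delta>}. h r)"
  define R where "R \<tau> = c1 / 2 * (\<delta> * (\<Sum>j<N. h (\<rho> + real j * \<delta> + \<tau>)) + H) + mass2 \<rho>" for \<tau>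
  have H0: "0 \<le> H" unfolding H_def using h0 by (intro set_lebesgue_integral_nonneg')
  have H_mono: "(LBINT r:{a..b}. h r) \<le> H" if "\<rho> \<le> a" "b \<le> \<rho> + (real N + 1) * \<delta>" for a b
  proof -
    have "set_integrable lborel {\<rho>..\<rho> + (real N + 1) * \<delta>} h" by (rule h_int[OF \<rho>])
    moreover have "set_integrable lborel {a..b} h" using that \<rho> by (intro h_int) auto
    ultimately show ?thesis unfolding H_def set_lebesgue_integral_def set_integrable_def
      using h0 that by (intro integral_mono) (auto simp: indicator_def)
  qed
  have bound: "(\<Sum>y\<in>L. time_energy N (\<lambda>j. tent N j * v (\<rho> + real j * \<delta> + \<tau>) y)) \<le> R \<tau>"
    if \<tau>: "\<tau> \<in> {0..\<delta>}" for \<tau>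
  proof -
    have "0 \<le> \<rho> + \<tau>" using \<rho> \<tau> by simp
    from sampled_time_energy_bound[OF this N \<delta> c1 w0 comp]
    have "(\<Sum>y\<in>L. time_energy N (\<lambda>j. tent N j * v (\<rho> + real j * \<delta> + \<tau>) y))
      \<le> c1 / 2 * (\<delta> * (\<Sum>j<N. h (\<rho> + real j * \<delta> + \<tau>)) + (LBINT r:{\<rho> + \<tau>..\<rho> + \<tau> + real N * \<delta>}. h r)) + mass2 (\<rho> + \<tau>)"
      unfolding h_def by (simp add: add_ac)
    also have "\<dots> \<le> R \<tau>"
    proof -
      have "(LBINT r:{\<rho> + \<tau>..\<rho> + \<tau> + real N * \<delta>}. h r) \<le> H"
        using \<tau> by (intro H_mono) (auto simp: algebra_simps)
      moreover have "mass2 (\<rho> + \<tau>) \<le> mass2 \<rho>" using \<tau> \<rho> by (intro mass2_antimono) auto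
      ultimately show ?thesis unfolding R_def using c1 \<delta> by (intro add_mono mult_left_mono) auto
    qed
    finally show ?thesis .
  qed
  have shift: "(LBINT \<tau>:{0..\<delta>}. h (a + \<tau>)) = (LBINT r:{a..a + \<delta>}. h r)" for a
  proof -
    have "(LBINT r:{a..a + \<delta>}. h r) = (LBINT \<tau>. indicator {a..a + \<delta>} (a + 1 * \<tau>) *\<^sub>R h (a + 1 * \<tau>))"
      unfolding set_lebesgue_integral_def by (subst lborel_integral_real_affine[where c=1 and t=a]) auto
    also have "\<dots> = (LBINT \<tau>:{0..\<delta>}. h (a + \<tau>))"
      unfolding set_lebesgue_integral_def
      by (rule Bochner_Integration.integral_cong) (auto simp: indicator_def)
    finally show ?thesis ..
  qed
  have hs_int: "set_integrable lborel {0..\<delta>} (\<lambda>\<tau>. h (a + \<tau>))" if "0 \<le> a" for a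
    by (rule borel_integrable_atLeastAtMost', rule continuous_on_compose2[OF h_cont[OF that, of "a + \<delta>"]])
      (auto intro!: continuous_intros)
  have sum_shift: "(\<Sum>j<n. LBINT \<tau>:{0..\<delta>}. h (\<rho> + real j * \<delta> + \<tau>)) = (LBINT r:{\<rho>..\<rho> + real n * \<delta>}. h r)" for n
  proof (induction n)
    case 0
    then show ?case using set_lebesgue_integral_singleton[of \<rho> h] by simp
  next
    case (Suc n)
    have "(LBINT r:{\<rho>..\<rho> + real n * \<delta>}. h r) + (LBINT r:{\<rho> + real n * \<delta>..\<rho> + real n * \<delta> + \<delta>}. h r)
      = (LBINT r:{\<rho>..\<rho> + real n * \<delta> + \<delta>}. h r)"
      using \<delta> by (intro set_lebesgue_integral_combine h_int \<rho>) auto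
    then show ?case using Suc shift[of "\<rho> + real n * \<delta>"] by (simp add: algebra_simps)
  qed
  have j0: "0 \<le> \<rho> + real j * \<delta>" for j using \<rho> \<delta> by simp
  have S_int: "set_integrable lborel {0..\<delta>} (\<lambda>\<tau>. \<Sum>j<N. h (\<rho> + real j * \<delta> + \<tau>))"
    by (intro set_integrable_sum hs_int j0) simp
  have c_int: "set_integrable lborel {0..\<delta>} (\<lambda>\<tau>. a)" for a :: real
    by (intro borel_integrable_atLeastAtMost' continuous_on_const)
  have c_eq: "(LBINT \<tau>:{0..\<delta>}. a) = \<delta> * a" for a :: real
    using \<delta> by (simp add: set_integral_const)
  have R_int: "set_integrable lborel {0..\<delta>} R"
    unfolding R_def by (intro set_integral_add(1) set_integrable_mult_right S_int c_int)
  have "(LBINT \<tau>:{0..\<delta>}. R \<tau>) = c1 / 2 * (\<delta> * (LBINT r:{\<rho>..\<rho> + real N * \<delta>}. h r) + \<delta> * H) + \<delta> * mass2 \<rho>"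
  proof -
    have "(LBINT \<tau>:{0..\<delta>}. R \<tau>) = (LBINT \<tau>:{0..\<delta>}. c1 / 2 * (\<delta> * (\<Sum>j<N. h (\<rho> + real j * \<delta> + \<tau>)) + H)) + \<delta> * mass2 \<rho>"
      unfolding R_def by (subst set_integral_add(2)) (auto intro!: set_integral_add(1) set_integrable_mult_right S_int c_int simp: c_eq)
    also have "(LBINT \<tau>:{0..\<delta>}. c1 / 2 * (\<delta> * (\<Sum>j<N. h (\<rho> + real j * \<delta> + \<tau>)) + H))
        = c1 / 2 * (LBINT \<tau>:{0..\<delta>}. \<delta> * (\<Sum>j<N. h (\<rho> + real j * \<delta> + \<tau>)) + H)" by (rule set_integral_mult_right)
    also have "(LBINT \<tau>:{0..\<delta>}. \<delta> * (\<Sum>j<N. h (\<rho> + real j * \<delta> + \<tau>)) + H)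
        = (LBINT \<tau>:{0..\<delta>}. \<delta> * (\<Sum>j<N. h (\<rho> + real j * \<delta> + \<tau>))) + \<delta> * H"
      by (subst set_integral_add(2)) (auto intro!: set_integrable_mult_right S_int c_int simp: c_eq)
    also have "(LBINT \<tau>:{0..\<delta>}. \<delta> * (\<Sum>j<N. h (\<rho> + real j * \<delta> + \<tau>)))
        = \<delta> * (LBINT \<tau>:{0..\<delta>}. \<Sum>j<N. h (\<rho> + real j * \<delta> + \<tau>))" by (rule set_integral_mult_right)
    also have "(LBINT \<tau>:{0..\<delta>}. \<Sum>j<N. h (\<rho> + real j * \<delta> + \<tau>)) = (\<Sum>j<N. LBINT \<tau>:{0..\<delta>}. h (\<rho> + real j * \<delta> + \<tau>))"
      by (rule set_integral_sum) (auto intro!: hs_int j0)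
    finally show ?thesis unfolding sum_shift .
  qed
  also have "\<dots> \<le> c1 / 2 * (\<delta> * H + \<delta> * H) + \<delta> * mass2 \<rho>"
    using c1 \<delta> by (intro add_mono mult_left_mono H_mono) (auto simp: algebra_simps)
  also have "\<dots> = \<delta> * (c1 * H) + \<delta> * mass2 \<rho>" by (simp add: algebra_simps)
  also have "\<dots> \<le> \<delta> * (c1 * (c1 * (mass2 \<rho> / 2))) + \<delta> * mass2 \<rho>"
  proof (intro add_mono mult_left_mono order_refl)
    let ?b = "\<rho> + (real N + 1) * \<delta>"
    have b: "\<rho> \<le> ?b" using \<delta> by simp
    note en = energy_identity[OF \<rho> b]
    have "H \<le> (LBINT r:{\<rho>..?b}. c1 * E r (v r) (v r))"
      unfolding H_def set_lebesgue_integral_def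
    proof (rule integral_mono_AE)
      show "integrable lborel (\<lambda>r. indicator {\<rho>..?b} r *\<^sub>R h r)" using h_int[OF \<rho>] unfolding set_integrable_def .
      show "integrable lborel (\<lambda>r. indicator {\<rho>..?b} r *\<^sub>R (c1 * E r (v r) (v r)))"
        using set_integrable_mult_right[OF en(1), of c1] unfolding set_integrable_def .
      show "AE r in lborel. indicator {\<rho>..?b} r *\<^sub>R h r \<le> indicator {\<rho>..?b} r *\<^sub>R (c1 * E r (v r) (v r))"
        using comp' by eventually_elim (auto simp: indicator_def h_def intro!: dirichlet_form_mono)
    qed
    also have "\<dots> = c1 * (LBINT r:{\<rho>..?b}. E r (v r) (v r))" by (rule set_integral_mult_right)
    also have "\<dots> \<le> c1 * (mass2 \<rho> / 2)"
      using en(2) mass2_nonneg[of ?b] c1 by (intro mult_left_mono) auto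
    finally show "H \<le> c1 * (mass2 \<rho> / 2)" .
  qed (use c1 \<delta> in auto)
  also have "\<dots> = \<delta> * (c1\<^sup>2 / 2 + 1) * mass2 \<rho>" by (simp add: power2_eq_square algebra_simps)
  finally have total: "(LBINT \<tau>:{0..\<delta>}. R \<tau>) \<le> \<delta> * (c1\<^sup>2 / 2 + 1) * mass2 \<rho>" .
  have R0: "0 \<le> R \<tau>" for \<tau> unfolding R_def using c1 \<delta> h0 H0 mass2_nonneg
    by (intro add_nonneg_nonneg mult_nonneg_nonneg sum_nonneg) auto
  have "(\<integral>\<^sup>+\<tau>. indicator {0..\<delta>} \<tau> * (\<Sum>y\<in>L. ennreal (time_energy N (\<lambda>j. tent N j * v (\<rho> + real j * \<delta> + \<tau>) y))) \<partial>lborel)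
    \<le> (\<integral>\<^sup>+\<tau>. ennreal (indicator {0..\<delta>} \<tau> *\<^sub>R R \<tau>) \<partial>lborel)"
    using bound by (intro nn_integral_mono) (auto simp: indicator_def time_energy_nonneg intro!: ennreal_leI)
  also have "\<dots> = ennreal (LBINT \<tau>:{0..\<delta>}. R \<tau>)"
    unfolding set_lebesgue_integral_def
    by (rule nn_integral_eq_integral) (use R_int R0 in \<open>auto simp: set_integrable_def\<close>)
  also have "\<dots> \<le> ennreal (\<delta> * (c1\<^sup>2 / 2 + 1) * mass2 \<rho>)" by (rule ennreal_leI[OF total])
  finally show ?thesis .
qed

end

section \<open>Walks killed outside a box\<close>

definition cube :: "nat \<Rightarrow> 'n::finite site set" where
  "cube k = {x. \<forall>i. \<bar>x $ i\<bar> \<le> int k}"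

lemma finite_cube: "finite (cube k :: 'n::finite site set)"
proof -
  have "(cube k :: 'n site set) \<subseteq> vec_lambda ` (UNIV \<rightarrow>\<^sub>E {- int k..int k})"
  proof
    fix z :: "'n site" assume "z \<in> cube k"
    have "- int k \<le> z $ i \<and> z $ i \<le> int k" for i
    proof -
      have "\<bar>z $ i\<bar> \<le> int k" using \<open>z \<in> cube k\<close> unfolding cube_def by simp
      then show ?thesis by linarith
    qed
    then show "z \<in> vec_lambda ` (UNIV \<rightarrow>\<^sub>E {- int k..int k})"
      by (intro image_eqI[of _ _ "vec_nth z"]) auto
  qed
  then show ?thesis by (rule finite_subset) (intro finite_imageI finite_PiE, auto)
qed

lemma cube_mono: "k \<le> l \<Longrightarrow> (cube k :: 'n::finite site set) \<subseteq> cube l"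
proof
  fix x :: "'n site" assume kl: "k \<le> l" and x: "x \<in> cube k"
  have "\<bar>x $ i\<bar> \<le> int l" for i
  proof -
    have "\<bar>x $ i\<bar> \<le> int k" using x unfolding cube_def by simp
    also have "\<dots> \<le> int l" using kl by simp
    finally show ?thesis .
  qed
  then show "x \<in> cube l" by (simp add: cube_def)
qed

lemma eventually_in_cube: "\<forall>\<^sub>F k in sequentially. x \<in> (cube k :: 'n::finite site set)"
proof -
  have "x \<in> cube k" if k: "k \<ge> nat (\<Sum>i\<in>UNIV. \<bar>x $ i\<bar>)" for k
  proof -
    have "\<bar>x $ i\<bar> \<le> (\<Sum>i\<in>UNIV. \<bar>x $ i\<bar>)" for i by (rule member_le_sum) auto
    moreover have "(\<Sum>i\<in>UNIV. \<bar>x $ i\<bar>) \<le> int k" using k by linarith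
    ultimately show ?thesis unfolding cube_def using order_trans by blast
  qed
  then show ?thesis by (rule eventually_sequentiallyI)
qed

lemma bond_coordinate: "(x, y) \<in> bonds \<Longrightarrow> \<bar>x $ i - y $ i\<bar> \<le> 1"
  using member_le_sum[of i UNIV "\<lambda>i. \<bar>x $ i - y $ i\<bar>"] unfolding bonds_def graph_dist_def by auto

lemma bond_in_cube: assumes "(x, y) \<in> bonds" "x \<in> cube k" shows "y \<in> cube (Suc k)"
proof -
  have "\<bar>y $ i\<bar> \<le> int (Suc k)" for i
  proof -
    have "\<bar>x $ i - y $ i\<bar> \<le> 1" by (rule bond_coordinate[OF assms(1)])
    moreover have "\<bar>x $ i\<bar> \<le> int k" using assms(2) by (simp add: cube_def)
    ultimately show ?thesis by linarith
  qed
  then show ?thesis by (simp add: cube_def)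
qed

lemma axis_bond: "(x, x + axis i 1) \<in> (bonds :: ('n::finite site \<times> 'n site) set)"
  unfolding bonds_def graph_dist_def by (simp add: axis_def if_distrib[of abs] cong: if_cong)

text \<open>
All bonds along the coordinate directions carry at least the weight \<open>c0\<close>. Sites at distance one from the
support are required to lie in \<open>B\<close>, so that no difference of \<open>u\<close> is lost.
\<close>
lemma gradient_energy_le_dirichlet_form:
  fixes u :: "'n::finite site \<Rightarrow> real"
  assumes B: "finite B" and u: "\<And>x. u x \<noteq> 0 \<Longrightarrow> x \<in> B \<and> (\<forall>i. x + axis i 1 \<in> B \<and> x - axis i 1 \<in> B)"
    and w0: "\<And>x y. 0 \<le> w x y" and wb: "\<And>x y. x \<in> B \<Longrightarrow> y \<in> B \<Longrightarrow> (x, y) \<in> bonds \<Longrightarrow> c0 \<le> w x y" and c0: "0 \<le> c0"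
  shows "c0 * gradient_energy u \<le> 2 * dirichlet_form B w u u"
proof -
  let ?e = "\<lambda>i. axis i 1 :: 'n site"
  let ?B' = "\<lambda>i. {x \<in> B. x + ?e i \<in> B}"
  let ?t = "\<lambda>x y. w x y * ((u x - u y) * (u x - u y))"
  have gap: "(translation_gap u (?e i))\<^sup>2 = (\<Sum>x\<in>?B' i. (u x - u (x + ?e i))\<^sup>2)" for i
  proof -
    have "(translation_gap u (?e i))\<^sup>2 = (\<Sum>\<^sub>\<infinity>x. (u (x + ?e i) - u x)\<^sup>2)"
      unfolding translation_gap_def l2norm_def by (simp add: infsum_nonneg)
    also have "\<dots> = (\<Sum>x\<in>?B' i. (u (x + ?e i) - u x)\<^sup>2)"
    proof (rule infsum_finite_support)
      fix x assume x: "x \<notin> ?B' i"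
      have "u x = 0" using u[of x] x by blast
      moreover have "u (x + ?e i) = 0"
      proof (rule ccontr)
        assume "u (x + ?e i) \<noteq> 0"
        from u[OF this] have "x + ?e i \<in> B" "x + ?e i - ?e i \<in> B" by blast+
        then show False using x by simp
      qed
      ultimately show "(u (x + ?e i) - u x)\<^sup>2 = 0" by simp
    qed (use B in auto)
    finally show ?thesis by (simp add: power2_commute)
  qed
  have "c0 * gradient_energy u = (\<Sum>i\<in>UNIV. \<Sum>x\<in>?B' i. c0 * (u x - u (x + ?e i))\<^sup>2)"
    unfolding gradient_energy_def gap by (simp add: sum_distrib_left)
  also have "\<dots> \<le> (\<Sum>i\<in>UNIV. \<Sum>x\<in>?B' i. ?t x (x + ?e i))"
    unfolding power2_eq_square using wb axis_bond by (intro sum_mono mult_right_mono) auto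
  also have "\<dots> = (\<Sum>p\<in>Sigma UNIV ?B'. ?t (snd p) (snd p + ?e (fst p)))"
    using B by (subst sum.Sigma) (auto simp: case_prod_beta')
  also have "\<dots> = (\<Sum>q\<in>(\<lambda>p. (snd p, snd p + ?e (fst p))) ` Sigma UNIV ?B'. ?t (fst q) (snd q))"
  proof (subst sum.reindex)
    show "inj_on (\<lambda>p. (snd p, snd p + ?e (fst p))) (Sigma UNIV ?B')"
      by (auto simp: inj_on_def axis_eq_axis)
  qed simp
  also have "\<dots> \<le> (\<Sum>q\<in>B \<times> B. ?t (fst q) (snd q))"
  proof (rule sum_mono2)
    show "0 \<le> ?t (fst b) (snd b)" for b by (intro mult_nonneg_nonneg[OF w0 zero_le_square])
  qed (use B in auto)
  also have "\<dots> = 2 * dirichlet_form B w u u"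
    unfolding dirichlet_form_def by (simp add: sum.cartesian_product case_prod_beta')
  finally show ?thesis .
qed

definition symmetric_env :: "'n::finite environment \<Rightarrow> bool" where
  "symmetric_env \<omega> \<longleftrightarrow> (\<forall>t x y. \<omega> t (x, y) = \<omega> t (y, x))"

text \<open>
Jumps that leave the box are suppressed, while the exit rate is kept.
\<close>
definition killed_rates :: "nat \<Rightarrow> 'n::finite environment \<Rightarrow> real \<Rightarrow> 'n site \<Rightarrow> 'n site \<Rightarrow> real" where
  "killed_rates k \<omega> u x y = (if x \<in> cube k \<and> y \<in> cube k then \<omega> u (x, y) else 0)"

abbreviation full_kernel :: "'n::finite environment \<Rightarrow> real \<Rightarrow> real \<Rightarrow> 'n site \<Rightarrow> 'n site \<Rightarrow> ennreal" where
  "full_kernel \<omega> \<equiv> transition (\<lambda>u x y. \<omega> u (x, y)) (exit_rate \<omega>)"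

abbreviation killed_kernel :: "nat \<Rightarrow> 'n::finite environment \<Rightarrow> real \<Rightarrow> real \<Rightarrow> 'n site \<Rightarrow> 'n site \<Rightarrow> ennreal" where
  "killed_kernel k \<omega> \<equiv> transition (killed_rates k \<omega>) (exit_rate \<omega>)"

context
  fixes \<omega> :: "'n::finite environment"
  assumes env: "\<omega> \<in> environments" and loc: "locally_integrable_rates \<omega>" and sym: "symmetric_env \<omega>"
begin

interpretation J: jump_rates "\<lambda>u x y. \<omega> u (x, y)" "exit_rate \<omega>"
  by (rule jump_rates_environment[OF env loc])

lemma killed_jump_rates: "jump_rates (killed_rates k \<omega>) (exit_rate \<omega>)"
proof
  show "(\<lambda>u. killed_rates k \<omega> u x y) \<in> borel_measurable borel" for x y
    unfolding killed_rates_def using J.c_measurable[of x y] by (cases "x \<in> cube k \<and> y \<in> cube k") simp_all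
  show "0 \<le> killed_rates k \<omega> u x y" for u x y using J.c_nonneg[of u x y] by (simp add: killed_rates_def)
qed (use J.m_measurable J.m_nonneg J.m_integrable in auto)

text \<open>
Any two sites are eventually inside the box, so the truncated rates increase to the full ones.
\<close>
lemma killed_kernel_tendsto:
  "incseq (\<lambda>k. killed_kernel k \<omega> s t x y)"
  "(\<lambda>k. killed_kernel k \<omega> s t x y) \<longlonglongrightarrow> full_kernel \<omega> s t x y"
proof -
  have inc: "incseq (\<lambda>k. killed_rates k \<omega> u x y)" for u x y
  proof (rule incseq_SucI)
    fix k show "killed_rates k \<omega> u x y \<le> killed_rates (Suc k) \<omega> u x y"
      using cube_mono[of k "Suc k"] J.c_nonneg[of u x y] by (auto simp: killed_rates_def)
  qed
  have ev: "\<forall>\<^sub>F k in sequentially. killed_rates k \<omega> u x y = \<omega> u (x, y)" for u x y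
    using eventually_in_cube[of x] eventually_in_cube[of y] by eventually_elim (simp add: killed_rates_def)
  show "incseq (\<lambda>k. killed_kernel k \<omega> s t x y)"
    "(\<lambda>k. killed_kernel k \<omega> s t x y) \<longlonglongrightarrow> full_kernel \<omega> s t x y"
    using transition_mono_tendsto[of "\<lambda>k. killed_rates k \<omega>" "exit_rate \<omega>" "\<lambda>u x y. \<omega> u (x, y)", OF killed_jump_rates inc ev]
    by blast+
qed

lemma killed_kernel_le: "killed_kernel k \<omega> s t x y \<le> full_kernel \<omega> s t x y"
  using incseq_le[OF killed_kernel_tendsto] .

lemma full_kernel_le_1: "s \<le> t \<Longrightarrow> full_kernel \<omega> s t x y \<le> 1"
proof -
  assume st: "s \<le> t"
  have "full_kernel \<omega> s t x y \<le> (\<integral>\<^sup>+y. full_kernel \<omega> s t x y \<partial>count_space UNIV)"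
    by (rule nn_integral_ge_point) simp
  also have "\<dots> \<le> 1" by (rule transition_sum_le_1[OF env loc st])
  finally show ?thesis .
qed

lemma rate_int: "set_integrable lborel {a..b} (\<lambda>u. \<omega> u (x, y))"
proof (cases "(x, y) \<in> bonds")
  case True
  then show ?thesis using loc unfolding locally_integrable_rates_def by blast
next
  case False
  then have "\<omega> u (x, y) = 0" for u using env unfolding environments_def by blast
  then show ?thesis by (simp add: set_integrable_def)
qed

definition killed_flow :: "nat \<Rightarrow> 'n site \<Rightarrow> real \<Rightarrow> 'n site \<Rightarrow> real" where
  "killed_flow k x t y = enn2real (killed_kernel k \<omega> 0 t x y)"

text \<open>
The forward equation in the box. Since the exit rate also counts the bonds that leave the box, the generator
is the one on the box enlarged by one layer, with value zero on the layer.
\<close>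
lemma killed_flow_finite_heat_flow:
  assumes x: "x \<in> cube k"
  shows "finite_heat_flow (\<lambda>r y z. \<omega> r (y, z)) (killed_flow k x) (cube k) (cube (Suc k))"
proof -
  interpret Q: jump_rates "killed_rates k \<omega>" "exit_rate \<omega>" by (rule killed_jump_rates)
  have out: "killed_kernel k \<omega> s t x y = 0" if "y \<notin> cube k" for s t y
    using x that by (subst Q.transition_last_jump) (auto simp: killed_rates_def)
  have out': "killed_flow k x r y = 0" if "y \<notin> cube k" for r y
    unfolding killed_flow_def out[OF that] by simp
  have le1: "killed_kernel k \<omega> 0 r x z \<le> 1" if "0 \<le> r" for r z
    using killed_kernel_le full_kernel_le_1[OF that] by (rule order_trans)
  have kint: "set_integrable lborel {a..b} (\<lambda>u. killed_rates k \<omega> u z y)" for a b z y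
    unfolding killed_rates_def using rate_int[of a b z y] by (cases "z \<in> cube k \<and> y \<in> cube k") (auto simp: set_integrable_def)
  have exit: "exit_rate \<omega> r y = (\<Sum>z\<in>cube (Suc k). \<omega> r (y, z))" if "y \<in> cube k" for r y
    unfolding exit_rate_def
  proof (rule sum.mono_neutral_left[OF finite_cube])
    show "{z. (y, z) \<in> bonds} \<subseteq> cube (Suc k)" using bond_in_cube[OF _ that] by blast
    show "\<forall>i\<in>cube (Suc k) - {z. (y, z) \<in> bonds}. \<omega> r (y, i) = 0"
      using env unfolding environments_def by blast
  qed
  have gen: "(\<Sum>z\<in>cube k. killed_flow k x r z * killed_rates k \<omega> r z y) - exit_rate \<omega> r y * killed_flow k x r y
      = (\<Sum>z\<in>cube (Suc k). \<omega> r (y, z) * (killed_flow k x r z - killed_flow k x r y))" if y: "y \<in> cube k" for r y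
  proof -
    have "(\<Sum>z\<in>cube k. killed_flow k x r z * killed_rates k \<omega> r z y) = (\<Sum>z\<in>cube k. \<omega> r (y, z) * killed_flow k x r z)"
      using y sym by (intro sum.cong refl) (auto simp: killed_rates_def symmetric_env_def)
    also have "\<dots> = (\<Sum>z\<in>cube (Suc k). \<omega> r (y, z) * killed_flow k x r z)"
      using cube_mono[of k "Suc k"] out' by (intro sum.mono_neutral_left finite_cube) auto
    finally show ?thesis unfolding exit[OF y]
      by (simp add: sum_distrib_right right_diff_distrib sum_subtractf)
  qed
  have fw: "set_integrable lborel {0..t} (\<lambda>r. \<Sum>z\<in>cube (Suc k). \<omega> r (y, z) * (killed_flow k x r z - killed_flow k x r y))"
    "killed_flow k x t y = (if x = y then 1 else 0) + (LBINT r:{0..t}. \<Sum>z\<in>cube (Suc k). \<omega> r (y, z) * (killed_flow k x r z - killed_flow k x r y))"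
    if t: "0 \<le> t" and y: "y \<in> cube k" for t y
  proof -
    have N0: "killed_rates k \<omega> u z y = 0" if "z \<notin> cube k" for u z
      using that by (simp add: killed_rates_def)
    note F = Q.forward_equation[OF t le1 finite_cube[of k] N0 kint]
    show "set_integrable lborel {0..t} (\<lambda>r. \<Sum>z\<in>cube (Suc k). \<omega> r (y, z) * (killed_flow k x r z - killed_flow k x r y))"
      using F(1) unfolding killed_flow_def[symmetric] gen[OF y] .
    show "killed_flow k x t y = (if x = y then 1 else 0) + (LBINT r:{0..t}. \<Sum>z\<in>cube (Suc k). \<omega> r (y, z) * (killed_flow k x r z - killed_flow k x r y))"
      using F(2) unfolding killed_flow_def[symmetric] gen[OF y] .
  qed
  show ?thesis
  proof
    show "\<omega> r (y, z) = \<omega> r (z, y)" for r y z using sym unfolding symmetric_env_def by blast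
    show "finite (cube (Suc k) :: 'n site set)" by (rule finite_cube)
    show "cube k \<subseteq> (cube (Suc k) :: 'n site set)" by (rule cube_mono) simp
    show "0 \<le> \<omega> r (y, z)" for r y z by (rule J.c_nonneg)
    show "(\<lambda>r. \<omega> r (y, z)) \<in> borel_measurable borel" for y z by (rule J.c_measurable)
    show "set_integrable lborel {a..b} (\<lambda>r. \<omega> r (y, z))" for a b y z by (rule rate_int)
    show "killed_flow k x r y = 0" if "y \<notin> cube k" for r y by (rule out'[OF that])
    fix s t :: real and y :: "'n site" assume st: "0 \<le> s" "s \<le> t" and y: "y \<in> cube k"
    let ?f = "\<lambda>r. \<Sum>z\<in>cube (Suc k). \<omega> r (y, z) * (killed_flow k x r z - killed_flow k x r y)"
    have t0: "0 \<le> t" using st by simp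
    show "set_integrable lborel {s..t} ?f" using fw(1)[OF t0 y] by (rule set_integrable_subset) (use st in auto)
    show "killed_flow k x t y = killed_flow k x s y + (LBINT r:{s..t}. ?f r)"
    proof -
      have "(LBINT r:{0..s}. ?f r) + (LBINT r:{s..t}. ?f r) = (LBINT r:{0..t}. ?f r)"
        by (rule set_lebesgue_integral_combine[OF st fw(1)[OF t0 y]])
      moreover note fw(2)[OF t0 y] fw(2)[OF st(1) y]
      ultimately show ?thesis by linarith
    qed
  qed
qed

end

text \<open>
The value that the dissipation lemma produces for \<open>p = 2 / d\<close> and \<open>\<kappa> = c0 / (16 * d)\<close>.
\<close>
definition nash_constant :: "real \<Rightarrow> real \<Rightarrow> real" where
  "nash_constant d c0 = (2 powr (1 + d / 2) / (c0 / (16 * d))) powr (d / 2)"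

context
  fixes \<omega> :: "'n::finite environment" and c0 :: real
  assumes env: "\<omega> \<in> environments" and loc: "locally_integrable_rates \<omega>" and sym: "symmetric_env \<omega>"
    and c0: "c0 > 0" and elliptic: "AE r in lborel. \<forall>e\<in>bonds. c0 \<le> \<omega> r e"
begin

text \<open>
The Nash inequality bounds the dissipation rate of the squared norm from below by a power of it, as the total mass is at most one.
\<close>
lemma killed_flow_decay:
  assumes x: "x \<in> cube k" and t: "t > 0"
  shows "(\<Sum>y\<in>cube k. (killed_flow \<omega> k x t y)\<^sup>2) \<le> nash_constant (real CARD('n)) c0 * t powr (- real CARD('n) / 2)"
proof -
  let ?d = "real CARD('n)" and ?v = "killed_flow \<omega> k x"
  have d0: "?d > 0" by simp
  interpret H: finite_heat_flow "\<lambda>r y z. \<omega> r (y, z)" ?v "cube k" "cube (Suc k)"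
    by (rule killed_flow_finite_heat_flow[OF env loc sym x])
  have v0: "0 \<le> ?v r y" for r y by (simp add: killed_flow_def[OF env loc sym])
  have fin: "finite {y. ?v r y \<noteq> 0}" for r
    by (rule finite_subset[OF _ finite_cube[of k]]) (use H.v_out in blast)
  have sum1: "(\<Sum>y\<in>cube k. ?v r y) \<le> 1" if r: "0 \<le> r" for r
  proof -
    have kk: "killed_kernel k \<omega> 0 r x y = ennreal (?v r y)" for y
    proof -
      have "killed_kernel k \<omega> 0 r x y \<le> 1"
        using killed_kernel_le[OF env loc sym] full_kernel_le_1[OF env loc sym r] by (rule order_trans)
      then have "killed_kernel k \<omega> 0 r x y < top" by (rule order_le_less_trans) simp
      then show ?thesis unfolding killed_flow_def[OF env loc sym] by simp
    qed
    have "ennreal (\<Sum>y\<in>cube k. ?v r y) = (\<Sum>y\<in>cube k. killed_kernel k \<omega> 0 r x y)"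
      unfolding kk using v0 by (simp add: sum_ennreal)
    also have "\<dots> = (\<integral>\<^sup>+y\<in>cube k. killed_kernel k \<omega> 0 r x y \<partial>count_space UNIV)"
      by (subst nn_integral_count_space'[of "cube k"]) (auto simp: finite_cube indicator_def)
    also have "\<dots> \<le> (\<integral>\<^sup>+y. full_kernel \<omega> 0 r x y \<partial>count_space UNIV)"
      using killed_kernel_le[OF env loc sym] by (intro nn_integral_mono) (auto simp: indicator_def)
    also have "\<dots> \<le> 1" by (rule transition_sum_le_1[OF env loc r])
    finally show ?thesis by simp
  qed
  have inf1: "(\<Sum>\<^sub>\<infinity>y. ?v r y) = (\<Sum>y\<in>cube k. ?v r y)" for r
    by (rule infsum_finite_support[OF finite_cube]) (rule H.v_out)
  have inf2: "(\<Sum>\<^sub>\<infinity>y. (?v r y)\<^sup>2) = H.mass2 r" for r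
    unfolding H.mass2_def by (rule infsum_finite_support[OF finite_cube]) (simp add: H.v_out)
  have dis: "c0 / (16 * ?d) * (t - s) * H.mass2 t powr (1 + 2 / ?d) \<le> H.mass2 s - H.mass2 t"
    if st: "0 \<le> s" "s \<le> t" for s t
  proof -
    let ?K = "c0 / (16 * ?d) * H.mass2 t powr (1 + 2 / ?d)"
    have "(t - s) * ?K = (LBINT r:{s..t}. ?K)" using st by (simp add: set_integral_const)
    also have "\<dots> \<le> (LBINT r:{s..t}. 2 * dirichlet_form (cube (Suc k)) (\<lambda>y z. \<omega> r (y, z)) (?v r) (?v r))"
      unfolding set_lebesgue_integral_def
    proof (rule integral_mono_AE)
      show "integrable lborel (\<lambda>r. indicator {s..t} r *\<^sub>R ?K)"
        using borel_integrable_atLeastAtMost'[OF continuous_on_const, of s t ?K] unfolding set_integrable_def .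
      show "integrable lborel (\<lambda>r. indicator {s..t} r *\<^sub>R (2 * dirichlet_form (cube (Suc k)) (\<lambda>y z. \<omega> r (y, z)) (?v r) (?v r)))"
        using set_integrable_mult_right[OF H.energy_identity(1)[OF st], of 2] unfolding set_integrable_def .
      show "AE r in lborel. indicator {s..t} r *\<^sub>R ?K
          \<le> indicator {s..t} r *\<^sub>R (2 * dirichlet_form (cube (Suc k)) (\<lambda>y z. \<omega> r (y, z)) (?v r) (?v r))"
        using elliptic
      proof eventually_elim
        case (elim r)
        show ?case
        proof (cases "r \<in> {s..t}")
          case True
          then have r: "0 \<le> r" "r \<le> t" using st by auto
          have "H.mass2 t powr (1 + 2 / ?d) / (16 * ?d) \<le> H.mass2 r powr (1 + 2 / ?d) / (16 * ?d)"
            using H.mass2_antimono[OF r] H.mass2_nonneg[of t] by (intro divide_right_mono powr_mono2) auto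
          also have "\<dots> \<le> gradient_energy (?v r)"
            using nash_inequality[OF fin v0, of r] sum1[OF r(1)] unfolding inf1 inf2 by simp
          finally have "?K \<le> c0 * gradient_energy (?v r)" using c0
            by (metis (no_types, lifting) less_imp_le mult_left_mono times_divide_eq_left times_divide_eq_right mult.commute)
          also have "\<dots> \<le> 2 * dirichlet_form (cube (Suc k)) (\<lambda>y z. \<omega> r (y, z)) (?v r) (?v r)"
          proof (rule gradient_energy_le_dirichlet_form[OF finite_cube])
            fix y assume "?v r y \<noteq> 0"
            then have y: "y \<in> cube k" using H.v_out by blast
            have "y + axis i 1 \<in> cube (Suc k)" for i by (rule bond_in_cube[OF axis_bond y])
            moreover have "y - axis i 1 \<in> cube (Suc k)" for i
            proof -
              have "(y - axis i 1, y) \<in> bonds" using axis_bond[of "y - axis i 1" i] by simp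
              then have "(y, y - axis i 1) \<in> bonds" unfolding bonds_def graph_dist_def by (simp add: abs_minus_commute)
              then show ?thesis by (rule bond_in_cube[OF _ y])
            qed
            ultimately show "y \<in> cube (Suc k) \<and> (\<forall>i. y + axis i 1 \<in> cube (Suc k) \<and> y - axis i 1 \<in> cube (Suc k))"
              using y cube_mono[of k "Suc k"] by auto
          qed (use H.w_nonneg elim c0 in auto)
          finally show ?thesis using True by simp
        qed simp
      qed
    qed
    also have "\<dots> = 2 * (LBINT r:{s..t}. dirichlet_form (cube (Suc k)) (\<lambda>y z. \<omega> r (y, z)) (?v r) (?v r))"
      by (rule set_integral_mult_right)
    also have "\<dots> = H.mass2 s - H.mass2 t" by (rule H.energy_identity(2)[OF st, symmetric])
    finally show ?thesis by (simp add: mult_ac)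
  qed
  have bounds: "0 \<le> H.mass2 t \<and> H.mass2 t \<le> 1" if "0 \<le> t" for t
  proof -
    have "H.mass2 t \<le> (\<Sum>y\<in>cube k. ?v t y)"
      unfolding H.mass2_def
    proof (rule sum_mono)
      fix y :: "'n site" assume "y \<in> cube k"
      then have "?v t y \<le> (\<Sum>y\<in>cube k. ?v t y)" using v0 finite_cube by (intro member_le_sum) auto
      then have "?v t y \<le> 1" using sum1[OF that] by simp
      then show "(?v t y)\<^sup>2 \<le> ?v t y" using v0[of t y] by (simp add: power2_eq_square mult_left_le)
    qed
    then show ?thesis using sum1[OF that] H.mass2_nonneg by auto
  qed
  have "H.mass2 t \<le> (2 powr (1 + 1 / (2 / ?d)) / (c0 / (16 * ?d))) powr (1 / (2 / ?d)) * t powr (- 1 / (2 / ?d))"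
    by (rule superlinear_dissipation_decay[OF bounds _ _ dis t]) (use c0 in auto)
  then show ?thesis by (simp add: nash_constant_def H.mass2_def)
qed

end

section \<open>Quenched bounds on the whole lattice\<close>

definition reversed_env :: "'n::finite environment \<Rightarrow> 'n environment" where
  "reversed_env \<omega> = (\<lambda>t. \<omega> (- t))"

text \<open>
What the proof uses of one environment. The hypotheses on the law hold for each time separately,
so for a fixed environment they hold at almost every time.
\<close>
definition regular_env :: "real \<Rightarrow> real \<Rightarrow> 'n::finite environment \<Rightarrow> bool" where
  "regular_env c0 c1 \<omega> \<longleftrightarrow> \<omega> \<in> environments \<and> locally_integrable_rates \<omega> \<and> symmetric_env \<omega> \<and>
     (AE r in lborel. \<forall>e\<in>bonds. c0 \<le> \<omega> r e \<and> \<omega> r e \<le> c1 * \<omega> 0 e \<and> \<omega> 0 e \<le> c1 * \<omega> r e)"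

lemma AE_lborel_reflect:
  assumes "AE r in lborel. Q (r :: real)" shows "AE r in lborel. Q (- r)"
proof -
  have "AE r in distr lborel borel uminus. Q (r :: real)"
    using assms by (simp only: lborel_distr_uminus)
  then show ?thesis by (rule AE_distrD[rotated]) simp
qed

lemma regular_env_reversed:
  assumes "regular_env c0 c1 \<omega>" shows "regular_env c0 c1 (reversed_env \<omega>)"
proof -
  have "set_integrable lborel {a..b} (\<lambda>t. \<omega> (- t) e)" if "e \<in> bonds" for a b e
  proof -
    have "set_integrable lborel {-b..-a} (\<lambda>t. \<omega> t e)"
      using assms that unfolding regular_env_def locally_integrable_rates_def by blast
    then have "integrable lborel (\<lambda>t. indicator {-b..-a} (0 + (-1) * t) *\<^sub>R \<omega> (0 + (-1) * t) e)"
      unfolding set_integrable_def by (intro lborel_integrable_real_affine) auto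
    then show ?thesis unfolding set_integrable_def
      by (rule back_subst[of "integrable lborel"]) (auto simp: indicator_def fun_eq_iff)
  qed
  moreover have "AE r in lborel. \<forall>e\<in>bonds. c0 \<le> \<omega> (- r) e \<and> \<omega> (- r) e \<le> c1 * \<omega> 0 e \<and> \<omega> 0 e \<le> c1 * \<omega> (- r) e"
    by (rule AE_lborel_reflect) (use assms in \<open>simp add: regular_env_def\<close>)
  moreover have "reversed_env \<omega> \<in> environments"
    using assms unfolding regular_env_def reversed_env_def environments_def by blast
  moreover have "symmetric_env (reversed_env \<omega>)"
    using assms unfolding regular_env_def reversed_env_def symmetric_env_def by blast
  ultimately show ?thesis
    unfolding regular_env_def locally_integrable_rates_def by (simp add: reversed_env_def)
qed

text \<open>
By symmetry of the conductances the reversed walk uses the same bonds.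
\<close>
lemma full_kernel_reversed:
  assumes "\<omega> \<in> environments" "locally_integrable_rates \<omega>" "symmetric_env \<omega>"
    "reversed_env \<omega> \<in> environments" "locally_integrable_rates (reversed_env \<omega>)"
  shows "full_kernel \<omega> s t x y = full_kernel (reversed_env \<omega>) (- t) (- s) y x"
proof (rule transition_reversal)
  show "jump_rates (\<lambda>u x y. \<omega> u (x, y)) (exit_rate \<omega>)" by (rule jump_rates_environment) fact+
  show "jump_rates (\<lambda>u x y. reversed_env \<omega> u (x, y)) (exit_rate (reversed_env \<omega>))"
    by (rule jump_rates_environment) fact+
  show "reversed_env \<omega> u (x, y) = \<omega> (- u) (y, x)" for u x y
    using assms(3) unfolding symmetric_env_def reversed_env_def by blast
  show "exit_rate (reversed_env \<omega>) u x = exit_rate \<omega> (- u) x" for u x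
    by (simp add: exit_rate_def reversed_env_def)
qed

text \<open>
Covariance under a simultaneous translation of time by \<open>a\<close> and relabelling of the sites by \<open>\<sigma>\<close>.
\<close>
lemma path_kernel_shift:
  assumes "jump_rates c m" "jump_rates c' m'" and bij: "bij \<sigma>"
    and c': "\<And>u x y. c' u x y = c (u + a) (\<sigma> x) (\<sigma> y)" and m': "\<And>u x. m' u x = m (u + a) (\<sigma> x)"
  shows "path_kernel c' m' n s t x y = path_kernel c m n (s + a) (t + a) (\<sigma> x) (\<sigma> y)"
proof -
  interpret A: jump_rates c m by fact
  interpret B: jump_rates c' m' by fact
  have S: "survival m' s t x = survival m (s + a) (t + a) (\<sigma> x)" for s t x
  proof -
    have "(LBINT u:{s + a..t + a}. m u (\<sigma> x)) = (LBINT u. indicator {s + a..t + a} (a + 1 * u) *\<^sub>R m (a + 1 * u) (\<sigma> x))"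
      unfolding set_lebesgue_integral_def by (subst lborel_integral_real_affine[where c=1 and t=a]) auto
    also have "\<dots> = (LBINT u:{s..t}. m (u + a) (\<sigma> x))"
      unfolding set_lebesgue_integral_def
      by (rule Bochner_Integration.integral_cong) (auto simp: indicator_def add.commute)
    finally show ?thesis unfolding survival_def m' by simp
  qed
  show ?thesis
  proof (induction n arbitrary: t y)
    case 0
    have "x = y \<longleftrightarrow> \<sigma> x = \<sigma> y" using bij by (auto dest: bij_is_inj simp: inj_eq)
    then show ?case by (simp add: S)
  next
    case (Suc n)
    note [measurable] = borel_measurable_indicator_Icc
    have m1: "(\<lambda>u. \<integral>\<^sup>+z. path_kernel c m n (s + a) u (\<sigma> x) z * ennreal (c u z (\<sigma> y)) \<partial>count_space UNIV) \<in> borel_measurable borel"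
      by (rule borel_measurable_nn_integral_count_space) measurable
    note [measurable] = m1
    have "path_kernel c m (Suc n) (s + a) (t + a) (\<sigma> x) (\<sigma> y) = (\<integral>\<^sup>+u. indicator {s + a..t + a} u *
     ((\<integral>\<^sup>+z. path_kernel c m n (s + a) u (\<sigma> x) z * ennreal (c u z (\<sigma> y)) \<partial>count_space UNIV) * ennreal (survival m u (t + a) (\<sigma> y))) \<partial>lborel)"
      by (rule path_kernel.simps(2))
    also have "\<dots> = (\<integral>\<^sup>+u. indicator {s + a..t + a} (a + 1 * u) *
     ((\<integral>\<^sup>+z. path_kernel c m n (s + a) (a + 1 * u) (\<sigma> x) z * ennreal (c (a + 1 * u) z (\<sigma> y)) \<partial>count_space UNIV) * ennreal (survival m (a + 1 * u) (t + a) (\<sigma> y))) \<partial>lborel)"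
      by (subst nn_integral_real_affine[where c="1" and t=a]) auto
    also have "\<dots> = path_kernel c' m' (Suc n) s t x y"
      unfolding path_kernel.simps(2)[of c' m']
    proof (rule nn_integral_cong)
      fix u
      have "(\<integral>\<^sup>+z. path_kernel c m n (s + a) (a + 1 * u) (\<sigma> x) z * ennreal (c (a + 1 * u) z (\<sigma> y)) \<partial>count_space UNIV)
        = (\<integral>\<^sup>+z. path_kernel c m n (s + a) (u + a) (\<sigma> x) (\<sigma> z) * ennreal (c (u + a) (\<sigma> z) (\<sigma> y)) \<partial>count_space UNIV)"
        using nn_integral_bij_count_space[of \<sigma> UNIV UNIV "\<lambda>z. path_kernel c m n (s + a) (u + a) (\<sigma> x) z * ennreal (c (u + a) z (\<sigma> y))"] bij
        by (simp add: add.commute)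
      then show "indicator {s + a..t + a} (a + 1 * u) *
     ((\<integral>\<^sup>+z. path_kernel c m n (s + a) (a + 1 * u) (\<sigma> x) z * ennreal (c (a + 1 * u) z (\<sigma> y)) \<partial>count_space UNIV) * ennreal (survival m (a + 1 * u) (t + a) (\<sigma> y)))
      = indicator {s..t} u * ((\<integral>\<^sup>+z. path_kernel c' m' n s u x z * ennreal (c' u z y) \<partial>count_space UNIV) * ennreal (survival m' u t y))"
        unfolding Suc c' S by (auto simp: indicator_def add.commute)
    qed
    finally show ?case by simp
  qed
qed

lemma graph_dist_translate: "graph_dist (x + z) (y + z) = graph_dist x y"
  by (simp add: graph_dist_def)

lemma bonds_translate: "(x + z, y + z) \<in> bonds \<longleftrightarrow> (x, y) \<in> bonds"
  by (simp add: bonds_def graph_dist_translate)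

lemma exit_rate_shift: "exit_rate (shift a z \<omega>) u x = exit_rate \<omega> (u + a) (x + z)"
proof -
  have "exit_rate \<omega> (u + a) (x + z) = (\<Sum>y\<in>(\<lambda>y. y + z) ` {y. (x, y) \<in> bonds}. \<omega> (u + a) (x + z, y))"
    unfolding exit_rate_def
  proof (rule sum.cong[OF _ refl])
    show "{y. (x + z, y) \<in> bonds} = (\<lambda>y. y + z) ` {y. (x, y) \<in> bonds}"
    proof (intro set_eqI iffI)
      fix y assume "y \<in> {y. (x + z, y) \<in> bonds}"
      then have "(x + z, (y - z) + z) \<in> bonds" by simp
      then have "(x, y - z) \<in> bonds" unfolding bonds_translate .
      then show "y \<in> (\<lambda>y. y + z) ` {y. (x, y) \<in> bonds}" by (intro image_eqI[of _ _ "y - z"]) auto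
    qed (auto simp: bonds_translate)
  qed
  also have "\<dots> = (\<Sum>y | (x, y) \<in> bonds. \<omega> (u + a) (x + z, y + z))"
    by (subst sum.reindex) auto
  finally show ?thesis by (simp add: exit_rate_def shift_def)
qed

lemma full_kernel_shift:
  assumes "\<omega> \<in> environments" "locally_integrable_rates \<omega>"
    "shift a z \<omega> \<in> environments" "locally_integrable_rates (shift a z \<omega>)"
  shows "full_kernel (shift a z \<omega>) s t x y = full_kernel \<omega> (s + a) (t + a) (x + z) (y + z)"
  unfolding transition_def
proof (rule suminf_cong, rule path_kernel_shift[where \<sigma>="\<lambda>x. x + z"])
  show "jump_rates (\<lambda>u x y. \<omega> u (x, y)) (exit_rate \<omega>)" by (rule jump_rates_environment) fact+
  show "jump_rates (\<lambda>u x y. shift a z \<omega> u (x, y)) (exit_rate (shift a z \<omega>))"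
    by (rule jump_rates_environment) fact+
  show "bij (\<lambda>x. x + z)" by (rule bij_plus_right)
qed (simp_all add: exit_rate_shift, simp add: shift_def)

context
  fixes \<omega> :: "'n::finite environment" and c0 c1 :: real
  assumes reg: "regular_env c0 c1 \<omega>" and c0: "c0 > 0" and c1: "c1 \<ge> 1"
begin

lemma reg_facts: "\<omega> \<in> environments" "locally_integrable_rates \<omega>" "symmetric_env \<omega>"
  "AE r in lborel. \<forall>e\<in>bonds. c0 \<le> \<omega> r e"
  using reg unfolding regular_env_def by (auto elim: eventually_mono)

lemma comparable_to_initial:
  "AE r in lborel. \<forall>y\<in>B. \<forall>z\<in>B. \<omega> r (y, z) \<le> c1 * \<omega> 0 (y, z)"
  "AE r in lborel. \<forall>y\<in>B. \<forall>z\<in>B. \<omega> 0 (y, z) \<le> c1 * \<omega> r (y, z)"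
proof -
  have z: "\<omega> r e = 0" if "e \<notin> bonds" for r e using reg_facts(1) that unfolding environments_def by blast
  have "AE r in lborel. \<forall>e. \<omega> r e \<le> c1 * \<omega> 0 e \<and> \<omega> 0 e \<le> c1 * \<omega> r e"
  proof -
    have "AE r in lborel. \<forall>e\<in>bonds. c0 \<le> \<omega> r e \<and> \<omega> r e \<le> c1 * \<omega> 0 e \<and> \<omega> 0 e \<le> c1 * \<omega> r e"
      using reg unfolding regular_env_def by blast
    then show ?thesis
  proof eventually_elim
    case (elim r)
    show ?case
    proof
      fix e show "\<omega> r e \<le> c1 * \<omega> 0 e \<and> \<omega> 0 e \<le> c1 * \<omega> r e"
        using elim z[of e] by (cases "e \<in> bonds") auto
    qed
  qed
  qed
  then show "AE r in lborel. \<forall>y\<in>B. \<forall>z\<in>B. \<omega> r (y, z) \<le> c1 * \<omega> 0 (y, z)"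
    "AE r in lborel. \<forall>y\<in>B. \<forall>z\<in>B. \<omega> 0 (y, z) \<le> c1 * \<omega> r (y, z)"
    by (auto elim: eventually_mono)
qed

interpretation J: jump_rates "\<lambda>u x y. \<omega> u (x, y)" "exit_rate \<omega>"
  by (rule jump_rates_environment[OF reg_facts(1,2)])

lemma killed_flow_tendsto:
  assumes "0 \<le> t"
  shows "(\<lambda>k. killed_flow \<omega> k x t y) \<longlonglongrightarrow> enn2real (full_kernel \<omega> 0 t x y)"
  unfolding killed_flow_def[OF reg_facts(1-3)]
proof (rule tendsto_enn2real)
  have "full_kernel \<omega> 0 t x y \<le> 1" by (rule full_kernel_le_1[OF reg_facts(1-3) assms])
  then have "full_kernel \<omega> 0 t x y < top" by (rule order_le_less_trans) simp
  then show "(\<lambda>k. killed_kernel k \<omega> 0 t x y) \<longlonglongrightarrow> ennreal (enn2real (full_kernel \<omega> 0 t x y))"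
    using killed_kernel_tendsto(2)[OF reg_facts(1-3), of 0 t x y] by simp
qed simp

lemma killed_flow_measurable[measurable (raw)]:
  assumes "g \<in> borel_measurable M"
  shows "(\<lambda>v. killed_flow \<omega> k x (g v) y) \<in> borel_measurable M"
proof -
  interpret Q: jump_rates "killed_rates k \<omega>" "exit_rate \<omega>" by (rule killed_jump_rates[OF reg_facts(1-3)])
  show ?thesis unfolding killed_flow_def[OF reg_facts(1-3)] using assms by measurable
qed

lemma killed_flow_out: "x \<in> cube k \<Longrightarrow> y \<notin> cube k \<Longrightarrow> killed_flow \<omega> k x r y = 0"
  using finite_heat_flow.v_out[OF killed_flow_finite_heat_flow[OF reg_facts(1-3)]] .

text \<open>
Fatou's lemma passes the bound from the boxes to the lattice.
\<close>
lemma full_kernel_square_sum: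
  assumes t: "t > 0"
  shows "(\<integral>\<^sup>+y. ennreal ((enn2real (full_kernel \<omega> 0 t x y))\<^sup>2) \<partial>count_space UNIV)
    \<le> ennreal (nash_constant (real CARD('n)) c0 * t powr (- real CARD('n) / 2))" (is "_ \<le> ?C")
proof -
  obtain k0 where k0: "x \<in> cube k0"
    using eventually_happens[OF eventually_in_cube[of x]] by auto
  have k: "x \<in> cube (k + k0)" for k using cube_mono[of k0 "k + k0"] k0 by auto
  have lim: "(\<lambda>k. ennreal ((killed_flow \<omega> (k + k0) x t y)\<^sup>2)) \<longlonglongrightarrow> ennreal ((enn2real (full_kernel \<omega> 0 t x y))\<^sup>2)" for y
    using LIMSEQ_ignore_initial_segment[OF killed_flow_tendsto[of t x y], of k0] t
    by (intro tendsto_ennrealI tendsto_power) auto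
  have "(\<integral>\<^sup>+y. ennreal ((enn2real (full_kernel \<omega> 0 t x y))\<^sup>2) \<partial>count_space UNIV)
    = (\<integral>\<^sup>+y. liminf (\<lambda>k. ennreal ((killed_flow \<omega> (k + k0) x t y)\<^sup>2)) \<partial>count_space UNIV)"
    by (intro nn_integral_cong lim_imp_Liminf[symmetric] lim) simp
  also have "\<dots> \<le> liminf (\<lambda>k. \<integral>\<^sup>+y. ennreal ((killed_flow \<omega> (k + k0) x t y)\<^sup>2) \<partial>count_space UNIV)"
    by (rule nn_integral_liminf) simp
  also have "\<dots> \<le> limsup (\<lambda>k. \<integral>\<^sup>+y. ennreal ((killed_flow \<omega> (k + k0) x t y)\<^sup>2) \<partial>count_space UNIV)"
    by (rule Liminf_le_Limsup) simp
  also have "\<dots> \<le> ?C"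
  proof (rule Limsup_bounded, rule always_eventually, rule allI)
    fix k
    have "(\<integral>\<^sup>+y. ennreal ((killed_flow \<omega> (k + k0) x t y)\<^sup>2) \<partial>count_space UNIV)
      = (\<Sum>y\<in>cube (k + k0). ennreal ((killed_flow \<omega> (k + k0) x t y)\<^sup>2))"
      using k killed_flow_out by (intro nn_integral_count_space' finite_cube) auto
    also have "\<dots> = ennreal (\<Sum>y\<in>cube (k + k0). (killed_flow \<omega> (k + k0) x t y)\<^sup>2)"
      by (rule sum_ennreal) simp
    also have "\<dots> \<le> ?C"
      by (intro ennreal_leI killed_flow_decay[OF reg_facts(1-3) c0 reg_facts(4) k t])
    finally show "(\<integral>\<^sup>+y. ennreal ((killed_flow \<omega> (k + k0) x t y)\<^sup>2) \<partial>count_space UNIV) \<le> ?C" .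
  qed
  finally show ?thesis .
qed

text \<open>
The bound on the time energy in a box, the decay of the squared norm at time \<open>\<rho>\<close>, and Fatou's lemma.
\<close>
lemma full_kernel_time_energy:
  assumes \<rho>: "\<rho> > 0" and N: "N > 0" and \<delta>: "\<delta> > 0"
  shows "(\<integral>\<^sup>+\<tau>. indicator {0..\<delta>} \<tau> * (\<integral>\<^sup>+y. ennreal (time_energy N
      (\<lambda>j. tent N j * enn2real (full_kernel \<omega> 0 (\<rho> + real j * \<delta> + \<tau>) x y))) \<partial>count_space UNIV) \<partial>lborel)
    \<le> ennreal (\<delta> * (c1\<^sup>2 / 2 + 1) * (nash_constant (real CARD('n)) c0 * \<rho> powr (- real CARD('n) / 2)))" (is "_ \<le> ?C")
proof -
  obtain k0 where k0: "x \<in> cube k0"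
    using eventually_happens[OF eventually_in_cube[of x]] by auto
  have k: "x \<in> cube (k + k0)" for k using cube_mono[of k0 "k + k0"] k0 by auto
  define T where "T k \<tau> y = ennreal (time_energy N (\<lambda>j. tent N j * killed_flow \<omega> (k + k0) x (\<rho> + real j * \<delta> + \<tau>) y))" for k \<tau> y
  define T' where "T' \<tau> y = ennreal (time_energy N (\<lambda>j. tent N j * enn2real (full_kernel \<omega> 0 (\<rho> + real j * \<delta> + \<tau>) x y)))" for \<tau> y
  have lim: "(\<lambda>k. T k \<tau> y) \<longlonglongrightarrow> T' \<tau> y" if "0 \<le> \<tau>" for \<tau> y
    unfolding T_def T'_def
    using that \<rho> \<delta> by (intro tendsto_ennrealI tendsto_time_energy tendsto_mult_left LIMSEQ_ignore_initial_segment killed_flow_tendsto) auto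
  have T_sum: "(\<integral>\<^sup>+y. T k \<tau> y \<partial>count_space UNIV) = (\<Sum>y\<in>cube (k + k0). T k \<tau> y)" for k \<tau>
  proof (intro nn_integral_count_space' finite_cube)
    fix y :: "'n site" assume "y \<notin> cube (k + k0)"
    then have "T k \<tau> y = ennreal (time_energy N (\<lambda>j. 0))" unfolding T_def using k by (simp add: killed_flow_out)
    also have "time_energy N (\<lambda>j. 0) = 0" unfolding time_energy_def half_energy_def dft_def by simp
    finally show "T k \<tau> y = 0" by simp
  qed auto
  have T_meas: "(\<lambda>\<tau>. T k \<tau> y) \<in> borel_measurable borel" for k y
    unfolding T_def
    by (intro measurable_compose[OF borel_measurable_time_energy measurable_ennreal]) measurable
  have TS_meas: "(\<lambda>\<tau>. indicator {0..\<delta>} \<tau> * (\<integral>\<^sup>+y. T k \<tau> y \<partial>count_space UNIV)) \<in> borel_measurable lborel" for k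
    by (intro borel_measurable_times_ennreal borel_measurable_nn_integral_count_space) (simp_all add: T_meas)
  have "(\<integral>\<^sup>+\<tau>. indicator {0..\<delta>} \<tau> * (\<integral>\<^sup>+y. T' \<tau> y \<partial>count_space UNIV) \<partial>lborel)
    \<le> (\<integral>\<^sup>+\<tau>. liminf (\<lambda>k. indicator {0..\<delta>} \<tau> * (\<integral>\<^sup>+y. T k \<tau> y \<partial>count_space UNIV)) \<partial>lborel)"
  proof (rule nn_integral_mono)
    fix \<tau> :: real
    show "indicator {0..\<delta>} \<tau> * (\<integral>\<^sup>+y. T' \<tau> y \<partial>count_space UNIV) \<le> liminf (\<lambda>k. indicator {0..\<delta>} \<tau> * (\<integral>\<^sup>+y. T k \<tau> y \<partial>count_space UNIV))"
    proof (cases "\<tau> \<in> {0..\<delta>}")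
      case True
      then have "(\<integral>\<^sup>+y. T' \<tau> y \<partial>count_space UNIV) = (\<integral>\<^sup>+y. liminf (\<lambda>k. T k \<tau> y) \<partial>count_space UNIV)"
        by (intro nn_integral_cong lim_imp_Liminf[symmetric] lim) auto
      also have "\<dots> \<le> liminf (\<lambda>k. \<integral>\<^sup>+y. T k \<tau> y \<partial>count_space UNIV)"
        by (rule nn_integral_liminf) simp
      finally show ?thesis using True by simp
    qed simp
  qed
  also have "\<dots> \<le> liminf (\<lambda>k. \<integral>\<^sup>+\<tau>. indicator {0..\<delta>} \<tau> * (\<integral>\<^sup>+y. T k \<tau> y \<partial>count_space UNIV) \<partial>lborel)"
    by (rule nn_integral_liminf[OF TS_meas])
  also have "\<dots> \<le> limsup (\<lambda>k. \<integral>\<^sup>+\<tau>. indicator {0..\<delta>} \<tau> * (\<integral>\<^sup>+y. T k \<tau> y \<partial>count_space UNIV) \<partial>lborel)"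
    by (rule Liminf_le_Limsup) simp
  also have "\<dots> \<le> ?C"
  proof (rule Limsup_bounded, rule always_eventually, rule allI)
    fix k
    interpret H: finite_heat_flow "\<lambda>r y z. \<omega> r (y, z)" "killed_flow \<omega> (k + k0) x" "cube (k + k0)" "cube (Suc (k + k0))"
      by (rule killed_flow_finite_heat_flow[OF reg_facts(1-3) k])
    have "(\<integral>\<^sup>+\<tau>. indicator {0..\<delta>} \<tau> * (\<integral>\<^sup>+y. T k \<tau> y \<partial>count_space UNIV) \<partial>lborel) \<le> ennreal (\<delta> * (c1\<^sup>2 / 2 + 1) * H.mass2 \<rho>)"
      unfolding T_sum unfolding T_def
      by (rule H.averaged_time_energy_bound[OF _ N \<delta> _ _ comparable_to_initial]) (use \<rho> c1 J.c_nonneg in auto)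
    also have "\<dots> \<le> ?C"
      using killed_flow_decay[OF reg_facts(1-3) c0 reg_facts(4) k \<rho>, of k] \<delta>
      unfolding H.mass2_def by (intro ennreal_leI mult_left_mono) auto
    finally show "(\<integral>\<^sup>+\<tau>. indicator {0..\<delta>} \<tau> * (\<integral>\<^sup>+y. T k \<tau> y \<partial>count_space UNIV) \<partial>lborel) \<le> ?C" .
  qed
  finally show ?thesis unfolding T'_def .
qed

end

section \<open>Random environments\<close>

text \<open>
The kernel as a real number in \<open>[0, 1]\<close> for every environment. Almost surely the cap is inactive; it only
makes all integrals over the environment exist without exceptional sets.
\<close>
definition capped_kernel :: "'n::finite environment \<Rightarrow> real \<Rightarrow> real \<Rightarrow> 'n site \<Rightarrow> 'n site \<Rightarrow> real" where
  "capped_kernel \<omega> s t x y = enn2real (min 1 (full_kernel \<omega> s t x y))"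

lemma capped_kernel_bounds: "0 \<le> capped_kernel \<omega> s t x y" "capped_kernel \<omega> s t x y \<le> 1"
proof -
  show "0 \<le> capped_kernel \<omega> s t x y" by (simp add: capped_kernel_def)
  have "enn2real (min 1 (full_kernel \<omega> s t x y)) \<le> enn2real 1" by (rule enn2real_mono) auto
  then show "capped_kernel \<omega> s t x y \<le> 1" by (simp add: capped_kernel_def)
qed

lemma capped_kernel_eq:
  assumes "regular_env c0 c1 \<omega>" "s \<le> t"
  shows "ennreal (capped_kernel \<omega> s t x y) = full_kernel \<omega> s t x y"
    and "capped_kernel \<omega> s t x y = enn2real (full_kernel \<omega> s t x y)"
proof -
  have le: "full_kernel \<omega> s t x y \<le> 1"
    by (rule full_kernel_le_1) (use assms in \<open>auto simp: regular_env_def\<close>)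
  then have "min 1 (full_kernel \<omega> s t x y) = full_kernel \<omega> s t x y" by (simp add: min_absorb2)
  then show "capped_kernel \<omega> s t x y = enn2real (full_kernel \<omega> s t x y)" by (simp add: capped_kernel_def)
  moreover have "full_kernel \<omega> s t x y < top" using le by (rule order_le_less_trans) simp
  ultimately show "ennreal (capped_kernel \<omega> s t x y) = full_kernel \<omega> s t x y" by simp
qed

lemma capped_kernel_reversed:
  assumes reg: "regular_env c0 c1 \<omega>"
  shows "capped_kernel \<omega> s t x y = capped_kernel (reversed_env \<omega>) (- t) (- s) y x"
proof -
  have "full_kernel \<omega> s t x y = full_kernel (reversed_env \<omega>) (- t) (- s) y x"
    using reg regular_env_reversed[OF reg] by (intro full_kernel_reversed) (auto simp: regular_env_def)
  then show ?thesis by (simp add: capped_kernel_def)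
qed

lemma capped_kernel_forward_equation:
  fixes \<omega> :: "'n::finite environment"
  assumes reg: "regular_env c0 c1 \<omega>" and t: "0 \<le> t"
  shows "set_integrable lborel {0..t} (\<lambda>r. (\<Sum>z | (z, y) \<in> bonds. capped_kernel \<omega> 0 r x z * \<omega> r (z, y)) - exit_rate \<omega> r y * capped_kernel \<omega> 0 r x y)"
    and "capped_kernel \<omega> 0 t x y = (if x = y then 1 else 0) + (LBINT r:{0..t}. (\<Sum>z | (z, y) \<in> bonds. capped_kernel \<omega> 0 r x z * \<omega> r (z, y)) - exit_rate \<omega> r y * capped_kernel \<omega> 0 r x y)"
proof -
  have r: "\<omega> \<in> environments" "locally_integrable_rates \<omega>" "symmetric_env \<omega>" using reg by (auto simp: regular_env_def)
  interpret J: jump_rates "\<lambda>u x y. \<omega> u (x, y)" "exit_rate \<omega>" by (rule jump_rates_environment[OF r(1,2)])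
  have fin: "finite {z. (z, y) \<in> (bonds :: ('n site \<times> 'n site) set)}"
  proof -
    have "{z. (z, y) \<in> bonds} = {z. (y, z) \<in> bonds}"
      unfolding bonds_def graph_dist_def by (simp add: abs_minus_commute)
    then show ?thesis using nbr_fin[OF r(1,2), of y] by simp
  qed
  have N0: "\<omega> u (z, y) = 0" if "z \<notin> {z. (z, y) \<in> bonds}" for u z
    using r(1) that unfolding environments_def by blast
  note F = J.forward_equation[OF t full_kernel_le_1[OF r] fin N0 rate_int[OF r], of x]
  have eq: "enn2real (full_kernel \<omega> 0 r x z) = capped_kernel \<omega> 0 r x z" if "0 \<le> r" for r z
    using capped_kernel_eq(2)[OF reg that] by simp
  have cong: "(\<Sum>z | (z, y) \<in> bonds. enn2real (full_kernel \<omega> 0 r x z) * \<omega> r (z, y)) - exit_rate \<omega> r y * enn2real (full_kernel \<omega> 0 r x y)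
      = (\<Sum>z | (z, y) \<in> bonds. capped_kernel \<omega> 0 r x z * \<omega> r (z, y)) - exit_rate \<omega> r y * capped_kernel \<omega> 0 r x y" if "r \<in> {0..t}" for r
    using that by (simp add: eq)
  show "set_integrable lborel {0..t} (\<lambda>r. (\<Sum>z | (z, y) \<in> bonds. capped_kernel \<omega> 0 r x z * \<omega> r (z, y)) - exit_rate \<omega> r y * capped_kernel \<omega> 0 r x y)"
    using F(1) by (subst set_integrable_cong[OF refl refl cong[symmetric]]) auto
  have "capped_kernel \<omega> 0 t x y = (if x = y then 1 else 0) + (LBINT r:{0..t}. (\<Sum>z | (z, y) \<in> bonds. enn2real (full_kernel \<omega> 0 r x z) * \<omega> r (z, y)) - exit_rate \<omega> r y * enn2real (full_kernel \<omega> 0 r x y))"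
    unfolding eq[OF t, symmetric] by (rule F(2))
  also have "(LBINT r:{0..t}. (\<Sum>z | (z, y) \<in> bonds. enn2real (full_kernel \<omega> 0 r x z) * \<omega> r (z, y)) - exit_rate \<omega> r y * enn2real (full_kernel \<omega> 0 r x y))
    = (LBINT r:{0..t}. (\<Sum>z | (z, y) \<in> bonds. capped_kernel \<omega> 0 r x z * \<omega> r (z, y)) - exit_rate \<omega> r y * capped_kernel \<omega> 0 r x y)"
    by (rule set_lebesgue_integral_cong) (use cong in auto)
  finally show "capped_kernel \<omega> 0 t x y = (if x = y then 1 else 0) + (LBINT r:{0..t}. (\<Sum>z | (z, y) \<in> bonds. capped_kernel \<omega> 0 r x z * \<omega> r (z, y)) - exit_rate \<omega> r y * capped_kernel \<omega> 0 r x y)" .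
qed

lemma continuous_on_capped_kernel:
  assumes reg: "regular_env c0 c1 \<omega>"
  shows "continuous_on {0..T} (\<lambda>t. capped_kernel \<omega> 0 t x y)"
proof (cases "0 \<le> T")
  case True
  let ?G = "\<lambda>r. (\<Sum>z | (z, y) \<in> bonds. capped_kernel \<omega> 0 r x z * \<omega> r (z, y)) - exit_rate \<omega> r y * capped_kernel \<omega> 0 r x y"
  have "continuous_on {0..T} (\<lambda>t. (if x = y then 1 else 0) + (LBINT r:{0..t}. ?G r))"
    by (intro continuous_intros continuous_on_set_lebesgue_integral capped_kernel_forward_equation(1)[OF reg True])
  then show ?thesis
  proof (rule continuous_on_eq)
    fix t assume "t \<in> {0..T}"
    then show "(if x = y then 1 else 0) + (LBINT r:{0..t}. ?G r) = capped_kernel \<omega> 0 t x y"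
      by (intro capped_kernel_forward_equation(2)[OF reg, symmetric]) simp
  qed
qed simp

locale conductance_law =
  fixes P :: "'n::finite environment measure" and c0 c1 :: real
  assumes adm: "admissible P" and c0: "c0 > 0"
    and elliptic: "\<And>e t. e \<in> bonds \<Longrightarrow> AE \<omega> in P. \<omega> t e \<ge> c0"
    and c1: "c1 \<ge> 1"
    and ratio: "\<And>e t. e \<in> bonds \<Longrightarrow> AE \<omega> in P. inverse c1 \<le> \<omega> t e / \<omega> 0 e \<and> \<omega> t e / \<omega> 0 e \<le> c1"

sublocale conductance_law \<subseteq> prob_space P
  using adm unfolding admissible_def environment_law_def by blast

context conductance_law
begin

lemma law_facts:
  "space P \<subseteq> environments" "sets P = sets (restrict_space borel (space P))"
  "\<omega> \<in> space P \<Longrightarrow> shift s z \<omega> \<in> space P" "distr P P (shift s z) = P"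
  "e \<in> bonds \<Longrightarrow> integrable P (\<lambda>\<omega>. \<omega> t e)"
  using adm unfolding admissible_def environment_law_def stationary_law_def by blast+

lemma env_zero: "\<omega> \<in> space P \<Longrightarrow> e \<notin> bonds \<Longrightarrow> \<omega> t e = 0"
  using law_facts(1) unfolding environments_def by blast

lemma env_nonneg: "\<omega> \<in> space P \<Longrightarrow> 0 \<le> \<omega> t e"
proof (cases "e \<in> bonds")
  case True
  assume "\<omega> \<in> space P"
  then have "0 < \<omega> t e" using law_facts(1) True unfolding environments_def by blast
  then show ?thesis by simp
qed (simp add: env_zero)

lemma evaluation_measurable[measurable]: "(\<lambda>\<omega>. \<omega> t e) \<in> borel_measurable P"
proof -
  have f: "continuous_on UNIV (\<lambda>\<omega> :: 'n environment. \<omega> t)" by (rule continuous_on_product_coordinates)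
  have g: "continuous_on UNIV (\<lambda>f :: 'n site \<times> 'n site \<Rightarrow> real. f e)" by (rule continuous_on_product_coordinates)
  have "continuous_on UNIV (\<lambda>\<omega> :: 'n environment. \<omega> t e)"
    by (rule continuous_on_compose2[OF g f subset_UNIV])
  then have "(\<lambda>\<omega> :: 'n environment. \<omega> t e) \<in> borel_measurable borel" by (rule borel_measurable_continuous_onI)
  then show ?thesis unfolding measurable_cong_sets[OF law_facts(2) refl] by (rule measurable_restrict_space1)
qed

lemma shift_measurable[measurable]: "shift s z \<in> measurable P P"
proof -
  have "continuous_on UNIV (shift s z :: 'n environment \<Rightarrow> _)"
  proof (rule continuous_on_coordinatewise_then_product, rule continuous_on_coordinatewise_then_product)
    fix t and e :: "'n site \<times> 'n site"
    have f: "continuous_on UNIV (\<lambda>\<omega> :: 'n environment. \<omega> (t + s))" by (rule continuous_on_product_coordinates)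
    have g: "continuous_on UNIV (\<lambda>f :: 'n site \<times> 'n site \<Rightarrow> real. f (fst e + z, snd e + z))"
      by (rule continuous_on_product_coordinates)
    have "continuous_on UNIV (\<lambda>\<omega> :: 'n environment. \<omega> (t + s) (fst e + z, snd e + z))"
      by (rule continuous_on_compose2[OF g f subset_UNIV])
    then show "continuous_on UNIV (\<lambda>\<omega> :: 'n environment. shift s z \<omega> t e)"
      by (simp add: shift_def case_prod_beta)
  qed
  then have b: "shift s z \<in> measurable (borel :: 'n environment measure) borel"
    by (rule borel_measurable_continuous_onI)
  have "shift s z \<in> measurable (restrict_space borel (space P)) (restrict_space borel (space P))"
    by (rule measurable_restrict_space3[OF b]) (use law_facts(3) in auto)
  then show ?thesis using law_facts(2) measurable_cong_sets by blast
qed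

lemma stationary_nn_integral:
  assumes "F \<in> borel_measurable P"
  shows "(\<integral>\<^sup>+\<omega>. F (shift s z \<omega>) \<partial>P) = (\<integral>\<^sup>+\<omega>. F \<omega> \<partial>P)"
proof -
  have "(\<integral>\<^sup>+\<omega>. F \<omega> \<partial>P) = (\<integral>\<^sup>+\<omega>. F \<omega> \<partial>distr P P (shift s z))" by (simp only: law_facts(4))
  also have "\<dots> = (\<integral>\<^sup>+\<omega>. F (shift s z \<omega>) \<partial>P)" by (rule nn_integral_distr[OF shift_measurable]) (use assms in simp)
  finally show ?thesis by simp
qed

lemma stationary_integral:
  fixes F :: "'n environment \<Rightarrow> real"
  assumes "F \<in> borel_measurable P"
  shows "(\<integral>\<omega>. F (shift s z \<omega>) \<partial>P) = (\<integral>\<omega>. F \<omega> \<partial>P)"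
proof -
  have "(\<integral>\<omega>. F \<omega> \<partial>P) = (\<integral>\<omega>. F \<omega> \<partial>distr P P (shift s z))" by (simp only: law_facts(4))
  also have "\<dots> = (\<integral>\<omega>. F (shift s z \<omega>) \<partial>P)" by (rule integral_distr[OF shift_measurable assms])
  finally show ?thesis by simp
qed

lemma AE_shift: "AE \<omega> in P. Q \<omega> \<Longrightarrow> AE \<omega> in P. Q (shift s z \<omega>)"
  using AE_distrD[OF shift_measurable, of Q s z] by (simp only: law_facts(4))

text \<open>
The indicator of \<open>{\<omega>. a < \<omega> 0 e}\<close>, evaluated at the environment shifted by \<open>t\<close>, is the indicator of
\<open>{\<omega>. a < \<omega> t e}\<close>; its joint measurability is part of admissibility.
\<close>
lemma environment_jointly_measurable:
  "(\<lambda>(\<omega>, t). \<omega> t e) \<in> borel_measurable (P \<Otimes>\<^sub>M borel)"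
proof (rule borel_measurableI_greater)
  fix a :: real
  define A where "A = {\<omega> \<in> space P. a < \<omega> 0 e}"
  have A: "A \<in> sets P" unfolding A_def by measurable
  then have "(\<lambda>(\<omega>, t, x). indicator A (shift t x \<omega>) :: real) \<in> borel_measurable (P \<Otimes>\<^sub>M (borel \<Otimes>\<^sub>M count_space UNIV))"
    using adm unfolding admissible_def by blast
  from measurable_compose[OF _ this, of "\<lambda>p. (fst p, snd p, 0)" "P \<Otimes>\<^sub>M borel"]
  have m[measurable]: "(\<lambda>p. indicator A (shift (snd p) 0 (fst p)) :: real) \<in> borel_measurable (P \<Otimes>\<^sub>M borel)"
    by simp
  have "{p \<in> space (P \<Otimes>\<^sub>M borel). a < (case p of (\<omega>, t) \<Rightarrow> \<omega> t e)}
    = {p \<in> space (P \<Otimes>\<^sub>M borel). indicator A (shift (snd p) 0 (fst p)) = (1 :: real)}"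
  proof (rule Collect_cong, rule conj_cong[OF refl])
    fix p :: "'n environment \<times> real" assume "p \<in> space (P \<Otimes>\<^sub>M borel)"
    then have "shift (snd p) 0 (fst p) \<in> space P" by (auto simp: space_pair_measure intro: law_facts(3))
    moreover have "shift (snd p) 0 (fst p) 0 e = fst p (snd p) e" by (simp add: shift_def case_prod_beta)
    ultimately show "(a < (case p of (\<omega>, t) \<Rightarrow> \<omega> t e)) = (indicator A (shift (snd p) 0 (fst p)) = (1 :: real))"
      by (auto simp: A_def indicator_def case_prod_beta)
  qed
  also have "\<dots> \<in> sets (P \<Otimes>\<^sub>M borel)" by measurable
  finally show "{p \<in> space (P \<Otimes>\<^sub>M borel). a < (case p of (\<omega>, t) \<Rightarrow> \<omega> t e)} \<in> sets (P \<Otimes>\<^sub>M borel)" .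
qed

lemma environment_measurable_comp[measurable (raw)]:
  assumes "\<pi> \<in> measurable M P" "g \<in> borel_measurable M"
  shows "(\<lambda>v. \<pi> v (g v) e) \<in> borel_measurable M"
  using measurable_compose[OF measurable_Pair[OF assms] environment_jointly_measurable[of e]] by simp

lemma exit_rate_jointly_measurable: "(\<lambda>(\<omega>, t). exit_rate \<omega> t x) \<in> borel_measurable (P \<Otimes>\<^sub>M borel)"
  unfolding exit_rate_def case_prod_beta'
  using environment_jointly_measurable by (intro borel_measurable_sum) (simp add: case_prod_beta')

lemma exit_rate_measurable_comp[measurable (raw)]:
  assumes "\<pi> \<in> measurable M P" "g \<in> borel_measurable M"
  shows "(\<lambda>v. exit_rate (\<pi> v) (g v) x) \<in> borel_measurable M"
  using measurable_compose[OF measurable_Pair[OF assms] exit_rate_jointly_measurable[of x]] by simp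

lemma full_kernel_measurable_comp[measurable (raw)]:
  assumes "\<pi> \<in> measurable M P" "g \<in> borel_measurable M" "h \<in> borel_measurable M"
  shows "(\<lambda>v. full_kernel (\<pi> v) (g v) (h v) x y) \<in> borel_measurable M"
proof -
  have "(\<lambda>(\<omega>, s, t). full_kernel \<omega> s t x y) \<in> borel_measurable (P \<Otimes>\<^sub>M (borel \<Otimes>\<^sub>M borel))"
    by (rule transition_measurable[where cc="\<lambda>\<omega> u x y. \<omega> u (x, y)" and mm=exit_rate])
      (rule environment_jointly_measurable exit_rate_jointly_measurable)+
  from measurable_compose[OF _ this, of "\<lambda>v. (\<pi> v, g v, h v)" M] assms
  show ?thesis by simp
qed

lemma capped_kernel_measurable_comp[measurable (raw)]:
  assumes [measurable]: "\<pi> \<in> measurable M P" "g \<in> borel_measurable M" "h \<in> borel_measurable M"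
  shows "(\<lambda>v. capped_kernel (\<pi> v) (g v) (h v) x y) \<in> borel_measurable M"
  unfolding capped_kernel_def by measurable

definition mean_rate :: "'n site \<times> 'n site \<Rightarrow> ennreal" where
  "mean_rate e = (\<integral>\<^sup>+\<omega>. ennreal (\<omega> 0 e) \<partial>P)"

lemma mean_rate_finite: "mean_rate e < \<infinity>"
proof (cases "e \<in> bonds")
  case True
  have "mean_rate e = ennreal (\<integral>\<omega>. \<omega> 0 e \<partial>P)"
    unfolding mean_rate_def using env_nonneg by (intro nn_integral_eq_integral law_facts(5)[OF True] AE_I2) auto
  then show ?thesis by simp
next
  case False
  have "mean_rate e = (\<integral>\<^sup>+\<omega>. 0 \<partial>P)"
    unfolding mean_rate_def by (rule nn_integral_cong) (simp add: env_zero[OF _ False])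
  then show ?thesis by simp
qed

text \<open>
Stationarity in time.
\<close>
lemma nn_integral_rate: "(\<integral>\<^sup>+\<omega>. ennreal (\<omega> t e) \<partial>P) = mean_rate e"
proof -
  have "(\<integral>\<^sup>+\<omega>. ennreal (shift t 0 \<omega> 0 e) \<partial>P) = mean_rate e"
    unfolding mean_rate_def by (rule stationary_nn_integral) measurable
  then show ?thesis by (simp add: shift_def case_prod_beta)
qed

lemma locally_integrable_rates_iff:
  assumes \<omega>: "\<omega> \<in> space P"
  shows "locally_integrable_rates \<omega> \<longleftrightarrow>
    (\<forall>e\<in>bonds. \<forall>n::nat. (\<integral>\<^sup>+t. indicator {- real n..real n} t * ennreal (\<omega> t e) \<partial>lborel) < \<infinity>)"
proof -
  have m[measurable]: "(\<lambda>t. \<omega> t e) \<in> borel_measurable borel" for e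
    using environment_measurable_comp[of "\<lambda>_. \<omega>" borel "\<lambda>t. t" e] \<omega> by simp
  have iff: "set_integrable lborel {a..b} (\<lambda>t. \<omega> t e) \<longleftrightarrow> (\<integral>\<^sup>+t. indicator {a..b} t * ennreal (\<omega> t e) \<partial>lborel) < \<infinity>" for a b e
  proof -
    have "(\<integral>\<^sup>+t. ennreal (norm (indicator {a..b} t *\<^sub>R \<omega> t e)) \<partial>lborel) = (\<integral>\<^sup>+t. indicator {a..b} t * ennreal (\<omega> t e) \<partial>lborel)"
      using env_nonneg[OF \<omega>] by (intro nn_integral_cong) (auto simp: indicator_def)
    then show ?thesis unfolding set_integrable_def integrable_iff_bounded by simp
  qed
  show ?thesis
  proof
    assume "locally_integrable_rates \<omega>"
    then show "\<forall>e\<in>bonds. \<forall>n::nat. (\<integral>\<^sup>+t. indicator {- real n..real n} t * ennreal (\<omega> t e) \<partial>lborel) < \<infinity>"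
      unfolding locally_integrable_rates_def iff by blast
  next
    assume R: "\<forall>e\<in>bonds. \<forall>n::nat. (\<integral>\<^sup>+t. indicator {- real n..real n} t * ennreal (\<omega> t e) \<partial>lborel) < \<infinity>"
    show "locally_integrable_rates \<omega>"
      unfolding locally_integrable_rates_def
    proof (intro ballI allI)
      fix e :: "'n site \<times> 'n site" and a b :: real assume e: "e \<in> bonds"
      obtain n :: nat where n: "real n \<ge> max \<bar>a\<bar> \<bar>b\<bar>" using real_arch_simple by blast
      have "set_integrable lborel {- real n..real n} (\<lambda>t. \<omega> t e)" unfolding iff using R e by blast
      then show "set_integrable lborel {a..b} (\<lambda>t. \<omega> t e)"
        by (rule set_integrable_subset) (use n in auto)
    qed
  qed
qed

lemma countable_bonds: "countable (bonds :: ('n site \<times> 'n site) set)" by (rule countableI_type)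

lemma local_mass_measurable: "(\<lambda>\<omega>. \<integral>\<^sup>+t. indicator {- real n..real n} t * ennreal (\<omega> t e) \<partial>lborel) \<in> borel_measurable P"
proof -
  have "(\<lambda>(\<omega>, t). indicator {- real n..real n} t * ennreal (\<omega> t e)) \<in> borel_measurable (P \<Otimes>\<^sub>M lborel)"
    using environment_jointly_measurable[of e] unfolding case_prod_beta' by measurable
  then show ?thesis by (rule lborel.borel_measurable_nn_integral)
qed

lemma locally_integrable_measurable: "{\<omega> \<in> space P. locally_integrable_rates \<omega>} \<in> sets P"
proof -
  note local_mass_measurable[measurable]
  have "{\<omega> \<in> space P. locally_integrable_rates \<omega>} = {\<omega> \<in> space P. \<forall>e\<in>bonds. \<forall>n::nat. (\<integral>\<^sup>+t. indicator {- real n..real n} t * ennreal (\<omega> t e) \<partial>lborel) < \<infinity>}"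
    using locally_integrable_rates_iff by auto
  also have "\<dots> \<in> sets P"
    by (intro sets.sets_Collect_countable_Ball sets.sets_Collect_countable_All) measurable
  finally show ?thesis .
qed

lemma AE_locally_integrable: "AE \<omega> in P. locally_integrable_rates \<omega>"
proof -
  interpret PL: pair_sigma_finite P lborel ..
  have "AE \<omega> in P. (\<integral>\<^sup>+t. indicator {- real n..real n} t * ennreal (\<omega> t e) \<partial>lborel) < \<infinity>" for n :: nat and e
  proof -
    have jm: "(\<lambda>(\<omega>, t). indicator {- real n..real n} t * ennreal (\<omega> t e)) \<in> borel_measurable (P \<Otimes>\<^sub>M lborel)"
      using environment_jointly_measurable[of e] unfolding case_prod_beta' by measurable
    have "(\<integral>\<^sup>+\<omega>. \<integral>\<^sup>+t. indicator {- real n..real n} t * ennreal (\<omega> t e) \<partial>lborel \<partial>P)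
      = (\<integral>\<^sup>+t. \<integral>\<^sup>+\<omega>. indicator {- real n..real n} t * ennreal (\<omega> t e) \<partial>P \<partial>lborel)"
      by (rule PL.Fubini'[symmetric, OF jm])
    also have "\<dots> = (\<integral>\<^sup>+t. indicator {- real n..real n} t * mean_rate e \<partial>lborel)"
      by (intro nn_integral_cong) (simp add: nn_integral_cmult nn_integral_rate)
    also have "\<dots> = mean_rate e * emeasure lborel {- real n..real n}"
      by (subst mult.commute) (simp add: nn_integral_cmult_indicator)
    also have "\<dots> < \<infinity>" using mean_rate_finite[of e] by (simp add: ennreal_mult_less_top)
    finally have "(\<integral>\<^sup>+\<omega>. \<integral>\<^sup>+t. indicator {- real n..real n} t * ennreal (\<omega> t e) \<partial>lborel \<partial>P) \<noteq> \<infinity>" by simp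
    from nn_integral_noteq_infinite[OF local_mass_measurable this]
    show ?thesis by eventually_elim (simp add: less_top)
  qed
  then have "AE \<omega> in P. \<forall>e\<in>bonds. \<forall>n::nat. (\<integral>\<^sup>+t. indicator {- real n..real n} t * ennreal (\<omega> t e) \<partial>lborel) < \<infinity>"
    by (simp add: AE_ball_countable[OF countable_bonds] AE_all_countable)
  then show ?thesis
    using AE_space by eventually_elim (simp add: locally_integrable_rates_iff)
qed

text \<open>
Tonelli exchanges the null sets of environments at each time for null sets of times in each environment.
\<close>
lemma AE_time_swap:
  assumes "Measurable.pred (P \<Otimes>\<^sub>M lborel) (\<lambda>p. Q (fst p) (snd p))" and "\<And>t. AE \<omega> in P. Q \<omega> (t :: real)"
  shows "AE \<omega> in P. AE t in lborel. Q \<omega> t"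
proof -
  interpret PL: pair_sigma_finite P lborel ..
  have "AE t in lborel. AE \<omega> in P. Q \<omega> t" using assms(2) by simp
  then show ?thesis using PL.AE_commute[of Q] assms(1) by (simp add: pred_def)
qed

lemma AE_regular: "AE \<omega> in P. regular_env c0 c1 \<omega>"
proof -
  have sym: "AE \<omega> in P. \<forall>e\<in>bonds. \<forall>t. \<omega> t (fst e, snd e) = \<omega> t (snd e, fst e)"
    unfolding AE_ball_countable[OF countable_bonds]
    using adm unfolding admissible_def by auto
  have bnd: "AE \<omega> in P. AE t in lborel. c0 \<le> \<omega> t e \<and> \<omega> t e \<le> c1 * \<omega> 0 e \<and> \<omega> 0 e \<le> c1 * \<omega> t e" if e: "e \<in> bonds" for e
  proof (rule AE_time_swap)
    show "Measurable.pred (P \<Otimes>\<^sub>M lborel) (\<lambda>p. c0 \<le> fst p (snd p) e \<and> fst p (snd p) e \<le> c1 * fst p 0 e \<and> fst p 0 e \<le> c1 * fst p (snd p) e)"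
      by measurable
    fix t
    show "AE \<omega> in P. c0 \<le> \<omega> t e \<and> \<omega> t e \<le> c1 * \<omega> 0 e \<and> \<omega> 0 e \<le> c1 * \<omega> t e"
      using elliptic[OF e, of t] elliptic[OF e, of 0] ratio[OF e, of t]
    proof eventually_elim
      case (elim \<omega>)
      then have "\<omega> 0 e > 0" "\<omega> t e > 0" using c0 by linarith+
      with elim c1 show ?case by (simp add: field_simps)
    qed
  qed
  then have bnd': "AE \<omega> in P. \<forall>e\<in>bonds. AE t in lborel. c0 \<le> \<omega> t e \<and> \<omega> t e \<le> c1 * \<omega> 0 e \<and> \<omega> 0 e \<le> c1 * \<omega> t e"
    by (simp add: AE_ball_countable[OF countable_bonds])
  show ?thesis
    using sym bnd' AE_locally_integrable AE_space
  proof eventually_elim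
    case (elim \<omega>)
    have "symmetric_env \<omega>" unfolding symmetric_env_def
    proof (intro allI)
      fix t and x y :: "'n site"
      show "\<omega> t (x, y) = \<omega> t (y, x)"
      proof (cases "(x, y) \<in> bonds")
        case True
        then show ?thesis using elim(1) by fastforce
      next
        case False
        then have "(y, x) \<notin> bonds" unfolding bonds_def graph_dist_def by (simp add: abs_minus_commute)
        then show ?thesis using False env_zero[OF elim(4)] by simp
      qed
    qed
    moreover have "AE t in lborel. \<forall>e\<in>bonds. c0 \<le> \<omega> t e \<and> \<omega> t e \<le> c1 * \<omega> 0 e \<and> \<omega> 0 e \<le> c1 * \<omega> t e"
      using elim(2) by (simp add: AE_ball_countable[OF countable_bonds])
    ultimately show ?case using elim law_facts(1) unfolding regular_env_def by blast
  qed
qed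

lemma AE_capped_kernel_shift:
  assumes "s \<le> t"
  shows "AE \<omega> in P. capped_kernel (shift a z \<omega>) s t x y = capped_kernel \<omega> (s + a) (t + a) (x + z) (y + z)"
  using AE_regular AE_shift[OF AE_regular, of a z]
  by eventually_elim (simp add: capped_kernel_def regular_env_def full_kernel_shift)

end

section \<open>The averaged heat kernel and its time derivative\<close>

context conductance_law
begin

definition mean_kernel :: "real \<Rightarrow> 'n site \<Rightarrow> 'n site \<Rightarrow> real" where
  "mean_kernel t y y' = (\<integral>\<omega>. capped_kernel \<omega> 0 t y y' \<partial>P)"

lemma capped_kernel_integrable: "integrable P (\<lambda>\<omega>. capped_kernel \<omega> s t x y)"
  by (rule integrable_const_bound[of _ 1]) (auto simp: capped_kernel_bounds)

lemma mean_kernel_nn: "(\<integral>\<^sup>+\<omega>. ennreal (capped_kernel \<omega> 0 t y y') \<partial>P) = ennreal (mean_kernel t y y')"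
  unfolding mean_kernel_def
  by (rule nn_integral_eq_integral[OF capped_kernel_integrable]) (simp add: capped_kernel_bounds)

lemma mean_kernel_nonneg: "0 \<le> mean_kernel t y y'"
  unfolding mean_kernel_def by (rule integral_nonneg_AE) (simp add: capped_kernel_bounds)

text \<open>
The heat kernel vanishes for environments that are not locally integrable, and these form a null set.
\<close>
lemma mean_heat_kernel_eq: assumes t: "0 \<le> t" shows "mean_heat_kernel P 0 t y y' = mean_kernel t y y'"
proof -
  have eq: "heat_kernel \<omega> 0 t y y' = indicator {\<omega> \<in> space P. locally_integrable_rates \<omega>} \<omega> * capped_kernel \<omega> 0 t y y'"
    if \<omega>: "\<omega> \<in> space P" for \<omega>
  proof (cases "locally_integrable_rates \<omega>")
    case True
    have env: "\<omega> \<in> environments" using \<omega> law_facts(1) by blast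
    have e: "full_kernel \<omega> 0 t y y' = ennreal (heat_kernel \<omega> 0 t y y')"
      by (rule heat_kernel_eq_transition[OF env True t, symmetric])
    have b: "0 \<le> heat_kernel \<omega> 0 t y y'" unfolding heat_kernel_def by simp
    have "(\<integral>\<^sup>+y'. full_kernel \<omega> 0 t y y' \<partial>count_space UNIV) \<le> 1" by (rule transition_sum_le_1[OF env True t])
    then have "full_kernel \<omega> 0 t y y' \<le> 1"
      using nn_integral_ge_point[of y' UNIV "full_kernel \<omega> 0 t y"] by (auto intro: order_trans)
    then have "min 1 (full_kernel \<omega> 0 t y y') = full_kernel \<omega> 0 t y y'" by (simp add: min_absorb2)
    then show ?thesis using True \<omega> b by (simp add: capped_kernel_def e)
  next
    case False
    then show ?thesis by (simp add: heat_kernel_def)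
  qed
  have "mean_heat_kernel P 0 t y y' = (\<integral>\<omega>. indicator {\<omega> \<in> space P. locally_integrable_rates \<omega>} \<omega> * capped_kernel \<omega> 0 t y y' \<partial>P)"
    unfolding mean_heat_kernel_def by (rule Bochner_Integration.integral_cong) (simp_all add: eq)
  also have "\<dots> = mean_kernel t y y'"
    unfolding mean_kernel_def
  proof (rule integral_cong_AE)
    show "(\<lambda>\<omega>. indicator {\<omega> \<in> space P. locally_integrable_rates \<omega>} \<omega> * capped_kernel \<omega> 0 t y y') \<in> borel_measurable P"
      by (rule borel_measurable_times[OF borel_measurable_indicator[OF locally_integrable_measurable]]) measurable
    show "AE \<omega> in P. indicator {\<omega> \<in> space P. locally_integrable_rates \<omega>} \<omega> * capped_kernel \<omega> 0 t y y' = capped_kernel \<omega> 0 t y y'"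
      using AE_locally_integrable AE_space by eventually_elim simp
  qed measurable
  finally show ?thesis .
qed

text \<open>
Chapman-Kolmogorov at time zero, for the walk run from \<open>- \<sigma>\<close> to \<open>\<tau>\<close>. By stationarity in time the result depends
only on \<open>\<sigma> + \<tau>\<close>, so the same averaged kernel has a whole family of such representations.
\<close>
lemma mean_kernel_pairing:
  assumes "0 \<le> \<sigma>" "0 \<le> \<tau>"
  shows "(\<integral>\<^sup>+z. \<integral>\<^sup>+\<omega>. ennreal (capped_kernel \<omega> (- \<sigma>) 0 y z) * ennreal (capped_kernel \<omega> 0 \<tau> z y') \<partial>P \<partial>count_space UNIV)
    = ennreal (mean_kernel (\<sigma> + \<tau>) y y')"
proof -
  have "(\<integral>\<^sup>+z. \<integral>\<^sup>+\<omega>. ennreal (capped_kernel \<omega> (- \<sigma>) 0 y z) * ennreal (capped_kernel \<omega> 0 \<tau> z y') \<partial>P \<partial>count_space UNIV)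
    = (\<integral>\<^sup>+\<omega>. \<integral>\<^sup>+z. ennreal (capped_kernel \<omega> (- \<sigma>) 0 y z) * ennreal (capped_kernel \<omega> 0 \<tau> z y') \<partial>count_space UNIV \<partial>P)"
    by (rule nn_integral_count_space_nn_integral[symmetric]) (auto intro: countableI_type)
  also have "\<dots> = (\<integral>\<^sup>+\<omega>. ennreal (capped_kernel \<omega> (- \<sigma>) \<tau> y y') \<partial>P)"
  proof (rule nn_integral_cong_AE, use AE_regular in eventually_elim)
    case (elim \<omega>)
    interpret J: jump_rates "\<lambda>u x y. \<omega> u (x, y)" "exit_rate \<omega>"
      using elim by (intro jump_rates_environment) (auto simp: regular_env_def)
    have "(\<integral>\<^sup>+z. ennreal (capped_kernel \<omega> (- \<sigma>) 0 y z) * ennreal (capped_kernel \<omega> 0 \<tau> z y') \<partial>count_space UNIV)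
      = (\<integral>\<^sup>+z. full_kernel \<omega> (- \<sigma>) 0 y z * full_kernel \<omega> 0 \<tau> z y' \<partial>count_space UNIV)"
      using assms by (simp add: capped_kernel_eq(1)[OF elim])
    also have "\<dots> = full_kernel \<omega> (- \<sigma>) \<tau> y y'"
      using assms by (intro J.chapman_kolmogorov[symmetric]) auto
    also have "\<dots> = ennreal (capped_kernel \<omega> (- \<sigma>) \<tau> y y')"
      using assms by (intro capped_kernel_eq(1)[OF elim, symmetric]) auto
    finally show ?case .
  qed
  also have "\<dots> = (\<integral>\<^sup>+\<omega>. ennreal (capped_kernel (shift \<sigma> 0 \<omega>) (- \<sigma>) \<tau> y y') \<partial>P)"
    by (rule stationary_nn_integral[symmetric]) measurable
  also have "\<dots> = (\<integral>\<^sup>+\<omega>. ennreal (capped_kernel \<omega> 0 (\<sigma> + \<tau>) y y') \<partial>P)"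
    using AE_capped_kernel_shift[of "- \<sigma>" \<tau> \<sigma> 0 y y'] assms
    by (intro nn_integral_cong_AE) (auto simp: add.commute)
  also have "\<dots> = ennreal (mean_kernel (\<sigma> + \<tau>) y y')" by (rule mean_kernel_nn)
  finally show ?thesis .
qed

definition drift :: "'n site \<Rightarrow> 'n site \<Rightarrow> real \<Rightarrow> 'n environment \<Rightarrow> real" where
  "drift y y' r \<omega> = (\<Sum>z | (z, y') \<in> bonds. capped_kernel \<omega> 0 r y z * \<omega> r (z, y')) - exit_rate \<omega> r y' * capped_kernel \<omega> 0 r y y'"

text \<open>
The drift of the forward equation, with the environment shifted so that the conductances are those at
time zero. In this form the time \<open>r\<close> enters only through the kernel.
\<close>
definition pulled_drift :: "'n site \<Rightarrow> 'n site \<Rightarrow> real \<Rightarrow> 'n environment \<Rightarrow> real" where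
  "pulled_drift y y' r \<omega> = (\<Sum>z | (z, y') \<in> bonds. capped_kernel \<omega> (- r) 0 y z * \<omega> 0 (z, y')) - exit_rate \<omega> 0 y' * capped_kernel \<omega> (- r) 0 y y'"

text \<open>
A dominating function: kernels take values in \<open>[0, 1]\<close>.
\<close>
definition drift_bound :: "'n site \<Rightarrow> real \<Rightarrow> 'n environment \<Rightarrow> real" where
  "drift_bound y' r \<omega> = (\<Sum>z | (z, y') \<in> bonds. \<omega> r (z, y')) + (\<Sum>z | (y', z) \<in> bonds. \<omega> r (y', z))"

lemma abs_diff_le_drift_bound:
  assumes \<omega>: "\<omega> \<in> space P" and k: "\<And>z. 0 \<le> k z" "\<And>z. k z \<le> 1"
  shows "\<bar>(\<Sum>z | (z, y') \<in> bonds. k z * \<omega> r (z, y')) - exit_rate \<omega> r y' * k y'\<bar> \<le> drift_bound y' r \<omega>"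
proof -
  have "0 \<le> (\<Sum>z | (z, y') \<in> bonds. k z * \<omega> r (z, y'))" "0 \<le> exit_rate \<omega> r y' * k y'"
    unfolding exit_rate_def using k env_nonneg[OF \<omega>] by (intro sum_nonneg mult_nonneg_nonneg; simp)+
  moreover have "(\<Sum>z | (z, y') \<in> bonds. k z * \<omega> r (z, y')) \<le> (\<Sum>z | (z, y') \<in> bonds. \<omega> r (z, y'))"
    using k env_nonneg[OF \<omega>] by (intro sum_mono mult_left_le_one_le) auto
  moreover have "exit_rate \<omega> r y' * k y' \<le> (\<Sum>z | (y', z) \<in> bonds. \<omega> r (y', z))"
    unfolding exit_rate_def using k env_nonneg[OF \<omega>] by (intro mult_left_le sum_nonneg) auto
  moreover have "0 \<le> (\<Sum>z | (z, y') \<in> bonds. \<omega> r (z, y'))" "0 \<le> (\<Sum>z | (y', z) \<in> bonds. \<omega> r (y', z))"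
    using env_nonneg[OF \<omega>] by (intro sum_nonneg; simp)+
  ultimately show ?thesis unfolding drift_bound_def by linarith
qed

lemma drift_bound_nonneg: "\<omega> \<in> space P \<Longrightarrow> 0 \<le> drift_bound y' r \<omega>"
  unfolding drift_bound_def by (intro add_nonneg_nonneg sum_nonneg env_nonneg)

lemma drift_bound_mean: "(\<integral>\<^sup>+\<omega>. ennreal (drift_bound y' r \<omega>) \<partial>P)
  = (\<Sum>z | (z, y') \<in> bonds. mean_rate (z, y')) + (\<Sum>z | (y', z) \<in> bonds. mean_rate (y', z))"
proof -
  have "(\<integral>\<^sup>+\<omega>. ennreal (drift_bound y' r \<omega>) \<partial>P) = (\<integral>\<^sup>+\<omega>. (\<Sum>z | (z, y') \<in> bonds. ennreal (\<omega> r (z, y'))) + (\<Sum>z | (y', z) \<in> bonds. ennreal (\<omega> r (y', z))) \<partial>P)"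
    unfolding drift_bound_def
    by (rule nn_integral_cong) (simp add: env_nonneg sum_nonneg sum_ennreal)
  also have "\<dots> = (\<Sum>z | (z, y') \<in> bonds. mean_rate (z, y')) + (\<Sum>z | (y', z) \<in> bonds. mean_rate (y', z))"
    by (subst nn_integral_add) (simp_all add: nn_integral_sum nn_integral_rate)
  finally show ?thesis .
qed

lemma finite_neighbours: "finite {z. (z, y') \<in> (bonds :: ('n site \<times> 'n site) set)}" "finite {z. (y', z) \<in> (bonds :: ('n site \<times> 'n site) set)}"
proof -
  have "AE \<omega> in P. \<omega> \<in> environments \<and> locally_integrable_rates \<omega>"
    using AE_regular by eventually_elim (simp add: regular_env_def)
  then have "\<exists>\<omega>. \<omega> \<in> environments \<and> locally_integrable_rates (\<omega> :: 'n environment)"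
    by (rule eventually_happens'[rotated]) (simp add: ae_filter_eq_bot_iff emeasure_space_1)
  then obtain \<omega> :: "'n environment" where "\<omega> \<in> environments" "locally_integrable_rates \<omega>" by blast
  then show 2: "finite {z. (y', z) \<in> (bonds :: ('n site \<times> 'n site) set)}" using nbr_fin by blast
  have "{z. (z, y') \<in> bonds} = {z. (y', z) \<in> (bonds :: ('n site \<times> 'n site) set)}"
    unfolding bonds_def graph_dist_def by (simp add: abs_minus_commute)
  with 2 show "finite {z. (z, y') \<in> (bonds :: ('n site \<times> 'n site) set)}" by simp
qed

lemma drift_bound_mean_finite: "(\<integral>\<^sup>+\<omega>. ennreal (drift_bound y' r \<omega>) \<partial>P) < \<infinity>"
  unfolding drift_bound_mean using mean_rate_finite finite_neighbours by (simp add: ennreal_sum_less_top)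

lemma drift_bound_measurable[measurable]: "drift_bound y' r \<in> borel_measurable P"
  unfolding drift_bound_def[abs_def] by measurable

lemma drift_bound_integrable: "integrable P (drift_bound y' r)"
proof (rule integrableI_bounded)
  have "(\<integral>\<^sup>+\<omega>. ennreal (norm (drift_bound y' r \<omega>)) \<partial>P) = (\<integral>\<^sup>+\<omega>. ennreal (drift_bound y' r \<omega>) \<partial>P)"
    by (rule nn_integral_cong) (simp add: drift_bound_nonneg)
  then show "(\<integral>\<^sup>+\<omega>. ennreal (norm (drift_bound y' r \<omega>)) \<partial>P) < \<infinity>" using drift_bound_mean_finite by simp
qed measurable

lemma pulled_drift_measurable[measurable]: "pulled_drift y y' r \<in> borel_measurable P"
  unfolding pulled_drift_def[abs_def] by measurable

lemma mean_drift_eq: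
  assumes "0 \<le> r"
  shows "(\<integral>\<omega>. drift y y' r \<omega> \<partial>P) = (\<integral>\<omega>. pulled_drift y y' r \<omega> \<partial>P)"
proof -
  have "AE \<omega> in P. \<forall>z. capped_kernel (shift r 0 \<omega>) (- r) 0 y z = capped_kernel \<omega> 0 r y z"
    unfolding AE_all_countable using AE_capped_kernel_shift[of "- r" 0 r 0 y] assms by simp
  then have "AE \<omega> in P. pulled_drift y y' r (shift r 0 \<omega>) = drift y y' r \<omega>"
  proof eventually_elim
    case (elim \<omega>)
    have e: "exit_rate (shift r 0 \<omega>) 0 y' = exit_rate \<omega> r y'" by (simp add: exit_rate_shift)
    have "shift r 0 \<omega> 0 (z, y') = \<omega> r (z, y')" for z by (simp add: shift_def)
    with elim e show ?case by (simp add: pulled_drift_def drift_def)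
  qed
  moreover have "drift y y' r \<in> borel_measurable P" unfolding drift_def[abs_def] by measurable
  moreover have "(\<lambda>\<omega>. pulled_drift y y' r (shift r 0 \<omega>)) \<in> borel_measurable P" by measurable
  ultimately have "(\<integral>\<omega>. drift y y' r \<omega> \<partial>P) = (\<integral>\<omega>. pulled_drift y y' r (shift r 0 \<omega>) \<partial>P)"
    by (intro integral_cong_AE) auto
  also have "\<dots> = (\<integral>\<omega>. pulled_drift y y' r \<omega> \<partial>P)" by (rule stationary_integral) measurable
  finally show ?thesis .
qed

text \<open>
Dominated convergence. The drift itself need not be continuous in time, but the pulled drift is, by reversal
and the forward equation of the reversed environment.
\<close>
lemma mean_drift_continuous: "continuous_on {0..T} (\<lambda>r. \<integral>\<omega>. pulled_drift y y' r \<omega> \<partial>P)"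
  unfolding continuous_on_sequentially
proof (intro allI ballI impI, elim conjE)
  fix x :: "nat \<Rightarrow> real" and a :: real
  assume a: "a \<in> {0..T}" and x: "\<forall>n. x n \<in> {0..T}" and lim: "x \<longlonglongrightarrow> a"
  have "(\<lambda>n. \<integral>\<omega>. pulled_drift y y' (x n) \<omega> \<partial>P) \<longlonglongrightarrow> (\<integral>\<omega>. pulled_drift y y' a \<omega> \<partial>P)"
  proof (rule integral_dominated_convergence[where w="drift_bound y' 0"])
    show "AE \<omega> in P. (\<lambda>n. pulled_drift y y' (x n) \<omega>) \<longlonglongrightarrow> pulled_drift y y' a \<omega>"
      using AE_regular
    proof eventually_elim
      case (elim \<omega>)
      have "continuous_on {0..T} (\<lambda>r. capped_kernel (reversed_env \<omega>) 0 r z y)" for z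
        by (rule continuous_on_capped_kernel[OF regular_env_reversed[OF elim]])
      then have "(\<lambda>n. capped_kernel (reversed_env \<omega>) 0 (x n) z y) \<longlonglongrightarrow> capped_kernel (reversed_env \<omega>) 0 a z y" for z
        using a x lim unfolding continuous_on_sequentially comp_def by blast
      then have "(\<lambda>n. capped_kernel \<omega> (- x n) 0 y z) \<longlonglongrightarrow> capped_kernel \<omega> (- a) 0 y z" for z
        unfolding capped_kernel_reversed[OF elim, of _ 0 y z] by simp
      then show ?case unfolding pulled_drift_def by (intro tendsto_intros)
    qed
    show "AE \<omega> in P. norm (pulled_drift y y' (x n) \<omega>) \<le> drift_bound y' 0 \<omega>" for n
      unfolding pulled_drift_def real_norm_def
      by (rule AE_I2, rule abs_diff_le_drift_bound) (simp_all add: capped_kernel_bounds)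
  qed (use drift_bound_integrable in measurable)
  then show "((\<lambda>r. \<integral>\<omega>. pulled_drift y y' r \<omega> \<partial>P) \<circ> x) \<longlonglongrightarrow> (\<integral>\<omega>. pulled_drift y y' a \<omega> \<partial>P)"
    by (simp add: comp_def)
qed

text \<open>
The expectation of the forward equation; Fubini applies since the conductances have finite mean.
\<close>
lemma mean_kernel_integral_equation:
  assumes t: "0 \<le> t"
  shows "mean_kernel t y y' = (if y = y' then 1 else 0) + (LBINT r:{0..t}. (\<integral>\<omega>. pulled_drift y y' r \<omega> \<partial>P))"
proof -
  interpret PL: pair_sigma_finite P lborel ..
  let ?f = "\<lambda>\<omega> r. indicator {0..t} r *\<^sub>R drift y y' r \<omega>"
  have m[measurable]: "(\<lambda>p. ?f (fst p) (snd p)) \<in> borel_measurable (P \<Otimes>\<^sub>M lborel)"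
    unfolding drift_def by measurable
  have int: "integrable (P \<Otimes>\<^sub>M lborel) (\<lambda>(\<omega>, r). ?f \<omega> r)"
  proof (rule integrableI_bounded)
    show "(\<lambda>(\<omega>, r). ?f \<omega> r) \<in> borel_measurable (P \<Otimes>\<^sub>M lborel)" using m by (simp add: case_prod_beta')
    have mb: "(\<lambda>p. indicator {0..t} (snd p) * ennreal (drift_bound y' (snd p) (fst p))) \<in> borel_measurable (P \<Otimes>\<^sub>M lborel)"
      unfolding drift_bound_def by measurable
    have "(\<integral>\<^sup>+p. ennreal (norm (case p of (\<omega>, r) \<Rightarrow> ?f \<omega> r)) \<partial>(P \<Otimes>\<^sub>M lborel))
      \<le> (\<integral>\<^sup>+p. indicator {0..t} (snd p) * ennreal (drift_bound y' (snd p) (fst p)) \<partial>(P \<Otimes>\<^sub>M lborel))"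
    proof (rule nn_integral_mono)
      fix p :: "'n environment \<times> real" assume "p \<in> space (P \<Otimes>\<^sub>M lborel)"
      then have "fst p \<in> space P" by (auto simp: space_pair_measure)
      then have "\<bar>drift y y' (snd p) (fst p)\<bar> \<le> drift_bound y' (snd p) (fst p)"
        unfolding drift_def by (intro abs_diff_le_drift_bound) (simp_all add: capped_kernel_bounds)
      then show "ennreal (norm (case p of (\<omega>, r) \<Rightarrow> ?f \<omega> r)) \<le> indicator {0..t} (snd p) * ennreal (drift_bound y' (snd p) (fst p))"
        by (auto simp: case_prod_beta indicator_def ennreal_leI)
    qed
    also have "\<dots> = (\<integral>\<^sup>+r. \<integral>\<^sup>+\<omega>. indicator {0..t} r * ennreal (drift_bound y' r \<omega>) \<partial>P \<partial>lborel)"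
      using PL.nn_integral_snd[OF mb] by simp
    also have "\<dots> = (\<integral>\<^sup>+r. ((\<Sum>z | (z, y') \<in> bonds. mean_rate (z, y')) + (\<Sum>z | (y', z) \<in> bonds. mean_rate (y', z))) * indicator {0..t} r \<partial>lborel)"
    proof (rule nn_integral_cong)
      fix r :: real
      show "(\<integral>\<^sup>+\<omega>. indicator {0..t} r * ennreal (drift_bound y' r \<omega>) \<partial>P)
        = ((\<Sum>z | (z, y') \<in> bonds. mean_rate (z, y')) + (\<Sum>z | (y', z) \<in> bonds. mean_rate (y', z))) * indicator {0..t} r"
        by (subst nn_integral_cmult, measurable) (simp add: drift_bound_mean mult.commute)
    qed
    also have "\<dots> = ((\<Sum>z | (z, y') \<in> bonds. mean_rate (z, y')) + (\<Sum>z | (y', z) \<in> bonds. mean_rate (y', z))) * emeasure lborel {0..t}"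
      by (rule nn_integral_cmult_indicator) simp
    also have "\<dots> < \<infinity>"
      using drift_bound_mean_finite[of y' 0] t unfolding drift_bound_mean by (simp add: ennreal_mult_less_top)
    finally show "(\<integral>\<^sup>+p. ennreal (norm (case p of (\<omega>, r) \<Rightarrow> ?f \<omega> r)) \<partial>(P \<Otimes>\<^sub>M lborel)) < \<infinity>" .
  qed
  have "mean_kernel t y y' = (\<integral>\<omega>. (if y = y' then 1 else 0) + (LBINT r. ?f \<omega> r) \<partial>P)"
    unfolding mean_kernel_def
  proof (rule integral_cong_AE)
    show "AE \<omega> in P. capped_kernel \<omega> 0 t y y' = (if y = y' then 1 else 0) + (LBINT r. ?f \<omega> r)"
      using AE_regular
    proof eventually_elim
      case (elim \<omega>)
      show ?case using capped_kernel_forward_equation(2)[OF elim t, of y y']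
        unfolding drift_def set_lebesgue_integral_def .
    qed
    have "(\<lambda>\<omega>. LBINT r. ?f \<omega> r) \<in> borel_measurable P"
      using lborel.borel_measurable_lebesgue_integral[of "?f" P] m by (simp add: case_prod_beta')
    then show "(\<lambda>\<omega>. (if y = y' then 1 else 0) + (LBINT r. ?f \<omega> r)) \<in> borel_measurable P" by simp
  qed measurable
  also have "\<dots> = (if y = y' then 1 else 0) + (\<integral>\<omega>. (LBINT r. ?f \<omega> r) \<partial>P)"
    using PL.integrable_fst[OF int] by (subst Bochner_Integration.integral_add) (auto simp: prob_space)
  also have "(\<integral>\<omega>. (LBINT r. ?f \<omega> r) \<partial>P) = (LBINT r. (\<integral>\<omega>. ?f \<omega> r \<partial>P))"
    by (rule PL.Fubini_integral[OF int, symmetric])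
  also have "\<dots> = (LBINT r:{0..t}. (\<integral>\<omega>. pulled_drift y y' r \<omega> \<partial>P))"
    unfolding set_lebesgue_integral_def
    by (rule Bochner_Integration.integral_cong) (auto simp: indicator_def mean_drift_eq)
  finally show ?thesis .
qed

text \<open>
The averaged kernel is the integral of a continuous function, even though for a fixed environment the kernel
is only absolutely continuous in time.
\<close>
lemma mean_kernel_has_derivative:
  assumes t: "0 < t"
  shows "((\<lambda>t. mean_kernel t y y') has_real_derivative (\<integral>\<omega>. pulled_drift y y' t \<omega> \<partial>P)) (at t)"
proof -
  let ?g = "\<lambda>r. \<integral>\<omega>. pulled_drift y y' r \<omega> \<partial>P"
  have c: "continuous_on {0..t + 1} ?g" by (rule mean_drift_continuous)
  have "((\<lambda>u. integral {0..u} ?g) has_vector_derivative ?g t) (at t within {0..t + 1})"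
    by (rule integral_has_vector_derivative[OF c]) (use t in auto)
  then have "((\<lambda>u. integral {0..u} ?g) has_vector_derivative ?g t) (at t)"
    using t by (simp add: at_within_Icc_at)
  then have "((\<lambda>u. (if y = y' then 1 else 0) + integral {0..u} ?g) has_real_derivative ?g t) (at t)"
    by (auto intro!: derivative_eq_intros simp: has_real_derivative_iff_has_vector_derivative)
  then show ?thesis
  proof (rule DERIV_cong_ev[THEN iffD1, rotated -1])
    show "\<forall>\<^sub>F u in nhds t. (if y = y' then 1 else 0) + integral {0..u} ?g = mean_kernel u y y'"
    proof (rule eventually_nhds_in_open[of "{0<..}", THEN eventually_mono])
      fix u :: real assume "u \<in> {0<..}"
      then have u: "0 \<le> u" by simp
      have "set_integrable lborel {0..u} ?g"
        by (rule borel_integrable_atLeastAtMost'[OF mean_drift_continuous])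
      then have "(LBINT r:{0..u}. ?g r) = integral {0..u} ?g" by (rule set_borel_integral_eq_integral(2))
      then show "(if y = y' then 1 else 0) + integral {0..u} ?g = mean_kernel u y y'"
        using mean_kernel_integral_equation[OF u, of y y'] by simp
    qed (use t in auto)
  qed simp_all
qed

end

section \<open>Averaged energies and decay\<close>

context conductance_law
begin

text \<open>
Stationarity in space: a sum over starting points with a fixed end point becomes a sum over end points
with the origin as starting point.
\<close>
lemma sum_over_sites_eq_from_origin:
  fixes F :: "'n environment \<Rightarrow> 'n site \<Rightarrow> 'n site \<Rightarrow> ennreal"
  assumes m: "\<And>x y. (\<lambda>\<omega>. F \<omega> x y) \<in> borel_measurable P"
    and cov: "\<And>a x y. AE \<omega> in P. F (shift 0 a \<omega>) x y = F \<omega> (x + a) (y + a)"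
  shows "(\<integral>\<^sup>+z. \<integral>\<^sup>+\<omega>. F \<omega> z y \<partial>P \<partial>count_space UNIV) = (\<integral>\<^sup>+w. \<integral>\<^sup>+\<omega>. F \<omega> 0 w \<partial>P \<partial>count_space UNIV)"
proof -
  have "(\<integral>\<^sup>+\<omega>. F \<omega> z y \<partial>P) = (\<integral>\<^sup>+\<omega>. F \<omega> 0 (y - z) \<partial>P)" for z
  proof -
    have "(\<integral>\<^sup>+\<omega>. F \<omega> z y \<partial>P) = (\<integral>\<^sup>+\<omega>. F (shift 0 z \<omega>) 0 (y - z) \<partial>P)"
      using cov[of z 0 "y - z"] by (intro nn_integral_cong_AE) auto
    also have "\<dots> = (\<integral>\<^sup>+\<omega>. F \<omega> 0 (y - z) \<partial>P)" by (rule stationary_nn_integral[OF m])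
    finally show ?thesis .
  qed
  then have "(\<integral>\<^sup>+z. \<integral>\<^sup>+\<omega>. F \<omega> z y \<partial>P \<partial>count_space UNIV) = (\<integral>\<^sup>+z. \<integral>\<^sup>+\<omega>. F \<omega> 0 (y - z) \<partial>P \<partial>count_space UNIV)" by simp
  also have "\<dots> = (\<integral>\<^sup>+w. \<integral>\<^sup>+\<omega>. F \<omega> 0 w \<partial>P \<partial>count_space UNIV)"
    by (rule nn_integral_bij_count_space) (rule bij_betw_byWitness[where f'="\<lambda>z. y - z"], auto)
  finally show ?thesis .
qed

text \<open>
A bound for almost every environment passes to the average over environments by Tonelli.
\<close>
lemma averaged_swap:
  fixes G :: "'n environment \<Rightarrow> real \<Rightarrow> 'n site \<Rightarrow> ennreal"
  assumes m: "\<And>w. (\<lambda>p. G (fst p) (snd p) w) \<in> borel_measurable (P \<Otimes>\<^sub>M lborel)" and A[measurable]: "A \<in> sets borel"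
    and b: "AE \<omega> in P. (\<integral>\<^sup>+\<tau>. indicator A \<tau> * (\<integral>\<^sup>+w. G \<omega> \<tau> w \<partial>count_space UNIV) \<partial>lborel) \<le> C"
  shows "(\<integral>\<^sup>+\<tau>. indicator A \<tau> * (\<integral>\<^sup>+w. \<integral>\<^sup>+\<omega>. G \<omega> \<tau> w \<partial>P \<partial>count_space UNIV) \<partial>lborel) \<le> C"
proof -
  interpret PL: pair_sigma_finite P lborel ..
  have mw: "(\<lambda>\<omega>. G \<omega> \<tau> w) \<in> borel_measurable P" for \<tau> w
    using measurable_compose[OF measurable_Pair2'[of \<tau> lborel P] m[of w]] by simp
  have ms: "(\<lambda>\<omega>. \<integral>\<^sup>+w. G \<omega> \<tau> w \<partial>count_space UNIV) \<in> borel_measurable P" for \<tau>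
    by (rule borel_measurable_nn_integral_count_space[OF mw])
  have mp[measurable]: "(\<lambda>p. \<integral>\<^sup>+w. G (fst p) (snd p) w \<partial>count_space UNIV) \<in> borel_measurable (P \<Otimes>\<^sub>M lborel)"
    by (rule borel_measurable_nn_integral_count_space[OF m])
  have jm: "(\<lambda>(\<omega>, \<tau>). indicator A \<tau> * (\<integral>\<^sup>+w. G \<omega> \<tau> w \<partial>count_space UNIV)) \<in> borel_measurable (P \<Otimes>\<^sub>M lborel)"
    unfolding case_prod_beta' by measurable
  have "(\<integral>\<^sup>+\<tau>. indicator A \<tau> * (\<integral>\<^sup>+w. \<integral>\<^sup>+\<omega>. G \<omega> \<tau> w \<partial>P \<partial>count_space UNIV) \<partial>lborel)
    = (\<integral>\<^sup>+\<tau>. \<integral>\<^sup>+\<omega>. indicator A \<tau> * (\<integral>\<^sup>+w. G \<omega> \<tau> w \<partial>count_space UNIV) \<partial>P \<partial>lborel)"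
  proof (rule nn_integral_cong)
    fix \<tau>
    have "(\<integral>\<^sup>+w. \<integral>\<^sup>+\<omega>. G \<omega> \<tau> w \<partial>P \<partial>count_space UNIV) = (\<integral>\<^sup>+\<omega>. \<integral>\<^sup>+w. G \<omega> \<tau> w \<partial>count_space UNIV \<partial>P)"
      by (rule nn_integral_count_space_nn_integral[symmetric]) (use mw in \<open>auto intro: countableI_type\<close>)
    then show "indicator A \<tau> * (\<integral>\<^sup>+w. \<integral>\<^sup>+\<omega>. G \<omega> \<tau> w \<partial>P \<partial>count_space UNIV)
      = (\<integral>\<^sup>+\<omega>. indicator A \<tau> * (\<integral>\<^sup>+w. G \<omega> \<tau> w \<partial>count_space UNIV) \<partial>P)"
      by (simp add: nn_integral_cmult[OF ms])
  qed
  also have "\<dots> = (\<integral>\<^sup>+\<omega>. \<integral>\<^sup>+\<tau>. indicator A \<tau> * (\<integral>\<^sup>+w. G \<omega> \<tau> w \<partial>count_space UNIV) \<partial>lborel \<partial>P)"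
    by (rule PL.Fubini'[OF jm])
  also have "\<dots> \<le> (\<integral>\<^sup>+\<omega>. C \<partial>P)" by (rule nn_integral_mono_AE[OF b])
  also have "\<dots> = C" by (simp add: emeasure_space_1)
  finally show ?thesis .
qed

definition decay :: "real \<Rightarrow> real" where
  "decay \<rho> = nash_constant (real CARD('n)) c0 * \<rho> powr (- real CARD('n) / 2)"

text \<open>
The kernel started at time zero in \<open>x\<close>, sampled at times \<open>\<rho> + j * \<delta> + \<tau>\<close> and cut off.
\<close>
definition forward_samples :: "nat \<Rightarrow> real \<Rightarrow> real \<Rightarrow> 'n environment \<Rightarrow> real \<Rightarrow> 'n site \<Rightarrow> 'n site \<Rightarrow> nat \<Rightarrow> real" where
  "forward_samples N \<rho> \<delta> \<omega> \<tau> x y j = tent N j * capped_kernel \<omega> 0 (\<rho> + real j * \<delta> + \<tau>) x y"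

text \<open>
The kernel arriving at time zero in \<open>x\<close>, as a function of the starting time. The arguments are ordered as for
the forward samples, with the site occupied at time zero first.
\<close>
definition backward_samples :: "nat \<Rightarrow> real \<Rightarrow> real \<Rightarrow> 'n environment \<Rightarrow> real \<Rightarrow> 'n site \<Rightarrow> 'n site \<Rightarrow> nat \<Rightarrow> real" where
  "backward_samples N \<rho> \<delta> \<omega> \<tau> x y j = tent N j * capped_kernel \<omega> (- (\<rho> + real j * \<delta> + \<tau>)) 0 y x"

lemma sample_energy_measurable[measurable (raw)]:
  assumes m: "\<pi> \<in> measurable M P" "g \<in> borel_measurable M"
  shows "(\<lambda>v. time_energy N (forward_samples N \<rho> \<delta> (\<pi> v) (g v) x y)) \<in> borel_measurable M"
    and "(\<lambda>v. time_energy N (backward_samples N \<rho> \<delta> (\<pi> v) (g v) x y)) \<in> borel_measurable M"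
  unfolding forward_samples_def[abs_def] backward_samples_def[abs_def]
  by (intro borel_measurable_time_energy borel_measurable_times borel_measurable_const
      capped_kernel_measurable_comp[OF m(1)] borel_measurable_uminus borel_measurable_add m(2))+

lemma capped_kernel_square_measurable[measurable]:
  "(\<lambda>\<omega>. ennreal ((capped_kernel \<omega> s t x y)\<^sup>2)) \<in> borel_measurable P"
  by (intro measurable_compose[OF _ measurable_ennreal] borel_measurable_power
      capped_kernel_measurable_comp measurable_ident_sets borel_measurable_const refl)

lemma samples_shift:
  assumes "0 < \<rho>" "0 < \<delta>" "0 \<le> \<tau>"
  shows "AE \<omega> in P. forward_samples N \<rho> \<delta> (shift 0 a \<omega>) \<tau> x y = forward_samples N \<rho> \<delta> \<omega> \<tau> (x + a) (y + a)"
    and "AE \<omega> in P. backward_samples N \<rho> \<delta> (shift 0 a \<omega>) \<tau> x y = backward_samples N \<rho> \<delta> \<omega> \<tau> (x + a) (y + a)"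
proof -
  have p: "0 \<le> \<rho> + real j * \<delta> + \<tau>" for j using assms by simp
  have "AE \<omega> in P. \<forall>j. capped_kernel (shift 0 a \<omega>) 0 (\<rho> + real j * \<delta> + \<tau>) x y = capped_kernel \<omega> 0 (\<rho> + real j * \<delta> + \<tau>) (x + a) (y + a)"
    unfolding AE_all_countable using AE_capped_kernel_shift[OF p, of 0 a] by simp
  then show "AE \<omega> in P. forward_samples N \<rho> \<delta> (shift 0 a \<omega>) \<tau> x y = forward_samples N \<rho> \<delta> \<omega> \<tau> (x + a) (y + a)"
    by eventually_elim (simp add: forward_samples_def fun_eq_iff)
  have n: "- (\<rho> + real j * \<delta> + \<tau>) \<le> 0" for j using p[of j] by simp
  have "AE \<omega> in P. \<forall>j. capped_kernel (shift 0 a \<omega>) (- (\<rho> + real j * \<delta> + \<tau>)) 0 y x = capped_kernel \<omega> (- (\<rho> + real j * \<delta> + \<tau>)) 0 (y + a) (x + a)"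
    unfolding AE_all_countable using AE_capped_kernel_shift[OF n, of 0 a] by simp
  then show "AE \<omega> in P. backward_samples N \<rho> \<delta> (shift 0 a \<omega>) \<tau> x y = backward_samples N \<rho> \<delta> \<omega> \<tau> (x + a) (y + a)"
    by eventually_elim (simp add: backward_samples_def fun_eq_iff)
qed

lemma backward_samples_reversed:
  assumes "regular_env c0 c1 \<omega>"
  shows "backward_samples N \<rho> \<delta> \<omega> \<tau> x y = forward_samples N \<rho> \<delta> (reversed_env \<omega>) \<tau> x y"
  unfolding backward_samples_def[abs_def] forward_samples_def[abs_def] capped_kernel_reversed[OF assms, of _ 0 y x]
  by (simp add: algebra_simps)

lemma quenched_sample_energy:
  assumes reg: "regular_env c0 c1 \<omega>" and p: "0 < \<rho>" "0 < \<delta>" "0 < N"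
  shows "(\<integral>\<^sup>+\<tau>. indicator {0..\<delta>} \<tau> * (\<integral>\<^sup>+y. ennreal (time_energy N (forward_samples N \<rho> \<delta> \<omega> \<tau> x y)) \<partial>count_space UNIV) \<partial>lborel)
    \<le> ennreal (\<delta> * (c1\<^sup>2 / 2 + 1) * decay \<rho>)"
proof -
  have "(\<integral>\<^sup>+\<tau>. indicator {0..\<delta>} \<tau> * (\<integral>\<^sup>+y. ennreal (time_energy N (forward_samples N \<rho> \<delta> \<omega> \<tau> x y)) \<partial>count_space UNIV) \<partial>lborel)
    = (\<integral>\<^sup>+\<tau>. indicator {0..\<delta>} \<tau> * (\<integral>\<^sup>+y. ennreal (time_energy N
      (\<lambda>j. tent N j * enn2real (full_kernel \<omega> 0 (\<rho> + real j * \<delta> + \<tau>) x y))) \<partial>count_space UNIV) \<partial>lborel)"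
  proof (rule nn_integral_cong)
    fix \<tau> :: real
    have "forward_samples N \<rho> \<delta> \<omega> \<tau> x y = (\<lambda>j. tent N j * enn2real (full_kernel \<omega> 0 (\<rho> + real j * \<delta> + \<tau>) x y))"
      if "\<tau> \<in> {0..\<delta>}" for y
    proof
      fix j
      have "0 \<le> \<rho> + real j * \<delta> + \<tau>" using p that by simp
      then show "forward_samples N \<rho> \<delta> \<omega> \<tau> x y j = tent N j * enn2real (full_kernel \<omega> 0 (\<rho> + real j * \<delta> + \<tau>) x y)"
        by (simp add: forward_samples_def capped_kernel_eq(2)[OF reg])
    qed
    then show "indicator {0..\<delta>} \<tau> * (\<integral>\<^sup>+y. ennreal (time_energy N (forward_samples N \<rho> \<delta> \<omega> \<tau> x y)) \<partial>count_space UNIV)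
      = indicator {0..\<delta>} \<tau> * (\<integral>\<^sup>+y. ennreal (time_energy N
      (\<lambda>j. tent N j * enn2real (full_kernel \<omega> 0 (\<rho> + real j * \<delta> + \<tau>) x y))) \<partial>count_space UNIV)"
      by (cases "\<tau> \<in> {0..\<delta>}") simp_all
  qed
  also have "\<dots> \<le> ennreal (\<delta> * (c1\<^sup>2 / 2 + 1) * decay \<rho>)"
    unfolding decay_def by (rule full_kernel_time_energy[OF reg c0 c1 p(1,3,2)])
  finally show ?thesis .
qed

text \<open>
For both families one sums over the site at time zero, which stationarity in space converts into a sum over the
other end point. For the backward samples reversal then reduces to the forward ones.
\<close>
lemma mean_sample_energy:
  fixes y :: "'n site"
  assumes p: "0 < \<rho>" "0 < \<delta>" "0 < N"
  shows "(\<integral>\<^sup>+\<tau>. indicator {0..\<delta>} \<tau> * (\<integral>\<^sup>+z. \<integral>\<^sup>+\<omega>. ennreal (time_energy N (forward_samples N \<rho> \<delta> \<omega> \<tau> z y)) \<partial>P \<partial>count_space UNIV) \<partial>lborel)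
    \<le> ennreal (\<delta> * (c1\<^sup>2 / 2 + 1) * decay \<rho>)" (is "?F \<le> ?C")
    and "(\<integral>\<^sup>+\<tau>. indicator {0..\<delta>} \<tau> * (\<integral>\<^sup>+z. \<integral>\<^sup>+\<omega>. ennreal (time_energy N (backward_samples N \<rho> \<delta> \<omega> \<tau> z y)) \<partial>P \<partial>count_space UNIV) \<partial>lborel)
    \<le> ennreal (\<delta> * (c1\<^sup>2 / 2 + 1) * decay \<rho>)" (is "?B \<le> ?C")
proof -
  have "?F = (\<integral>\<^sup>+\<tau>. indicator {0..\<delta>} \<tau> * (\<integral>\<^sup>+w. \<integral>\<^sup>+\<omega>. ennreal (time_energy N (forward_samples N \<rho> \<delta> \<omega> \<tau> 0 w)) \<partial>P \<partial>count_space UNIV) \<partial>lborel)"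
  proof (rule nn_integral_cong)
    fix \<tau> :: real
    have "(\<integral>\<^sup>+z. \<integral>\<^sup>+\<omega>. ennreal (time_energy N (forward_samples N \<rho> \<delta> \<omega> \<tau> z y)) \<partial>P \<partial>count_space UNIV)
      = (\<integral>\<^sup>+w. \<integral>\<^sup>+\<omega>. ennreal (time_energy N (forward_samples N \<rho> \<delta> \<omega> \<tau> 0 w)) \<partial>P \<partial>count_space UNIV)" if "0 \<le> \<tau>"
    proof (rule sum_over_sites_eq_from_origin)
      fix a x y
      show "AE \<omega> in P. ennreal (time_energy N (forward_samples N \<rho> \<delta> (shift 0 a \<omega>) \<tau> x y))
        = ennreal (time_energy N (forward_samples N \<rho> \<delta> \<omega> \<tau> (x + a) (y + a)))"
        using samples_shift(1)[OF p(1,2) that, of N a x y] by eventually_elim simp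
    qed measurable
    then show "indicator {0..\<delta>} \<tau> * (\<integral>\<^sup>+z. \<integral>\<^sup>+\<omega>. ennreal (time_energy N (forward_samples N \<rho> \<delta> \<omega> \<tau> z y)) \<partial>P \<partial>count_space UNIV)
      = indicator {0..\<delta>} \<tau> * (\<integral>\<^sup>+w. \<integral>\<^sup>+\<omega>. ennreal (time_energy N (forward_samples N \<rho> \<delta> \<omega> \<tau> 0 w)) \<partial>P \<partial>count_space UNIV)"
      by (cases "\<tau> \<in> {0..\<delta>}") simp_all
  qed
  also have "\<dots> \<le> ?C"
  proof (rule averaged_swap)
    show "AE \<omega> in P. (\<integral>\<^sup>+\<tau>. indicator {0..\<delta>} \<tau> * (\<integral>\<^sup>+w. ennreal (time_energy N (forward_samples N \<rho> \<delta> \<omega> \<tau> 0 w)) \<partial>count_space UNIV) \<partial>lborel) \<le> ?C"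
      using AE_regular by eventually_elim (rule quenched_sample_energy[OF _ p])
  qed measurable
  finally show "?F \<le> ?C" .
  have "?B = (\<integral>\<^sup>+\<tau>. indicator {0..\<delta>} \<tau> * (\<integral>\<^sup>+w. \<integral>\<^sup>+\<omega>. ennreal (time_energy N (backward_samples N \<rho> \<delta> \<omega> \<tau> 0 w)) \<partial>P \<partial>count_space UNIV) \<partial>lborel)"
  proof (rule nn_integral_cong)
    fix \<tau> :: real
    have "(\<integral>\<^sup>+z. \<integral>\<^sup>+\<omega>. ennreal (time_energy N (backward_samples N \<rho> \<delta> \<omega> \<tau> z y)) \<partial>P \<partial>count_space UNIV)
      = (\<integral>\<^sup>+w. \<integral>\<^sup>+\<omega>. ennreal (time_energy N (backward_samples N \<rho> \<delta> \<omega> \<tau> 0 w)) \<partial>P \<partial>count_space UNIV)" if "0 \<le> \<tau>"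
    proof (rule sum_over_sites_eq_from_origin)
      fix a x y
      show "AE \<omega> in P. ennreal (time_energy N (backward_samples N \<rho> \<delta> (shift 0 a \<omega>) \<tau> x y))
        = ennreal (time_energy N (backward_samples N \<rho> \<delta> \<omega> \<tau> (x + a) (y + a)))"
        using samples_shift(2)[OF p(1,2) that, of N a x y] by eventually_elim simp
    qed measurable
    then show "indicator {0..\<delta>} \<tau> * (\<integral>\<^sup>+z. \<integral>\<^sup>+\<omega>. ennreal (time_energy N (backward_samples N \<rho> \<delta> \<omega> \<tau> z y)) \<partial>P \<partial>count_space UNIV)
      = indicator {0..\<delta>} \<tau> * (\<integral>\<^sup>+w. \<integral>\<^sup>+\<omega>. ennreal (time_energy N (backward_samples N \<rho> \<delta> \<omega> \<tau> 0 w)) \<partial>P \<partial>count_space UNIV)"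
      by (cases "\<tau> \<in> {0..\<delta>}") simp_all
  qed
  also have "\<dots> \<le> ?C"
  proof (rule averaged_swap)
    show "AE \<omega> in P. (\<integral>\<^sup>+\<tau>. indicator {0..\<delta>} \<tau> * (\<integral>\<^sup>+w. ennreal (time_energy N (backward_samples N \<rho> \<delta> \<omega> \<tau> 0 w)) \<partial>count_space UNIV) \<partial>lborel) \<le> ?C"
      using AE_regular
    proof eventually_elim
      case (elim \<omega>)
      show ?case unfolding backward_samples_reversed[OF elim]
        by (rule quenched_sample_energy[OF regular_env_reversed[OF elim] p])
    qed
  qed measurable
  finally show "?B \<le> ?C" .
qed

lemma mean_square_sums:
  fixes y :: "'n site"
  assumes t: "0 < t"
  shows "(\<integral>\<^sup>+z. \<integral>\<^sup>+\<omega>. ennreal ((capped_kernel \<omega> 0 t z y)\<^sup>2) \<partial>P \<partial>count_space UNIV) \<le> ennreal (decay t)"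
    and "(\<integral>\<^sup>+z. \<integral>\<^sup>+\<omega>. ennreal ((capped_kernel \<omega> (- t) 0 y z)\<^sup>2) \<partial>P \<partial>count_space UNIV) \<le> ennreal (decay t)"
proof -
  have q: "(\<integral>\<^sup>+w. ennreal ((capped_kernel \<omega> 0 t 0 w)\<^sup>2) \<partial>count_space UNIV) \<le> ennreal (decay t)" if "regular_env c0 c1 \<omega>" for \<omega> :: "'n environment"
    using full_kernel_square_sum[OF that c0 c1 t, of 0] t by (simp add: decay_def capped_kernel_eq(2)[OF that])
  have av: "(\<integral>\<^sup>+w. \<integral>\<^sup>+\<omega>. G \<omega> w \<partial>P \<partial>count_space UNIV) \<le> ennreal (decay t)"
    if m: "\<And>w. (\<lambda>\<omega>. G \<omega> w) \<in> borel_measurable P" and b: "AE \<omega> in P. (\<integral>\<^sup>+w. G \<omega> w \<partial>count_space UNIV) \<le> ennreal (decay t)"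
    for G :: "'n environment \<Rightarrow> 'n site \<Rightarrow> ennreal"
  proof -
    have "(\<integral>\<^sup>+w. \<integral>\<^sup>+\<omega>. G \<omega> w \<partial>P \<partial>count_space UNIV) = (\<integral>\<^sup>+\<omega>. \<integral>\<^sup>+w. G \<omega> w \<partial>count_space UNIV \<partial>P)"
      by (rule nn_integral_count_space_nn_integral[symmetric]) (use m in \<open>auto intro: countableI_type\<close>)
    also have "\<dots> \<le> (\<integral>\<^sup>+\<omega>. ennreal (decay t) \<partial>P)" by (rule nn_integral_mono_AE[OF b])
    finally show ?thesis by (simp add: emeasure_space_1)
  qed
  have "(\<integral>\<^sup>+z. \<integral>\<^sup>+\<omega>. ennreal ((capped_kernel \<omega> 0 t z y)\<^sup>2) \<partial>P \<partial>count_space UNIV)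
    = (\<integral>\<^sup>+w. \<integral>\<^sup>+\<omega>. ennreal ((capped_kernel \<omega> 0 t 0 w)\<^sup>2) \<partial>P \<partial>count_space UNIV)"
  proof (rule sum_over_sites_eq_from_origin)
    fix a x y
    show "AE \<omega> in P. ennreal ((capped_kernel (shift 0 a \<omega>) 0 t x y)\<^sup>2) = ennreal ((capped_kernel \<omega> 0 t (x + a) (y + a))\<^sup>2)"
      using AE_capped_kernel_shift[of 0 t 0 a x y] t by auto
  qed measurable
  also have "\<dots> \<le> ennreal (decay t)"
    by (rule av[OF capped_kernel_square_measurable]) (use AE_regular in eventually_elim, rule q)
  finally show "(\<integral>\<^sup>+z. \<integral>\<^sup>+\<omega>. ennreal ((capped_kernel \<omega> 0 t z y)\<^sup>2) \<partial>P \<partial>count_space UNIV) \<le> ennreal (decay t)" .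
  have "(\<integral>\<^sup>+z. \<integral>\<^sup>+\<omega>. ennreal ((capped_kernel \<omega> (- t) 0 y z)\<^sup>2) \<partial>P \<partial>count_space UNIV)
    = (\<integral>\<^sup>+w. \<integral>\<^sup>+\<omega>. ennreal ((capped_kernel \<omega> (- t) 0 w 0)\<^sup>2) \<partial>P \<partial>count_space UNIV)"
  proof (rule sum_over_sites_eq_from_origin)
    fix a x y
    show "AE \<omega> in P. ennreal ((capped_kernel (shift 0 a \<omega>) (- t) 0 y x)\<^sup>2) = ennreal ((capped_kernel \<omega> (- t) 0 (y + a) (x + a))\<^sup>2)"
      using AE_capped_kernel_shift[of "- t" 0 0 a y x] t by auto
  qed measurable
  also have "\<dots> \<le> ennreal (decay t)"
  proof (rule av[OF capped_kernel_square_measurable], use AE_regular in eventually_elim)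
    case (elim \<omega>)
    show "(\<integral>\<^sup>+w. ennreal ((capped_kernel \<omega> (- t) 0 w 0)\<^sup>2) \<partial>count_space UNIV) \<le> ennreal (decay t)"
      unfolding capped_kernel_reversed[OF elim, of _ 0 _ 0] using q[OF regular_env_reversed[OF elim]] by simp
  qed
  finally show "(\<integral>\<^sup>+z. \<integral>\<^sup>+\<omega>. ennreal ((capped_kernel \<omega> (- t) 0 y z)\<^sup>2) \<partial>P \<partial>count_space UNIV) \<le> ennreal (decay t)" .
qed

text \<open>
The pairing representation with both times equal to \<open>t / 2\<close>, and the arithmetic-geometric mean inequality.
\<close>
lemma mean_kernel_decay:
  assumes t: "0 < t"
  shows "mean_kernel t y y' \<le> decay (t / 2)"
proof -
  have n: "0 \<le> decay s" for s by (simp add: decay_def nash_constant_def)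
  let ?a = "\<lambda>\<omega> z. capped_kernel \<omega> (- (t / 2)) 0 y z" and ?b = "\<lambda>\<omega> z. capped_kernel \<omega> 0 (t / 2) z y'"
  have "ennreal (2 * mean_kernel t y y') = 2 * ennreal (mean_kernel (t / 2 + t / 2) y y')"
    by (simp add: ennreal_mult' mean_kernel_nonneg)
  also have "\<dots> = 2 * (\<integral>\<^sup>+z. \<integral>\<^sup>+\<omega>. ennreal (?a \<omega> z) * ennreal (?b \<omega> z) \<partial>P \<partial>count_space UNIV)"
    using t by (subst mean_kernel_pairing) auto
  also have "\<dots> = (\<integral>\<^sup>+z. \<integral>\<^sup>+\<omega>. 2 * (ennreal (?a \<omega> z) * ennreal (?b \<omega> z)) \<partial>P \<partial>count_space UNIV)"
    by (subst nn_integral_cmult[symmetric], simp) (intro nn_integral_cong nn_integral_cmult[symmetric], measurable)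
  also have "\<dots> \<le> (\<integral>\<^sup>+z. \<integral>\<^sup>+\<omega>. ennreal ((?a \<omega> z)\<^sup>2) + ennreal ((?b \<omega> z)\<^sup>2) \<partial>P \<partial>count_space UNIV)"
  proof (intro nn_integral_mono)
    fix z \<omega>
    have "2 * (ennreal (?a \<omega> z) * ennreal (?b \<omega> z)) = ennreal (2 * ?a \<omega> z * ?b \<omega> z)"
      by (simp add: ennreal_mult' ennreal_mult'' capped_kernel_bounds mult.assoc)
    also have "\<dots> \<le> ennreal ((?a \<omega> z)\<^sup>2 + (?b \<omega> z)\<^sup>2)"
      by (rule ennreal_leI) (use sum_squares_bound[of "?a \<omega> z" "?b \<omega> z"] in simp)
    finally show "2 * (ennreal (?a \<omega> z) * ennreal (?b \<omega> z)) \<le> ennreal ((?a \<omega> z)\<^sup>2) + ennreal ((?b \<omega> z)\<^sup>2)" by simp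
  qed
  also have "\<dots> = (\<integral>\<^sup>+z. \<integral>\<^sup>+\<omega>. ennreal ((?a \<omega> z)\<^sup>2) \<partial>P \<partial>count_space UNIV) + (\<integral>\<^sup>+z. \<integral>\<^sup>+\<omega>. ennreal ((?b \<omega> z)\<^sup>2) \<partial>P \<partial>count_space UNIV)"
    by (subst nn_integral_add[symmetric], simp, simp) (intro nn_integral_cong nn_integral_add, measurable)
  also have "\<dots> \<le> ennreal (decay (t / 2)) + ennreal (decay (t / 2))"
    by (rule add_mono) (use t in \<open>intro mean_square_sums; simp\<close>)+
  also have "\<dots> = ennreal (2 * decay (t / 2))" using n[of "t / 2"] by (simp flip: ennreal_plus)
  finally have "2 * mean_kernel t y y' \<le> 2 * decay (t / 2)"
    using n[of "t / 2"] by (subst (asm) ennreal_le_iff) auto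
  then show ?thesis by simp
qed

end

section \<open>Increments of the averaged kernel\<close>

text \<open>
Twice this difference is the sum of the squared slopes of the tent. It measures by how much the two weights in the
comparison of the kernel at times \<open>t\<close> and \<open>t - \<delta>\<close> differ.
\<close>
lemma tent_autocorrelation:
  shows "0 \<le> (\<Sum>j<N. (tent N j)\<^sup>2) - (\<Sum>j<N. tent N j * tent N (Suc j))"
    and "(\<Sum>j<N. (tent N j)\<^sup>2) - (\<Sum>j<N. tent N j * tent N (Suc j)) \<le> 1 / (2 * real N)"
proof -
  have "(\<Sum>j<Suc N. (tent N j)\<^sup>2) = (tent N 0)\<^sup>2 + (\<Sum>j<N. (tent N (Suc j))\<^sup>2)"
    by (rule sum.lessThan_Suc_shift)
  then have s: "(\<Sum>j<N. (tent N (Suc j))\<^sup>2) = (\<Sum>j<N. (tent N j)\<^sup>2)" by (simp add: tent_0 tent_N)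
  have "(\<Sum>j<N. (tent N (Suc j) - tent N j)\<^sup>2)
    = (\<Sum>j<N. (tent N (Suc j))\<^sup>2) + (\<Sum>j<N. (tent N j)\<^sup>2) - 2 * (\<Sum>j<N. tent N j * tent N (Suc j))"
    by (simp add: power2_diff sum.distrib sum_subtractf sum_distrib_left mult.assoc mult.commute mult.left_commute)
  then have e: "2 * ((\<Sum>j<N. (tent N j)\<^sup>2) - (\<Sum>j<N. tent N j * tent N (Suc j))) = (\<Sum>j<N. (tent N (Suc j) - tent N j)\<^sup>2)"
    using s by simp
  have "0 \<le> (\<Sum>j<N. (tent N (Suc j) - tent N j)\<^sup>2)" by (rule sum_nonneg) simp
  then show "0 \<le> (\<Sum>j<N. (tent N j)\<^sup>2) - (\<Sum>j<N. tent N j * tent N (Suc j))"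
    unfolding e[symmetric] by (simp only: zero_le_mult_iff) simp
  have "(\<Sum>j<N. (tent N (Suc j) - tent N j)\<^sup>2) \<le> (\<Sum>j<N. (1 / real N)\<^sup>2)"
  proof (rule sum_mono)
    fix j
    have "\<bar>tent N (Suc j) - tent N j\<bar> ^ 2 \<le> (1 / real N) ^ 2" by (rule power_mono[OF tent_lipschitz]) simp
    then show "(tent N (Suc j) - tent N j)\<^sup>2 \<le> (1 / real N)\<^sup>2" by simp
  qed
  also have "\<dots> = 1 / real N" by (simp add: power2_eq_square)
  finally show "(\<Sum>j<N. (tent N j)\<^sup>2) - (\<Sum>j<N. tent N j * tent N (Suc j)) \<le> 1 / (2 * real N)"
    using e by simp
qed

text \<open>
On the middle half of the range the tent is at least \<open>1 / 4\<close>.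
\<close>
lemma tent_overlap:
  assumes N: "N = 4 * M" and M: "0 < M"
  shows "real N / 32 \<le> (\<Sum>j<N. tent N j * tent N (Suc j))"
proof -
  have q: "1 / 4 \<le> tent N j" if "M \<le> j" "j \<le> 3 * M" for j
  proof -
    have "M \<le> min j (N - j)" using that N by auto
    then have "real M / real N \<le> real (min j (N - j)) / real N" by (intro divide_right_mono) auto
    then show ?thesis using N M by (simp add: tent_def)
  qed
  have "real N / 32 = (\<Sum>j\<in>{M..<3 * M}. 1 / 4 * (1 / 4))" using N by simp
  also have "\<dots> \<le> (\<Sum>j\<in>{M..<3 * M}. tent N j * tent N (Suc j))"
    by (intro sum_mono mult_mono q) (auto simp: tent_bounds)
  also have "\<dots> \<le> (\<Sum>j<N. tent N j * tent N (Suc j))"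
    using N by (intro sum_mono2) (auto simp: tent_bounds)
  finally show ?thesis .
qed

context conductance_law
begin

text \<open>
The pairing of the two sample families sees only the total elapsed time.
\<close>
lemma samples_pairing:
  assumes "0 \<le> \<rho>" "0 \<le> \<rho>'" "0 \<le> \<delta>" "0 \<le> \<tau>" "0 \<le> \<tau>'"
  shows "(\<integral>\<^sup>+z. \<integral>\<^sup>+\<omega>. ennreal (backward_samples N \<rho> \<delta> \<omega> \<tau> z y j * forward_samples N \<rho>' \<delta> \<omega> \<tau>' z y' i) \<partial>P \<partial>count_space UNIV)
    = ennreal (tent N j * tent N i * mean_kernel (\<rho> + real j * \<delta> + \<tau> + (\<rho>' + real i * \<delta> + \<tau>')) y y')"
proof -
  let ?a = "\<lambda>\<omega> z. capped_kernel \<omega> (- (\<rho> + real j * \<delta> + \<tau>)) 0 y z" and ?b = "\<lambda>\<omega> z. capped_kernel \<omega> 0 (\<rho>' + real i * \<delta> + \<tau>') z y'"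
  have m: "(\<lambda>\<omega>. ennreal (?a \<omega> z) * ennreal (?b \<omega> z)) \<in> borel_measurable P" for z
    by (intro borel_measurable_times_ennreal measurable_compose[OF _ measurable_ennreal]
        capped_kernel_measurable_comp measurable_ident_sets borel_measurable_const refl)
  have "(\<integral>\<^sup>+z. \<integral>\<^sup>+\<omega>. ennreal (backward_samples N \<rho> \<delta> \<omega> \<tau> z y j * forward_samples N \<rho>' \<delta> \<omega> \<tau>' z y' i) \<partial>P \<partial>count_space UNIV)
    = (\<integral>\<^sup>+z. \<integral>\<^sup>+\<omega>. ennreal (tent N j * tent N i) * (ennreal (?a \<omega> z) * ennreal (?b \<omega> z)) \<partial>P \<partial>count_space UNIV)"
  proof (intro nn_integral_cong)
    fix z \<omega>
    have "backward_samples N \<rho> \<delta> \<omega> \<tau> z y j * forward_samples N \<rho>' \<delta> \<omega> \<tau>' z y' i = tent N j * tent N i * (?a \<omega> z * ?b \<omega> z)"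
      unfolding backward_samples_def forward_samples_def by (simp only: mult_ac)
    then show "ennreal (backward_samples N \<rho> \<delta> \<omega> \<tau> z y j * forward_samples N \<rho>' \<delta> \<omega> \<tau>' z y' i)
      = ennreal (tent N j * tent N i) * (ennreal (?a \<omega> z) * ennreal (?b \<omega> z))"
      by (simp only: ennreal_mult mult_nonneg_nonneg tent_bounds capped_kernel_bounds)
  qed
  also have "\<dots> = ennreal (tent N j * tent N i) * (\<integral>\<^sup>+z. \<integral>\<^sup>+\<omega>. ennreal (?a \<omega> z) * ennreal (?b \<omega> z) \<partial>P \<partial>count_space UNIV)"
    by (simp only: nn_integral_cmult[OF m] nn_integral_cmult[OF borel_measurable_count_space])
  also have "(\<integral>\<^sup>+z. \<integral>\<^sup>+\<omega>. ennreal (?a \<omega> z) * ennreal (?b \<omega> z) \<partial>P \<partial>count_space UNIV)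
    = ennreal (mean_kernel (\<rho> + real j * \<delta> + \<tau> + (\<rho>' + real i * \<delta> + \<tau>')) y y')"
    by (rule mean_kernel_pairing) (use assms in auto)
  finally show ?thesis by (simp add: ennreal_mult tent_bounds mean_kernel_nonneg)
qed

lemma mean_energy_measurable:
  "(\<lambda>\<tau>. \<integral>\<^sup>+z. \<integral>\<^sup>+\<omega>. ennreal (time_energy N (forward_samples N \<rho> \<delta> \<omega> \<tau> z y)) \<partial>P \<partial>count_space UNIV) \<in> borel_measurable borel"
  "(\<lambda>\<tau>. \<integral>\<^sup>+z. \<integral>\<^sup>+\<omega>. ennreal (time_energy N (backward_samples N \<rho> \<delta> \<omega> \<tau> z y)) \<partial>P \<partial>count_space UNIV) \<in> borel_measurable borel"
proof -
  have "(\<lambda>p. ennreal (time_energy N (forward_samples N \<rho> \<delta> (snd p) (fst p) z y))) \<in> borel_measurable (borel \<Otimes>\<^sub>M P)"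
    "(\<lambda>p. ennreal (time_energy N (backward_samples N \<rho> \<delta> (snd p) (fst p) z y))) \<in> borel_measurable (borel \<Otimes>\<^sub>M P)" for z
    by (intro measurable_compose[OF _ measurable_ennreal] sample_energy_measurable measurable_snd measurable_fst)+
  then show "(\<lambda>\<tau>. \<integral>\<^sup>+z. \<integral>\<^sup>+\<omega>. ennreal (time_energy N (forward_samples N \<rho> \<delta> \<omega> \<tau> z y)) \<partial>P \<partial>count_space UNIV) \<in> borel_measurable borel"
    "(\<lambda>\<tau>. \<integral>\<^sup>+z. \<integral>\<^sup>+\<omega>. ennreal (time_energy N (backward_samples N \<rho> \<delta> \<omega> \<tau> z y)) \<partial>P \<partial>count_space UNIV) \<in> borel_measurable borel"
    by (intro borel_measurable_nn_integral_count_space borel_measurable_nn_integral; simp add: case_prod_beta')+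
qed

lemma decay_nonneg: "0 \<le> decay \<rho>"
  by (simp add: decay_def nash_constant_def)

lemma decay_antimono: "0 < r \<Longrightarrow> r \<le> s \<Longrightarrow> decay s \<le> decay r"
  unfolding decay_def by (intro mult_left_mono powr_mono2') (simp_all add: nash_constant_def)

text \<open>
The forward samples \<open>B\<close> enter reflected in time, since a longer run before time zero goes with a shorter
one after it. Reflection preserves the time energy. Both inequalities are kept free of subtraction,
so that they can be integrated as extended nonnegative reals.
\<close>
lemma weighted_increment_pointwise:
  fixes a B :: "nat \<Rightarrow> real"
  assumes "0 < N"
  defines "b \<equiv> \<lambda>j. B ((N - j) mod N)"
  shows "2 * (\<Sum>j<N. a j * b (Suc j mod N)) \<le> 2 * (\<Sum>j<N. a j * b j) + (time_energy N a + time_energy N B)"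
    and "2 * (\<Sum>j<N. a j * b j) \<le> 2 * (\<Sum>j<N. a j * b (Suc j mod N)) + (time_energy N a + time_energy N B)"
proof -
  have elementary: "2 * v \<le> 2 * w + p" "2 * w \<le> 2 * v + p" if "\<bar>u\<bar> \<le> p / 2" "u = v - w" for u v w p :: real
    using that by linarith+
  have "time_energy N b = time_energy N B" unfolding b_def by (rule time_energy_reflect) fact
  then have "\<bar>\<Sum>j<N. a j * (b (Suc j mod N) - b j)\<bar> \<le> (time_energy N a + time_energy N B) / 2"
    using abs_sum_mult_increment_le[OF assms(1), of a b] by simp
  moreover have "(\<Sum>j<N. a j * (b (Suc j mod N) - b j)) = (\<Sum>j<N. a j * b (Suc j mod N)) - (\<Sum>j<N. a j * b j)"
    by (simp add: right_diff_distrib sum_subtractf)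
  ultimately show "2 * (\<Sum>j<N. a j * b (Suc j mod N)) \<le> 2 * (\<Sum>j<N. a j * b j) + (time_energy N a + time_energy N B)"
    "2 * (\<Sum>j<N. a j * b j) \<le> 2 * (\<Sum>j<N. a j * b (Suc j mod N)) + (time_energy N a + time_energy N B)"
    by (rule elementary)+
qed

lemma mean_pairing_comparison:
  fixes f g :: "'n environment \<Rightarrow> 'n site \<Rightarrow> nat \<Rightarrow> real"
  assumes nn: "\<And>\<omega> z j. 0 \<le> f \<omega> z j" "\<And>\<omega> z j. 0 \<le> g \<omega> z j" "\<And>\<omega> z. 0 \<le> e \<omega> z" "\<And>\<omega> z. 0 \<le> e' \<omega> z"
    and m: "\<And>z j. (\<lambda>\<omega>. f \<omega> z j) \<in> borel_measurable P" "\<And>z j. (\<lambda>\<omega>. g \<omega> z j) \<in> borel_measurable P"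
      "\<And>z. (\<lambda>\<omega>. e \<omega> z) \<in> borel_measurable P" "\<And>z. (\<lambda>\<omega>. e' \<omega> z) \<in> borel_measurable P"
    and le: "\<And>\<omega> z. 2 * (\<Sum>j<N. f \<omega> z j) \<le> 2 * (\<Sum>j<N. g \<omega> z j) + (e \<omega> z + e' \<omega> z)"
    and F: "\<And>j. j < N \<Longrightarrow> (\<integral>\<^sup>+z. \<integral>\<^sup>+\<omega>. ennreal (f \<omega> z j) \<partial>P \<partial>count_space UNIV) = ennreal (F j)" "\<And>j. 0 \<le> F j"
    and G: "\<And>j. j < N \<Longrightarrow> (\<integral>\<^sup>+z. \<integral>\<^sup>+\<omega>. ennreal (g \<omega> z j) \<partial>P \<partial>count_space UNIV) = ennreal (G j)" "\<And>j. 0 \<le> G j"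
  shows "ennreal (2 * (\<Sum>j<N. F j)) \<le> ennreal (2 * (\<Sum>j<N. G j))
    + ((\<integral>\<^sup>+z. \<integral>\<^sup>+\<omega>. ennreal (e \<omega> z) \<partial>P \<partial>count_space (UNIV :: 'n site set)) + (\<integral>\<^sup>+z. \<integral>\<^sup>+\<omega>. ennreal (e' \<omega> z) \<partial>P \<partial>count_space UNIV))"
proof -
  have S: "ennreal (2 * (\<Sum>j<N. H j)) = (\<integral>\<^sup>+z. \<integral>\<^sup>+\<omega>. ennreal (2 * (\<Sum>j<N. h \<omega> z j)) \<partial>P \<partial>count_space (UNIV :: 'n site set))"
    if nh: "\<And>\<omega> z j. 0 \<le> h \<omega> z j" and mh: "\<And>z j. (\<lambda>\<omega>. h \<omega> z j) \<in> borel_measurable P"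
      and H: "\<And>j. j < N \<Longrightarrow> (\<integral>\<^sup>+z. \<integral>\<^sup>+\<omega>. ennreal (h \<omega> z j) \<partial>P \<partial>count_space UNIV) = ennreal (H j)" "\<And>j. 0 \<le> H j"
    for h :: "'n environment \<Rightarrow> 'n site \<Rightarrow> nat \<Rightarrow> real" and H
  proof -
    have mh': "(\<lambda>\<omega>. ennreal (h \<omega> z j)) \<in> borel_measurable P" for z j
      by (rule measurable_compose[OF mh measurable_ennreal])
    have e: "ennreal (2 * (\<Sum>j<N. c j)) = 2 * (\<Sum>j<N. ennreal (c j))" if "\<And>j. 0 \<le> c j" for c :: "nat \<Rightarrow> real"
      using that by (simp add: ennreal_mult' sum_ennreal)
    have "(\<integral>\<^sup>+z. \<integral>\<^sup>+\<omega>. ennreal (2 * (\<Sum>j<N. h \<omega> z j)) \<partial>P \<partial>count_space UNIV)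
      = (\<integral>\<^sup>+z. \<integral>\<^sup>+\<omega>. 2 * (\<Sum>j<N. ennreal (h \<omega> z j)) \<partial>P \<partial>count_space UNIV)"
      by (simp only: e[OF nh])
    also have "\<dots> = 2 * (\<Sum>j<N. \<integral>\<^sup>+z. \<integral>\<^sup>+\<omega>. ennreal (h \<omega> z j) \<partial>P \<partial>count_space UNIV)"
      by (simp only: nn_integral_cmult[OF borel_measurable_sum[OF mh']] nn_integral_sum[OF mh']
          nn_integral_cmult[OF borel_measurable_count_space] nn_integral_sum[OF borel_measurable_count_space])
    also have "\<dots> = ennreal (2 * (\<Sum>j<N. H j))" using H by (simp add: e[OF H(2)])
    finally show ?thesis by simp
  qed
  have me: "(\<lambda>\<omega>. ennreal (e \<omega> z)) \<in> borel_measurable P" "(\<lambda>\<omega>. ennreal (e' \<omega> z)) \<in> borel_measurable P" for z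
    using m by (auto intro: measurable_compose[OF _ measurable_ennreal])
  have mg: "(\<lambda>\<omega>. ennreal (2 * (\<Sum>j<N. g \<omega> z j))) \<in> borel_measurable P" for z
    by (intro measurable_compose[OF _ measurable_ennreal] borel_measurable_times borel_measurable_const borel_measurable_sum m)
  have "ennreal (2 * (\<Sum>j<N. F j)) = (\<integral>\<^sup>+z. \<integral>\<^sup>+\<omega>. ennreal (2 * (\<Sum>j<N. f \<omega> z j)) \<partial>P \<partial>count_space UNIV)"
    by (rule S[OF nn(1) m(1) F])
  also have "\<dots> \<le> (\<integral>\<^sup>+z. \<integral>\<^sup>+\<omega>. ennreal (2 * (\<Sum>j<N. g \<omega> z j)) + (ennreal (e \<omega> z) + ennreal (e' \<omega> z)) \<partial>P \<partial>count_space UNIV)"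
  proof (intro nn_integral_mono)
    fix z \<omega>
    have "0 \<le> (\<Sum>j<N. g \<omega> z j)" by (rule sum_nonneg) (rule nn)
    then have "ennreal (2 * (\<Sum>j<N. g \<omega> z j)) + (ennreal (e \<omega> z) + ennreal (e' \<omega> z)) = ennreal (2 * (\<Sum>j<N. g \<omega> z j) + (e \<omega> z + e' \<omega> z))"
      using nn by simp
    then show "ennreal (2 * (\<Sum>j<N. f \<omega> z j)) \<le> ennreal (2 * (\<Sum>j<N. g \<omega> z j)) + (ennreal (e \<omega> z) + ennreal (e' \<omega> z))"
      using ennreal_leI[OF le[of \<omega> z]] by (simp only:)
  qed
  also have "\<dots> = (\<integral>\<^sup>+z. \<integral>\<^sup>+\<omega>. ennreal (2 * (\<Sum>j<N. g \<omega> z j)) \<partial>P \<partial>count_space UNIV)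
    + ((\<integral>\<^sup>+z. \<integral>\<^sup>+\<omega>. ennreal (e \<omega> z) \<partial>P \<partial>count_space (UNIV :: 'n site set)) + (\<integral>\<^sup>+z. \<integral>\<^sup>+\<omega>. ennreal (e' \<omega> z) \<partial>P \<partial>count_space UNIV))"
    by (simp only: nn_integral_add[OF mg borel_measurable_add[OF me]] nn_integral_add[OF me]
        nn_integral_add[OF borel_measurable_count_space borel_measurable_count_space])
  also have "(\<integral>\<^sup>+z. \<integral>\<^sup>+\<omega>. ennreal (2 * (\<Sum>j<N. g \<omega> z j)) \<partial>P \<partial>count_space UNIV) = ennreal (2 * (\<Sum>j<N. G j))"
    by (rule S[OF nn(2) m(2) G, symmetric])
  finally show ?thesis .
qed

text \<open>
The kernel at time \<open>t\<close> is represented by runs of length \<open>t / 3 + j * \<delta> + \<tau>\<close> before and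
\<open>2 * t / 3 - j * \<delta> - \<tau>\<close> after time zero, for \<open>j < N\<close>, with weight \<open>(tent N j)\<^sup>2\<close>. Shortening the second run by
one step \<open>\<delta>\<close> gives the kernel at time \<open>t - \<delta>\<close>. The total weight is of order \<open>N\<close>, while the difference is
bounded by time energies, which do not grow with \<open>N\<close>. The factor \<open>1 / N\<close> that is gained is \<open>3 * \<delta> / t\<close>.
\<close>
lemma mean_kernel_increment:
  assumes t: "0 < t" and N: "N = 4 * M" "0 < M"
  defines "\<delta> \<equiv> t / (3 * real N)"
  shows "\<bar>mean_kernel t y y' - mean_kernel (t - \<delta>) y y'\<bar> \<le> 96 * (c1\<^sup>2 / 2 + 2) * decay (t / 6) * \<delta> / t"
proof -
  have N0: "0 < N" "4 \<le> N" using N by auto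
  have \<delta>: "0 < \<delta>" "real N * \<delta> = t / 3" using t N0 by (auto simp: \<delta>_def)
  have "4 * \<delta> \<le> real N * \<delta>" using N0 \<delta> by (intro mult_right_mono) auto
  then have \<delta>t: "t / 6 \<le> t / 3 - \<delta>" "\<delta> < t" using \<delta> t by linarith+
  define \<kappa> where "\<kappa> = c1\<^sup>2 / 2 + 1"
  have \<kappa>: "0 \<le> \<kappa>" by (simp add: \<kappa>_def)
  define D where "D = decay (t / 6)"
  have D: "0 \<le> D" by (simp add: D_def decay_nonneg)
  define u v where "u = (\<Sum>j<N. tent N j * tent N (Suc j)) * mean_kernel (t - \<delta>) y y'"
    and "v = (\<Sum>j<N. (tent N j)\<^sup>2) * mean_kernel t y y'"
  have uv0: "0 \<le> u" "0 \<le> v"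
    unfolding u_def v_def by (intro mult_nonneg_nonneg sum_nonneg mean_kernel_nonneg tent_bounds zero_le_power2)+
  define a where "a \<omega> \<tau> z = backward_samples N (t / 3) \<delta> \<omega> \<tau> z y" for \<omega> \<tau> z
  define B where "B \<omega> \<tau> z = forward_samples N (t / 3 - \<delta>) \<delta> \<omega> (\<delta> - \<tau>) z y'" for \<omega> \<tau> z
  \<comment> \<open>Index zero is paired with index \<open>N mod N = 0\<close>, where the tent vanishes, as it does at \<open>N\<close>.\<close>
  define b where "b \<omega> \<tau> z j = B \<omega> \<tau> z ((N - j) mod N)" for \<omega> \<tau> z j
  define EA where "EA \<tau> = (\<integral>\<^sup>+z. \<integral>\<^sup>+\<omega>. ennreal (time_energy N (backward_samples N (t / 3) \<delta> \<omega> \<tau> z y)) \<partial>P \<partial>count_space UNIV)" for \<tau>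
  define EB where "EB \<tau> = (\<integral>\<^sup>+z. \<integral>\<^sup>+\<omega>. ennreal (time_energy N (forward_samples N (t / 3 - \<delta>) \<delta> \<omega> \<tau> z y')) \<partial>P \<partial>count_space UNIV)" for \<tau>
  have mEA[measurable]: "EA \<in> borel_measurable borel" and mEB[measurable]: "EB \<in> borel_measurable borel"
    unfolding EA_def[abs_def] EB_def[abs_def] by (rule mean_energy_measurable)+
  have step: "ennreal (2 * u) \<le> ennreal (2 * v) + (EA \<tau> + EB (\<delta> - \<tau>)) \<and> ennreal (2 * v) \<le> ennreal (2 * u) + (EA \<tau> + EB (\<delta> - \<tau>))"
    if \<tau>: "0 \<le> \<tau>" "\<tau> \<le> \<delta>" for \<tau>
  proof -
    have pos: "0 \<le> a \<omega> \<tau> z j" "0 \<le> b \<omega> \<tau> z j" for \<omega> z j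
      unfolding a_def b_def B_def backward_samples_def forward_samples_def
      by (intro mult_nonneg_nonneg tent_bounds capped_kernel_bounds)+
    have ms: "(\<lambda>\<omega>. a \<omega> \<tau> z j) \<in> borel_measurable P" "(\<lambda>\<omega>. b \<omega> \<tau> z j) \<in> borel_measurable P" for z j
      unfolding a_def b_def B_def backward_samples_def forward_samples_def
      by (intro borel_measurable_times capped_kernel_measurable_comp measurable_ident_sets borel_measurable_const refl)+
    have me: "(\<lambda>\<omega>. time_energy N (a \<omega> \<tau> z)) \<in> borel_measurable P" "(\<lambda>\<omega>. time_energy N (B \<omega> \<tau> z)) \<in> borel_measurable P" for z
      unfolding a_def B_def by (intro sample_energy_measurable measurable_ident_sets borel_measurable_const refl)+
    have pair: "(\<integral>\<^sup>+z. \<integral>\<^sup>+\<omega>. ennreal (a \<omega> \<tau> z j * B \<omega> \<tau> z i) \<partial>P \<partial>count_space UNIV)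
      = ennreal (tent N j * tent N i * mean_kernel (t / 3 + real j * \<delta> + \<tau> + (t / 3 - \<delta> + real i * \<delta> + (\<delta> - \<tau>))) y y')" for i j
      unfolding a_def B_def by (rule samples_pairing) (use t \<delta> \<delta>t \<tau> in auto)
    have same: "(\<integral>\<^sup>+z. \<integral>\<^sup>+\<omega>. ennreal (a \<omega> \<tau> z j * b \<omega> \<tau> z j) \<partial>P \<partial>count_space UNIV)
      = ennreal ((tent N j)\<^sup>2 * mean_kernel t y y')" if j: "j < N" for j
    proof (cases "j = 0")
      case True
      then show ?thesis unfolding b_def pair by (simp add: tent_0)
    next
      case False
      have "real (N - j) * \<delta> = t / 3 - real j * \<delta>" using j \<delta>(2) by (simp add: of_nat_diff left_diff_distrib)
      then have e: "t / 3 + real j * \<delta> + \<tau> + (t / 3 - \<delta> + real (N - j) * \<delta> + (\<delta> - \<tau>)) = t" by simp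
      have "(N - j) mod N = N - j" using False N0 by simp
      then show ?thesis unfolding b_def pair by (simp only: e tent_reflect[OF less_imp_le[OF j]] power2_eq_square)
    qed
    have nxt: "(\<integral>\<^sup>+z. \<integral>\<^sup>+\<omega>. ennreal (a \<omega> \<tau> z j * b \<omega> \<tau> z (Suc j mod N)) \<partial>P \<partial>count_space UNIV)
      = ennreal (tent N j * tent N (Suc j) * mean_kernel (t - \<delta>) y y')" if j: "j < N" for j
    proof (cases "Suc j = N")
      case True
      then show ?thesis unfolding b_def pair by (simp add: tent_0 tent_N)
    next
      case False
      then have j': "Suc j < N" using j by simp
      have "real (N - Suc j) * \<delta> = t / 3 - real j * \<delta> - \<delta>" using j' \<delta>(2) by (simp add: of_nat_diff algebra_simps)
      then have e: "t / 3 + real j * \<delta> + \<tau> + (t / 3 - \<delta> + real (N - Suc j) * \<delta> + (\<delta> - \<tau>)) = t - \<delta>" by simp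
      have "Suc j mod N = Suc j" "(N - Suc j) mod N = N - Suc j" using j' by simp_all
      then show ?thesis unfolding b_def pair by (simp only: e tent_reflect[OF less_imp_le[OF j']])
    qed
    have U: "2 * (\<Sum>j<N. tent N j * tent N (Suc j) * mean_kernel (t - \<delta>) y y') = 2 * u"
      and V: "2 * (\<Sum>j<N. (tent N j)\<^sup>2 * mean_kernel t y y') = 2 * v"
      by (simp_all add: u_def v_def sum_distrib_right)
    have EAB: "EA \<tau> = (\<integral>\<^sup>+z. \<integral>\<^sup>+\<omega>. ennreal (time_energy N (a \<omega> \<tau> z)) \<partial>P \<partial>count_space UNIV)"
      "EB (\<delta> - \<tau>) = (\<integral>\<^sup>+z. \<integral>\<^sup>+\<omega>. ennreal (time_energy N (B \<omega> \<tau> z)) \<partial>P \<partial>count_space UNIV)"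
      by (simp_all only: EA_def EB_def a_def B_def)
    have pw: "2 * (\<Sum>j<N. a \<omega> \<tau> z j * b \<omega> \<tau> z (Suc j mod N)) \<le> 2 * (\<Sum>j<N. a \<omega> \<tau> z j * b \<omega> \<tau> z j) + (time_energy N (a \<omega> \<tau> z) + time_energy N (B \<omega> \<tau> z))"
      "2 * (\<Sum>j<N. a \<omega> \<tau> z j * b \<omega> \<tau> z j) \<le> 2 * (\<Sum>j<N. a \<omega> \<tau> z j * b \<omega> \<tau> z (Suc j mod N)) + (time_energy N (a \<omega> \<tau> z) + time_energy N (B \<omega> \<tau> z))" for \<omega> z
      unfolding b_def by (rule weighted_increment_pointwise[OF N0(1)])+
    note nn = mult_nonneg_nonneg[OF pos(1) pos(2)]
    note mm = borel_measurable_times[OF ms(1) ms(2)]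
    note tn = mult_nonneg_nonneg[OF _ mean_kernel_nonneg]
    show ?thesis
      unfolding EAB U[symmetric] V[symmetric]
    proof (intro conjI)
      show "ennreal (2 * (\<Sum>j<N. tent N j * tent N (Suc j) * mean_kernel (t - \<delta>) y y'))
        \<le> ennreal (2 * (\<Sum>j<N. (tent N j)\<^sup>2 * mean_kernel t y y')) + ((\<integral>\<^sup>+z. \<integral>\<^sup>+\<omega>. ennreal (time_energy N (a \<omega> \<tau> z)) \<partial>P \<partial>count_space UNIV) + (\<integral>\<^sup>+z. \<integral>\<^sup>+\<omega>. ennreal (time_energy N (B \<omega> \<tau> z)) \<partial>P \<partial>count_space UNIV))"
        by (rule mean_pairing_comparison[OF nn nn time_energy_nonneg time_energy_nonneg mm mm me pw(1) nxt _ same])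
          (simp_all add: tent_bounds mean_kernel_nonneg)
      show "ennreal (2 * (\<Sum>j<N. (tent N j)\<^sup>2 * mean_kernel t y y'))
        \<le> ennreal (2 * (\<Sum>j<N. tent N j * tent N (Suc j) * mean_kernel (t - \<delta>) y y')) + ((\<integral>\<^sup>+z. \<integral>\<^sup>+\<omega>. ennreal (time_energy N (a \<omega> \<tau> z)) \<partial>P \<partial>count_space UNIV) + (\<integral>\<^sup>+z. \<integral>\<^sup>+\<omega>. ennreal (time_energy N (B \<omega> \<tau> z)) \<partial>P \<partial>count_space UNIV))"
        by (rule mean_pairing_comparison[OF nn nn time_energy_nonneg time_energy_nonneg mm mm me pw(2) same _ nxt])
          (simp_all add: tent_bounds mean_kernel_nonneg)
    qed
  qed
  have IA: "(\<integral>\<^sup>+\<tau>. indicator {0..\<delta>} \<tau> * EA \<tau> \<partial>lborel) \<le> ennreal (\<delta> * \<kappa> * D)"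
  proof -
    have "(\<integral>\<^sup>+\<tau>. indicator {0..\<delta>} \<tau> * EA \<tau> \<partial>lborel) \<le> ennreal (\<delta> * \<kappa> * decay (t / 3))"
      unfolding EA_def \<kappa>_def by (rule mean_sample_energy(2)) (use t \<delta> N0 in auto)
    also have "\<dots> \<le> ennreal (\<delta> * \<kappa> * D)"
      unfolding D_def using \<delta> \<kappa> t by (intro ennreal_leI mult_left_mono decay_antimono) auto
    finally show ?thesis .
  qed
  \<comment> \<open>The offsets of the forward samples run backwards, from \<open>\<delta>\<close> to zero.\<close>
  have IB: "(\<integral>\<^sup>+\<tau>. indicator {0..\<delta>} \<tau> * EB (\<delta> - \<tau>) \<partial>lborel) \<le> ennreal (\<delta> * \<kappa> * D)"
  proof -
    have "(\<integral>\<^sup>+\<tau>. indicator {0..\<delta>} \<tau> * EB \<tau> \<partial>lborel)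
      = ennreal \<bar>- 1\<bar> * (\<integral>\<^sup>+\<tau>. indicator {0..\<delta>} (\<delta> + (- 1) * \<tau>) * EB (\<delta> + (- 1) * \<tau>) \<partial>lborel)"
      by (rule nn_integral_real_affine[OF borel_measurable_times_ennreal[OF borel_measurable_indicator mEB]]) simp_all
    also have "\<dots> = (\<integral>\<^sup>+\<tau>. indicator {0..\<delta>} \<tau> * EB (\<delta> - \<tau>) \<partial>lborel)"
      by (simp, intro nn_integral_cong) (auto simp: indicator_def)
    finally have "(\<integral>\<^sup>+\<tau>. indicator {0..\<delta>} \<tau> * EB (\<delta> - \<tau>) \<partial>lborel) = (\<integral>\<^sup>+\<tau>. indicator {0..\<delta>} \<tau> * EB \<tau> \<partial>lborel)" by simp
    also have "\<dots> \<le> ennreal (\<delta> * \<kappa> * decay (t / 3 - \<delta>))"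
      unfolding EB_def \<kappa>_def by (rule mean_sample_energy(1)) (use t \<delta> \<delta>t N0 in auto)
    also have "\<dots> \<le> ennreal (\<delta> * \<kappa> * D)"
      unfolding D_def using \<delta> \<delta>t \<kappa> t by (intro ennreal_leI mult_left_mono decay_antimono) auto
    finally show ?thesis .
  qed
  have i: "(\<lambda>\<tau>. indicator {0..\<delta>} \<tau> :: ennreal) \<in> borel_measurable borel" by (rule borel_measurable_indicator) simp
  have s: "(\<lambda>\<tau>. \<delta> - \<tau>) \<in> borel_measurable borel" by (intro borel_measurable_diff borel_measurable_const measurable_ident_sets refl)
  have mA: "(\<lambda>\<tau>. indicator {0..\<delta>} \<tau> * EA \<tau>) \<in> borel_measurable lborel"
    using borel_measurable_times_ennreal[OF i mEA] by simp
  have mB: "(\<lambda>\<tau>. indicator {0..\<delta>} \<tau> * EB (\<delta> - \<tau>)) \<in> borel_measurable lborel"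
    using borel_measurable_times_ennreal[OF i measurable_compose[OF s mEB]] by simp
  have mQ: "(\<lambda>\<tau>. ennreal q * indicator {0..\<delta>} \<tau>) \<in> borel_measurable lborel" for q
    using borel_measurable_times_ennreal[OF borel_measurable_const i] by simp
  \<comment> \<open>Integrating over the offset, since only the averaged time energies are bounded.\<close>
  have average: "p \<le> q + \<kappa> * D"
    if pq: "0 \<le> q" and le: "\<And>\<tau>. 0 \<le> \<tau> \<Longrightarrow> \<tau> \<le> \<delta> \<Longrightarrow> ennreal (2 * p) \<le> ennreal (2 * q) + (EA \<tau> + EB (\<delta> - \<tau>))" for p q
  proof -
    have "ennreal (2 * p) * ennreal \<delta> = (\<integral>\<^sup>+\<tau>. ennreal (2 * p) * indicator {0..\<delta>} \<tau> \<partial>lborel)"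
      using \<delta> by (simp add: nn_integral_cmult_indicator)
    also have "\<dots> \<le> (\<integral>\<^sup>+\<tau>. ennreal (2 * q) * indicator {0..\<delta>} \<tau> + (indicator {0..\<delta>} \<tau> * EA \<tau> + indicator {0..\<delta>} \<tau> * EB (\<delta> - \<tau>)) \<partial>lborel)"
      by (rule nn_integral_mono) (auto simp: indicator_def le)
    also have "\<dots> = ennreal (2 * q) * ennreal \<delta> + ((\<integral>\<^sup>+\<tau>. indicator {0..\<delta>} \<tau> * EA \<tau> \<partial>lborel) + (\<integral>\<^sup>+\<tau>. indicator {0..\<delta>} \<tau> * EB (\<delta> - \<tau>) \<partial>lborel))"
      using \<delta> by (simp add: nn_integral_add[OF mQ borel_measurable_add[OF mA mB]] nn_integral_add[OF mA mB] nn_integral_cmult_indicator)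
    also have "\<dots> \<le> ennreal (2 * q) * ennreal \<delta> + (ennreal (\<delta> * \<kappa> * D) + ennreal (\<delta> * \<kappa> * D))"
      by (intro add_left_mono add_mono IA IB)
    also have "\<dots> = ennreal (2 * q * \<delta> + 2 * (\<delta> * \<kappa> * D))"
    proof -
      have "ennreal (2 * q) * ennreal \<delta> = ennreal (2 * q * \<delta>)"
        by (rule ennreal_mult[symmetric]) (use pq \<delta> in auto)
      moreover have "ennreal (\<delta> * \<kappa> * D) + ennreal (\<delta> * \<kappa> * D) = ennreal (2 * (\<delta> * \<kappa> * D))"
      proof -
        have "0 \<le> \<delta> * \<kappa> * D" using \<delta>(1) \<kappa> D by simp
        then have "ennreal (\<delta> * \<kappa> * D) + ennreal (\<delta> * \<kappa> * D) = ennreal (\<delta> * \<kappa> * D + \<delta> * \<kappa> * D)"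
          by (intro ennreal_plus[symmetric])
        then show ?thesis by (simp only: mult_2)
      qed
      moreover have "ennreal (2 * q * \<delta> + 2 * (\<delta> * \<kappa> * D)) = ennreal (2 * q * \<delta>) + ennreal (2 * (\<delta> * \<kappa> * D))"
        using pq \<delta>(1) \<kappa> D by (intro ennreal_plus) simp_all
      ultimately show ?thesis by (simp only:)
    qed
    finally have "ennreal (2 * p * \<delta>) \<le> ennreal (2 * q * \<delta> + 2 * (\<delta> * \<kappa> * D))"
      using \<delta> by (simp add: ennreal_mult'')
    then have "2 * p * \<delta> \<le> 2 * q * \<delta> + 2 * (\<delta> * \<kappa> * D)"
      using pq \<delta> \<kappa> D by (subst (asm) ennreal_le_iff) auto
    then have "(2 * \<delta>) * p \<le> (2 * \<delta>) * (q + \<kappa> * D)" by (simp add: algebra_simps)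
    then show ?thesis using \<delta> by (subst (asm) mult_le_cancel_left_pos) auto
  qed
  have uv: "\<bar>v - u\<bar> \<le> \<kappa> * D"
    using average[OF uv0(2), of u] average[OF uv0(1), of v] step by force
  define w0 w1 where "w0 = (\<Sum>j<N. (tent N j)\<^sup>2)" and "w1 = (\<Sum>j<N. tent N j * tent N (Suc j))"
  have w: "0 \<le> w0 - w1" "w0 - w1 \<le> 1 / (2 * real N)" "real N / 32 \<le> w1"
    unfolding w0_def w1_def by (rule tent_autocorrelation tent_overlap[OF N])+
  have "1 / (2 * real N) \<le> 1" using N0 by simp
  with w(2) have "w0 - w1 \<le> 1" by (rule order_trans)
  have "mean_kernel t y y' \<le> D"
    using mean_kernel_decay[OF t, of y y'] decay_antimono[of "t / 6" "t / 2"] t by (simp add: D_def)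
  then have "(w0 - w1) * mean_kernel t y y' \<le> 1 * D"
    using w \<open>w0 - w1 \<le> 1\<close> by (intro mult_mono mean_kernel_nonneg) auto
  moreover have "0 \<le> (w0 - w1) * mean_kernel t y y'" by (intro mult_nonneg_nonneg w mean_kernel_nonneg)
  moreover have "w1 * (mean_kernel t y y' - mean_kernel (t - \<delta>) y y') = (v - u) - (w0 - w1) * mean_kernel t y y'"
    unfolding u_def v_def w0_def[symmetric] w1_def[symmetric] by (simp add: algebra_simps)
  ultimately have "\<bar>w1 * (mean_kernel t y y' - mean_kernel (t - \<delta>) y y')\<bar> \<le> \<kappa> * D + D"
    using uv by linarith
  moreover have w1: "0 < w1" using w(3) N0 by (intro less_le_trans[OF _ w(3)]) simp
  ultimately have r: "w1 * \<bar>mean_kernel t y y' - mean_kernel (t - \<delta>) y y'\<bar> \<le> \<kappa> * D + D"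
    by (simp add: abs_mult)
  have "real N / 32 * \<bar>mean_kernel t y y' - mean_kernel (t - \<delta>) y y'\<bar> \<le> w1 * \<bar>mean_kernel t y y' - mean_kernel (t - \<delta>) y y'\<bar>"
    by (rule mult_right_mono[OF w(3)]) simp
  also note r
  finally have "\<bar>mean_kernel t y y' - mean_kernel (t - \<delta>) y y'\<bar> \<le> 32 * (\<kappa> * D + D) / real N"
    using N0 by (simp add: field_simps)
  also have "\<dots> = 96 * (c1\<^sup>2 / 2 + 2) * D * \<delta> / t"
    using t N0 by (simp add: \<kappa>_def \<delta>_def field_simps)
  finally show ?thesis unfolding D_def .
qed

text \<open>
The increment bound is linear in the step, so the difference quotients along
\<open>\<delta> = t / (12 * Suc M)\<close> are bounded uniformly.
\<close>
lemma mean_kernel_derivative_bound: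
  assumes t: "0 < t"
  shows "\<bar>deriv (\<lambda>t. mean_kernel t y y') t\<bar>
    \<le> 96 * (c1\<^sup>2 / 2 + 2) * nash_constant (real CARD('n)) c0 * 6 powr (real CARD('n) / 2) * t powr (- real CARD('n) / 2 - 1)"
proof -
  let ?f = "\<lambda>t. mean_kernel t y y'" and ?g = "\<integral>\<omega>. pulled_drift y y' t \<omega> \<partial>P"
  let ?K = "96 * (c1\<^sup>2 / 2 + 2) * decay (t / 6) / t"
  define \<delta> where "\<delta> M = t / (3 * real (4 * Suc M))" for M
  have d: "(?f has_real_derivative ?g) (at t)" by (rule mean_kernel_has_derivative[OF t])
  have "(\<lambda>M. - (t / 12) * inverse (real (Suc M))) \<longlonglongrightarrow> - (t / 12) * 0"
    by (intro tendsto_intros LIMSEQ_inverse_real_of_nat)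
  moreover have "- (t / 12) * inverse (real (Suc M)) = - \<delta> M" for M by (simp add: \<delta>_def field_simps)
  ultimately have l: "(\<lambda>M. - \<delta> M) \<longlonglongrightarrow> 0" by simp
  have nz: "\<delta> M > 0" for M using t by (simp add: \<delta>_def)
  have lim: "filterlim (\<lambda>M. - \<delta> M) (at 0) sequentially"
    using l less_imp_neq[OF nz] by (auto simp: filterlim_at intro!: always_eventually)
  have "((\<lambda>h. (?f (t + h) - ?f t) / h) \<longlongrightarrow> ?g) (at 0)" by (rule DERIV_D[OF d])
  from filterlim_compose[OF this lim] have "(\<lambda>M. (?f (t + - \<delta> M) - ?f t) / (- \<delta> M)) \<longlonglongrightarrow> ?g" .
  then have "(\<lambda>M. \<bar>(?f (t + - \<delta> M) - ?f t) / (- \<delta> M)\<bar>) \<longlonglongrightarrow> \<bar>?g\<bar>" by (rule tendsto_rabs)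
  then have "\<bar>?g\<bar> \<le> ?K"
  proof (rule LIMSEQ_le_const2, intro exI allI impI)
    fix M
    have "\<bar>?f t - ?f (t - \<delta> M)\<bar> \<le> 96 * (c1\<^sup>2 / 2 + 2) * decay (t / 6) * \<delta> M / t"
      unfolding \<delta>_def by (rule mean_kernel_increment[OF t refl]) simp
    then have "\<bar>?f t - ?f (t - \<delta> M)\<bar> / \<delta> M \<le> ?K" using nz[of M] t by (simp add: field_simps)
    then show "\<bar>(?f (t + - \<delta> M) - ?f t) / (- \<delta> M)\<bar> \<le> ?K"
      using nz[of M] by (simp add: abs_divide abs_minus_commute)
  qed
  also have "?K = 96 * (c1\<^sup>2 / 2 + 2) * nash_constant (real CARD('n)) c0 * 6 powr (real CARD('n) / 2) * t powr (- real CARD('n) / 2 - 1)"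
  proof -
    define h where "h = real CARD('n) / 2"
    have h: "- real CARD('n) / 2 = - h" "real CARD('n) / 2 = h" by (simp_all add: h_def)
    have "(t / 6) powr - h = t powr - h / 6 powr - h" by (rule powr_divide)
    also have "\<dots> = t powr - h * 6 powr h" unfolding powr_minus_divide[of 6 h] by simp
    finally have 6: "(t / 6) powr - h = t powr - h * 6 powr h" .
    have 1: "t powr (- h - 1) = t powr - h / t" using t by (simp only: powr_diff powr_one less_imp_le)
    show ?thesis unfolding decay_def h 6 1 by simp
  qed
  finally show ?thesis using DERIV_imp_deriv[OF d] by simp
qed

end

theorem corollary1p9:
  fixes P :: "'n::finite environment measure" and c0 c1 :: real
  assumes "admissible P"
    and "c0 > 0"
    and "\<And>e t. e \<in> bonds \<Longrightarrow> AE \<omega> in P. \<omega> t e \<ge> c0"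
    and "c1 \<ge> 1"
    and "\<And>e t. e \<in> bonds \<Longrightarrow> AE \<omega> in P. inverse c1 \<le> \<omega> t e / \<omega> 0 e \<and> \<omega> t e / \<omega> 0 e \<le> c1"
  shows "\<exists>C. \<forall>y y'. \<forall>t\<ge>1.
           (\<lambda>t. mean_heat_kernel P 0 t y y') differentiable (at t) \<and>
           \<bar>deriv (\<lambda>t. mean_heat_kernel P 0 t y y') t\<bar> \<le> C * t powr (- real CARD('n) / 2 - 1)"
proof -
  interpret conductance_law P c0 c1 by standard (fact assms)+
  show ?thesis
  proof (intro exI allI impI conjI)
    fix y y' :: "'n site" and t :: real assume t: "1 \<le> t"
    have ev: "\<forall>\<^sub>F s in nhds t. mean_heat_kernel P 0 s y y' = mean_kernel s y y'"
      using t by (intro eventually_nhds_in_open[of "{0<..}", THEN eventually_mono] mean_heat_kernel_eq) auto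
    have d: "((\<lambda>s. mean_kernel s y y') has_real_derivative (\<integral>\<omega>. pulled_drift y y' t \<omega> \<partial>P)) (at t)"
      by (rule mean_kernel_has_derivative) (use t in simp)
    then have "((\<lambda>s. mean_heat_kernel P 0 s y y') has_real_derivative (\<integral>\<omega>. pulled_drift y y' t \<omega> \<partial>P)) (at t)"
      using DERIV_cong_ev[OF refl ev refl] by simp
    then show "(\<lambda>t. mean_heat_kernel P 0 t y y') differentiable (at t)" by (auto simp: real_differentiable_def)
    have "deriv (\<lambda>t. mean_heat_kernel P 0 t y y') t = deriv (\<lambda>t. mean_kernel t y y') t"
      by (rule deriv_cong_ev[OF ev refl])
    then show "\<bar>deriv (\<lambda>t. mean_heat_kernel P 0 t y y') t\<bar>
      \<le> 96 * (c1\<^sup>2 / 2 + 2) * nash_constant (real CARD('n)) c0 * 6 powr (real CARD('n) / 2) * t powr (- real CARD('n) / 2 - 1)"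
      using mean_kernel_derivative_bound[of t y y'] t by simp
  qed
qed

end
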